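(* Consider the random connection model, with $P_t$, $p_n(\cdot,s)$, $t_*$ as described in the context. For any $t\in[0,t_* )$ there are constants $c_1(t),c_2(t)$ such that for all $n\in\mathbb{N}_0$ $$\|p_n(\cdot,t)\|_\infty\le c_1(t)c_2(t)^n,\qquad \|p_n(\cdot,t)\|_1\le c_1(t)c_2(t)^n .$$ Moreover, for any $s\in[0,t_* )$ there is a neighbourhood $U(s)$ of $s$ such that $$P_t(\cdot)=\sum_{n=0}^\infty(t-s)^np_n(\cdot,s),\quad t\in U(s),$$ where the convergence holds in $L^1$ and $L^\infty$.
   Context: $\varphi:\mathbb{R}^d\to[0,1]$ is measurable with $\varphi(x)=\varphi(-x)$ and $0<m_\varphi:=\int\varphi(x)\,dx<\infty$. For $t\ge0$, $\eta_t$ is a stationary Poisson process on $\mathbb{R}^d$ with intensity $t$; for $t>0$ write $\eta_t=\{X_i:i\in\mathbb{N}\}$ with a.s. distinct $X_i$, and $\eta_0=\emptyset$. $\mathbb{R}^{[2d]}$ is the space of two-element subsets of $\mathbb{R}^d$; $<$ is the strict lexicographic order on $\mathbb{R}^d$. For points $y_1,\dots,y_k\in\mathbb{R}^d$ let $(Z_i)_{i\in I}$ be the family consisting of $y_1,\dots,y_k$ and (if $t>0$) the $X_j$, $j\in\mathbb{N}$, and let $\chi_t^{y_1,\dots,y_k}:=\{(\{Z_i,Z_j\},U_{i,j}):i,j\in I,\ Z_i<Z_j\}$ with independent marks $U_{i,j}$, uniform on $[0,1]$ and independent of $\eta_t$; when the added points vary over subfamilies of a fixed finite family the same marks are used for the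 same pairs of indices. For $\mathbf{x}=(x_1,\dots,x_n)$ and $J\subset[n]:=\{1,\dots,n\}$, $\mathbf{x}_J:=(x_i)_{i\in J}$. For a point process $\tilde\chi$ on $\mathbb{R}^{[2d]}\times[0,1]$, $\mathcal{G}(\tilde\chi)$ is the graph whose vertices are the endpoints of those $e\in\mathbb{R}^{[2d]}$ with $\tilde\chi(\{e\}\times[0,1])=1$ and in which $e=\{x,y\}$ is an edge iff $\tilde\chi(\{(e,u)\})=1$ for some $u\le\varphi(y-x)$. $C(x,\tilde\chi)$ is the (vertex set of the) connected component of $x$ in $\mathcal{G}(\tilde\chi)$, and $C(x,\tilde\chi):=\{x\}$ if $x$ is not a vertex. $P_t(x):=\mathbb{P}(x\in C(0,\chi_t^{0,x}))$; $t_*:=\sup\{t\ge0:\mathbb{E}\exp(z|C(0,\chi_t^0)|)<\infty\text{ for some }z>0\}$. For $s\in[0,t_* )$: $p_0(x,s):=P_s(x)$ and, for $n\in\mathbb{N}$, $$p_n(x,s):=\frac1{n!}\int_{(\mathbb{R}^d)^n}\mathbb{E}\sum_{J\subset[n]}(-1)^{n-|J|}\mathbf{1}\{x\in C(0,\chi_s^{0,\mathbf{x}_J,x})\}\,d\mathbf{x}.$$ Neighbourhoods of $s$ are neighbourhoods in $[0,t_* )$. $\|f\|_1=\int|f|\,dx$ and $\|\cdot\|_\infty$ is the supremum norm; $L^1$, $L^\infty$ are the corresponding spaces of functions on $\mathbb{R}^d$. *)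

theory Defs
  imports "HOL-Probability.Probability" "HOL-Library.Fun_Lexorder"
begin

text \<open>
  The random variables \<open>X 0, X 1, \<dots>\<close> enumerate, without repetition, the points of a stationary
  Poisson process of intensity \<open>t > 0\<close>.  Counts are taken in \<open>ennreal\<close>, so that they are
  \<open>\<infinity>\<close> on infinite sets.  The Poisson weights are written out because \<open>poisson_pmf\<close> is
  specified for positive rates only, whereas \<open>B\<close> may be a null set.
\<close>

definition point_count :: "(nat \<Rightarrow> 'w \<Rightarrow> 'a) \<Rightarrow> 'a set \<Rightarrow> 'w \<Rightarrow> ennreal" where
  "point_count X B \<omega> = emeasure (count_space UNIV) {i. X i \<omega> \<in> B}"

definition poisson_enumeration ::
    "'w measure \<Rightarrow> real \<Rightarrow> (nat \<Rightarrow> 'w \<Rightarrow> 'a::euclidean_space) \<Rightarrow> bool" where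
  "poisson_enumeration M t X \<longleftrightarrow>
     (\<forall>i. X i \<in> borel_measurable M) \<and>
     (AE \<omega> in M. inj (\<lambda>i. X i \<omega>)) \<and>
     (\<forall>B\<in>sets borel. emeasure lborel B < \<infinity> \<longrightarrow>
        (\<forall>k. \<P>(\<omega> in M. point_count X B \<omega> = of_nat k)
           = (t * measure lborel B) ^ k / fact k * exp (- (t * measure lborel B)))) \<and>
     (\<forall>\<B>\<subseteq>sets borel. finite \<B> \<and> disjoint \<B> \<longrightarrow>
        prob_space.indep_vars M (\<lambda>_. borel) (point_count X) \<B>)"

text \<open>
  Added points carry indices \<open>Inl k\<close>, the points of the Poisson process indices \<open>Inr j\<close>; the mark
  of an ordered pair of indices is \<open>U t (i, j)\<close>.  Keeping the index of an added point fixed while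
  the set of added points varies keeps the marks fixed as well.
\<close>

type_synonym point_index = "nat + nat"

type_synonym 'd point = "(real, 'd) vec"

text \<open>
  Independence of the marks from the Poisson process refers to the enumeration \<open>(X t j)\<^sub>j\<close>, not
  only to the set of its values: marks are attached to pairs of indices.  Nothing is assumed on
  the joint law for different intensities.
\<close>

locale random_connection_model = prob_space M
  for M :: "'w measure" +
  fixes \<phi> :: "'d::{finite,linorder} point \<Rightarrow> real"
    and X :: "real \<Rightarrow> nat \<Rightarrow> 'w \<Rightarrow> 'd point"
    and U :: "real \<Rightarrow> point_index \<times> point_index \<Rightarrow> 'w \<Rightarrow> real"
  assumes phi_measurable: "\<phi> \<in> borel_measurable borel"
    and phi_range: "0 \<le> \<phi> x" "\<phi> x \<le> 1"
    and phi_sym: "\<phi> (- x) = \<phi> x"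
    and phi_integrable: "integrable lborel \<phi>"
    and phi_integral_pos: "0 < (LINT x|lborel. \<phi> x)"
    and poisson: "0 < t \<Longrightarrow> poisson_enumeration M t (X t)"
    and marks_indep: "0 \<le> t \<Longrightarrow> indep_vars (\<lambda>_. borel) (U t) UNIV"
    and marks_uniform: "0 \<le> t \<Longrightarrow> distr M lborel (U t p) = uniform_measure lborel {0..1}"
    and marks_indep_points: "0 < t \<Longrightarrow>
          indep_set
            (sets (vimage_algebra (space M) (\<lambda>\<omega> j. X t j \<omega>) (PiM UNIV (\<lambda>_. borel))))
            (sets (vimage_algebra (space M) (\<lambda>\<omega> p. U t p \<omega>) (PiM UNIV (\<lambda>_. borel))))"

definition lex_less :: "'d::{finite,linorder} point \<Rightarrow> 'd point \<Rightarrow> bool" where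
  "lex_less x y \<longleftrightarrow> less_fun (vec_nth x) (vec_nth y)"

text \<open>
  \<open>marked_edges X U t A y \<omega>\<close> is the process \<open>\<chi>\<^sub>t\<close> with added points \<open>y k\<close>, \<open>k \<in> A\<close>.
\<close>

definition marked_edges ::
    "(real \<Rightarrow> nat \<Rightarrow> 'w \<Rightarrow> 'd::{finite,linorder} point) \<Rightarrow>
     (real \<Rightarrow> point_index \<times> point_index \<Rightarrow> 'w \<Rightarrow> real) \<Rightarrow>
     real \<Rightarrow> nat set \<Rightarrow> (nat \<Rightarrow> 'd point) \<Rightarrow> 'w \<Rightarrow> ('d point set \<times> real) set" where
  "marked_edges X U t A y \<omega> =
     (let I = Inl ` A \<union> (if 0 < t then range Inr else {});
          Z = case_sum y (\<lambda>j. X t j \<omega>)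
      in {({Z i, Z j}, U t (i, j) \<omega>) | i j. i \<in> I \<and> j \<in> I \<and> lex_less (Z i) (Z j)})"

text \<open>
  The graph of a set \<open>\<xi>\<close> of marked edges.  The number of marks in \<open>[0, 1]\<close> of an edge plays the
  role of \<open>\<xi>({e} \<times> [0,1])\<close>; as \<open>card\<close> is \<open>0\<close> on infinite sets, \<open>card \<dots> = 1\<close> says that there is
  exactly one.
\<close>

definition graph_verts :: "('a set \<times> real) set \<Rightarrow> 'a set" where
  "graph_verts \<xi> = \<Union>{e. card e = 2 \<and> card {u\<in>{0..1}. (e, u) \<in> \<xi>} = 1}"

definition graph_adj :: "('a::ab_group_add \<Rightarrow> real) \<Rightarrow> ('a set \<times> real) set \<Rightarrow> 'a \<Rightarrow> 'a \<Rightarrow> bool" where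
  "graph_adj \<phi> \<xi> x y \<longleftrightarrow> x \<in> graph_verts \<xi> \<and> y \<in> graph_verts \<xi> \<and> x \<noteq> y \<and>
     (\<exists>u\<in>{0..1}. ({x, y}, u) \<in> \<xi> \<and> u \<le> \<phi> (y - x))"

definition cluster :: "('a::ab_group_add \<Rightarrow> real) \<Rightarrow> 'a \<Rightarrow> ('a set \<times> real) set \<Rightarrow> 'a set" where
  "cluster \<phi> x \<xi> = (if x \<in> graph_verts \<xi> then {y. (graph_adj \<phi> \<xi>)\<^sup>*\<^sup>* x y} else {x})"

definition pair_conn ::
    "'w measure \<Rightarrow> ('d::{finite,linorder} point \<Rightarrow> real) \<Rightarrow>
     (real \<Rightarrow> nat \<Rightarrow> 'w \<Rightarrow> 'd point) \<Rightarrow>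
     (real \<Rightarrow> point_index \<times> point_index \<Rightarrow> 'w \<Rightarrow> real) \<Rightarrow> real \<Rightarrow> 'd point \<Rightarrow> real" where
  "pair_conn M \<phi> X U t x =
     \<P>(\<omega> in M. x \<in> cluster \<phi> 0 (marked_edges X U t {0, 1} (\<lambda>k. if k = 0 then 0 else x) \<omega>))"

text \<open>
  \<open>t_star\<close> may be \<open>\<infinity>\<close>.  The exponential moment of the cluster size is a nonnegative integral
  whose integrand is \<open>\<infinity>\<close> where the cluster is infinite.
\<close>

definition exp_moment ::
    "'w measure \<Rightarrow> ('d::{finite,linorder} point \<Rightarrow> real) \<Rightarrow>
     (real \<Rightarrow> nat \<Rightarrow> 'w \<Rightarrow> 'd point) \<Rightarrow>
     (real \<Rightarrow> point_index \<times> point_index \<Rightarrow> 'w \<Rightarrow> real) \<Rightarrow> real \<Rightarrow> real \<Rightarrow> ennreal" where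
  "exp_moment M \<phi> X U t z =
     (\<integral>\<^sup>+\<omega>. (let C = cluster \<phi> 0 (marked_edges X U t {0} (\<lambda>_. 0) \<omega>)
            in if finite C then ennreal (exp (z * real (card C))) else \<infinity>) \<partial>M)"

definition t_star ::
    "'w measure \<Rightarrow> ('d::{finite,linorder} point \<Rightarrow> real) \<Rightarrow>
     (real \<Rightarrow> nat \<Rightarrow> 'w \<Rightarrow> 'd point) \<Rightarrow>
     (real \<Rightarrow> point_index \<times> point_index \<Rightarrow> 'w \<Rightarrow> real) \<Rightarrow> ereal" where
  "t_star M \<phi> X U = (SUP t\<in>{t. 0 \<le> t \<and> (\<exists>z>0. exp_moment M \<phi> X U t z < \<infinity>)}. ereal t)"

definition subcritical ::
    "'w measure \<Rightarrow> ('d::{finite,linorder} point \<Rightarrow> real) \<Rightarrow>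
     (real \<Rightarrow> nat \<Rightarrow> 'w \<Rightarrow> 'd point) \<Rightarrow>
     (real \<Rightarrow> point_index \<times> point_index \<Rightarrow> 'w \<Rightarrow> real) \<Rightarrow> real set" where
  "subcritical M \<phi> X U = {t. 0 \<le> t \<and> ereal t < t_star M \<phi> X U}"

text \<open>
  In the coefficient \<open>p\<^sub>n(x, s)\<close> the added points \<open>0, x\<^sub>1, \<dots>, x\<^sub>n, x\<close> have the indices
  \<open>0, 1, \<dots>, n, n + 1\<close>.
\<close>

definition expansion_integrand ::
    "'w measure \<Rightarrow> ('d::{finite,linorder} point \<Rightarrow> real) \<Rightarrow>
     (real \<Rightarrow> nat \<Rightarrow> 'w \<Rightarrow> 'd point) \<Rightarrow>
     (real \<Rightarrow> point_index \<times> point_index \<Rightarrow> 'w \<Rightarrow> real) \<Rightarrow>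
     nat \<Rightarrow> 'd point \<Rightarrow> real \<Rightarrow> (nat \<Rightarrow> 'd point) \<Rightarrow> real" where
  "expansion_integrand M \<phi> X U n x s xs =
     (LINT \<omega>|M. (\<Sum>J\<in>Pow {1..n}. (-1) ^ (n - card J) *
        of_bool (x \<in> cluster \<phi> 0
          (marked_edges X U s ({0} \<union> J \<union> {Suc n})
             (\<lambda>k. if k = 0 then 0 else if k \<le> n then xs k else x) \<omega>))))"

definition expansion_coeff ::
    "'w measure \<Rightarrow> ('d::{finite,linorder} point \<Rightarrow> real) \<Rightarrow>
     (real \<Rightarrow> nat \<Rightarrow> 'w \<Rightarrow> 'd point) \<Rightarrow>
     (real \<Rightarrow> point_index \<times> point_index \<Rightarrow> 'w \<Rightarrow> real) \<Rightarrow>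
     nat \<Rightarrow> 'd point \<Rightarrow> real \<Rightarrow> real" where
  "expansion_coeff M \<phi> X U n x s =
     (if n = 0 then pair_conn M \<phi> X U s x
      else 1 / fact n *
        (LINT xs|PiM {1..n} (\<lambda>_. lborel). expansion_integrand M \<phi> X U n x s xs))"

definition L1_norm :: "('a::euclidean_space \<Rightarrow> real) \<Rightarrow> ennreal" where
  "L1_norm f = (\<integral>\<^sup>+x. ennreal \<bar>f x\<bar> \<partial>lborel)"

text \<open>The supremum over all points, not the essential supremum.\<close>

definition sup_norm :: "('a \<Rightarrow> real) \<Rightarrow> ennreal" where
  "sup_norm f = (SUP x. ennreal \<bar>f x\<bar>)"

definition in_L1 :: "('a::euclidean_space \<Rightarrow> real) \<Rightarrow> bool" where
  "in_L1 f \<longleftrightarrow> f \<in> borel_measurable borel \<and> L1_norm f < \<infinity>"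

definition in_Linf :: "('a::euclidean_space \<Rightarrow> real) \<Rightarrow> bool" where
  "in_Linf f \<longleftrightarrow> f \<in> borel_measurable borel \<and> sup_norm f < \<infinity>"

definition sums_in_L1 :: "(nat \<Rightarrow> 'a::euclidean_space \<Rightarrow> real) \<Rightarrow> ('a \<Rightarrow> real) \<Rightarrow> bool" where
  "sums_in_L1 f g \<longleftrightarrow> (\<forall>n. in_L1 (f n)) \<and> in_L1 g \<and>
     (\<lambda>N. L1_norm (\<lambda>x. g x - (\<Sum>n<N. f n x))) \<longlonglongrightarrow> 0"

definition sums_in_Linf :: "(nat \<Rightarrow> 'a::euclidean_space \<Rightarrow> real) \<Rightarrow> ('a \<Rightarrow> real) \<Rightarrow> bool" where
  "sums_in_Linf f g \<longleftrightarrow> (\<forall>n. in_Linf (f n)) \<and> in_Linf g \<and>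
     (\<lambda>N. sup_norm (\<lambda>x. g x - (\<Sum>n<N. f n x))) \<longlonglongrightarrow> 0"

end

theory Submission
  imports Defs
begin

text \<open>
  Summing over the Poisson points which belong to the cluster of \<open>0\<close>, the factorial moment formula
  and the avoidance probability of the remaining points give
  \<open>P\<^sub>t(x) = (\<Sum>m. t\<^sup>m / m! * (\<integral> g(v) exp (- t V(v)) dv))\<close>, where \<open>g(v)\<close> is the probability that the graph on
  \<open>0, x, v\<^sub>1, \<dots>, v\<^sub>m\<close> is connected and \<open>V(v)\<close> the expected volume of the points adjacent to it, so that
  \<open>V \<le> (m + 2) m\<^sub>\<phi>\<close>.  An inclusion-exclusion over the added points \<open>x\<^sub>1, \<dots>, x\<^sub>n\<close> identifies \<open>p\<^sub>n(x, s)\<close>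
  with the \<open>n\<close>-th Taylor coefficient of this series at \<open>s\<close>.  The coefficients and the remainder are
  dominated by the series with \<open>(s + r)\<^sup>m exp ((r - s) V)\<close> in place of \<open>s\<^sup>m exp (- s V)\<close>.  As \<open>V\<close> grows
  at most linearly in the size of the cluster, this replacement costs a factor exponential in the
  size, with a rate that is small with \<open>r\<close>, and is absorbed by the exponential moment.
\<close>

section \<open>Factorial moments of the Poisson process\<close>

text \<open>The process is known only through an enumeration and the laws of its counts, and marks
  are attached to pairs of indices. What can be computed directly are sums over injective tuples of
  indices, so the law of a cluster becomes explicit only after summing over all indexings of its
  points. The avoidance probability is likewise extracted from factorial moments, without
  subtraction in extended nonnegative reals. Nothing relates the processes at different intensities,
  so no coupling compares \<open>s\<close> with \<open>t\<close>. Instead, thinning at intensity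
  \<open>t\<close> with retention probability \<open>p\<close> shows that the cluster law is a
  series in \<open>p * t\<close> alone. Thus a finite exponential moment at some
  \<open>t > s\<close> yields one at \<open>s\<close> itself. Half of the exponential rate is held
  in reserve: in the supremum norm it covers the second added point, in the integral norm the factor
  proportional to the cluster size that integration over \<open>x\<close> produces. As the supremum
  is over all points, \<open>x = 0\<close>, where two added points coincide, is evaluated
  directly.\<close>

definition injs :: "nat \<Rightarrow> nat set \<Rightarrow> (nat \<Rightarrow> nat) set" where
  "injs k T = {j \<in> {..<k} \<rightarrow>\<^sub>E T. inj_on j {..<k}}"

lemma countable_injs [simp]: "countable (injs k T)"
  unfolding injs_def by (rule countable_subset[of _ "{..<k} \<rightarrow>\<^sub>E T"]) (auto intro!: countable_PiE)

lemma injs_0: "injs 0 T = {\<lambda>_. undefined}"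
  by (auto simp: injs_def)

lemma injs_empty: "0 < k \<Longrightarrow> injs k {} = {}"
  by (auto simp: injs_def PiE_eq_empty_iff)

text \<open>The tuple is built one entry at a time. By disjointness only earlier entries assigned to
  the same cell block a choice for the new one, which leaves \<open>card (S b) - q\<close> choices
  when \<open>q\<close> entries of cell \<open>b\<close> are already placed. If a cell is too small,
  the truncated difference makes one factor zero, as it should.\<close>

lemma card_injs_disjoint:
  fixes S :: "'c \<Rightarrow> nat set"
  assumes fin: "finite D" "\<And>b. b \<in> D \<Longrightarrow> finite (S b)"
    and disj: "\<And>b b'. b \<in> D \<Longrightarrow> b' \<in> D \<Longrightarrow> b \<noteq> b' \<Longrightarrow> S b \<inter> S b' = {}"
    and c: "\<And>i. i < k \<Longrightarrow> c i \<in> D"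
  shows "finite {j \<in> injs k UNIV. \<forall>i<k. j i \<in> S (c i)} \<and>
    card {j \<in> injs k UNIV. \<forall>i<k. j i \<in> S (c i)} =
      (\<Prod>b\<in>D. \<Prod>q<card {i. i < k \<and> c i = b}. card (S b) - q)"
  using c
proof (induction k)
  case 0
  then show ?case by (simp add: injs_0)
next
  case (Suc k)
  let ?E = "\<lambda>k. {j \<in> injs k UNIV. \<forall>i<k. j i \<in> S (c i)}"
  let ?r = "\<lambda>k b. card {i. i < k \<and> c i = b}"
  have IH: "finite (?E k)" "card (?E k) = (\<Prod>b\<in>D. \<Prod>q<?r k b. card (S b) - q)"
    using Suc by auto
  have ck: "c k \<in> D" using Suc.prems by simp
  have cD: "c i \<in> D" if "i < Suc k" for i using Suc.prems that by blast
  let ?F = "\<lambda>(j, v). j(k := v)"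
  have inj: "inj_on ?F (SIGMA j:?E k. S (c k) - j ` {..<k})"
  proof (rule inj_onI, clarsimp)
    fix j v j' v' assume a: "j \<in> injs k UNIV" "j' \<in> injs k UNIV" "j(k := v) = j'(k := v')"
    have "v = v'" using fun_upd_eqD[OF a(3)] .
    moreover have "j i = j' i" for i
    proof (cases "i = k")
      case True then show ?thesis using a(1,2) by (auto simp: injs_def PiE_def extensional_def)
    next
      case False then show ?thesis using fun_cong[OF a(3), of i] by simp
    qed
    ultimately show "j = j' \<and> v = v'" by auto
  qed
  have img: "?E (Suc k) = ?F ` (SIGMA j:?E k. S (c k) - j ` {..<k})"
  proof (intro equalityI subsetI)
    fix j assume j: "j \<in> ?E (Suc k)"
    let ?g = "j(k := undefined)"
    have "?g \<in> ?E k" using j by (auto simp: injs_def PiE_def extensional_def inj_on_def)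
    moreover have "j k \<noteq> j i" if "i < k" for i
      using j that inj_on_eq_iff[of j "{..<Suc k}" k i] by (auto simp: injs_def)
    then have "j k \<in> S (c k) - ?g ` {..<k}" using j by auto
    ultimately have "(?g, j k) \<in> (SIGMA j:?E k. S (c k) - j ` {..<k})" by blast
    moreover have "j = ?F (?g, j k)" by auto
    ultimately show "j \<in> ?F ` (SIGMA j:?E k. S (c k) - j ` {..<k})" by blast
  next
    fix j assume "j \<in> ?F ` (SIGMA j:?E k. S (c k) - j ` {..<k})"
    then obtain g v where g: "g \<in> ?E k" "v \<in> S (c k)" "v \<notin> g ` {..<k}" "j = g(k := v)" by auto
    then show "j \<in> ?E (Suc k)"
      by (auto simp: injs_def PiE_def extensional_def less_Suc_eq lessThan_Suc inj_on_def)
  qed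
  have card_diff: "card (S (c k) - j ` {..<k}) = card (S (c k)) - ?r k (c k)" if j: "j \<in> ?E k" for j
  proof -
    have "S (c k) \<inter> j ` {..<k} = j ` {i. i < k \<and> c i = c k}"
    proof (intro equalityI subsetI)
      fix v assume "v \<in> S (c k) \<inter> j ` {..<k}"
      then obtain i where i: "i < k" "v = j i" "v \<in> S (c k)" by auto
      have "j i \<in> S (c i)" using j i by auto
      then have "c i = c k" using disj[of "c i" "c k"] cD i ck by (auto simp: less_Suc_eq)
      then show "v \<in> j ` {i. i < k \<and> c i = c k}" using i by auto
    next
      fix v assume "v \<in> j ` {i. i < k \<and> c i = c k}"
      then obtain i where "i < k" "c i = c k" "v = j i" by auto
      then show "v \<in> S (c k) \<inter> j ` {..<k}" using j by (metis (mono_tags, lifting) IntI image_eqI lessThan_iff mem_Collect_eq)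
    qed
    moreover have "card (j ` {i. i < k \<and> c i = c k}) = ?r k (c k)"
      using j by (intro card_image) (auto simp: injs_def inj_on_def)
    ultimately show ?thesis
      by (metis card_Diff_subset_Int finite_Int fin(2)[OF ck])
  qed
  have "finite (SIGMA j:?E k. S (c k) - j ` {..<k})"
    using IH(1) fin(2)[OF ck] by (intro finite_SigmaI) auto
  then have f: "finite (?E (Suc k))" unfolding img by (rule finite_imageI)
  have "card (?E (Suc k)) = card (SIGMA j:?E k. S (c k) - j ` {..<k})"
    unfolding img by (rule card_image[OF inj])
  also have "\<dots> = (\<Sum>j\<in>?E k. card (S (c k) - j ` {..<k}))"
    using IH(1) fin(2)[OF ck] by (intro card_SigmaI) auto
  also have "\<dots> = (\<Sum>j\<in>?E k. card (S (c k)) - ?r k (c k))"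
    by (intro sum.cong refl card_diff)
  also have "\<dots> = (card (S (c k)) - ?r k (c k)) * (\<Prod>b\<in>D. \<Prod>q<?r k b. card (S b) - q)"
    using IH(2) by simp
  also have "\<dots> = (\<Prod>b\<in>D. \<Prod>q<?r (Suc k) b. card (S b) - q)"
  proof -
    have r: "?r (Suc k) b = (if b = c k then Suc (?r k b) else ?r k b)" for b
    proof (cases "b = c k")
      case True
      then have "{i. i < Suc k \<and> c i = b} = insert k {i. i < k \<and> c i = b}" by (auto simp: less_Suc_eq)
      then show ?thesis using True by simp
    next
      case False
      then have "{i. i < Suc k \<and> c i = b} = {i. i < k \<and> c i = b}" by (auto simp: less_Suc_eq)
      then show ?thesis using False by simp
    qed
    have D: "D = insert (c k) (D - {c k})" using ck by auto
    have "(\<Prod>b\<in>D. \<Prod>q<?r (Suc k) b. card (S b) - q)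
       = (\<Prod>q<?r (Suc k) (c k). card (S (c k)) - q) * (\<Prod>b\<in>D-{c k}. \<Prod>q<?r (Suc k) b. card (S b) - q)"
      by (rule prod.remove[OF fin(1) ck])
    moreover have "(\<Prod>b\<in>D. \<Prod>q<?r k b. card (S b) - q)
       = (\<Prod>q<?r k (c k). card (S (c k)) - q) * (\<Prod>b\<in>D-{c k}. \<Prod>q<?r k b. card (S b) - q)"
      by (rule prod.remove[OF fin(1) ck])
    moreover have "(\<Prod>b\<in>D-{c k}. \<Prod>q<?r (Suc k) b. card (S b) - q)
        = (\<Prod>b\<in>D-{c k}. \<Prod>q<?r k b. card (S b) - q)"
      by (intro prod.cong refl) (auto simp: r)
    ultimately show ?thesis by (simp add: r algebra_simps)
  qed
  finally show ?case using f by blast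
qed

lemma fact_eq_falling: "r \<le> k \<Longrightarrow> fact k = (\<Prod>q<r. k - q) * fact (k - r)"
proof (induction r)
  case (Suc r)
  then have "k - r = Suc (k - Suc r)" by simp
  then have "fact (k - r) = (k - r) * fact (k - Suc r)" by (metis fact_Suc of_nat_id)
  then show ?case using Suc by (simp add: algebra_simps)
qed simp

lemma falling_zero: "k < r \<Longrightarrow> (\<Prod>q<r. k - q) = (0::nat)"
  by (intro prod_zero) auto

text \<open>The falling factorial cancels against \<open>fact k\<close> and leaves the exponential
  series shifted by \<open>r\<close>; the first \<open>r\<close> terms vanish because natural
  subtraction truncates. These are the factorial moments of the Poisson law.\<close>

lemma poisson_falling_sums:
  fixes l :: real
  shows "(\<lambda>k. real (\<Prod>q<r. k - q) * (l ^ k / fact k * exp (- l))) sums (l ^ r)"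
proof -
  have "(\<lambda>k. l ^ k / fact k) sums exp l"
    using exp_converges[of l] by (simp add: scaleR_conv_of_real field_simps)
  then have "(\<lambda>k. l ^ k / fact k * (l ^ r * exp (- l))) sums (exp l * (l ^ r * exp (- l)))"
    by (rule sums_mult2)
  also have "exp l * (l ^ r * exp (- l)) = l ^ r" by (simp add: exp_minus field_simps)
  also have "(\<lambda>k. l ^ k / fact k * (l ^ r * exp (- l)))
     = (\<lambda>k. real (\<Prod>q<r. (k + r) - q) * (l ^ (k + r) / fact (k + r) * exp (- l)))"
  proof
    fix k
    have "fact (k + r) = real (\<Prod>q<r. (k + r) - q) * fact k"
      using fact_eq_falling[of r "k + r"] by (metis add_diff_cancel_right' le_add2 of_nat_fact of_nat_mult)
    moreover have "real (\<Prod>q<r. (k + r) - q) \<noteq> 0"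
      using calculation by (metis fact_nonzero mult_zero_left)
    ultimately show "l ^ k / fact k * (l ^ r * exp (- l)) =
        real (\<Prod>q<r. (k + r) - q) * (l ^ (k + r) / fact (k + r) * exp (- l))"
      by (simp add: power_add field_simps del: of_nat_prod)
  qed
  finally show ?thesis
    by (subst (asm) sums_iff_shift) (simp add: falling_zero del: of_nat_prod)
qed

text \<open>Both subtractions truncate at zero. Falling factorials of counts can therefore be formed
  in \<open>ennreal\<close>, where the counts live.\<close>

lemma of_nat_diff_ennreal: "of_nat (a - b) = (of_nat a - of_nat b :: ennreal)"
proof (cases "b \<le> a")
  case True
  then show ?thesis
    by (simp add: ennreal_of_nat_eq_real_of_nat ennreal_minus of_nat_diff)
next
  case False
  then show ?thesis by (simp add: ennreal_of_nat_eq_real_of_nat ennreal_minus ennreal_neg)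
qed

text \<open>The prescribed weights add up to one, so the count is almost surely a natural number and
  in particular finite. The expectation is then a series over its values.\<close>

lemma (in prob_space) poisson_factorial_moment:
  fixes N :: "'a \<Rightarrow> ennreal"
  assumes [measurable]: "N \<in> borel_measurable M"
    and l: "0 \<le> l"
    and P: "\<And>k. \<P>(\<omega> in M. N \<omega> = of_nat k) = l ^ k / fact k * exp (- l)"
  shows "AE \<omega> in M. \<exists>k. N \<omega> = of_nat k"
    and "(\<integral>\<^sup>+\<omega>. (\<Prod>q<r. N \<omega> - of_nat q) \<partial>M) = ennreal (l ^ r)"
proof -
  have A[measurable]: "{\<omega>\<in>space M. N \<omega> = of_nat k} \<in> sets M" for k by measurable
  have em: "emeasure M {\<omega>\<in>space M. N \<omega> = of_nat k} = ennreal (l ^ k / fact k * exp (- l))" for k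
    unfolding P[symmetric] by (simp add: emeasure_eq_measure)
  have nn: "0 \<le> l ^ k / fact k * exp (- l)" for k using l by simp
  have "emeasure M (\<Union>k. {\<omega>\<in>space M. N \<omega> = of_nat k}) = (\<Sum>k. ennreal (l ^ k / fact k * exp (- l)))"
    unfolding em[symmetric]
    by (intro suminf_emeasure[symmetric]) (auto simp: disjoint_family_on_def)
  also have "\<dots> = ennreal 1"
    using poisson_falling_sums[of 0 l] nn by (intro suminf_ennreal_eq) auto
  finally have 1: "emeasure M (\<Union>k. {\<omega>\<in>space M. N \<omega> = of_nat k}) = 1" by simp
  have "AE \<omega> in M. \<omega> \<in> (\<Union>k. {\<omega>\<in>space M. N \<omega> = of_nat k})"
    using 1 by (intro AE_prob_1) (simp add: emeasure_eq_measure)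
  then show AE: "AE \<omega> in M. \<exists>k. N \<omega> = of_nat k" by eventually_elim auto
  have "(\<integral>\<^sup>+\<omega>. (\<Prod>q<r. N \<omega> - of_nat q) \<partial>M)
     = (\<integral>\<^sup>+\<omega>. (\<Sum>k. of_nat (\<Prod>q<r. k - q) * indicator {\<omega>\<in>space M. N \<omega> = of_nat k} \<omega>) \<partial>M)"
  proof (intro nn_integral_cong_AE, use AE AE_space in eventually_elim)
    case (elim \<omega>)
    then obtain k where k: "N \<omega> = of_nat k" by auto
    have "(\<Sum>k. of_nat (\<Prod>q<r. k - q) * indicator {\<omega>\<in>space M. N \<omega> = of_nat k} \<omega>)
      = (\<Sum>k\<in>{k}. of_nat (\<Prod>q<r. k - q) * indicator {\<omega>\<in>space M. N \<omega> = of_nat k} \<omega> :: ennreal)"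
      using k by (intro suminf_finite) (auto simp: indicator_def)
    also have "\<dots> = of_nat (\<Prod>q<r. k - q)" using k elim by (simp add: indicator_def)
    also have "\<dots> = (\<Prod>q<r. N \<omega> - of_nat q)" by (simp add: k of_nat_diff_ennreal)
    finally show ?case by simp
  qed
  also have "\<dots> = (\<Sum>k. of_nat (\<Prod>q<r. k - q) * emeasure M {\<omega>\<in>space M. N \<omega> = of_nat k})"
    by (subst nn_integral_suminf) (auto simp: nn_integral_cmult)
  also have "\<dots> = (\<Sum>k. ennreal (real (\<Prod>q<r. k - q) * (l ^ k / fact k * exp (- l))))"
    unfolding em by (simp only: ennreal_of_nat_eq_real_of_nat ennreal_mult[OF of_nat_0_le_iff nn])
  also have "\<dots> = ennreal (l ^ r)"
    by (rule suminf_ennreal_eq[OF mult_nonneg_nonneg[OF of_nat_0_le_iff nn] poisson_falling_sums])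
  finally show "(\<integral>\<^sup>+\<omega>. (\<Prod>q<r. N \<omega> - of_nat q) \<partial>M) = ennreal (l ^ r)" .
qed

lemma borel_measurable_nn_integral_count_space:
  fixes f :: "'i \<Rightarrow> 'a \<Rightarrow> ennreal"
  assumes I: "countable I" and [measurable]: "\<And>i. i \<in> I \<Longrightarrow> f i \<in> borel_measurable M"
  shows "(\<lambda>x. \<integral>\<^sup>+i. f i x \<partial>count_space I) \<in> borel_measurable M"
proof (cases "finite I")
  case True
  then show ?thesis by (simp add: nn_integral_count_space_finite)
next
  case False
  note * = bij_betw_from_nat_into[OF I False]
  have "I \<noteq> {}" using False by auto
  then have [measurable]: "f (from_nat_into I n) \<in> borel_measurable M" for n
    by (intro assms(2) from_nat_into)
  have "(\<integral>\<^sup>+i. f i x \<partial>count_space I) = (\<Sum>n. f (from_nat_into I n) x)" for x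
    by (simp add: nn_integral_bij_count_space[symmetric, OF *] nn_integral_count_space_nat)
  then show ?thesis by simp
qed

section \<open>Factorial moment measures of the enumerated process\<close>

context random_connection_model
begin

text \<open>The locale constrains \<open>X t\<close> only for \<open>t > 0\<close>; at intensity
  zero the process is empty, so there are no indices.\<close>

definition pts :: "real \<Rightarrow> nat set" where
  "pts t = (if 0 < t then UNIV else {})"

lemma X_measurable [measurable]: "0 < t \<Longrightarrow> X t i \<in> borel_measurable M"
  using poisson[of t] by (auto simp: poisson_enumeration_def)

text \<open>When the cells are pairwise equal or disjoint, the inner sum counts injective tuples and
  is a product of falling factorials of cell counts. These counts are independent and Poisson, so
  the expectation splits into factorial moments.\<close>

lemma factorial_moment_disjoint:
  assumes t: "0 < t" and fin: "finite D" and D: "D \<subseteq> sets borel" and disj: "disjoint D"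
    and fm: "\<And>B. B \<in> D \<Longrightarrow> emeasure lborel B < \<infinity>"
    and c: "\<And>i. i < k \<Longrightarrow> c i \<in> D"
  shows "(\<integral>\<^sup>+\<omega>. (\<integral>\<^sup>+j. (\<Prod>i<k. indicator (c i) (X t (j i) \<omega>)) \<partial>count_space (injs k UNIV)) \<partial>M)
    = (\<Prod>i<k. ennreal t * emeasure lborel (c i))"
proof -
  let ?N = "point_count (X t)"
  let ?r = "\<lambda>b. card {i. i < k \<and> c i = b}"
  have PE: "poisson_enumeration M t (X t)" using poisson[OF t] .
  have ind: "indep_vars (\<lambda>_. borel) ?N D"
    using PE D fin disj unfolding poisson_enumeration_def by blast
  then have [measurable]: "?N B \<in> borel_measurable M" if "B \<in> D" for B
    using that by (auto simp: indep_vars_def)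
  have law: "\<P>(\<omega> in M. ?N B \<omega> = of_nat n)
      = (t * measure lborel B) ^ n / fact n * exp (- (t * measure lborel B))" if "B \<in> D" for B n
    using PE D fm that unfolding poisson_enumeration_def by blast
  have pm: "AE \<omega> in M. \<exists>n. ?N B \<omega> = of_nat n"
    "(\<integral>\<^sup>+\<omega>. (\<Prod>q<r. ?N B \<omega> - of_nat q) \<partial>M) = ennreal ((t * measure lborel B) ^ r)"
    if B: "B \<in> D" for B r
    using poisson_factorial_moment[of "?N B" "t * measure lborel B"] law[OF B] B t by auto
  have fin_AE: "AE \<omega> in M. \<forall>B\<in>D. \<exists>n. ?N B \<omega> = of_nat n"
    using pm(1) fin by (intro AE_finite_allI) auto
  have "(\<integral>\<^sup>+\<omega>. (\<integral>\<^sup>+j. (\<Prod>i<k. indicator (c i) (X t (j i) \<omega>)) \<partial>count_space (injs k UNIV)) \<partial>M)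
     = (\<integral>\<^sup>+\<omega>. (\<Prod>b\<in>D. \<Prod>q<?r b. ?N b \<omega> - of_nat q) \<partial>M)"
  proof (intro nn_integral_cong_AE, use fin_AE in eventually_elim)
    case (elim \<omega>)
    let ?S = "\<lambda>B. {i. X t i \<omega> \<in> B}"
    have S: "finite (?S B)" "?N B \<omega> = of_nat (card (?S B))" if B: "B \<in> D" for B
    proof -
      obtain n where "?N B \<omega> = of_nat n" using elim B by blast
      then have "emeasure (count_space UNIV) (?S B) \<noteq> \<infinity>" unfolding point_count_def by simp
      then show f: "finite (?S B)" using emeasure_count_space_infinite[of "?S B" UNIV] by blast
      then show "?N B \<omega> = of_nat (card (?S B))" by (simp add: point_count_def)
    qed
    let ?E = "{j \<in> injs k UNIV. \<forall>i<k. j i \<in> ?S (c i)}"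
    have *: "finite ?E" "card ?E = (\<Prod>b\<in>D. \<Prod>q<?r b. card (?S b) - q)"
    proof -
      have "?S b \<inter> ?S b' = {}" if "b \<in> D" "b' \<in> D" "b \<noteq> b'" for b b'
        using disjointD[OF disj that] by auto
      note card_injs_disjoint[where D=D and S="?S" and c=c and k=k, OF fin S(1) this c]
      then show "finite ?E" "card ?E = (\<Prod>b\<in>D. \<Prod>q<?r b. card (?S b) - q)" by simp_all
    qed
    have "(\<integral>\<^sup>+j. (\<Prod>i<k. indicator (c i) (X t (j i) \<omega>)) \<partial>count_space (injs k UNIV))
       = (\<integral>\<^sup>+j. indicator ?E j \<partial>count_space (injs k UNIV))"
      by (intro nn_integral_cong) (auto simp: indicator_def of_bool_def prod_eq_1_iff intro!: prod_zero)
    also have "\<dots> = of_nat (card ?E)" using *(1) by (subst nn_integral_indicator) auto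
    also have "\<dots> = (\<Prod>b\<in>D. \<Prod>q<?r b. ?N b \<omega> - of_nat q)"
      unfolding *(2) by (simp add: S(2) of_nat_diff_ennreal cong: prod.cong)
    finally show ?case .
  qed
  also have "\<dots> = (\<Prod>b\<in>D. \<integral>\<^sup>+\<omega>. (\<Prod>q<?r b. ?N b \<omega> - of_nat q) \<partial>M)"
    by (intro indep_vars_nn_integral fin indep_vars_compose2[OF ind, of "\<lambda>b v. \<Prod>q<?r b. v - of_nat q"]) auto
  also have "\<dots> = (\<Prod>b\<in>D. \<Prod>i\<in>{i \<in> {..<k}. c i = b}. ennreal t * emeasure lborel (c i))"
  proof (intro prod.cong refl)
    fix b assume b: "b \<in> D"
    have "(\<Prod>i\<in>{i \<in> {..<k}. c i = b}. ennreal t * emeasure lborel (c i))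
       = (ennreal t * emeasure lborel b) ^ ?r b" by simp
    also have "\<dots> = ennreal ((t * measure lborel b) ^ ?r b)"
    proof -
      have "ennreal t * emeasure lborel b = ennreal (t * measure lborel b)"
        using fm[OF b] t by (simp add: emeasure_eq_ennreal_measure ennreal_mult)
      then show ?thesis using t by (simp add: ennreal_power)
    qed
    finally show "(\<integral>\<^sup>+\<omega>. (\<Prod>q<?r b. ?N b \<omega> - of_nat q) \<partial>M)
        = (\<Prod>i\<in>{i \<in> {..<k}. c i = b}. ennreal t * emeasure lborel (c i))"
      using pm(2)[OF b] by simp
  qed
  also have "\<dots> = (\<Prod>i<k. ennreal t * emeasure lborel (c i))"
    using fin c by (intro prod.group) auto
  finally show ?thesis .
qed

text \<open>
  Splitting the sides of a rectangle into the atoms of the finite algebra they generate reduces it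
  to rectangles whose sides are pairwise equal or disjoint.
\<close>

lemma factorial_moment_rectangle:
  assumes t: "0 < t" and A: "\<And>i. i < k \<Longrightarrow> A i \<in> sets borel"
    and fm: "\<And>i. i < k \<Longrightarrow> emeasure lborel (A i) < \<infinity>"
  shows "(\<integral>\<^sup>+\<omega>. (\<integral>\<^sup>+j. (\<Prod>i<k. indicator (A i) (X t (j i) \<omega>)) \<partial>count_space (injs k UNIV)) \<partial>M)
    = (\<Prod>i<k. ennreal t * emeasure lborel (A i))"
proof -
  define B where "B \<sigma> = {x. \<forall>i<k. x \<in> A i \<longleftrightarrow> i \<in> \<sigma>}" for \<sigma>
  let ?G = "\<lambda>i. {\<sigma>\<in>Pow {..<k}. i \<in> \<sigma>}"
  have B[measurable]: "B \<sigma> \<in> sets borel" for \<sigma>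
  proof -
    have "B \<sigma> = (\<Inter>i\<in>{..<k}. if i \<in> \<sigma> then A i else - A i)" by (auto simp: B_def split: if_splits)
    moreover have "\<dots> \<in> sets borel" if "k \<noteq> 0"
      by (rule sets.finite_INT) (use that A in auto)
    moreover have "B \<sigma> = UNIV" if "k = 0" using that by (simp add: B_def)
    ultimately show ?thesis by (cases "k = 0") auto
  qed
  have Bsub: "B \<sigma> \<subseteq> A i" if "\<sigma> \<in> ?G i" "i < k" for \<sigma> i
    using that by (auto simp: B_def)
  have ind: "indicator (A i) x = (\<Sum>\<sigma>\<in>?G i. indicator (B \<sigma>) x :: ennreal)" if "i < k" for i x
  proof -
    let ?s = "{i. i < k \<and> x \<in> A i}"
    have "indicator (B \<sigma>) x = (indicator {?s} \<sigma> :: ennreal)" if "\<sigma> \<in> ?G i" for \<sigma>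
      using that by (auto simp: B_def indicator_def)
    then have "(\<Sum>\<sigma>\<in>?G i. indicator (B \<sigma>) x :: ennreal) = (\<Sum>\<sigma>\<in>?G i. indicator {?s} \<sigma>)"
      by (intro sum.cong) auto
    also have "\<dots> = indicator (?G i) ?s" by (simp add: indicator_def)
    also have "\<dots> = indicator (A i) x" using that by (auto simp: indicator_def)
    finally show ?thesis by simp
  qed
  have em: "emeasure lborel (A i) = (\<Sum>\<sigma>\<in>?G i. emeasure lborel (B \<sigma>))" if "i < k" for i
  proof -
    have "emeasure lborel (A i) = (\<integral>\<^sup>+x. indicator (A i) x \<partial>lborel)" using A that by simp
    also have "\<dots> = (\<Sum>\<sigma>\<in>?G i. emeasure lborel (B \<sigma>))" by (simp add: ind that nn_integral_sum)
    finally show ?thesis .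
  qed
  \<comment> \<open>The atom of the empty \<open>\<sigma>\<close> is left out: it lies outside all
    sides and may have infinite volume.\<close>
  let ?D = "B ` (\<Union>i\<in>{..<k}. ?G i)"
  let ?P = "PiE {..<k} ?G"
  have finP: "finite ?P" by (intro finite_PiE) auto
  have "(\<integral>\<^sup>+\<omega>. (\<integral>\<^sup>+j. (\<Prod>i<k. indicator (A i) (X t (j i) \<omega>)) \<partial>count_space (injs k UNIV)) \<partial>M)
    = (\<integral>\<^sup>+\<omega>. (\<integral>\<^sup>+j. (\<Sum>g\<in>?P. \<Prod>i<k. indicator (B (g i)) (X t (j i) \<omega>)) \<partial>count_space (injs k UNIV)) \<partial>M)"
    by (subst prod_sum_PiE[symmetric]) (auto simp: ind)
  also have "\<dots> = (\<integral>\<^sup>+\<omega>. (\<Sum>g\<in>?P. (\<integral>\<^sup>+j. (\<Prod>i<k. indicator (B (g i)) (X t (j i) \<omega>)) \<partial>count_space (injs k UNIV))) \<partial>M)"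
    by (simp add: nn_integral_sum)
  also have "\<dots> = (\<Sum>g\<in>?P. (\<integral>\<^sup>+\<omega>. (\<integral>\<^sup>+j. (\<Prod>i<k. indicator (B (g i)) (X t (j i) \<omega>)) \<partial>count_space (injs k UNIV)) \<partial>M))"
    using t by (intro nn_integral_sum borel_measurable_nn_integral_count_space countable_injs) measurable
  also have "\<dots> = (\<Sum>g\<in>?P. \<Prod>i<k. ennreal t * emeasure lborel (B (g i)))"
  proof (intro sum.cong refl factorial_moment_disjoint[where D="?D"] t)
    show "disjoint ?D" by (force simp: disjoint_def B_def)
    show "emeasure lborel b < \<infinity>" if "b \<in> ?D" for b
    proof -
      from that obtain s where "b = B s" "s \<in> (\<Union>i\<in>{..<k}. ?G i)" by (rule imageE)
      moreover from this(2) obtain i where "i < k" "s \<in> ?G i" by blast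
      ultimately have *: "b = B s" "i < k" "s \<in> ?G i" by blast+
      show ?thesis
        using * fm[of i] emeasure_mono[OF Bsub[OF *(3,2)], of lborel] A[of i] by (auto intro: le_less_trans)
    qed
    show "B (g i) \<in> ?D" if "g \<in> ?P" "i < k" for g i using that by (auto simp: PiE_iff)
  qed auto
  also have "\<dots> = (\<Prod>i<k. \<Sum>\<sigma>\<in>?G i. ennreal t * emeasure lborel (B \<sigma>))"
    by (subst prod_sum_PiE) auto
  also have "\<dots> = (\<Prod>i<k. ennreal t * emeasure lborel (A i))"
    by (simp add: em sum_distrib_left)
  finally show ?thesis .
qed

text \<open>The factorial moment measure of order \<open>k\<close> is the image of \<open>M\<close>
  times counting measure on injective tuples under evaluation. It agrees with \<open>t ^ k\<close>
  times Lebesgue measure on boxes, and uniqueness of the product measure does the rest. At intensity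
  zero both sides vanish unless the tuple is empty.\<close>

lemma factorial_moment:
  assumes t: "0 \<le> t" and f[measurable]: "f \<in> borel_measurable (PiM {..<k} (\<lambda>_. lborel))"
  shows "(\<integral>\<^sup>+\<omega>. (\<integral>\<^sup>+j. f (\<lambda>i\<in>{..<k}. X t (j i) \<omega>) \<partial>count_space (injs k (pts t))) \<partial>M)
    = ennreal (t ^ k) * (\<integral>\<^sup>+w. f w \<partial>PiM {..<k} (\<lambda>_. lborel))"
proof (cases "0 < t")
  case False
  then have "t = 0" "pts t = {}" using t by (auto simp: pts_def)
  then show ?thesis
    by (cases "k = 0")
       (simp_all add: injs_0 injs_empty nn_integral_count_space_finite PiM_empty emeasure_space_1 
         nn_integral_count_space_finite restrict_def)
next
  case True
  have T: "pts t = UNIV" using True by (simp add: pts_def)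
  let ?C = "count_space (injs k UNIV)" and ?Q = "PiM {..<k} (\<lambda>_. lborel) :: (nat \<Rightarrow> 'd point) measure"
  let ?h = "\<lambda>(\<omega>, j). \<lambda>i\<in>{..<k}. X t (j i) \<omega>"
  interpret L: product_sigma_finite "\<lambda>_::nat. lborel :: 'd point measure" by standard
  interpret C: sigma_finite_measure ?C by (rule sigma_finite_measure_count_space_countable) simp
  have Xm[measurable]: "(\<lambda>p. X t (snd p i) (fst p)) \<in> borel_measurable (M \<Otimes>\<^sub>M ?C)" for i
    using True
    by (intro measurable_compose_countable'[where I="UNIV" and g="\<lambda>p. snd p i" and f="\<lambda>n p. X t n (fst p)"]
      measurable_compose[OF measurable_snd]) (auto simp: measurable_count_space_eq1)
  have h[measurable]: "?h \<in> measurable (M \<Otimes>\<^sub>M ?C) ?Q"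
    unfolding case_prod_beta by (intro measurable_restrict) (simp add: measurable_lborel2)
  let ?P = "distr (M \<Otimes>\<^sub>M ?C) ?Q ?h"
  have int: "(\<integral>\<^sup>+w. g w \<partial>?P) = (\<integral>\<^sup>+\<omega>. (\<integral>\<^sup>+j. g (\<lambda>i\<in>{..<k}. X t (j i) \<omega>) \<partial>?C) \<partial>M)"
    if [measurable]: "g \<in> borel_measurable ?Q" for g :: "_ \<Rightarrow> ennreal"
    by (subst nn_integral_distr) (auto simp: C.nn_integral_fst[symmetric])
  have fin_rect: "emeasure ?P (Pi\<^sub>E {..<k} A) = ennreal (t ^ k) * emeasure ?Q (Pi\<^sub>E {..<k} A)"
    if A: "\<And>i. i < k \<Longrightarrow> A i \<in> sets borel" "\<And>i. i < k \<Longrightarrow> emeasure lborel (A i) < \<infinity>" for A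
  proof -
    have [measurable]: "Pi\<^sub>E {..<k} A \<in> sets ?Q" using A by (intro sets_PiM_I_finite) auto
    have "emeasure ?P (Pi\<^sub>E {..<k} A) = (\<integral>\<^sup>+w. indicator (Pi\<^sub>E {..<k} A) w \<partial>?P)" by simp
    also have "\<dots> = (\<integral>\<^sup>+\<omega>. (\<integral>\<^sup>+j. (\<Prod>i<k. indicator (A i) (X t (j i) \<omega>)) \<partial>?C) \<partial>M)"
      by (subst int) (auto intro!: nn_integral_cong prod_zero simp: indicator_def PiE_iff)
    also have "\<dots> = (\<Prod>i<k. ennreal t * emeasure lborel (A i))"
      by (rule factorial_moment_rectangle[OF True A])
    also have "\<dots> = ennreal (t ^ k) * emeasure ?Q (Pi\<^sub>E {..<k} A)"
      using A t by (subst L.emeasure_PiM) (auto simp: prod.distrib ennreal_power)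
    finally show ?thesis .
  qed
  \<comment> \<open>Sides of infinite volume are exhausted by balls; the formula for finite volumes
    carries over by monotone limits.\<close>
  have rect: "emeasure ?P (Pi\<^sub>E {..<k} A) = ennreal (t ^ k) * emeasure ?Q (Pi\<^sub>E {..<k} A)"
    if A: "\<And>i. i < k \<Longrightarrow> A i \<in> sets borel" for A
  proof -
    let ?A = "\<lambda>n::nat. Pi\<^sub>E {..<k} (\<lambda>i. A i \<inter> ball 0 (real n))"
    have m: "range ?A \<subseteq> sets ?Q" using A by (auto intro!: sets_PiM_I_finite)
    have i: "incseq ?A" by (intro monoI PiE_mono) (auto simp: subset_eq)
    have u: "(\<Union>n. ?A n) = Pi\<^sub>E {..<k} A"
    proof (intro equalityI subsetI)
      fix w assume w: "w \<in> Pi\<^sub>E {..<k} A"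
      have "\<exists>n::nat. \<forall>i<k. norm (w i) < real n"
      proof -
        obtain n :: nat where "(\<Sum>i<k. norm (w i)) < real n" using reals_Archimedean2 by blast
        moreover have "norm (w i) \<le> (\<Sum>i<k. norm (w i))" if "i < k" for i
          using that by (intro member_le_sum) auto
        ultimately show ?thesis by (meson le_less_trans)
      qed
      then show "w \<in> (\<Union>n. ?A n)" using w by (auto simp: PiE_iff)
    qed (auto simp: PiE_iff)
    have f: "emeasure lborel (A i \<inter> ball 0 (real n)) < \<infinity>" if "i < k" for i n
      using emeasure_mono[of "A i \<inter> ball 0 (real n)" "ball 0 (real n)" lborel]
        emeasure_lborel_ball_finite[of "0::'d point" "real n"] by (auto intro: le_less_trans)
    have "emeasure ?P (Pi\<^sub>E {..<k} A) = (SUP n. emeasure ?P (?A n))"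
      unfolding u[symmetric] using m i by (intro SUP_emeasure_incseq[symmetric]) auto
    also have "\<dots> = (SUP n. ennreal (t ^ k) * emeasure ?Q (?A n))"
      using A f by (intro SUP_cong refl fin_rect) auto
    also have "\<dots> = ennreal (t ^ k) * (SUP n. emeasure ?Q (?A n))"
      by (rule SUP_mult_left_ennreal[symmetric])
    also have "(SUP n. emeasure ?Q (?A n)) = emeasure ?Q (Pi\<^sub>E {..<k} A)"
      unfolding u[symmetric] using m i by (intro SUP_emeasure_incseq) auto
    finally show ?thesis .
  qed
  have tk: "ennreal (1 / t ^ k) * ennreal (t ^ k) = 1"
    using True by (simp add: ennreal_mult[symmetric])
  \<comment> \<open>The uniqueness rule characterises the product measure itself, so the factor
    \<open>t ^ k\<close> is divided out beforehand.\<close>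
  have "scale_measure (ennreal (1 / t ^ k)) ?P = ?Q"
    using rect tk by (intro L.PiM_eqI) (auto simp: mult.assoc[symmetric] intro!: L.emeasure_PiM)
  then have "(\<integral>\<^sup>+w. f w \<partial>?Q) = (\<integral>\<^sup>+w. f w \<partial>scale_measure (ennreal (1 / t ^ k)) ?P)" by simp
  also have "\<dots> = ennreal (1 / t ^ k) * (\<integral>\<^sup>+w. f w \<partial>?P)"
    by (rule nn_integral_scale_measure) simp
  finally have "(\<integral>\<^sup>+w. f w \<partial>?Q) = ennreal (1 / t ^ k) * (\<integral>\<^sup>+w. f w \<partial>?P)" .
  then show ?thesis
    unfolding T int[OF f, symmetric] using tk by (simp add: mult.assoc[symmetric] mult.commute)
qed

end

section \<open>Avoidance probabilities\<close>

lemma countable_finite_subsets [simp]: "countable {L :: 'a::countable set. L \<subseteq> T \<and> finite L \<and> P L}"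
  by (rule countable_subset[OF _ countable_Collect_finite]) auto

text \<open>Each set of \<open>l\<close> indices is the image of exactly \<open>fact l\<close>
  injective tuples; exchanging the sums over tuples and over sets collects them.\<close>

lemma nn_integral_injs_image:
  "(\<integral>\<^sup>+j. F (j ` {..<l}) \<partial>count_space (injs l T))
    = of_nat (fact l) * (\<integral>\<^sup>+L. F L \<partial>count_space {L. L \<subseteq> T \<and> finite L \<and> card L = l})"
proof -
  let ?\<L> = "{L. L \<subseteq> T \<and> finite L \<and> card L = l}"
  have "(\<integral>\<^sup>+j. F (j ` {..<l}) \<partial>count_space (injs l T))
     = (\<integral>\<^sup>+j. (\<integral>\<^sup>+L. F L * indicator {j ` {..<l}} L \<partial>count_space ?\<L>) \<partial>count_space (injs l T))"
  proof (intro nn_integral_cong)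
    fix j assume "j \<in> space (count_space (injs l T))"
    then have "j ` {..<l} \<in> ?\<L>" by (auto simp: injs_def card_image)
    then show "F (j ` {..<l}) = (\<integral>\<^sup>+L. F L * indicator {j ` {..<l}} L \<partial>count_space ?\<L>)"
      by (subst nn_integral_count_space'[of "{j ` {..<l}}"]) auto
  qed
  also have "\<dots> = (\<integral>\<^sup>+L. (\<integral>\<^sup>+j. F L * indicator {j ` {..<l}} L \<partial>count_space (injs l T)) \<partial>count_space ?\<L>)"
    by (intro nn_integral_count_space_nn_integral) auto
  also have "\<dots> = (\<integral>\<^sup>+L. of_nat (fact l) * F L \<partial>count_space ?\<L>)"
  proof (intro nn_integral_cong)
    fix L assume "L \<in> space (count_space ?\<L>)"
    then have L: "L \<subseteq> T" "finite L" "card L = l" by auto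
    let ?I = "{f \<in> {..<l} \<rightarrow>\<^sub>E L. inj_on f {..<l}}"
    have eq: "{j \<in> injs l T. j ` {..<l} = L} = ?I"
    proof (intro equalityI subsetI)
      fix j assume j: "j \<in> ?I"
      then have "j ` {..<l} \<subseteq> L" "card (j ` {..<l}) = card L" using L by (auto simp: card_image)
      then have "j ` {..<l} = L" using L(2) by (intro card_subset_eq) auto
      then show "j \<in> {j \<in> injs l T. j ` {..<l} = L}" using j L(1) by (auto simp: injs_def PiE_iff)
    next
      fix j assume "j \<in> {j \<in> injs l T. j ` {..<l} = L}"
      then show "j \<in> ?I" by (auto simp: injs_def PiE_iff)
    qed
    have fin: "finite ?I" using L by (intro finite_subset[of ?I "{..<l} \<rightarrow>\<^sub>E L"] finite_PiE) auto
    have "card ?I = prod ((-) l) {0..<l}"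
      using card_inj_on_subset_funcset[of "{..<l}" L "{..<l}"] L by simp
    also have "\<dots> = fact l" using fact_eq_falling[of l l] by (simp add: atLeast0LessThan)
    finally have c: "card ?I = fact l" .
    have "(\<integral>\<^sup>+j. F L * indicator {j ` {..<l}} L \<partial>count_space (injs l T))
       = (\<integral>\<^sup>+j. F L * indicator ?I j \<partial>count_space (injs l T))"
      unfolding eq[symmetric] by (intro nn_integral_cong) (auto simp: indicator_def)
    also have "\<dots> = F L * emeasure (count_space (injs l T)) ?I"
      unfolding eq[symmetric] by (subst nn_integral_cmult) auto
    also have "\<dots> = of_nat (fact l) * F L"
      using fin c eq by (subst emeasure_count_space_finite) (auto simp: mult.commute)
    finally show "(\<integral>\<^sup>+j. F L * indicator {j ` {..<l}} L \<partial>count_space (injs l T)) = of_nat (fact l) * F L" .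
  qed
  also have "\<dots> = of_nat (fact l) * (\<integral>\<^sup>+L. F L \<partial>count_space ?\<L>)"
    by (rule nn_integral_cmult) auto
  finally show ?thesis .
qed

text \<open>
  Inclusion-exclusion with the odd terms moved to the other side, so that it is an identity of
  extended nonnegative reals and needs no convergence assumption.
\<close>

lemma inclusion_exclusion_ennreal:
  fixes a :: "nat \<Rightarrow> real"
  assumes a: "\<And>i. 0 \<le> a i" "\<And>i. a i \<le> 1"
  shows "(INF N. ennreal (\<Prod>i\<in>S \<inter> {..<N}. 1 - a i))
      + (\<integral>\<^sup>+L. ennreal (\<Prod>i\<in>L. a i) \<partial>count_space {L. L \<subseteq> S \<and> finite L \<and> odd (card L)})
    = (\<integral>\<^sup>+L. ennreal (\<Prod>i\<in>L. a i) \<partial>count_space {L. L \<subseteq> S \<and> finite L \<and> even (card L)})"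
proof -
  let ?C = "\<lambda>Q. {L. L \<subseteq> S \<and> finite L \<and> Q (card L)}"
  \<comment> \<open>Restricting to indices below \<open>N\<close> makes every sum finite, so that
    the product can be expanded. As \<open>N\<close> grows, the restricted sums increase and the
    products decrease to their limits, and the identity survives.\<close>
  let ?E = "\<lambda>Q N. \<integral>\<^sup>+L. ennreal (\<Prod>i\<in>L. a i) * indicator (Pow {..<N}) L \<partial>count_space (?C Q)"
  let ?P = "\<lambda>N. ennreal (\<Prod>i\<in>S \<inter> {..<N}. 1 - a i)"
  have limE: "?E Q \<longlonglongrightarrow> (\<integral>\<^sup>+L. ennreal (\<Prod>i\<in>L. a i) \<partial>count_space (?C Q))" for Q
  proof -
    have "(\<integral>\<^sup>+L. ennreal (\<Prod>i\<in>L. a i) \<partial>count_space (?C Q))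
       = (\<integral>\<^sup>+L. (SUP N. ennreal (\<Prod>i\<in>L. a i) * indicator (Pow {..<N}) L) \<partial>count_space (?C Q))"
    proof (intro nn_integral_cong)
      fix L assume "L \<in> space (count_space (?C Q))"
      then have "finite L" by auto
      then obtain n where n: "L \<subseteq> {..<n}" using finite_nat_iff_bounded by blast
      show "ennreal (\<Prod>i\<in>L. a i) = (SUP N. ennreal (\<Prod>i\<in>L. a i) * indicator (Pow {..<N}) L)"
      proof (rule antisym)
        show "ennreal (\<Prod>i\<in>L. a i) \<le> (SUP N. ennreal (\<Prod>i\<in>L. a i) * indicator (Pow {..<N}) L)"
          by (rule SUP_upper2[of n]) (use n in auto)
        show "(SUP N. ennreal (\<Prod>i\<in>L. a i) * indicator (Pow {..<N}) L) \<le> ennreal (\<Prod>i\<in>L. a i)"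
          by (rule SUP_least) (auto simp: indicator_def)
      qed
    qed
    also have "\<dots> = (SUP N. ?E Q N)"
      by (rule nn_integral_monotone_convergence_SUP)
         (auto intro!: incseq_SucI simp: le_fun_def indicator_def subset_eq less_SucI)
    finally show ?thesis
      by (simp only:) (intro LIMSEQ_SUP incseq_SucI nn_integral_mono, auto simp: indicator_def subset_eq less_SucI)
  qed
  have "decseq ?P"
  proof (rule decseq_SucI, rule ennreal_leI)
    fix N
    have e: "S \<inter> {..<Suc N} = (if N \<in> S then insert N (S \<inter> {..<N}) else S \<inter> {..<N})"
      by (auto simp: less_Suc_eq)
    have "(\<Prod>i\<in>S \<inter> {..<Suc N}. 1 - a i) = (if N \<in> S then 1 - a N else 1) * (\<Prod>i\<in>S \<inter> {..<N}. 1 - a i)"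
      unfolding e by simp
    also have "\<dots> \<le> (\<Prod>i\<in>S \<inter> {..<N}. 1 - a i)"
      using a[of N] by (intro mult_left_le_one_le prod_nonneg) (use a in auto)
    finally show "(\<Prod>i\<in>S \<inter> {..<Suc N}. 1 - a i) \<le> (\<Prod>i\<in>S \<inter> {..<N}. 1 - a i)" .
  qed
  then have limP: "?P \<longlonglongrightarrow> (INF N. ?P N)" by (rule LIMSEQ_INF)
  have eq: "?P N + ?E odd N = ?E even N" for N
  proof -
    let ?S = "S \<inter> {..<N}"
    have E: "?E Q N = (\<Sum>L\<in>{L\<in>Pow ?S. Q (card L)}. ennreal (\<Prod>i\<in>L. a i))" for Q
    proof -
      have "?E Q N = (\<Sum>L\<in>{L\<in>Pow ?S. Q (card L)}. ennreal (\<Prod>i\<in>L. a i) * indicator (Pow {..<N}) L)"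
        by (rule nn_integral_count_space') (auto simp: indicator_def intro: finite_subset[of _ ?S])
      also have "\<dots> = (\<Sum>L\<in>{L\<in>Pow ?S. Q (card L)}. ennreal (\<Prod>i\<in>L. a i))"
        by (intro sum.cong) (auto simp: indicator_def)
      finally show ?thesis .
    qed
    have nn: "0 \<le> (\<Prod>i\<in>L. a i)" for L by (intro prod_nonneg) (use a in auto)
    have "(\<Prod>i\<in>?S. 1 - a i) = (\<Sum>L\<in>Pow ?S. (-1) ^ card L * (\<Prod>i\<in>L. a i))"
      by (subst prod_diff_conv_sum) auto
    also have "\<dots> = (\<Sum>L\<in>{L\<in>Pow ?S. even (card L)} \<union> {L\<in>Pow ?S. odd (card L)}. (-1) ^ card L * (\<Prod>i\<in>L. a i))"
      by (intro sum.cong) auto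
    also have "\<dots> = (\<Sum>L\<in>{L\<in>Pow ?S. even (card L)}. \<Prod>i\<in>L. a i) - (\<Sum>L\<in>{L\<in>Pow ?S. odd (card L)}. \<Prod>i\<in>L. a i)"
      by (subst sum.union_disjoint) (auto simp: sum_negf)
    finally have P: "(\<Prod>i\<in>?S. 1 - a i) = (\<Sum>L\<in>{L\<in>Pow ?S. even (card L)}. \<Prod>i\<in>L. a i)
        - (\<Sum>L\<in>{L\<in>Pow ?S. odd (card L)}. \<Prod>i\<in>L. a i)" (is "?p = ?ev - ?od") .
    have "0 \<le> ?p" by (intro prod_nonneg) (use a in auto)
    moreover have "0 \<le> ?od" by (intro sum_nonneg nn)
    ultimately have e1: "ennreal (?p + ?od) = ennreal ?p + ennreal ?od" by (rule ennreal_plus)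
    have e2: "?p + ?od = ?ev" unfolding P by (rule diff_add_cancel)
    have e3: "ennreal ?p + ennreal ?od = ennreal ?ev"
      by (rule trans[OF e1[symmetric] arg_cong[OF e2, of ennreal]])
    have e4: "ennreal (\<Sum>L\<in>C. \<Prod>i\<in>L. a i) = (\<Sum>L\<in>C. ennreal (\<Prod>i\<in>L. a i))" for C
      by (intro sum_ennreal[symmetric] nn)
    show ?thesis unfolding E[of odd] E[of even] using e3 unfolding e4 .
  qed
  have "(\<lambda>N. ?P N + ?E odd N) \<longlonglongrightarrow> (INF N. ?P N) + (\<integral>\<^sup>+L. ennreal (\<Prod>i\<in>L. a i) \<partial>count_space (?C odd))"
    by (intro tendsto_add limP limE)
  then show ?thesis unfolding eq using limE[of even] by (rule LIMSEQ_unique)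
qed

text \<open>The exponential series is brought into the shape of
  \<open>inclusion_exclusion_ennreal\<close>, with the odd terms on the left and no subtraction. The
  bound by \<open>exp x\<close> provides the finiteness with which odd parts are cancelled
  later.\<close>

lemma exp_even_odd:
  assumes x: "0 \<le> (x::real)"
  shows "ennreal (exp (- x)) + (\<Sum>l. of_bool (odd l) * ennreal (x ^ l / fact l))
      = (\<Sum>l. of_bool (even l) * ennreal (x ^ l / fact l))"
    and "(\<Sum>l. of_bool (Q l) * ennreal (x ^ l / fact l)) \<le> ennreal (exp x)"
proof -
  have ex: "(\<lambda>l. y ^ l / fact l) sums exp y" for y :: real
    using exp_converges[of y] by (simp add: scaleR_conv_of_real field_simps)
  let ?f = "\<lambda>Q l. of_bool (Q l) * (x ^ l / fact l)"
  have nn: "0 \<le> ?f Q l" for Q l using x by simp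
  have s: "summable (?f Q)" for Q
    by (rule summable_comparison_test'[OF sums_summable[OF ex[of x]], of 0]) (use x in auto)
  have e: "(\<Sum>l. of_bool (Q l) * ennreal (x ^ l / fact l)) = ennreal (\<Sum>l. ?f Q l)" for Q
  proof -
    have "of_bool (Q l) * ennreal (x ^ l / fact l) = ennreal (?f Q l)" for l by simp
    then show ?thesis using suminf_ennreal2[OF nn[of Q] s[of Q]] by simp
  qed
  have "(\<lambda>l. (- x) ^ l / fact l + ?f odd l) sums (exp (- x) + (\<Sum>l. ?f odd l))"
    by (intro sums_add ex summable_sums s)
  moreover have "(- x) ^ l / fact l + ?f odd l = ?f even l" for l
    by (cases "even l") auto
  ultimately have "(\<Sum>l. ?f even l) = exp (- x) + (\<Sum>l. ?f odd l)"
    by (simp add: sums_iff)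
  then show "ennreal (exp (- x)) + (\<Sum>l. of_bool (odd l) * ennreal (x ^ l / fact l))
      = (\<Sum>l. of_bool (even l) * ennreal (x ^ l / fact l))"
    unfolding e using suminf_nonneg[OF s[of odd] nn[of odd]] by (simp add: ennreal_plus[symmetric] del: ennreal_plus)
  have "(\<Sum>l. ?f Q l) \<le> (\<Sum>l. x ^ l / fact l)"
    by (intro suminf_le s sums_summable[OF ex]) (use x in auto)
  then show "(\<Sum>l. of_bool (Q l) * ennreal (x ^ l / fact l)) \<le> ennreal (exp x)"
    unfolding e using ex[of x] by (intro ennreal_leI) (simp add: sums_iff)
qed

lemma nn_integral_finite_subsets_by_card:
  fixes h :: "nat set \<Rightarrow> ennreal"
  shows "(\<integral>\<^sup>+L. h L \<partial>count_space {L. L \<subseteq> S \<and> finite L \<and> Q (card L)})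
    = (\<Sum>l. of_bool (Q l) * (\<integral>\<^sup>+L. h L \<partial>count_space {L. L \<subseteq> S \<and> finite L \<and> card L = l}))"
proof -
  let ?C = "\<lambda>Q. {L. L \<subseteq> S \<and> finite L \<and> Q (card L)}"
  have "(\<integral>\<^sup>+L. h L \<partial>count_space (?C Q)) = (\<integral>\<^sup>+L. (\<Sum>l. h L * indicator {card L} l) \<partial>count_space (?C Q))"
  proof (intro nn_integral_cong)
    fix L
    have "(\<Sum>l. h L * indicator {card L} l) = (\<Sum>l\<in>{card L}. h L * indicator {card L} l)"
      by (rule suminf_finite) auto
    then show "h L = (\<Sum>l. h L * indicator {card L} l)" by simp
  qed
  also have "\<dots> = (\<Sum>l. \<integral>\<^sup>+L. h L * indicator {card L} l \<partial>count_space (?C Q))"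
    by (rule nn_integral_suminf) auto
  also have "(\<lambda>l. \<integral>\<^sup>+L. h L * indicator {card L} l \<partial>count_space (?C Q))
     = (\<lambda>l. of_bool (Q l) * (\<integral>\<^sup>+L. h L \<partial>count_space (?C (\<lambda>c. c = l))))"
  proof
    fix l
    have "(\<integral>\<^sup>+L. h L * indicator {card L} l \<partial>count_space (?C Q))
       = (\<integral>\<^sup>+L. of_bool (Q l) * h L \<partial>count_space (?C (\<lambda>c. c = l)))"
      by (subst (1 2) nn_integral_count_space_indicator, simp, simp)
         (intro nn_integral_cong, auto simp: indicator_def)
    then show "(\<integral>\<^sup>+L. h L * indicator {card L} l \<partial>count_space (?C Q))
       = of_bool (Q l) * (\<integral>\<^sup>+L. h L \<partial>count_space (?C (\<lambda>c. c = l)))"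
      by (simp add: nn_integral_cmult)
  qed
  finally show ?thesis .
qed

text \<open>An injective tuple of length \<open>k + l\<close> is the concatenation of one of length
  \<open>k\<close> with one of length \<open>l\<close> that avoids its range. This merges the choice
  of the cluster points and of further points into a single tuple.\<close>

lemma nn_integral_injs_add:
  fixes F :: "(nat \<Rightarrow> nat) \<Rightarrow> ennreal"
  shows "(\<integral>\<^sup>+j. (\<integral>\<^sup>+j'. F (\<lambda>i\<in>{..<k+l}. if i < k then j i else j' (i - k)) 
      \<partial>count_space (injs l (T - j ` {..<k}))) \<partial>count_space (injs k T))
    = (\<integral>\<^sup>+v. F v \<partial>count_space (injs (k + l) T))"
proof -
  let ?S = "SIGMA j:injs k T. injs l (T - j ` {..<k})"
  let ?g = "\<lambda>(j, j'). \<lambda>i\<in>{..<k+l}. if i < k then j i else j' (i - k) :: nat"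
  let ?h = "\<lambda>v. (restrict v {..<k}, \<lambda>i\<in>{..<l}. v (k + i) :: nat)"
  have bij: "bij_betw ?g ?S (injs (k + l) T)"
  proof (rule bij_betw_byWitness[where f'="?h"])
    show "\<forall>p\<in>?S. ?h (?g p) = p"
      by (auto simp: injs_def PiE_def extensional_def fun_eq_iff)
    show "\<forall>v\<in>injs (k + l) T. ?g (?h v) = v"
      by (auto simp: injs_def PiE_def extensional_def fun_eq_iff)
    show "?g ` ?S \<subseteq> injs (k + l) T"
    proof (rule image_subsetI)
      fix p assume "p \<in> ?S"
      then obtain j j' where p: "p = (j, j')" and j: "j \<in> injs k T" and j': "j' \<in> injs l (T - j ` {..<k})"
        by blast
      have "?g (j, j') \<in> {..<k+l} \<rightarrow>\<^sub>E T" using j j' by (auto simp: injs_def PiE_iff)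
      moreover have "inj_on (?g (j, j')) {..<k+l}"
      proof (rule inj_onI)
        fix x y assume xy: "x \<in> {..<k+l}" "y \<in> {..<k+l}" "?g (j, j') x = ?g (j, j') y"
        have m: "j' i \<notin> j ` {..<k}" if "i < l" for i using j' that by (auto simp: injs_def PiE_iff)
        have "x = y" if "x < k" "y < k" using that xy j by (auto simp: injs_def inj_on_def)
        moreover have False if "x < k" "\<not> y < k" 
        proof -
          have "y - k < l" "j x = j' (y - k)" using that xy by auto
          then show False using m[of "y - k"] that(1) by (metis image_eqI lessThan_iff)
        qed
        moreover have False if "\<not> x < k" "y < k"
        proof -
          have "x - k < l" "j y = j' (x - k)" using that xy by auto
          then show False using m[of "x - k"] that(2) by (metis image_eqI lessThan_iff)
        qed
        moreover have "x - k = y - k" if "\<not> x < k" "\<not> y < k" 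
          using that xy j' inj_onD[of j' "{..<l}" "x - k" "y - k"] by (auto simp: injs_def)
        ultimately show "x = y" using xy(1,2) by (cases "x < k"; cases "y < k") auto
      qed
      ultimately show "?g p \<in> injs (k + l) T" unfolding injs_def p by blast
    qed
    show "?h ` injs (k + l) T \<subseteq> ?S"
    proof (rule image_subsetI)
      fix v assume v: "v \<in> injs (k + l) T"
      have i: "v x = v y \<longleftrightarrow> x = y" if "x < k + l" "y < k + l" for x y
        using v that by (auto simp: injs_def inj_on_def)
      have m: "v x \<in> T" if "x < k + l" for x using v that by (auto simp: injs_def)
      have "restrict v {..<k} \<in> injs k T" using i m by (auto simp: injs_def inj_on_def)
      moreover have "(\<lambda>i\<in>{..<l}. v (k + i)) \<in> injs l (T - restrict v {..<k} ` {..<k})"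
        using i m by (auto simp: injs_def inj_on_def)
      ultimately show "?h v \<in> ?S" by blast
    qed
  qed
  have "(\<integral>\<^sup>+v. F v \<partial>count_space (injs (k + l) T)) = (\<integral>\<^sup>+p. F (?g p) \<partial>count_space ?S)"
    by (rule nn_integral_bij_count_space[OF bij, symmetric])
  also have "\<dots> = (\<integral>\<^sup>+p. F (?g p) * indicator ?S p \<partial>count_space UNIV)"
    by (rule nn_integral_count_space_indicator) simp
  also have "\<dots> = (\<integral>\<^sup>+j. (\<integral>\<^sup>+j'. F (?g (j, j')) * indicator ?S (j, j') \<partial>count_space UNIV) \<partial>count_space UNIV)"
    by (rule nn_integral_fst_count_space[symmetric])
  also have "\<dots> = (\<integral>\<^sup>+j. (\<integral>\<^sup>+j'. F (?g (j, j')) \<partial>count_space (injs l (T - j ` {..<k}))) * indicator (injs k T) j \<partial>count_space UNIV)"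
  proof (intro nn_integral_cong)
    fix j
    have "(\<integral>\<^sup>+j'. F (?g (j, j')) * indicator ?S (j, j') \<partial>count_space UNIV)
       = (\<integral>\<^sup>+j'. F (?g (j, j')) * indicator (injs l (T - j ` {..<k})) j' * indicator (injs k T) j \<partial>count_space UNIV)"
      by (intro nn_integral_cong) (auto simp: indicator_def)
    also have "\<dots> = (\<integral>\<^sup>+j'. F (?g (j, j')) * indicator (injs l (T - j ` {..<k})) j' \<partial>count_space UNIV) * indicator (injs k T) j"
      by (rule nn_integral_multc) auto
    also have "(\<integral>\<^sup>+j'. F (?g (j, j')) * indicator (injs l (T - j ` {..<k})) j' \<partial>count_space UNIV)
       = (\<integral>\<^sup>+j'. F (?g (j, j')) \<partial>count_space (injs l (T - j ` {..<k})))"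
      by (rule nn_integral_count_space_indicator[symmetric]) simp
    finally show "(\<integral>\<^sup>+j'. F (?g (j, j')) * indicator ?S (j, j') \<partial>count_space UNIV)
      = (\<integral>\<^sup>+j'. F (?g (j, j')) \<partial>count_space (injs l (T - j ` {..<k}))) * indicator (injs k T) j" .
  qed
  also have "\<dots> = (\<integral>\<^sup>+j. (\<integral>\<^sup>+j'. F (?g (j, j')) \<partial>count_space (injs l (T - j ` {..<k}))) \<partial>count_space (injs k T))"
    by (rule nn_integral_count_space_indicator[symmetric]) simp
  finally show ?thesis by simp
qed

lemma add_right_cancel_ennreal: "a + c = b + c \<Longrightarrow> c \<noteq> \<infinity> \<Longrightarrow> a = (b :: ennreal)"
  by (metis add.commute ennreal_add_left_cancel infinity_ennreal_def)

text \<open>Fubini over the last \<open>l\<close> coordinates: with the first \<open>k\<close>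
  fixed, the integrand is a product of functions of one coordinate each.\<close>

lemma nn_integral_PiM_prod_extend:
  fixes M :: "nat \<Rightarrow> 'a measure" and a :: "'a \<Rightarrow> (nat \<Rightarrow> 'a) \<Rightarrow> ennreal"
  assumes M: "product_sigma_finite M"
    and [measurable]: "f \<in> borel_measurable (PiM {..<k} M)"
    and a: "\<And>i. (\<lambda>p. a (fst p) (snd p)) \<in> borel_measurable (M i \<Otimes>\<^sub>M PiM {..<k} M)"
  shows "(\<integral>\<^sup>+v. f (restrict v {..<k}) * (\<Prod>i\<in>{k..<k+l}. a (v i) (restrict v {..<k})) \<partial>PiM {..<k+l} M)
    = (\<integral>\<^sup>+w. f w * (\<Prod>i\<in>{k..<k+l}. \<integral>\<^sup>+z. a z w \<partial>M i) \<partial>PiM {..<k} M)"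
proof -
  interpret product_sigma_finite M by (rule M)
  let ?J = "{k..<k+l}"
  have IJ: "{..<k+l} = {..<k} \<union> ?J" "{..<k} \<inter> ?J = {}" by auto
  have r: "(\<lambda>v. restrict v {..<k}) \<in> measurable (PiM ({..<k} \<union> ?J) M) (PiM {..<k} M)"
    by (rule measurable_restrict_subset) auto
  have am: "(\<lambda>v. a (v i) (restrict v {..<k})) \<in> borel_measurable (PiM ({..<k} \<union> ?J) M)" if "i \<in> ?J" for i
    using measurable_compose[OF measurable_Pair[OF measurable_component_singleton r] a[of i]] that by simp
  have "(\<integral>\<^sup>+v. f (restrict v {..<k}) * (\<Prod>i\<in>?J. a (v i) (restrict v {..<k})) \<partial>PiM {..<k+l} M)
    = (\<integral>\<^sup>+w. (\<integral>\<^sup>+y. f (restrict (merge {..<k} ?J (w, y)) {..<k}) *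
        (\<Prod>i\<in>?J. a (merge {..<k} ?J (w, y) i) (restrict (merge {..<k} ?J (w, y)) {..<k})) \<partial>PiM ?J M) \<partial>PiM {..<k} M)"
    unfolding IJ(1)
    by (rule product_nn_integral_fold[OF IJ(2)])
       (use measurable_compose[OF r] am in \<open>auto intro!: borel_measurable_times_ennreal borel_measurable_prod_ennreal\<close>)
  also have "\<dots> = (\<integral>\<^sup>+w. f w * (\<Prod>i\<in>?J. \<integral>\<^sup>+z. a z w \<partial>M i) \<partial>PiM {..<k} M)"
  proof (intro nn_integral_cong)
    fix w assume w: "w \<in> space (PiM {..<k} M)"
    have rw: "restrict (merge {..<k} ?J (w, y)) {..<k} = w" for y
      using w by (auto simp: space_PiM PiE_def extensional_def merge_def fun_eq_iff)
    have m: "(\<lambda>z. a z w) \<in> borel_measurable (M i)" for i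
      using measurable_compose[OF measurable_Pair2'[OF w] a, of i] by simp
    have "(\<integral>\<^sup>+y. f (restrict (merge {..<k} ?J (w, y)) {..<k}) *
        (\<Prod>i\<in>?J. a (merge {..<k} ?J (w, y) i) (restrict (merge {..<k} ?J (w, y)) {..<k})) \<partial>PiM ?J M)
      = (\<integral>\<^sup>+y. f w * (\<Prod>i\<in>?J. a (y i) w) \<partial>PiM ?J M)"
      unfolding rw by (intro nn_integral_cong arg_cong2[where f="(*)"] prod.cong) (auto simp: merge_def)
    also have "\<dots> = f w * (\<integral>\<^sup>+y. (\<Prod>i\<in>?J. a (y i) w) \<partial>PiM ?J M)"
      using m by (intro nn_integral_cmult borel_measurable_prod_ennreal measurable_compose[OF measurable_component_singleton]) auto
    also have "(\<integral>\<^sup>+y. (\<Prod>i\<in>?J. a (y i) w) \<partial>PiM ?J M) = (\<Prod>i\<in>?J. \<integral>\<^sup>+z. a z w \<partial>M i)"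
      using m by (intro product_nn_integral_prod) auto
    finally show "(\<integral>\<^sup>+y. f (restrict (merge {..<k} ?J (w, y)) {..<k}) *
        (\<Prod>i\<in>?J. a (merge {..<k} ?J (w, y) i) (restrict (merge {..<k} ?J (w, y)) {..<k})) \<partial>PiM ?J M)
      = f w * (\<Prod>i\<in>?J. \<integral>\<^sup>+z. a z w \<partial>M i)" .
  qed
  finally show ?thesis .
qed

section \<open>Avoidance by the points outside a given tuple\<close>

context random_connection_model
begin

definition loc :: "real \<Rightarrow> nat \<Rightarrow> (nat \<Rightarrow> nat) \<Rightarrow> 'w \<Rightarrow> nat \<Rightarrow> 'd point" where
  "loc t k j \<omega> = (\<lambda>i\<in>{..<k}. X t (j i) \<omega>)"

lemma X_measurable_pts: "i \<in> pts t \<Longrightarrow> X t i \<in> borel_measurable M"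
  by (auto simp: pts_def split: if_splits)

lemma loc_measurable:
  assumes j: "j \<in> injs k (pts t)"
  shows "loc t k j \<in> measurable M (PiM {..<k} (\<lambda>_. lborel))"
  unfolding loc_def
proof (rule measurable_restrict)
  fix i assume "i \<in> {..<k}"
  then have "j i \<in> pts t" using j by (auto simp: injs_def)
  then have "X t (j i) \<in> borel_measurable M" by (rule X_measurable_pts)
  then show "X t (j i) \<in> measurable M lborel" by simp
qed

text \<open>The \<open>k\<close> listed points together with an enumeration of \<open>L\<close> form
  an injective tuple of length \<open>k + l\<close>, so the factorial moment formula of that order
  applies. Each of the last \<open>l\<close> coordinates integrates to \<open>v\<close>, and
  \<open>1 / fact l\<close> removes the order in which \<open>L\<close> was listed.\<close>

lemma moment_with_points:
  fixes a :: "'d point \<Rightarrow> (nat \<Rightarrow> 'd point) \<Rightarrow> real"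
  assumes t: "0 \<le> t" and f[measurable]: "f \<in> borel_measurable (PiM {..<k} (\<lambda>_. lborel))"
    and a[measurable]: "(\<lambda>p. a (fst p) (snd p)) \<in> borel_measurable (lborel \<Otimes>\<^sub>M PiM {..<k} (\<lambda>_. lborel))"
    and a0: "\<And>z w. 0 \<le> a z w"
    and v: "\<And>w. w \<in> space (PiM {..<k} (\<lambda>_. lborel)) \<Longrightarrow> (\<integral>\<^sup>+z. ennreal (a z w) \<partial>lborel) = ennreal (v w)"
    and v0: "\<And>w. 0 \<le> v w"
    and vm[measurable]: "v \<in> borel_measurable (PiM {..<k} (\<lambda>_. lborel))"
  shows "(\<integral>\<^sup>+\<omega>. (\<integral>\<^sup>+j. f (loc t k j \<omega>) * (\<integral>\<^sup>+L. ennreal (\<Prod>i\<in>L. a (X t i \<omega>) (loc t k j \<omega>))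
      \<partial>count_space {L. L \<subseteq> pts t - j ` {..<k} \<and> finite L \<and> card L = l}) \<partial>count_space (injs k (pts t))) \<partial>M)
    = ennreal (t ^ k) * (\<integral>\<^sup>+w. f w * ennreal ((t * v w) ^ l / fact l) \<partial>PiM {..<k} (\<lambda>_. lborel))"
proof -
  interpret L: product_sigma_finite "\<lambda>_::nat. lborel :: 'd point measure" by standard
  let ?T = "pts t" and ?c = "ennreal (1 / fact l)"
  let ?G = "\<lambda>u. ?c * f (restrict u {..<k}) * (\<Prod>i\<in>{k..<k+l}. ennreal (a (u i) (restrict u {..<k})))"
  have cc: "?c * of_nat (fact l) = 1"
  proof -
    have "?c * of_nat (fact l) = ennreal (1 / fact l) * ennreal (fact l)"
      by (simp only: ennreal_of_nat_eq_real_of_nat of_nat_fact)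
    also have "\<dots> = ennreal (1 / fact l * fact l)" by (rule ennreal_mult[symmetric]) auto
    finally show ?thesis by simp
  qed
  have inner: "f (loc t k j \<omega>) * (\<integral>\<^sup>+L. ennreal (\<Prod>i\<in>L. a (X t i \<omega>) (loc t k j \<omega>))
      \<partial>count_space {L. L \<subseteq> ?T - j ` {..<k} \<and> finite L \<and> card L = l})
    = (\<integral>\<^sup>+j'. ?G (\<lambda>i\<in>{..<k+l}. X t ((\<lambda>i\<in>{..<k+l}. if i < k then j i else j' (i - k)) i) \<omega>)
        \<partial>count_space (injs l (?T - j ` {..<k})))"
    (is "?l = ?r") for j \<omega>
  proof -
    have "?l = f (loc t k j \<omega>) * (?c * of_nat (fact l)) * (\<integral>\<^sup>+L. ennreal (\<Prod>i\<in>L. a (X t i \<omega>) (loc t k j \<omega>))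
      \<partial>count_space {L. L \<subseteq> ?T - j ` {..<k} \<and> finite L \<and> card L = l})" unfolding cc by simp
    also have "\<dots> = (?c * f (loc t k j \<omega>)) * (\<integral>\<^sup>+j'. ennreal (\<Prod>i\<in>j' ` {..<l}. a (X t i \<omega>) (loc t k j \<omega>))
        \<partial>count_space (injs l (?T - j ` {..<k})))"
      by (subst nn_integral_injs_image) (simp add: mult_ac)
    also have "\<dots> = (\<integral>\<^sup>+j'. (?c * f (loc t k j \<omega>)) * ennreal (\<Prod>i\<in>j' ` {..<l}. a (X t i \<omega>) (loc t k j \<omega>))
        \<partial>count_space (injs l (?T - j ` {..<k})))"
      by (rule nn_integral_cmult[symmetric]) auto
    also have "\<dots> = ?r"
    proof (intro nn_integral_cong arg_cong2[where f="(*)"])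
      fix j' assume j': "j' \<in> space (count_space (injs l (?T - j ` {..<k})))"
      let ?u = "\<lambda>i\<in>{..<k+l}. X t ((\<lambda>i\<in>{..<k+l}. if i < k then j i else j' (i - k)) i) \<omega>"
      have ru: "restrict ?u {..<k} = loc t k j \<omega>" by (auto simp: loc_def fun_eq_iff)
      then show "f (loc t k j \<omega>) = f (restrict ?u {..<k})" by simp
      have "(\<Prod>i\<in>j' ` {..<l}. a (X t i \<omega>) (loc t k j \<omega>)) = (\<Prod>i<l. a (X t (j' i) \<omega>) (loc t k j \<omega>))"
        using j' by (subst prod.reindex) (auto simp: injs_def)
      also have "\<dots> = (\<Prod>i\<in>{k..<k+l}. a (?u i) (restrict ?u {..<k}))"
        unfolding ru by (intro prod.reindex_bij_witness[of _ "\<lambda>i. i - k" "\<lambda>i. i + k"]) auto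
      finally show "ennreal (\<Prod>i\<in>j' ` {..<l}. a (X t i \<omega>) (loc t k j \<omega>))
         = (\<Prod>i\<in>{k..<k+l}. ennreal (a (?u i) (restrict ?u {..<k})))"
        using a0 by (simp add: prod_ennreal)
    qed simp
    finally show ?thesis .
  qed
  have r: "(\<lambda>u. restrict u {..<k}) \<in> measurable (PiM {..<k+l} (\<lambda>_. lborel)) (PiM {..<k} (\<lambda>_. lborel))"
    by (rule measurable_restrict_subset) auto
  have am: "(\<lambda>u. a (u i) (restrict u {..<k})) \<in> borel_measurable (PiM {..<k+l} (\<lambda>_. lborel))" if "i < k+l" for i
    using measurable_compose[OF measurable_Pair[OF measurable_component_singleton r] a, of i] that by simp
  have G: "?G \<in> borel_measurable (PiM {..<k+l} (\<lambda>_. lborel))"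
    using measurable_compose[OF r f] am
    by (intro borel_measurable_times_ennreal borel_measurable_prod_ennreal measurable_compose[OF _ measurable_ennreal]) auto
  have "(\<integral>\<^sup>+\<omega>. (\<integral>\<^sup>+j. f (loc t k j \<omega>) * (\<integral>\<^sup>+L. ennreal (\<Prod>i\<in>L. a (X t i \<omega>) (loc t k j \<omega>))
      \<partial>count_space {L. L \<subseteq> ?T - j ` {..<k} \<and> finite L \<and> card L = l}) \<partial>count_space (injs k ?T)) \<partial>M)
    = (\<integral>\<^sup>+\<omega>. (\<integral>\<^sup>+u. ?G (\<lambda>i\<in>{..<k+l}. X t (u i) \<omega>) \<partial>count_space (injs (k+l) ?T)) \<partial>M)"
    unfolding inner by (intro nn_integral_cong nn_integral_injs_add)
  also have "\<dots> = ennreal (t ^ (k+l)) * (\<integral>\<^sup>+u. ?G u \<partial>PiM {..<k+l} (\<lambda>_. lborel))"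
    by (rule factorial_moment[OF t G])
  also have "(\<integral>\<^sup>+u. ?G u \<partial>PiM {..<k+l} (\<lambda>_. lborel))
     = (\<integral>\<^sup>+w. ?c * f w * (\<Prod>i\<in>{k..<k+l}. \<integral>\<^sup>+z. ennreal (a z w) \<partial>lborel) \<partial>PiM {..<k} (\<lambda>_. lborel))"
    by (rule nn_integral_PiM_prod_extend[OF L.product_sigma_finite_axioms, of "\<lambda>w. ?c * f w" k "\<lambda>z w. ennreal (a z w)"]) measurable
  also have "\<dots> = (\<integral>\<^sup>+w. ?c * f w * ennreal (v w ^ l) \<partial>PiM {..<k} (\<lambda>_. lborel))"
    by (intro nn_integral_cong) (simp add: v ennreal_power v0)
  also have "ennreal (t ^ (k+l)) * \<dots> = ennreal (t ^ k) * (ennreal (t ^ l) * \<dots>)"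
    using t by (simp add: power_add ennreal_mult mult.assoc)
  also have "ennreal (t ^ l) * (\<integral>\<^sup>+w. ?c * f w * ennreal (v w ^ l) \<partial>PiM {..<k} (\<lambda>_. lborel))
     = (\<integral>\<^sup>+w. ennreal (t ^ l) * (?c * f w * ennreal (v w ^ l)) \<partial>PiM {..<k} (\<lambda>_. lborel))"
    by (rule nn_integral_cmult[symmetric]) measurable
  also have "\<dots> = (\<integral>\<^sup>+w. f w * ennreal ((t * v w) ^ l / fact l) \<partial>PiM {..<k} (\<lambda>_. lborel))"
  proof (intro nn_integral_cong)
    fix w
    have "ennreal ((t * v w) ^ l / fact l) = ennreal (t ^ l) * ?c * ennreal (v w ^ l)"
      using t v0[of w] by (simp add: ennreal_mult[symmetric] power_mult_distrib)
    then show "ennreal (t ^ l) * (?c * f w * ennreal (v w ^ l)) = f w * ennreal ((t * v w) ^ l / fact l)"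
      by (simp add: mult_ac)
  qed
  finally show ?thesis .
qed

text \<open>The infimum of the products is the probability that none of the other points is
  selected, when a point at \<open>z\<close> is selected with probability \<open>a z w\<close>.
  Inclusion-exclusion turns it into sums over finite sets of other points, whose expectations are
  the terms of the series of \<open>exp (t * v w)\<close> sorted by parity; recombining the parities
  gives \<open>exp (- (t * v w))\<close>.\<close>

lemma void_probability_integrable:
  fixes a :: "'d point \<Rightarrow> (nat \<Rightarrow> 'd point) \<Rightarrow> real"
  assumes t: "0 \<le> t" and f[measurable]: "f \<in> borel_measurable (PiM {..<k} (\<lambda>_. lborel))"
    and a[measurable]: "(\<lambda>p. a (fst p) (snd p)) \<in> borel_measurable (lborel \<Otimes>\<^sub>M PiM {..<k} (\<lambda>_. lborel))"
    and a0: "\<And>z w. 0 \<le> a z w" and a1: "\<And>z w. a z w \<le> 1"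
    and v: "\<And>w. w \<in> space (PiM {..<k} (\<lambda>_. lborel)) \<Longrightarrow> (\<integral>\<^sup>+z. ennreal (a z w) \<partial>lborel) = ennreal (v w)"
    and v0: "\<And>w. 0 \<le> v w" and vC: "\<And>w. v w \<le> C"
    and vm[measurable]: "v \<in> borel_measurable (PiM {..<k} (\<lambda>_. lborel))"
    and fin: "(\<integral>\<^sup>+w. f w \<partial>PiM {..<k} (\<lambda>_. lborel)) < \<infinity>"
  shows "(\<integral>\<^sup>+j. (\<integral>\<^sup>+\<omega>. f (loc t k j \<omega>) *
      (INF N. ennreal (\<Prod>i\<in>(pts t - j ` {..<k}) \<inter> {..<N}. 1 - a (X t i \<omega>) (loc t k j \<omega>))) \<partial>M) \<partial>count_space (injs k (pts t)))
    = ennreal (t ^ k) * (\<integral>\<^sup>+w. f w * ennreal (exp (- (t * v w))) \<partial>PiM {..<k} (\<lambda>_. lborel))"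
proof -
  let ?T = "pts t" and ?Q = "PiM {..<k} (\<lambda>_. lborel) :: (nat \<Rightarrow> 'd point) measure"
  let ?C = "\<lambda>Q j. {L. L \<subseteq> ?T - j ` {..<k} \<and> finite L \<and> Q (card L)}"
  let ?I = "\<lambda>j \<omega>. (INF N. ennreal (\<Prod>i\<in>(?T - j ` {..<k}) \<inter> {..<N}. 1 - a (X t i \<omega>) (loc t k j \<omega>)))"
  let ?E = "\<lambda>Q j \<omega>. \<integral>\<^sup>+L. ennreal (\<Prod>i\<in>L. a (X t i \<omega>) (loc t k j \<omega>)) \<partial>count_space (?C Q j)"
  have am: "(\<lambda>\<omega>. a (X t i \<omega>) (loc t k j \<omega>)) \<in> borel_measurable M"
    if "i \<in> ?T" "j \<in> injs k ?T" for i j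
    using measurable_compose[OF measurable_Pair[OF _ loc_measurable[OF that(2)]] a, of "X t i"]
      X_measurable_pts[OF that(1)] by (simp add: measurable_lborel2)
  have fm: "(\<lambda>\<omega>. f (loc t k j \<omega>)) \<in> borel_measurable M" if "j \<in> injs k ?T" for j
    using measurable_compose[OF loc_measurable[OF that] f] .
  have Im: "?I j \<in> borel_measurable M" if "j \<in> injs k ?T" for j
    by (intro borel_measurable_INF measurable_compose[OF _ measurable_ennreal] borel_measurable_prod
          borel_measurable_diff borel_measurable_const am[OF _ that]) auto
  have Em: "(\<lambda>\<omega>. \<integral>\<^sup>+L. ennreal (\<Prod>i\<in>L. a (X t i \<omega>) (loc t k j \<omega>)) \<partial>count_space 
     {L. L \<subseteq> ?T - j ` {..<k} \<and> finite L \<and> card L = l}) \<in> borel_measurable M"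
    if "j \<in> injs k ?T" for j l
    by (intro borel_measurable_nn_integral_count_space measurable_compose[OF _ measurable_ennreal] borel_measurable_prod am[OF _ that]) auto
  have tot: "(\<integral>\<^sup>+j. (\<integral>\<^sup>+\<omega>. f (loc t k j \<omega>) * ?E Q j \<omega> \<partial>M) \<partial>count_space (injs k ?T))
      = ennreal (t ^ k) * (\<integral>\<^sup>+w. f w * (\<Sum>l. of_bool (Q l) * ennreal ((t * v w) ^ l / fact l)) \<partial>?Q)" for Q
  proof -
    let ?e = "\<lambda>l j \<omega>. \<integral>\<^sup>+L. ennreal (\<Prod>i\<in>L. a (X t i \<omega>) (loc t k j \<omega>)) \<partial>count_space {L. L \<subseteq> ?T - j ` {..<k} \<and> finite L \<and> card L = l}"
    have "(\<integral>\<^sup>+j. (\<integral>\<^sup>+\<omega>. f (loc t k j \<omega>) * ?E Q j \<omega> \<partial>M) \<partial>count_space (injs k ?T))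
       = (\<integral>\<^sup>+j. (\<integral>\<^sup>+\<omega>. (\<Sum>l. of_bool (Q l) * (f (loc t k j \<omega>) * ?e l j \<omega>)) \<partial>M) \<partial>count_space (injs k ?T))"
      unfolding nn_integral_finite_subsets_by_card[where Q=Q] ennreal_suminf_cmult[symmetric]
      by (simp add: mult_ac)
    also have "\<dots> = (\<Sum>l. of_bool (Q l) * (\<integral>\<^sup>+j. (\<integral>\<^sup>+\<omega>. f (loc t k j \<omega>) * ?e l j \<omega> \<partial>M) \<partial>count_space (injs k ?T)))"
      using fm Em
      by (simp add: nn_integral_suminf nn_integral_cmult cong: nn_integral_cong_simp)
    also have "\<dots> = (\<Sum>l. of_bool (Q l) * (ennreal (t ^ k) * (\<integral>\<^sup>+w. f w * ennreal ((t * v w) ^ l / fact l) \<partial>?Q)))"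
      using fm Em
      by (subst nn_integral_count_space_nn_integral[symmetric])
         (auto simp: moment_with_points[OF t f a a0 v v0 vm])
    also have "\<dots> = (\<Sum>l. ennreal (t ^ k) * (\<integral>\<^sup>+w. f w * (of_bool (Q l) * ennreal ((t * v w) ^ l / fact l)) \<partial>?Q))"
      by (intro suminf_cong) (auto simp: of_bool_def)
    also have "\<dots> = ennreal (t ^ k) * (\<integral>\<^sup>+w. (\<Sum>l. f w * (of_bool (Q l) * ennreal ((t * v w) ^ l / fact l))) \<partial>?Q)"
      by (subst nn_integral_suminf) auto
    finally show ?thesis by simp
  qed
  have tv: "0 \<le> t * v w" for w using t v0 by simp
  \<comment> \<open>The odd part is cancelled from both sides, and in \<open>ennreal\<close> this
    requires it to be finite. The bound \<open>vC\<close> and the integrability of \<open>f\<close>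
    provide that.\<close>
  have odd_fin: "ennreal (t ^ k) * (\<integral>\<^sup>+w. f w * (\<Sum>l. of_bool (odd l) * ennreal ((t * v w) ^ l / fact l)) \<partial>?Q) \<noteq> \<infinity>"
  proof -
    have "(\<integral>\<^sup>+w. f w * (\<Sum>l. of_bool (odd l) * ennreal ((t * v w) ^ l / fact l)) \<partial>?Q)
       \<le> (\<integral>\<^sup>+w. f w * ennreal (exp (t * C)) \<partial>?Q)"
      using vC t by (intro nn_integral_mono mult_left_mono order_trans[OF exp_even_odd(2)[OF tv]] ennreal_leI)
        (auto intro: mult_left_mono)
    also have "\<dots> = (\<integral>\<^sup>+w. f w \<partial>?Q) * ennreal (exp (t * C))" by (rule nn_integral_multc) measurable
    also have "\<dots> < \<infinity>" using fin by (simp add: ennreal_mult_less_top)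
    finally show ?thesis by (simp add: ennreal_mult_eq_top_iff)
  qed
  have "(\<integral>\<^sup>+j. (\<integral>\<^sup>+\<omega>. f (loc t k j \<omega>) * ?I j \<omega> \<partial>M) \<partial>count_space (injs k ?T))
     + (\<integral>\<^sup>+j. (\<integral>\<^sup>+\<omega>. f (loc t k j \<omega>) * ?E odd j \<omega> \<partial>M) \<partial>count_space (injs k ?T))
    = (\<integral>\<^sup>+j. (\<integral>\<^sup>+\<omega>. f (loc t k j \<omega>) * ?E even j \<omega> \<partial>M) \<partial>count_space (injs k ?T))"
  proof -
    have Em': "?E Q j \<in> borel_measurable M" if "j \<in> injs k ?T" for j Q
      unfolding nn_integral_finite_subsets_by_card[where Q=Q] using Em[OF that]
      by (intro borel_measurable_suminf_order borel_measurable_times_ennreal) auto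
    have "(\<integral>\<^sup>+\<omega>. f (loc t k j \<omega>) * ?I j \<omega> \<partial>M) + (\<integral>\<^sup>+\<omega>. f (loc t k j \<omega>) * ?E odd j \<omega> \<partial>M)
      = (\<integral>\<^sup>+\<omega>. f (loc t k j \<omega>) * ?E even j \<omega> \<partial>M)" if j: "j \<in> injs k ?T" for j
    proof -
      have "(\<integral>\<^sup>+\<omega>. f (loc t k j \<omega>) * ?I j \<omega> \<partial>M) + (\<integral>\<^sup>+\<omega>. f (loc t k j \<omega>) * ?E odd j \<omega> \<partial>M)
        = (\<integral>\<^sup>+\<omega>. f (loc t k j \<omega>) * ?I j \<omega> + f (loc t k j \<omega>) * ?E odd j \<omega> \<partial>M)"
        by (intro nn_integral_add[symmetric] borel_measurable_times_ennreal fm Im Em' j)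
      also have "\<dots> = (\<integral>\<^sup>+\<omega>. f (loc t k j \<omega>) * ?E even j \<omega> \<partial>M)"
        using a0 a1 by (simp add: inclusion_exclusion_ennreal[symmetric] distrib_left)
      finally show ?thesis .
    qed
    then show ?thesis
      by (subst nn_integral_add[symmetric]) (auto intro!: nn_integral_cong)
  qed
  also have "\<dots> = ennreal (t ^ k) * (\<integral>\<^sup>+w. f w * (ennreal (exp (- (t * v w))) + (\<Sum>l. of_bool (odd l) * ennreal ((t * v w) ^ l / fact l))) \<partial>?Q)"
    unfolding tot exp_even_odd(1)[OF tv] ..
  also have "\<dots> = ennreal (t ^ k) * (\<integral>\<^sup>+w. f w * ennreal (exp (- (t * v w))) \<partial>?Q)
      + ennreal (t ^ k) * (\<integral>\<^sup>+w. f w * (\<Sum>l. of_bool (odd l) * ennreal ((t * v w) ^ l / fact l)) \<partial>?Q)"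
    unfolding distrib_left by (subst nn_integral_add) (auto simp: distrib_left)
  finally show ?thesis
    unfolding tot[of odd] by (rule add_right_cancel_ennreal[OF _ odd_fin])
qed

text \<open>A bounded \<open>f\<close> may have infinite integral. It is cut off outside products of
  balls, where the previous formula holds, and recovered by monotone convergence on both
  sides.\<close>

lemma void_probability:
  fixes a :: "'d point \<Rightarrow> (nat \<Rightarrow> 'd point) \<Rightarrow> real"
  assumes t: "0 \<le> t" and f[measurable]: "f \<in> borel_measurable (PiM {..<k} (\<lambda>_. lborel))"
    and a: "(\<lambda>p. a (fst p) (snd p)) \<in> borel_measurable (lborel \<Otimes>\<^sub>M PiM {..<k} (\<lambda>_. lborel))"
    and a01: "\<And>z w. 0 \<le> a z w" "\<And>z w. a z w \<le> 1"
    and v: "\<And>w. w \<in> space (PiM {..<k} (\<lambda>_. lborel)) \<Longrightarrow> (\<integral>\<^sup>+z. ennreal (a z w) \<partial>lborel) = ennreal (v w)"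
    and v0: "\<And>w. 0 \<le> v w" and vC: "\<And>w. v w \<le> C"
    and vm[measurable]: "v \<in> borel_measurable (PiM {..<k} (\<lambda>_. lborel))"
    and f1: "\<And>w. f w \<le> 1"
  shows "(\<integral>\<^sup>+j. (\<integral>\<^sup>+\<omega>. f (loc t k j \<omega>) *
      (INF N. ennreal (\<Prod>i\<in>(pts t - j ` {..<k}) \<inter> {..<N}. 1 - a (X t i \<omega>) (loc t k j \<omega>))) \<partial>M) \<partial>count_space (injs k (pts t)))
    = ennreal (t ^ k) * (\<integral>\<^sup>+w. f w * ennreal (exp (- (t * v w))) \<partial>PiM {..<k} (\<lambda>_. lborel))"
proof -
  interpret L: product_sigma_finite "\<lambda>_::nat. lborel :: 'd point measure" by standard
  let ?T = "pts t" and ?Q = "PiM {..<k} (\<lambda>_. lborel) :: (nat \<Rightarrow> 'd point) measure"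
  let ?I = "\<lambda>j \<omega>. (INF N. ennreal (\<Prod>i\<in>(?T - j ` {..<k}) \<inter> {..<N}. 1 - a (X t i \<omega>) (loc t k j \<omega>)))"
  define B where "B n = Pi\<^sub>E {..<k} (\<lambda>_. ball (0::'d point) (real n))" for n :: nat
  have B[measurable]: "B n \<in> sets ?Q" for n unfolding B_def by (intro sets_PiM_I_finite) auto
  define F where "F n w = f w * indicator (B n) w" for n w
  have Fm[measurable]: "F n \<in> borel_measurable ?Q" for n unfolding F_def by measurable
  have incF: "F n w \<le> F (Suc n) w" for n w
    by (auto simp: F_def B_def indicator_def PiE_iff intro: less_trans)
  have SUPF: "(SUP n. F n w) = f w" if w: "w \<in> space ?Q" for w
  proof (rule antisym)
    obtain n :: nat where "(\<Sum>i<k. norm (w i)) < real n" using reals_Archimedean2 by blast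
    moreover have "norm (w i) \<le> (\<Sum>i<k. norm (w i))" if "i < k" for i
      using that by (intro member_le_sum) auto
    ultimately have "w \<in> B n" using w by (force simp: B_def space_PiM PiE_iff)
    then show "f w \<le> (SUP n. F n w)" by (intro SUP_upper2[of n]) (auto simp: F_def)
    show "(SUP n. F n w) \<le> f w" by (intro SUP_least) (auto simp: F_def indicator_def)
  qed
  have am: "(\<lambda>\<omega>. a (X t i \<omega>) (loc t k j \<omega>)) \<in> borel_measurable M"
    if "i \<in> ?T" "j \<in> injs k ?T" for i j
    using measurable_compose[OF measurable_Pair[OF _ loc_measurable[OF that(2)]] a, of "X t i"]
      X_measurable_pts[OF that(1)] by (simp add: measurable_lborel2)
  have Im: "?I j \<in> borel_measurable M" if "j \<in> injs k ?T" for j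
    by (intro borel_measurable_INF measurable_compose[OF _ measurable_ennreal] borel_measurable_prod
          borel_measurable_diff borel_measurable_const am[OF _ that]) auto
  have FIm: "(\<lambda>\<omega>. F n (loc t k j \<omega>) * ?I j \<omega>) \<in> borel_measurable M" if "j \<in> injs k ?T" for j n
    by (intro borel_measurable_times_ennreal Im that measurable_compose[OF loc_measurable[OF that] Fm])
  have "(\<integral>\<^sup>+j. (\<integral>\<^sup>+\<omega>. f (loc t k j \<omega>) * ?I j \<omega> \<partial>M) \<partial>count_space (injs k ?T))
     = (\<integral>\<^sup>+j. (SUP n. \<integral>\<^sup>+\<omega>. F n (loc t k j \<omega>) * ?I j \<omega> \<partial>M) \<partial>count_space (injs k ?T))"
  proof (intro nn_integral_cong)
    fix j assume "j \<in> space (count_space (injs k ?T))"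
    then have j: "j \<in> injs k ?T" by simp
    have "(\<integral>\<^sup>+\<omega>. f (loc t k j \<omega>) * ?I j \<omega> \<partial>M) = (\<integral>\<^sup>+\<omega>. (SUP n. F n (loc t k j \<omega>) * ?I j \<omega>) \<partial>M)"
      using measurable_space[OF loc_measurable[OF j]]
      by (intro nn_integral_cong) (simp add: SUP_mult_right_ennreal[symmetric] SUPF)
    also have "\<dots> = (SUP n. \<integral>\<^sup>+\<omega>. F n (loc t k j \<omega>) * ?I j \<omega> \<partial>M)"
      by (intro nn_integral_monotone_convergence_SUP FIm j incseq_SucI le_funI mult_right_mono incF) simp
    finally show "(\<integral>\<^sup>+\<omega>. f (loc t k j \<omega>) * ?I j \<omega> \<partial>M) = (SUP n. \<integral>\<^sup>+\<omega>. F n (loc t k j \<omega>) * ?I j \<omega> \<partial>M)" .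
  qed
  also have "\<dots> = (SUP n. \<integral>\<^sup>+j. (\<integral>\<^sup>+\<omega>. F n (loc t k j \<omega>) * ?I j \<omega> \<partial>M) \<partial>count_space (injs k ?T))"
    by (intro nn_integral_monotone_convergence_SUP incseq_SucI le_funI nn_integral_mono mult_right_mono incF) auto
  also have "\<dots> = (SUP n. ennreal (t ^ k) * (\<integral>\<^sup>+w. F n w * ennreal (exp (- (t * v w))) \<partial>?Q))"
  proof (intro SUP_cong refl void_probability_integrable[OF t Fm a a01 v v0 vC vm])
    fix n
    have "(\<integral>\<^sup>+w. F n w \<partial>?Q) \<le> (\<integral>\<^sup>+w. indicator (B n) w \<partial>?Q)"
      using f1 by (intro nn_integral_mono) (auto simp: F_def indicator_def)
    also have "\<dots> = (\<Prod>i<k. emeasure lborel (ball (0::'d point) (real n)))"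
      unfolding nn_integral_indicator[OF B] unfolding B_def by (rule L.emeasure_PiM) auto
    also have "\<dots> < \<infinity>"
      using emeasure_lborel_ball_finite[of "0::'d point" "real n"]
      by (simp add: power_less_top_ennreal)
    finally show "(\<integral>\<^sup>+w. F n w \<partial>?Q) < \<infinity>" .
  qed
  also have "\<dots> = ennreal (t ^ k) * (SUP n. \<integral>\<^sup>+w. F n w * ennreal (exp (- (t * v w))) \<partial>?Q)"
    by (rule SUP_mult_left_ennreal[symmetric])
  also have "(SUP n. \<integral>\<^sup>+w. F n w * ennreal (exp (- (t * v w))) \<partial>?Q)
     = (\<integral>\<^sup>+w. (SUP n. F n w * ennreal (exp (- (t * v w)))) \<partial>?Q)"
    by (intro nn_integral_monotone_convergence_SUP[symmetric] incseq_SucI le_funI mult_right_mono incF) auto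
  also have "\<dots> = (\<integral>\<^sup>+w. f w * ennreal (exp (- (t * v w))) \<partial>?Q)"
    by (intro nn_integral_cong) (simp add: SUP_mult_right_ennreal[symmetric] SUPF)
  finally show ?thesis .
qed

end

section \<open>Random graphs on finitely many points\<close>

text \<open>The start \<open>r\<close> is reached even when it does not lie in \<open>I\<close>, as
  may happen for the random index set left by thinning. Events about the result therefore require
  separately that it is contained in \<open>I\<close>.\<close>

definition reach :: "'i set \<Rightarrow> ('i \<Rightarrow> 'i \<Rightarrow> bool) \<Rightarrow> 'i \<Rightarrow> 'i set" where
  "reach I adj r = {i. (\<lambda>i j. i \<in> I \<and> j \<in> I \<and> adj i j)\<^sup>*\<^sup>* r i}"

lemma reach_self [simp]: "r \<in> reach I adj r"
  by (simp add: reach_def)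

lemma reach_step: "i \<in> reach I adj r \<Longrightarrow> i \<in> I \<Longrightarrow> j \<in> I \<Longrightarrow> adj i j \<Longrightarrow> j \<in> reach I adj r"
  unfolding reach_def by (auto intro: rtranclp.rtrancl_into_rtrancl)

lemma reach_induct [consumes 1, case_names base step]:
  assumes "x \<in> reach I adj r" "P r"
    and "\<And>i j. i \<in> reach I adj r \<Longrightarrow> i \<in> I \<Longrightarrow> j \<in> I \<Longrightarrow> adj i j \<Longrightarrow> P i \<Longrightarrow> P j"
  shows "P x"
proof -
  have "(\<lambda>i j. i \<in> I \<and> j \<in> I \<and> adj i j)\<^sup>*\<^sup>* r x" using assms(1) by (simp add: reach_def)
  then show ?thesis by induction (use assms(2,3) in \<open>auto simp: reach_def\<close>)
qed

lemma reach_subset: "reach I adj r \<subseteq> insert r I"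
proof
  fix x assume "x \<in> reach I adj r" then show "x \<in> insert r I" by (induction rule: reach_induct) auto
qed

lemma reach_mono: "I \<subseteq> I' \<Longrightarrow> (\<And>i j. i \<in> I \<Longrightarrow> j \<in> I \<Longrightarrow> adj i j \<Longrightarrow> adj' i j) \<Longrightarrow> reach I adj r \<subseteq> reach I' adj' r"
proof
  fix x assume *: "I \<subseteq> I'" "\<And>i j. i \<in> I \<Longrightarrow> j \<in> I \<Longrightarrow> adj i j \<Longrightarrow> adj' i j" and "x \<in> reach I adj r"
  from this(3) show "x \<in> reach I' adj' r"
    by (induction rule: reach_induct) (use * in \<open>auto intro: reach_step\<close>)
qed

lemma reach_cong: "(\<And>i j. i \<in> I \<Longrightarrow> j \<in> I \<Longrightarrow> adj i j = adj' i j) \<Longrightarrow> reach I adj r = reach I adj' r"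
  by (intro antisym reach_mono) auto

text \<open>Connectivity inside \<open>W\<close> and absence of edges leaving \<open>W\<close> are
  conditions on disjoint sets of edges; this is what makes the probability of a prescribed cluster a
  product.\<close>

lemma reach_eq_iff:
  assumes W: "W \<subseteq> I" "r \<in> W"
  shows "reach I adj r = W \<longleftrightarrow> reach W adj r = W \<and> (\<forall>j\<in>I - W. \<forall>w\<in>W. \<not> adj w j)"
proof
  assume eq: "reach I adj r = W"
  have "x \<in> reach W adj r" if "x \<in> reach I adj r" for x
    using that
  proof (induction rule: reach_induct)
    case (step i j)
    then show ?case using eq W by (auto intro!: reach_step[of i W adj r j] intro: reach_step)
  qed simp
  then have "W \<subseteq> reach W adj r" using eq by blast
  moreover have "reach W adj r \<subseteq> W" using reach_subset[of W adj r] W by auto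
  moreover have False if "j \<in> I - W" "w \<in> W" "adj w j" for j w
    using reach_step[of w I adj r j] eq W that by auto
  ultimately show "reach W adj r = W \<and> (\<forall>j\<in>I - W. \<forall>w\<in>W. \<not> adj w j)" by blast
next
  assume a: "reach W adj r = W \<and> (\<forall>j\<in>I - W. \<forall>w\<in>W. \<not> adj w j)"
  have "x \<in> W" if "x \<in> reach I adj r" for x
    using that by (induction rule: reach_induct) (use W a in auto)
  moreover have "W \<subseteq> reach I adj r"
    using a reach_mono[of W I adj adj r] W by auto
  ultimately show "reach I adj r = W" by blast
qed

lemma reach_image:
  assumes r: "r \<in> W" and adj: "\<And>i j. i \<in> W \<Longrightarrow> j \<in> W \<Longrightarrow> adj' (f i) (f j) \<longleftrightarrow> adj i j"
    and f: "inj_on f W"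
  shows "reach (f ` W) adj' (f r) = f ` reach W adj r"
proof (intro equalityI subsetI)
  fix x assume "x \<in> reach (f ` W) adj' (f r)"
  then show "x \<in> f ` reach W adj r"
  proof (induction rule: reach_induct)
    case (step a b)
    then obtain i where i: "i \<in> reach W adj r" "a = f i" by auto
    then have iW: "i \<in> W" using reach_subset[of W adj r] r by auto
    obtain j where j: "j \<in> W" "b = f j" using step by auto
    have "adj i j" using step(4) adj[OF iW j(1)] i j by simp
    then show ?case using reach_step[OF i(1) iW j(1)] j by auto
  qed simp
next
  fix x assume "x \<in> f ` reach W adj r"
  then obtain i where "i \<in> reach W adj r" "x = f i" by auto
  then show "x \<in> reach (f ` W) adj' (f r)"
  proof (induction arbitrary: x rule: reach_induct)
    case (step i j)
    then show ?case using adj[of i j] by (auto intro!: reach_step[of "f i"])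
  qed simp
qed

text \<open>\<open>Ber D \<psi> f\<close> is the expectation of \<open>f\<close> at a random subset of \<open>D\<close> containing each
  \<open>e\<close> independently with probability \<open>\<psi> e\<close>.\<close>

definition Ber :: "'e set \<Rightarrow> ('e \<Rightarrow> real) \<Rightarrow> ('e set \<Rightarrow> real) \<Rightarrow> real" where
  "Ber D \<psi> f = (\<Sum>E\<in>Pow D. f E * ((\<Prod>e\<in>E. \<psi> e) * (\<Prod>e\<in>D - E. 1 - \<psi> e)))"

lemma Ber_cong: "D = D' \<Longrightarrow> (\<And>e. e \<in> D \<Longrightarrow> \<psi> e = \<psi>' e) \<Longrightarrow> (\<And>E. E \<subseteq> D \<Longrightarrow> f E = f' E) \<Longrightarrow> Ber D \<psi> f = Ber D' \<psi>' f'"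
  unfolding Ber_def by (intro sum.cong arg_cong2[where f="(*)"] prod.cong) auto

lemma Ber_1: "finite D \<Longrightarrow> Ber D \<psi> (\<lambda>_. 1) = 1"
  using prod_add[of D \<psi> "\<lambda>e. 1 - \<psi> e"] by (simp add: Ber_def)

lemma Ber_diff: "Ber D \<psi> (\<lambda>E. f E - g E) = Ber D \<psi> f - Ber D \<psi> g"
  by (simp add: Ber_def sum_subtractf left_diff_distrib)

lemma Ber_mono:
  assumes "\<And>e. e \<in> D \<Longrightarrow> 0 \<le> \<psi> e \<and> \<psi> e \<le> 1" "\<And>E. E \<subseteq> D \<Longrightarrow> f E \<le> g E"
  shows "Ber D \<psi> f \<le> Ber D \<psi> g"
  unfolding Ber_def using assms
  by (intro sum_mono mult_right_mono mult_nonneg_nonneg prod_nonneg) auto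

lemma Ber_bounds:
  assumes "finite D" "\<And>e. e \<in> D \<Longrightarrow> 0 \<le> \<psi> e \<and> \<psi> e \<le> 1"
  shows "0 \<le> Ber D \<psi> (\<lambda>E. of_bool (Q E))" "Ber D \<psi> (\<lambda>E. of_bool (Q E)) \<le> 1"
proof -
  have "Ber D \<psi> (\<lambda>E. of_bool (Q E)) \<le> Ber D \<psi> (\<lambda>E. 1)" by (intro Ber_mono assms) auto
  then show "Ber D \<psi> (\<lambda>E. of_bool (Q E)) \<le> 1" using Ber_1[OF assms(1)] by simp
  show "0 \<le> Ber D \<psi> (\<lambda>E. of_bool (Q E))"
    unfolding Ber_def using assms by (intro sum_nonneg mult_nonneg_nonneg prod_nonneg) auto
qed

lemma Ber_all: "finite D \<Longrightarrow> Ber D \<psi> (\<lambda>E. of_bool (D \<subseteq> E)) = (\<Prod>e\<in>D. \<psi> e)"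
proof -
  assume D: "finite D"
  have "Ber D \<psi> (\<lambda>E. of_bool (D \<subseteq> E)) = (\<Sum>E\<in>{D}. of_bool (D \<subseteq> E) * ((\<Prod>e\<in>E. \<psi> e) * (\<Prod>e\<in>D - E. 1 - \<psi> e)))"
    unfolding Ber_def using D by (intro sum.mono_neutral_right) auto
  then show ?thesis by simp
qed

lemma Ber_none: "finite D \<Longrightarrow> Ber D \<psi> (\<lambda>E. of_bool (E = {})) = (\<Prod>e\<in>D. 1 - \<psi> e)"
proof -
  assume D: "finite D"
  have "Ber D \<psi> (\<lambda>E. of_bool (E = {})) = (\<Sum>E\<in>{{}}. of_bool (E = {}) * ((\<Prod>e\<in>E. \<psi> e) * (\<Prod>e\<in>D - E. 1 - \<psi> e)))"
    unfolding Ber_def using D by (intro sum.mono_neutral_right) auto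
  then show ?thesis by simp
qed

text \<open>Independence of the selections made in disjoint sets: the weight of \<open>E\<close>
  factors along its two parts.\<close>

lemma Ber_split:
  assumes fin: "finite D1" "finite D2" and disj: "D1 \<inter> D2 = {}"
  shows "Ber (D1 \<union> D2) \<psi> (\<lambda>E. f (E \<inter> D1) * g (E \<inter> D2)) = Ber D1 \<psi> f * Ber D2 \<psi> g"
proof -
  let ?w = "\<lambda>D E. (\<Prod>e\<in>E. \<psi> e) * (\<Prod>e\<in>D - E. 1 - \<psi> e)"
  have "Ber D1 \<psi> f * Ber D2 \<psi> g = (\<Sum>(E1, E2)\<in>Pow D1 \<times> Pow D2. (f E1 * ?w D1 E1) * (g E2 * ?w D2 E2))"
    unfolding Ber_def by (simp add: sum_product sum.cartesian_product)
  also have "\<dots> = (\<Sum>E\<in>Pow (D1 \<union> D2). f (E \<inter> D1) * g (E \<inter> D2) * ?w (D1 \<union> D2) E)"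
  proof (rule sum.reindex_bij_witness[of _ "\<lambda>E. (E \<inter> D1, E \<inter> D2)" "\<lambda>(E1, E2). E1 \<union> E2"], goal_cases)
    case (5 p)
    then obtain E1 E2 where p: "p = (E1, E2)" "E1 \<subseteq> D1" "E2 \<subseteq> D2" by auto
    have i: "(E1 \<union> E2) \<inter> D1 = E1" "(E1 \<union> E2) \<inter> D2 = E2" "D1 \<union> D2 - (E1 \<union> E2) = (D1 - E1) \<union> (D2 - E2)"
      using p disj by auto
    have "(\<Prod>e\<in>E1 \<union> E2. \<psi> e) = (\<Prod>e\<in>E1. \<psi> e) * (\<Prod>e\<in>E2. \<psi> e)"
      using p fin disj by (intro prod.union_disjoint) (auto intro: finite_subset)
    moreover have "(\<Prod>e\<in>(D1 - E1) \<union> (D2 - E2). 1 - \<psi> e) = (\<Prod>e\<in>D1 - E1. 1 - \<psi> e) * (\<Prod>e\<in>D2 - E2. 1 - \<psi> e)"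
      using p fin disj by (intro prod.union_disjoint) auto
    ultimately show ?case unfolding p by (simp only: prod.case i) (simp add: mult_ac)
  qed (use disj in auto)
  finally show ?thesis by (simp add: Ber_def)
qed

lemma Ber_restrict:
  assumes "finite D" "D1 \<subseteq> D"
  shows "Ber D \<psi> (\<lambda>E. f (E \<inter> D1)) = Ber D1 \<psi> f"
proof -
  have "D1 \<union> (D - D1) = D" using assms by auto
  then show ?thesis
    using Ber_split[of D1 "D - D1" \<psi> f "\<lambda>_. 1"] assms Ber_1[of "D - D1" \<psi>] finite_subset[OF assms(2,1)] by auto
qed

lemma Ber_family:
  assumes "finite J" "\<And>j. j \<in> J \<Longrightarrow> finite (B j)" "disjoint_family_on B J"
  shows "Ber (\<Union>j\<in>J. B j) \<psi> (\<lambda>E. \<Prod>j\<in>J. f j (E \<inter> B j)) = (\<Prod>j\<in>J. Ber (B j) \<psi> (f j))"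
  using assms
proof (induction J rule: finite_induct)
  case empty
  then show ?case by (simp add: Ber_def)
next
  case (insert i J)
  let ?B = "\<Union>j\<in>J. B j"
  have d: "B i \<inter> ?B = {}" using insert by (auto simp: disjoint_family_on_def)
  have df: "disjoint_family_on B J" using insert.prems by (auto simp: disjoint_family_on_def)
  have "Ber (B i \<union> ?B) \<psi> (\<lambda>E. f i (E \<inter> B i) * (\<Prod>j\<in>J. f j (E \<inter> ?B \<inter> B j))) = Ber (B i) \<psi> (f i) * Ber ?B \<psi> (\<lambda>E. \<Prod>j\<in>J. f j (E \<inter> B j))"
    using insert d by (intro Ber_split) auto
  moreover have "(\<Prod>j\<in>J. f j (E \<inter> ?B \<inter> B j)) = (\<Prod>j\<in>J. f j (E \<inter> B j))" for E
    by (intro prod.cong refl arg_cong2[where f=f] arg_cong[where f="f _"]) auto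
  ultimately show ?case using insert df by simp
qed

lemma Ber_reindex:
  assumes h: "inj_on h D"
  shows "Ber (h ` D) \<psi> f = Ber D (\<lambda>e. \<psi> (h e)) (\<lambda>E. f (h ` E))"
proof -
  have inj: "inj_on (image h) (Pow D)" using h by (simp add: inj_on_image_Pow)
  have "Ber (h ` D) \<psi> f = (\<Sum>E\<in>Pow D. f (h ` E) * ((\<Prod>e\<in>h ` E. \<psi> e) * (\<Prod>e\<in>h ` D - h ` E. 1 - \<psi> e)))"
    unfolding Ber_def image_Pow_surj[OF refl, symmetric] by (subst sum.reindex[OF inj]) (simp add: o_def)
  also have "\<dots> = Ber D (\<lambda>e. \<psi> (h e)) (\<lambda>E. f (h ` E))"
    unfolding Ber_def
  proof (intro sum.cong refl arg_cong2[where f="(*)"])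
    fix E assume E: "E \<in> Pow D"
    show "(\<Prod>e\<in>h ` E. \<psi> e) = (\<Prod>e\<in>E. \<psi> (h e))"
      using E h by (subst prod.reindex) (auto intro: inj_on_subset)
    have "h ` D - h ` E = h ` (D - E)" using E h by (auto simp: inj_on_def)
    then show "(\<Prod>e\<in>h ` D - h ` E. 1 - \<psi> e) = (\<Prod>e\<in>D - E. 1 - \<psi> (h e))"
      using h by (simp add: prod.reindex inj_on_diff)
  qed
  finally show ?thesis .
qed

section \<open>Independent edges realised by uniform marks\<close>

definition uniform_marks :: "('p \<Rightarrow> real) measure" where
  "uniform_marks = PiM UNIV (\<lambda>_. uniform_measure lborel {0..1})"

lemma sets_uniform_marks [measurable_cong, simp]: "sets uniform_marks = sets (PiM UNIV (\<lambda>_. borel))"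
  unfolding uniform_marks_def by (rule sets_PiM_cong) auto

lemma space_uniform_marks [simp]: "space uniform_marks = UNIV"
  by (simp add: uniform_marks_def space_PiM)

lemma measurable_mark [measurable]: "(\<lambda>u. u p) \<in> borel_measurable uniform_marks"
  unfolding measurable_cong_sets[OF sets_uniform_marks refl] by (rule measurable_component_singleton) simp

lemma prob_space_unit: "prob_space (uniform_measure lborel {0..1::real})"
  by (rule prob_space_uniform_measure) auto

lemma prob_space_uniform_marks: "prob_space uniform_marks"
  unfolding uniform_marks_def by (intro prob_space_PiM prob_space_unit)

lemma unit_le: "0 \<le> c \<Longrightarrow> c \<le> 1 \<Longrightarrow> emeasure (uniform_measure lborel {0..1::real}) {..c} = ennreal c"
proof -
  assume c: "0 \<le> c" "c \<le> 1"
  then have "{0..1} \<inter> {..c} = {0..c}" by auto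
  then show ?thesis using c by (simp add: divide_ennreal_def)
qed

lemma unit_gt: "0 \<le> c \<Longrightarrow> c \<le> 1 \<Longrightarrow> emeasure (uniform_measure lborel {0..1::real}) {c<..} = ennreal (1 - c)"
proof -
  assume c: "0 \<le> c" "c \<le> 1"
  then have "{0..1} \<inter> {c<..} = {c<..1}" by auto
  then show ?thesis using c by (simp add: divide_ennreal_def)
qed

text \<open>The mark space splits into the cylinders on which the set of \<open>e\<close> with
  \<open>u (m e) \<le> \<theta> e\<close> is a given \<open>E\<close>. Injectivity of
  \<open>m\<close> makes different \<open>e\<close> read different coordinates, so each cylinder has
  the product weight that appears in \<open>Ber\<close>.\<close>

lemma Ber_uniform_marks:
  assumes D: "finite D" and m: "inj_on m D" and \<theta>: "\<And>e. e \<in> D \<Longrightarrow> 0 \<le> \<theta> e \<and> \<theta> e \<le> 1"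
  shows "{u. \<Theta> {e\<in>D. u (m e) \<le> \<theta> e}} \<in> sets uniform_marks"
    and "emeasure uniform_marks {u. \<Theta> {e\<in>D. u (m e) \<le> \<theta> e}} = ennreal (Ber D \<theta> (\<lambda>E. of_bool (\<Theta> E)))"
proof -
  interpret product_prob_space "\<lambda>_. uniform_measure lborel {0..1::real}" UNIV
    by (simp add: product_prob_space_def product_sigma_finite_def product_prob_space_axioms_def
        prob_space_unit prob_space_imp_sigma_finite)
  let ?A = "\<lambda>E e. if e \<in> E then {..\<theta> e} else {\<theta> e<..}"
  let ?S = "\<lambda>E. {u. \<forall>e\<in>D. u (m e) \<in> ?A E e}"
  have S: "?S E \<in> sets uniform_marks" for E
  proof -
    have "{u\<in>space uniform_marks. u (m e) \<in> ?A E e} \<in> sets uniform_marks" for e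
    proof -
      have "(\<lambda>u. u (m e)) -` (?A E e) \<inter> space uniform_marks \<in> sets uniform_marks"
        by (rule measurable_sets[OF measurable_mark]) auto
      moreover have "(\<lambda>u. u (m e)) -` (?A E e) \<inter> space uniform_marks
        = {u\<in>space uniform_marks. u (m e) \<in> ?A E e}" by auto
      ultimately show ?thesis by simp
    qed
    then have "{u\<in>space uniform_marks. \<forall>e\<in>D. u (m e) \<in> ?A E e} \<in> sets uniform_marks"
      using D by (intro sets.sets_Collect_finite_All)
    then show ?thesis by simp
  qed
  have em: "emeasure uniform_marks (?S E) = ennreal ((\<Prod>e\<in>E. \<theta> e) * (\<Prod>e\<in>D - E. 1 - \<theta> e))" if E: "E \<subseteq> D" for E
  proof -
    let ?X = "\<lambda>p. ?A E (the_inv_into D m p)"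
    have "?S E = {u\<in>space (PiM UNIV (\<lambda>_. uniform_measure lborel {0..1})). \<forall>p\<in>m ` D. u p \<in> ?X p}"
      using m by (auto simp: space_PiM the_inv_into_f_f)
    then have "emeasure uniform_marks (?S E) = (\<Prod>p\<in>m ` D. emeasure (uniform_measure lborel {0..1}) (?X p))"
      unfolding uniform_marks_def using D by (simp only:) (rule emeasure_PiM_Collect, auto)
    also have "\<dots> = (\<Prod>e\<in>D. emeasure (uniform_measure lborel {0..1}) (?A E e))"
      using m by (subst prod.reindex) (auto simp: the_inv_into_f_f intro!: prod.cong)
    also have "\<dots> = (\<Prod>e\<in>D. ennreal (if e \<in> E then \<theta> e else 1 - \<theta> e))"
      using \<theta> by (intro prod.cong refl) (simp add: unit_le unit_gt del: emeasure_uniform_measure)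
    also have "\<dots> = ennreal (\<Prod>e\<in>D. if e \<in> E then \<theta> e else 1 - \<theta> e)"
      using \<theta> by (intro prod_ennreal) auto
    also have "(\<Prod>e\<in>D. if e \<in> E then \<theta> e else 1 - \<theta> e) = (\<Prod>e\<in>E. \<theta> e) * (\<Prod>e\<in>D - E. 1 - \<theta> e)"
      using D E by (subst prod.If_cases) (auto simp: Int_absorb1 Diff_eq intro: arg_cong2[where f="(*)"])
    finally show ?thesis .
  qed
  let ?P = "{E\<in>Pow D. \<Theta> E}"
  have S_iff: "u \<in> ?S E \<longleftrightarrow> {e\<in>D. u (m e) \<le> \<theta> e} = E" if "E \<subseteq> D" for u E
    using that by (auto split: if_splits)
  have eq: "{u. \<Theta> {e\<in>D. u (m e) \<le> \<theta> e}} = (\<Union>E\<in>?P. ?S E)"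
  proof -
    show ?thesis
    proof (intro equalityI subsetI)
      fix u assume "u \<in> {u. \<Theta> {e\<in>D. u (m e) \<le> \<theta> e}}"
      then have "{e\<in>D. u (m e) \<le> \<theta> e} \<in> ?P" by simp
      moreover have "u \<in> ?S {e\<in>D. u (m e) \<le> \<theta> e}" by (subst S_iff) auto
      ultimately show "u \<in> (\<Union>E\<in>?P. ?S E)" by (rule UN_I)
    next
      fix u assume "u \<in> (\<Union>E\<in>?P. ?S E)"
      then obtain E where E: "E \<in> ?P" "u \<in> ?S E" by (rule UN_E)
      then have "{e\<in>D. u (m e) \<le> \<theta> e} = E" using S_iff[of E u] by simp
      then show "u \<in> {u. \<Theta> {e\<in>D. u (m e) \<le> \<theta> e}}" using E(1) by simp
    qed
  qed
  have fP: "finite ?P" using D by simp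
  show "{u. \<Theta> {e\<in>D. u (m e) \<le> \<theta> e}} \<in> sets uniform_marks"
    unfolding eq using S fP by (intro sets.finite_UN) auto
  have "emeasure uniform_marks (\<Union>E\<in>?P. ?S E) = (\<Sum>E\<in>?P. emeasure uniform_marks (?S E))"
  proof (rule sum_emeasure[symmetric])
    show "disjoint_family_on ?S ?P"
      unfolding disjoint_family_on_def
    proof (intro ballI impI)
      fix E E' assume a: "E \<in> ?P" "E' \<in> ?P" "E \<noteq> E'"
      show "?S E \<inter> ?S E' = {}"
      proof (rule equals0I)
        fix u assume "u \<in> ?S E \<inter> ?S E'"
        then have "{e\<in>D. u (m e) \<le> \<theta> e} = E" "{e\<in>D. u (m e) \<le> \<theta> e} = E'"
          using S_iff[of E u] S_iff[of E' u] a(1,2) by simp_all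
        then show False using a(3) by simp
      qed
    qed
    show "?S ` ?P \<subseteq> sets uniform_marks" using S by blast
  qed (rule fP)
  also have "\<dots> = (\<Sum>E\<in>?P. ennreal ((\<Prod>e\<in>E. \<theta> e) * (\<Prod>e\<in>D - E. 1 - \<theta> e)))"
    using em by (intro sum.cong) auto
  also have "\<dots> = ennreal (\<Sum>E\<in>?P. (\<Prod>e\<in>E. \<theta> e) * (\<Prod>e\<in>D - E. 1 - \<theta> e))"
    using \<theta> by (intro sum_ennreal mult_nonneg_nonneg prod_nonneg) auto
  also have "(\<Sum>E\<in>?P. (\<Prod>e\<in>E. \<theta> e) * (\<Prod>e\<in>D - E. 1 - \<theta> e)) = Ber D \<theta> (\<lambda>E. of_bool (\<Theta> E))"
    unfolding Ber_def using D by (intro sum.mono_neutral_cong_left) auto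
  finally show "emeasure uniform_marks {u. \<Theta> {e\<in>D. u (m e) \<le> \<theta> e}} = ennreal (Ber D \<theta> (\<lambda>E. of_bool (\<Theta> E)))"
    unfolding eq .
qed

section \<open>Lexicographic order and the mark belonging to a pair of indices\<close>

lemma lex_less_asym: "lex_less x y \<Longrightarrow> \<not> lex_less y x"
  unfolding lex_less_def by (rule less_fun_asym)

lemma lex_less_irrefl [simp]: "\<not> lex_less x x"
  by (auto simp: lex_less_def less_fun_def)

text \<open>The comparison is decided at the least coordinate where the points differ, which exists
  because the coordinate type is finite and linearly ordered.\<close>

lemma lex_less_total:
  fixes x y :: "'d::{finite,linorder} point"
  assumes "x \<noteq> y" shows "lex_less x y \<or> lex_less y x"
proof -
  let ?S = "{k. x $ k \<noteq> y $ k}"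
  have ne: "?S \<noteq> {}" using assms by (auto simp: vec_eq_iff)
  define k where "k = Min ?S"
  have k: "k \<in> ?S" unfolding k_def using ne by (intro Min_in) auto
  have "x $ k' = y $ k'" if "k' < k" for k'
  proof (rule ccontr)
    assume "x $ k' \<noteq> y $ k'"
    then have "k \<le> k'" unfolding k_def by (intro Min_le) auto
    then show False using that by simp
  qed
  then show ?thesis using k unfolding lex_less_def less_fun_def by (metis (mono_tags) linorder_neqE mem_Collect_eq)
qed

definition pairs :: "'i set \<Rightarrow> 'i set set" where
  "pairs W = {e. e \<subseteq> W \<and> card e = 2}"

text \<open>Index of the mark that governs \<open>e\<close>: an ordered pair for a two-element set,
  the diagonal pair \<open>(i, i)\<close> for a singleton. Admitting singletons lets retention of
  points and presence of edges be handled by one family of marks.\<close>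

definition mark_index :: "('i \<Rightarrow> 'd::{finite,linorder} point) \<Rightarrow> 'i set \<Rightarrow> 'i \<times> 'i" where
  "mark_index z e = (SOME p. e = {fst p, snd p} \<and> (fst p = snd p \<or> lex_less (z (fst p)) (z (snd p))))"

lemma mark_index:
  assumes z: "inj_on z I" and e: "e \<subseteq> I" "card e = 1 \<or> card e = 2"
  shows "e = {fst (mark_index z e), snd (mark_index z e)}"
    and "fst (mark_index z e) = snd (mark_index z e) \<or> lex_less (z (fst (mark_index z e))) (z (snd (mark_index z e)))"
proof -
  have "\<exists>p. e = {fst p, snd p} \<and> (fst p = snd p \<or> lex_less (z (fst p)) (z (snd p)))"
  proof (cases "card e = 1")
    case True
    then obtain i where "e = {i}" by (auto simp: card_1_singleton_iff)
    then show ?thesis by (intro exI[of _ "(i, i)"]) auto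
  next
    case False
    then obtain i j where ij: "e = {i, j}" "i \<noteq> j" using e by (auto simp: card_2_iff)
    then have "z i \<noteq> z j" using z e by (auto simp: inj_on_def)
    then consider "lex_less (z i) (z j)" | "lex_less (z j) (z i)" using lex_less_total by blast
    then show ?thesis
    proof cases
      case 1 then show ?thesis using ij by (intro exI[of _ "(i, j)"]) auto
    next
      case 2 then show ?thesis using ij by (intro exI[of _ "(j, i)"]) auto
    qed
  qed
  from someI_ex[OF this]
  show "e = {fst (mark_index z e), snd (mark_index z e)}"
    "fst (mark_index z e) = snd (mark_index z e) \<or> lex_less (z (fst (mark_index z e))) (z (snd (mark_index z e)))"
    unfolding mark_index_def by auto
qed

lemma mark_index_singleton [simp]: "mark_index z {i} = (i, i)"
proof -
  have "mark_index z {i} = (SOME p. p = (i, i))"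
    unfolding mark_index_def by (intro arg_cong[where f=Eps] ext) (auto simp: prod_eq_iff)
  then show ?thesis by simp
qed

lemma mark_index_pair:
  assumes "lex_less (z i) (z j)"
  shows "mark_index z {i, j} = (i, j)" "mark_index z {j, i} = (i, j)"
proof -
  have ij: "i \<noteq> j" "\<not> lex_less (z j) (z i)" using assms lex_less_asym by auto
  have "mark_index z {i, j} = (SOME p. p = (i, j))"
    unfolding mark_index_def
  proof (intro arg_cong[where f=Eps] ext)
    fix p
    show "({i, j} = {fst p, snd p} \<and> (fst p = snd p \<or> lex_less (z (fst p)) (z (snd p)))) = (p = (i, j))"
      using ij assms by (cases p) (auto simp: doubleton_eq_iff)
  qed
  then show "mark_index z {i, j} = (i, j)" by simp
  then show "mark_index z {j, i} = (i, j)" by (simp add: insert_commute)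
qed

section \<open>Connectivity and neighbourhoods for fixed points\<close>

context random_connection_model
begin

text \<open>The symmetry of \<open>\<phi>\<close> makes the image a singleton, so the value does not
  depend on the order of the two indices.\<close>

definition edge_prob :: "('i \<Rightarrow> 'd point) \<Rightarrow> 'i set \<Rightarrow> real" where
  "edge_prob z e = the_elem ((\<lambda>(i, j). \<phi> (z i - z j)) ` {(i, j). e = {i, j}})"

lemma edge_prob_pair [simp]: "edge_prob z {i, j} = \<phi> (z i - z j)"
proof -
  have "(\<lambda>(i, j). \<phi> (z i - z j)) ` {(i', j'). {i, j} = {i', j'}} = {\<phi> (z i - z j)}"
    using phi_sym[of "z i - z j"] by (auto simp: doubleton_eq_iff)
  then show ?thesis by (simp add: edge_prob_def)
qed

text \<open>Adjacency on indices instead of points. It makes sense for every \<open>z\<close> and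
  \<open>u\<close>, and for distinct indices with distinct locations it is a condition on a single
  mark.\<close>

definition ladj :: "('i \<Rightarrow> 'd point) \<Rightarrow> ('i \<times> 'i \<Rightarrow> real) \<Rightarrow> 'i \<Rightarrow> 'i \<Rightarrow> bool" where
  "ladj z u i j \<longleftrightarrow> (lex_less (z i) (z j) \<and> u (i, j) \<le> \<phi> (z i - z j))
     \<or> (lex_less (z j) (z i) \<and> u (j, i) \<le> \<phi> (z i - z j))"

lemma ladj_iff:
  assumes "i \<noteq> j" "z i \<noteq> z j"
  shows "ladj z u i j \<longleftrightarrow> u (mark_index z {i, j}) \<le> edge_prob z {i, j}"
  using lex_less_total[OF assms(2)]
proof
  assume "lex_less (z i) (z j)" then show ?thesis
    using mark_index_pair(1)[of z i j] lex_less_asym[of "z i" "z j"] by (auto simp: ladj_def)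
next
  assume "lex_less (z j) (z i)" then show ?thesis
    using mark_index_pair(2)[of z j i] lex_less_asym[of "z j" "z i"] by (auto simp: ladj_def)
qed

lemma ladj_self [simp]: "\<not> ladj z u i i"
  by (simp add: ladj_def)

text \<open>Probability that the graph with independent edges on the points \<open>z i\<close>,
  \<open>i \<in> W\<close>, is connected; connectedness is tested from the base point
  \<open>r\<close>.\<close>

definition conn_prob :: "'i \<Rightarrow> 'i set \<Rightarrow> ('i \<Rightarrow> 'd point) \<Rightarrow> real" where
  "conn_prob r W z = Ber (pairs W) (edge_prob z) (\<lambda>E. of_bool (reach W (\<lambda>i j. {i, j} \<in> E) r = W))"

text \<open>Probability that a point at \<open>y\<close> is joined to at least one point of
  \<open>W\<close> when the edges are independent.\<close>

definition hit :: "('i \<Rightarrow> 'd point) \<Rightarrow> 'i set \<Rightarrow> 'd point \<Rightarrow> real" where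
  "hit z W y = 1 - (\<Prod>w\<in>W. 1 - \<phi> (y - z w))"

lemma hit_bounds: "0 \<le> hit z W y" "hit z W y \<le> 1"
  using phi_range by (auto simp: hit_def intro!: prod_le_1 prod_nonneg)

lemma pairs_finite [simp]: "finite W \<Longrightarrow> finite (pairs W)"
  unfolding pairs_def by (rule finite_subset[of _ "Pow W"]) auto

lemma edge_prob_range: "e \<in> pairs W \<Longrightarrow> 0 \<le> edge_prob z e \<and> edge_prob z e \<le> 1"
  using phi_range by (auto simp: pairs_def card_2_iff)

lemma conn_prob_bounds: "finite W \<Longrightarrow> 0 \<le> conn_prob r W z" "finite W \<Longrightarrow> conn_prob r W z \<le> 1"
  unfolding conn_prob_def using edge_prob_range by (intro Ber_bounds pairs_finite; blast)+

lemma pairs_image: "inj_on f W \<Longrightarrow> pairs (f ` W) = image f ` pairs W"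
proof (intro equalityI subsetI)
  fix e assume f: "inj_on f W" and e: "e \<in> pairs (f ` W)"
  then obtain e' where "e' \<subseteq> W" "e = f ` e'" by (auto simp: pairs_def subset_image_iff)
  moreover have "card e' = 2" using e calculation f by (auto simp: pairs_def card_image inj_on_subset)
  ultimately show "e \<in> image f ` pairs W" by (auto simp: pairs_def)
next
  fix e assume "inj_on f W" "e \<in> image f ` pairs W"
  then show "e \<in> pairs (f ` W)" by (auto simp: pairs_def card_image inj_on_subset)
qed

text \<open>Connectivity depends on the points and not on their names. This is needed whenever the
  same points appear once with indices of the process and once as coordinates of an integration
  variable.\<close>

lemma conn_prob_relabel:
  assumes f: "inj_on f W" and r: "r \<in> W" and z: "\<And>i. i \<in> W \<Longrightarrow> z' i = z (f i)"
  shows "conn_prob r W z' = conn_prob (f r) (f ` W) z"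
proof -
  have inj: "inj_on (image f) (pairs W)"
    by (rule inj_on_subset[OF inj_on_image_Pow[OF f]]) (auto simp: pairs_def)
  have "conn_prob (f r) (f ` W) z
    = Ber (pairs W) (\<lambda>e. edge_prob z (f ` e)) (\<lambda>E. of_bool (reach (f ` W) (\<lambda>i j. {i, j} \<in> image f ` E) (f r) = f ` W))"
    unfolding conn_prob_def pairs_image[OF f] by (rule Ber_reindex[OF inj])
  also have "\<dots> = conn_prob r W z'"
    unfolding conn_prob_def
  proof (rule Ber_cong)
    fix e assume "e \<in> pairs W"
    then obtain i j where "e = {i, j}" "i \<in> W" "j \<in> W" by (auto simp: pairs_def card_2_iff)
    then show "edge_prob z (f ` e) = edge_prob z' e" using z by simp
  next
    fix E assume E: "E \<subseteq> pairs W"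
    have "reach (f ` W) (\<lambda>i j. {i, j} \<in> image f ` E) (f r) = f ` reach W (\<lambda>i j. {i, j} \<in> E) r"
    proof (rule reach_image[OF r _ f])
      fix i j assume ij: "i \<in> W" "j \<in> W"
      show "{f i, f j} \<in> image f ` E \<longleftrightarrow> {i, j} \<in> E"
      proof
        assume "{f i, f j} \<in> image f ` E"
        then obtain e where e: "e \<in> E" "f ` {i, j} = f ` e" by auto
        moreover have "e \<subseteq> W" using e E by (auto simp: pairs_def)
        ultimately have "{i, j} = e" using inj_on_image_eq_iff[OF f, of "{i, j}" e] ij by auto
        then show "{i, j} \<in> E" using e by simp
      next
        assume "{i, j} \<in> E"
        then show "{f i, f j} \<in> image f ` E" by (auto intro!: image_eqI[of _ _ "{i, j}"])
      qed
    qed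
    moreover have "f ` reach W (\<lambda>i j. {i, j} \<in> E) r = f ` W \<longleftrightarrow> reach W (\<lambda>i j. {i, j} \<in> E) r = W"
      using inj_on_image_eq_iff[OF f, of "reach W (\<lambda>i j. {i, j} \<in> E) r" W]
        reach_subset[of W "\<lambda>i j. {i, j} \<in> E" r] r by auto
    ultimately show "of_bool (reach (f ` W) (\<lambda>i j. {i, j} \<in> image f ` E) (f r) = f ` W)
        = (of_bool (reach W (\<lambda>i j. {i, j} \<in> E) r = W) :: real)" by simp
  qed simp
  finally show ?thesis by simp
qed

lemma hit_relabel: "inj_on f W \<Longrightarrow> (\<And>i. i \<in> W \<Longrightarrow> z' i = z (f i)) \<Longrightarrow> hit z' W y = hit z (f ` W) y"
  unfolding hit_def by (subst prod.reindex) auto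

text \<open>
  The mark \<open>u (i, i)\<close> belongs to no edge of the model and is free to decide whether the point with
  index \<open>i\<close> is kept; this realises a thinning of the process on the same probability space.
\<close>

definition kept :: "('i \<Rightarrow> real) \<Rightarrow> 'i set \<Rightarrow> ('i \<times> 'i \<Rightarrow> real) \<Rightarrow> 'i set" where
  "kept \<rho> I u = {i\<in>I. u (i, i) \<le> \<rho> i}"

text \<open>By \<open>reach_eq_iff\<close> the event is a conjunction of conditions on disjoint sets
  of marks: retention of the points of \<open>W\<close>, the edges inside \<open>W\<close>, and for
  each outside point \<open>j\<close> its retention mark together with its edges to
  \<open>W\<close>. The factors are the probabilities of these conditions.\<close>

lemma finite_cluster_prob:
  assumes F: "finite F" and W: "W \<subseteq> F" "r \<in> W" and z: "inj_on z F"
    and \<rho>: "\<And>i. i \<in> F \<Longrightarrow> 0 \<le> \<rho> i \<and> \<rho> i \<le> 1"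
  shows "emeasure uniform_marks {u. W \<subseteq> kept \<rho> F u \<and> reach (kept \<rho> F u) (ladj z u) r = W}
    = ennreal ((\<Prod>i\<in>W. \<rho> i) * conn_prob r W z * (\<Prod>j\<in>F - W. 1 - \<rho> j * hit z W (z j)))" (is "emeasure _ ?Ev = _")
proof -
  have fW: "finite W" using F W finite_subset by auto
  \<comment> \<open>Singletons stand for the diagonal marks that decide retention, two-element sets
    for edges.\<close>
  define D where "D = (\<lambda>i. {i}) ` F \<union> pairs F"
  define \<theta> where "\<theta> e = (if card e = 2 then edge_prob z e else \<rho> (the_elem e))" for e
  have D1: "e \<subseteq> F \<and> (card e = 1 \<or> card e = 2)" if "e \<in> D" for e
    using that by (auto simp: D_def pairs_def)
  have finD: "finite D" using F by (auto simp: D_def)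
  have m: "inj_on (mark_index z) D"
  proof (rule inj_onI)
    fix e e' assume "e \<in> D" "e' \<in> D" "mark_index z e = mark_index z e'"
    then show "e = e'" using mark_index(1)[OF z, of e] mark_index(1)[OF z, of e'] D1[of e] D1[of e'] by simp
  qed
  have \<theta>01: "0 \<le> \<theta> e \<and> \<theta> e \<le> 1" if "e \<in> D" for e
    using that \<rho> edge_prob_range[of e F z] by (auto simp: \<theta>_def D_def pairs_def)
  define S where "S = (\<lambda>i. {i}) ` W"
  define B where "B j = insert {j} ((\<lambda>w. {w, j}) ` W)" for j
  let ?J = "F - W"
  let ?U = "\<Union>j\<in>?J. B j"
  let ?fS = "\<lambda>E. of_bool (S \<subseteq> E) :: real"
  let ?fP = "\<lambda>E. of_bool (reach W (\<lambda>i j. {i, j} \<in> E) r = W) :: real"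
  let ?fB = "\<lambda>j E. of_bool (\<not> ({j} \<in> E \<and> (\<exists>w\<in>W. {w, j} \<in> E))) :: real"
  define \<Theta> where "\<Theta> E \<longleftrightarrow> S \<subseteq> E \<and> reach W (\<lambda>i j. {i, j} \<in> E) r = W \<and> (\<forall>j\<in>?J. \<not> ({j} \<in> E \<and> (\<exists>w\<in>W. {w, j} \<in> E)))" for E
  have sub: "S \<subseteq> D" "pairs W \<subseteq> D" "?U \<subseteq> D"
    using W by (auto simp: S_def D_def B_def pairs_def card_insert_if)
  have disj: "S \<inter> pairs W = {}" "(S \<union> pairs W) \<inter> ?U = {}" "disjoint_family_on B ?J"
    by (auto simp: S_def pairs_def B_def disjoint_family_on_def doubleton_eq_iff)
  have fin: "finite S" "finite (pairs W)" "\<And>j. finite (B j)" "finite ?U"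
    using fW F by (auto simp: S_def B_def)
  have Ev: "?Ev = {u. \<Theta> {e\<in>D. u (mark_index z e) \<le> \<theta> e}}"
  proof (rule Collect_cong)
    fix u
    let ?E = "{e\<in>D. u (mark_index z e) \<le> \<theta> e}"
    have single: "{i} \<in> ?E \<longleftrightarrow> i \<in> kept \<rho> F u" for i
      by (auto simp: kept_def \<theta>_def D_def pairs_def)
    have edge: "{i, j} \<in> ?E \<longleftrightarrow> ladj z u i j" if "i \<in> F" "j \<in> F" "i \<noteq> j" for i j
    proof -
      have "z i \<noteq> z j" using z that by (auto simp: inj_on_def)
      moreover have "{i, j} \<in> D" "card {i, j} = 2" using that by (auto simp: D_def pairs_def)
      ultimately show ?thesis using ladj_iff[of i j z u] that by (simp add: \<theta>_def)
    qed
    have S: "S \<subseteq> ?E \<longleftrightarrow> W \<subseteq> kept \<rho> F u"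
      unfolding S_def image_subset_iff single by (simp only: subset_eq)
    show "(W \<subseteq> kept \<rho> F u \<and> reach (kept \<rho> F u) (ladj z u) r = W) = \<Theta> ?E"
    proof (cases "W \<subseteq> kept \<rho> F u")
      case True
      have C: "reach W (ladj z u) r = W \<longleftrightarrow> reach W (\<lambda>i j. {i, j} \<in> ?E) r = W"
      proof -
        have "reach W (ladj z u) r = reach W (\<lambda>i j. i \<noteq> j \<and> ladj z u i j) r" by (rule reach_cong) auto
        also have "\<dots> = reach W (\<lambda>i j. i \<noteq> j \<and> {i, j} \<in> ?E) r"
          using edge W by (intro reach_cong) blast
        also have "\<dots> = reach W (\<lambda>i j. {i, j} \<in> ?E) r"
        proof (rule antisym)
          show "reach W (\<lambda>i j. {i, j} \<in> ?E) r \<subseteq> reach W (\<lambda>i j. i \<noteq> j \<and> {i, j} \<in> ?E) r"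
          proof
            fix x assume "x \<in> reach W (\<lambda>i j. {i, j} \<in> ?E) r"
            then show "x \<in> reach W (\<lambda>i j. i \<noteq> j \<and> {i, j} \<in> ?E) r"
            proof (induction rule: reach_induct)
              case (step i j)
              then show ?case by (cases "i = j") (auto intro: reach_step)
            qed simp
          qed
        qed (rule reach_mono, auto)
        finally show ?thesis by simp
      qed
      have Bd: "(\<forall>j\<in>kept \<rho> F u - W. \<forall>w\<in>W. \<not> ladj z u w j) \<longleftrightarrow> (\<forall>j\<in>?J. \<not> ({j} \<in> ?E \<and> (\<exists>w\<in>W. {w, j} \<in> ?E)))"
      proof -
        have "ladj z u w j \<longleftrightarrow> {w, j} \<in> ?E" if "w \<in> W" "j \<in> F - W" for w j
          using edge[of w j] that W by auto
        moreover have "kept \<rho> F u \<subseteq> F" by (auto simp: kept_def)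
        ultimately show ?thesis unfolding single by blast
      qed
      show ?thesis unfolding \<Theta>_def reach_eq_iff[OF True W(2)] C Bd S using True by simp
    next
      case False
      then show ?thesis unfolding \<Theta>_def S by simp
    qed
  qed
  \<comment> \<open>Point \<open>j\<close> spoils the event iff it is retained and joined to
    \<open>W\<close>; these are independent, with probabilities \<open>\<rho> j\<close> and
    \<open>hit z W (z j)\<close>.\<close>
  have blk: "Ber (B j) \<theta> (?fB j) = 1 - \<rho> j * hit z W (z j)" if j: "j \<in> ?J" for j
  proof -
    let ?P = "(\<lambda>w. {w, j}) ` W"
    have d: "{{j}} \<inter> ?P = {}" using j by (auto simp: doubleton_eq_iff)
    have inj: "inj_on (\<lambda>w. {w, j}) W" by (auto simp: inj_on_def doubleton_eq_iff)
    have "Ber (B j) \<theta> (?fB j) = Ber ({{j}} \<union> ?P) \<theta> (\<lambda>E. 1 - of_bool ({{j}} \<subseteq> E \<inter> {{j}}) * (1 - of_bool (E \<inter> ?P = {})))"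
      by (intro Ber_cong) (auto simp: B_def)
    also have "\<dots> = 1 - Ber ({{j}} \<union> ?P) \<theta> (\<lambda>E. of_bool ({{j}} \<subseteq> E \<inter> {{j}}) * (1 - of_bool (E \<inter> ?P = {})))"
      using fW by (subst Ber_diff) (simp add: Ber_1)
    also have "Ber ({{j}} \<union> ?P) \<theta> (\<lambda>E. of_bool ({{j}} \<subseteq> E \<inter> {{j}}) * (1 - of_bool (E \<inter> ?P = {})))
       = Ber {{j}} \<theta> (\<lambda>E. of_bool ({{j}} \<subseteq> E)) * Ber ?P \<theta> (\<lambda>E. 1 - of_bool (E = {}))"
      using fW d by (intro Ber_split[where f="\<lambda>E. of_bool ({{j}} \<subseteq> E)" and g="\<lambda>E. 1 - of_bool (E = {})"]) auto
    also have "Ber {{j}} \<theta> (\<lambda>E. of_bool ({{j}} \<subseteq> E)) = \<rho> j"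
      by (subst Ber_all) (auto simp: \<theta>_def)
    also have "Ber ?P \<theta> (\<lambda>E. 1 - of_bool (E = {})) = 1 - (\<Prod>e\<in>?P. 1 - \<theta> e)"
      using fW by (subst Ber_diff) (simp add: Ber_1 Ber_none)
    also have "(\<Prod>e\<in>?P. 1 - \<theta> e) = (\<Prod>w\<in>W. 1 - \<phi> (z j - z w))"
    proof -
      have "\<theta> {w, j} = \<phi> (z j - z w)" if "w \<in> W" for w
      proof -
        have "card {w, j} = 2" using that j by (auto simp: card_insert_if)
        then show ?thesis using phi_sym[of "z j - z w"] by (simp add: \<theta>_def)
      qed
      then show ?thesis by (simp add: prod.reindex[OF inj])
    qed
    finally show ?thesis by (simp add: hit_def)
  qed
  \<comment> \<open>Edges between two points outside \<open>W\<close> occur in \<open>D\<close> but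
    do not influence the event; they are averaged out by \<open>Ber_restrict\<close>.\<close>
  have "Ber D \<theta> (\<lambda>E. of_bool (\<Theta> E)) = Ber D \<theta> (\<lambda>E. (\<lambda>E. ?fS (E \<inter> S) * ?fP (E \<inter> pairs W) * (\<Prod>j\<in>?J. ?fB j (E \<inter> B j))) (E \<inter> (S \<union> pairs W \<union> ?U)))"
  proof (rule Ber_cong)
    fix E
    have "?fB j (E \<inter> (S \<union> pairs W \<union> ?U) \<inter> B j) = ?fB j E" if "j \<in> ?J" for j
      using that by (auto simp: B_def)
    then have b: "(\<Prod>j\<in>?J. ?fB j (E \<inter> (S \<union> pairs W \<union> ?U) \<inter> B j)) = of_bool (\<forall>j\<in>?J. \<not> ({j} \<in> E \<and> (\<exists>w\<in>W. {w, j} \<in> E)))"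
      using F by (auto simp: of_bool_def prod_zero_iff intro!: prod.neutral)
    have c: "reach W (\<lambda>i j. {i, j} \<in> E \<inter> (S \<union> pairs W \<union> ?U) \<inter> pairs W) r = reach W (\<lambda>i j. {i, j} \<in> E) r"
    proof (rule antisym)
      show "reach W (\<lambda>i j. {i, j} \<in> E) r \<subseteq> reach W (\<lambda>i j. {i, j} \<in> E \<inter> (S \<union> pairs W \<union> ?U) \<inter> pairs W) r"
      proof
        fix x assume "x \<in> reach W (\<lambda>i j. {i, j} \<in> E) r"
        then show "x \<in> reach W (\<lambda>i j. {i, j} \<in> E \<inter> (S \<union> pairs W \<union> ?U) \<inter> pairs W) r"
        proof (induction rule: reach_induct)
          case (step i j)
          then show ?case by (cases "i = j") (auto intro!: reach_step[of i] simp: pairs_def)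
        qed simp
      qed
    qed (rule reach_mono, auto)
    have "E \<inter> (S \<union> pairs W \<union> ?U) \<inter> S = E \<inter> S" by auto
    then show "of_bool (\<Theta> E) = (\<lambda>E. ?fS (E \<inter> S) * ?fP (E \<inter> pairs W) * (\<Prod>j\<in>?J. ?fB j (E \<inter> B j))) (E \<inter> (S \<union> pairs W \<union> ?U))"
      unfolding b c \<Theta>_def by (auto simp: of_bool_def)
  qed auto
  also have "\<dots> = Ber (S \<union> pairs W \<union> ?U) \<theta> (\<lambda>E. ?fS (E \<inter> S) * ?fP (E \<inter> pairs W) * (\<Prod>j\<in>?J. ?fB j (E \<inter> B j)))"
    by (rule Ber_restrict) (use finD sub in auto)
  also have "\<dots> = Ber (S \<union> pairs W \<union> ?U) \<theta> (\<lambda>E. (\<lambda>E. ?fS (E \<inter> S) * ?fP (E \<inter> pairs W)) (E \<inter> (S \<union> pairs W)) * (\<lambda>E. \<Prod>j\<in>?J. ?fB j (E \<inter> B j)) (E \<inter> ?U))"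
  proof (rule Ber_cong, goal_cases)
    case (3 E)
    have "E \<inter> (S \<union> pairs W) \<inter> S = E \<inter> S" "E \<inter> (S \<union> pairs W) \<inter> pairs W = E \<inter> pairs W" by auto
    moreover have "(\<Prod>j\<in>?J. ?fB j (E \<inter> ?U \<inter> B j)) = (\<Prod>j\<in>?J. ?fB j (E \<inter> B j))"
    proof (rule prod.cong[OF refl])
      fix j assume "j \<in> ?J"
      then have "E \<inter> ?U \<inter> B j = E \<inter> B j" by auto
      then show "?fB j (E \<inter> ?U \<inter> B j) = ?fB j (E \<inter> B j)" by simp
    qed
    ultimately show ?case by simp
  qed auto
  also have "\<dots> = Ber (S \<union> pairs W) \<theta> (\<lambda>E. ?fS (E \<inter> S) * ?fP (E \<inter> pairs W)) * Ber ?U \<theta> (\<lambda>E. \<Prod>j\<in>?J. ?fB j (E \<inter> B j))"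
    using fin disj by (intro Ber_split) auto
  also have "Ber (S \<union> pairs W) \<theta> (\<lambda>E. ?fS (E \<inter> S) * ?fP (E \<inter> pairs W)) = Ber S \<theta> ?fS * Ber (pairs W) \<theta> ?fP"
    using fin disj by (intro Ber_split) auto
  also have "Ber S \<theta> ?fS = (\<Prod>i\<in>W. \<rho> i)"
    using fin by (subst Ber_all) (auto simp: S_def prod.reindex \<theta>_def)
  also have "Ber (pairs W) \<theta> ?fP = conn_prob r W z"
    unfolding conn_prob_def by (rule Ber_cong) (auto simp: \<theta>_def pairs_def)
  also have "Ber ?U \<theta> (\<lambda>E. \<Prod>j\<in>?J. ?fB j (E \<inter> B j)) = (\<Prod>j\<in>?J. Ber (B j) \<theta> (?fB j))"
    using F fin disj by (intro Ber_family) auto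
  also have "\<dots> = (\<Prod>j\<in>?J. 1 - \<rho> j * hit z W (z j))"
    by (intro prod.cong refl blk)
  finally show ?thesis
    unfolding Ev using Ber_uniform_marks(2)[OF finD m \<theta>01, where \<Theta>=\<Theta>] by simp
qed

end

section \<open>The law of a finite cluster\<close>

text \<open>Reachability is a union over path lengths, and each further step is an existential
  quantifier over a countable index type.\<close>

lemma pred_reach:
  fixes I :: "'k \<Rightarrow> 'i::countable set"
  assumes [measurable]: "\<And>i. Measurable.pred N (\<lambda>k. i \<in> I k)" "\<And>i j. Measurable.pred N (\<lambda>k. adj k i j)"
  shows "Measurable.pred N (\<lambda>k. x \<in> reach (I k) (adj k) r)"
proof -
  let ?R = "\<lambda>k i j. i \<in> I k \<and> j \<in> I k \<and> adj k i j"
  have "Measurable.pred N (\<lambda>k. ((?R k) ^^ n) r x)" for n x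
  proof (induction n arbitrary: x)
    case (Suc n)
    note Suc[measurable]
    show ?case by (simp add: relcompp_apply)
  qed simp
  then show ?thesis unfolding reach_def mem_Collect_eq rtranclp_power by measurable
qed

lemma pred_lex_less:
  fixes f g :: "'k \<Rightarrow> 'd::{finite,linorder} point"
  assumes [measurable]: "f \<in> borel_measurable N" "g \<in> borel_measurable N"
  shows "Measurable.pred N (\<lambda>k. lex_less (f k) (g k))"
proof -
  have [measurable]: "(\<lambda>k. f k $ i) \<in> borel_measurable N" "(\<lambda>k. g k $ i) \<in> borel_measurable N" for i
    using assms by (auto intro: measurable_compose[OF _ borel_measurable_nth])
  show ?thesis unfolding lex_less_def less_fun_def by measurable
qed

section \<open>Clusters as random sets of indices\<close>

context random_connection_model
begin

lemma phi_borel [measurable]: "\<phi> \<in> borel_measurable borel"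
  by (rule phi_measurable)

lemma pred_ladj:
  assumes [measurable]: "\<And>i. (\<lambda>k. z k i) \<in> borel_measurable N" "\<And>q. (\<lambda>k. u k q) \<in> borel_measurable N"
  shows "Measurable.pred N (\<lambda>k. ladj (z k) (u k) i j)"
proof -
  note pred_lex_less[measurable]
  show ?thesis unfolding ladj_def by measurable
qed

text \<open>The locale says nothing about \<open>X t\<close> at \<open>t = 0\<close>; the constant
  default keeps \<open>Xp t\<close> measurable there.\<close>

definition Xp :: "real \<Rightarrow> 'w \<Rightarrow> nat \<Rightarrow> 'd point" where
  "Xp t \<omega> j = (if 0 < t then X t j \<omega> else 0)"

definition marks :: "real \<Rightarrow> 'w \<Rightarrow> point_index \<times> point_index \<Rightarrow> real" where
  "marks t \<omega> q = U t q \<omega>"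

definition locs :: "real \<Rightarrow> (nat \<Rightarrow> 'd point) \<Rightarrow> 'w \<Rightarrow> point_index \<Rightarrow> 'd point" where
  "locs t y \<omega> = case_sum y (Xp t \<omega>)"

definition idx :: "real \<Rightarrow> nat set \<Rightarrow> point_index set" where
  "idx t A = Inl ` A \<union> Inr ` pts t"

definition keep_prob :: "real \<Rightarrow> point_index \<Rightarrow> real" where
  "keep_prob p = case_sum (\<lambda>_. 1) (\<lambda>_. p)"

text \<open>Cluster of the added point \<open>r\<close> as a set of indices, after each Poisson
  point has been retained independently with probability \<open>p\<close>. The case
  \<open>p = 1\<close> is the model itself, up to a null set of marks.\<close>

definition Cl :: "real \<Rightarrow> real \<Rightarrow> nat set \<Rightarrow> (nat \<Rightarrow> 'd point) \<Rightarrow> nat \<Rightarrow> 'w \<Rightarrow> point_index set" where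
  "Cl t p A y r \<omega> = reach (kept (keep_prob p) (idx t A) (marks t \<omega>)) (ladj (locs t y \<omega>) (marks t \<omega>)) (Inl r)"

lemma Xp_measurable [measurable]: "(\<lambda>\<omega>. Xp t \<omega> j) \<in> borel_measurable M"
  unfolding Xp_def by (cases "0 < t") auto

lemma marks_measurable: "0 \<le> t \<Longrightarrow> (\<lambda>\<omega>. marks t \<omega> q) \<in> borel_measurable M"
  using marks_indep[of t] unfolding marks_def indep_vars_def by blast

lemma locs_measurable [measurable]: "(\<lambda>\<omega>. locs t y \<omega> i) \<in> borel_measurable M"
  unfolding locs_def by (cases i) auto

lemma Xp_seq_measurable: "Xp t \<in> measurable M (PiM UNIV (\<lambda>_. borel))"
  by (rule measurable_PiM_single') (auto simp: space_PiM)

lemma marks_seq_measurable: "0 \<le> t \<Longrightarrow> marks t \<in> measurable M (PiM UNIV (\<lambda>_. borel))"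
  by (rule measurable_PiM_single') (auto simp: space_PiM marks_measurable)

lemma distr_marks:
  assumes t: "0 \<le> t"
  shows "distr M (PiM UNIV (\<lambda>_. borel)) (marks t) = uniform_marks"
proof -
  have m: "random_variable borel (U t q)" for q
    using marks_indep[OF t] unfolding indep_vars_def by blast
  have "distr M borel (U t q) = uniform_measure lborel {0..1}" for q
    using marks_uniform[OF t, of q] distr_cong[of M M borel lborel "U t q" "U t q"] by simp
  then have "distr M (PiM UNIV (\<lambda>_. borel)) (\<lambda>\<omega>. \<lambda>q\<in>UNIV. U t q \<omega>) = uniform_marks"
    using indep_vars_iff_distr_eq_PiM[where I=UNIV and M'="\<lambda>_. borel" and X="U t"] m marks_indep[OF t]
    by (simp add: uniform_marks_def)
  moreover have "(\<lambda>\<omega>. \<lambda>q\<in>UNIV. U t q \<omega>) = marks t" by (auto simp: marks_def fun_eq_iff)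
  ultimately show ?thesis by simp
qed

text \<open>By independence the joint law of points and marks is a product, so the marks can be
  averaged first with the points held fixed. At intensity zero the points are constant and only the
  law of the marks enters.\<close>

lemma points_marks_fubini:
  assumes t: "0 \<le> t" and G: "G \<in> borel_measurable (PiM UNIV (\<lambda>_. borel) \<Otimes>\<^sub>M PiM UNIV (\<lambda>_. borel))"
  shows "(\<integral>\<^sup>+\<omega>. G (Xp t \<omega>, marks t \<omega>) \<partial>M) = (\<integral>\<^sup>+\<omega>. (\<integral>\<^sup>+u. G (Xp t \<omega>, u) \<partial>uniform_marks) \<partial>M)"
proof -
  let ?A = "PiM UNIV (\<lambda>_. borel) :: (nat \<Rightarrow> 'd point) measure"
  let ?B = "PiM UNIV (\<lambda>_. borel) :: (point_index \<times> point_index \<Rightarrow> real) measure"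
  note m = Xp_seq_measurable[of t] marks_seq_measurable[OF t]
  interpret U: prob_space "uniform_marks :: (point_index \<times> point_index \<Rightarrow> real) measure"
    by (rule prob_space_uniform_marks)
  have G': "G \<in> borel_measurable (?A \<Otimes>\<^sub>M uniform_marks)"
    using G by (subst measurable_cong_sets[OF sets_pair_measure_cong[OF refl sets_uniform_marks] refl])
  show ?thesis
  proof (cases "0 < t")
    case True
    have Xe: "Xp t = (\<lambda>\<omega> j. X t j \<omega>)" using True by (auto simp: Xp_def fun_eq_iff)
    have Me: "marks t = (\<lambda>\<omega> p. U t p \<omega>)" by (auto simp: marks_def fun_eq_iff)
    have eq: "distr M ?A (Xp t) \<Otimes>\<^sub>M uniform_marks = distr M (?A \<Otimes>\<^sub>M ?B) (\<lambda>\<omega>. (Xp t \<omega>, marks t \<omega>))"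
      unfolding distr_marks[OF t, symmetric]
    proof (rule pair_measure_eqI)
      show "sigma_finite_measure (distr M ?A (Xp t))" "sigma_finite_measure (distr M ?B (marks t))"
        using m by (auto intro!: prob_space_imp_sigma_finite prob_space_distr)
      fix a b assume a: "a \<in> sets (distr M ?A (Xp t))" and b: "b \<in> sets (distr M ?B (marks t))"
      let ?a = "Xp t -` a \<inter> space M" and ?b = "marks t -` b \<inter> space M"
      have ab: "?a \<in> sets M" "?b \<in> sets M" using a b m by (auto intro: measurable_sets)
      have "prob (?a \<inter> ?b) = prob ?a * prob ?b"
      proof (rule indep_setD[OF marks_indep_points[OF True]])
        show "?a \<in> sets (vimage_algebra (space M) (\<lambda>\<omega> j. X t j \<omega>) ?A)"
          using a unfolding Xe by (intro in_vimage_algebra) simp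
        show "?b \<in> sets (vimage_algebra (space M) (\<lambda>\<omega> p. U t p \<omega>) ?B)"
          using b unfolding Me by (intro in_vimage_algebra) simp
      qed
      moreover have "(\<lambda>\<omega>. (Xp t \<omega>, marks t \<omega>)) -` (a \<times> b) \<inter> space M = ?a \<inter> ?b" by auto
      ultimately show "emeasure (distr M ?A (Xp t)) a * emeasure (distr M ?B (marks t)) b
          = emeasure (distr M (?A \<Otimes>\<^sub>M ?B) (\<lambda>\<omega>. (Xp t \<omega>, marks t \<omega>))) (a \<times> b)"
        using a b m ab by (simp add: emeasure_distr emeasure_eq_measure ennreal_mult)
    qed simp
    have G'': "G \<in> borel_measurable (distr M ?A (Xp t) \<Otimes>\<^sub>M uniform_marks)"
      using G' by (subst measurable_cong_sets[OF sets_pair_measure_cong[OF sets_distr refl] refl])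
    have "(\<integral>\<^sup>+\<omega>. G (Xp t \<omega>, marks t \<omega>) \<partial>M) = (\<integral>\<^sup>+z. G z \<partial>distr M (?A \<Otimes>\<^sub>M ?B) (\<lambda>\<omega>. (Xp t \<omega>, marks t \<omega>)))"
      by (rule nn_integral_distr[symmetric]) (use G m in auto)
    also have "\<dots> = (\<integral>\<^sup>+x. (\<integral>\<^sup>+u. G (x, u) \<partial>uniform_marks) \<partial>distr M ?A (Xp t))"
      unfolding eq[symmetric] by (rule U.nn_integral_fst[symmetric]) (rule G'')
    also have "\<dots> = (\<integral>\<^sup>+\<omega>. (\<integral>\<^sup>+u. G (Xp t \<omega>, u) \<partial>uniform_marks) \<partial>M)"
      by (rule nn_integral_distr[OF m(1)]) (simp add: U.borel_measurable_nn_integral_fst[OF G'])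
    finally show ?thesis .
  next
    case False
    then have Xe: "Xp t \<omega> = (\<lambda>_. 0)" for \<omega> by (auto simp: Xp_def fun_eq_iff)
    have "(\<integral>\<^sup>+\<omega>. G (Xp t \<omega>, marks t \<omega>) \<partial>M) = (\<integral>\<^sup>+u. G (\<lambda>_. 0, u) \<partial>distr M ?B (marks t))"
      unfolding Xe
      by (rule nn_integral_distr[symmetric, OF m(2)]) (auto intro!: measurable_compose[OF measurable_Pair1' G] simp: space_PiM)
    then show ?thesis unfolding distr_marks[OF t] Xe by (simp add: emeasure_space_1)
  qed
qed

text \<open>A singleton is a null set, so its count has a Poisson law with rate zero.\<close>

lemma AE_points_avoid:
  assumes t: "0 < t" shows "AE \<omega> in M. \<forall>j. X t j \<omega> \<noteq> a"
proof -
  have PE: "poisson_enumeration M t (X t)" using poisson[OF t] .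
  have B: "{a} \<in> sets borel" "emeasure lborel {a} < \<infinity>" "measure lborel {a} = 0"
    by (simp_all add: measure_def)
  have "\<P>(\<omega> in M. point_count (X t) {a} \<omega> = of_nat 0)
    = (t * measure lborel {a}) ^ 0 / fact 0 * exp (- (t * measure lborel {a}))"
    using PE B(1,2) unfolding poisson_enumeration_def by blast
  then have "\<P>(\<omega> in M. point_count (X t) {a} \<omega> = of_nat 0) = 1" unfolding B(3) by simp
  then have "AE \<omega> in M. point_count (X t) {a} \<omega> = 0"
    by (auto dest: AE_prob_1)
  then show ?thesis
  proof eventually_elim
    case (elim \<omega>)
    then have "{i. X t i \<omega> \<in> {a}} = {}" by (simp add: point_count_def emeasure_count_space_eq_0)
    then show ?case by auto
  qed
qed

lemma AE_inj_locs:
  assumes A: "finite A" "inj_on y A"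
  shows "AE \<omega> in M. inj_on (locs t y \<omega>) (idx t A)"
proof (cases "0 < t")
  case True
  have "AE \<omega> in M. inj (\<lambda>i. X t i \<omega>)" using poisson[OF True] by (simp add: poisson_enumeration_def)
  moreover have "AE \<omega> in M. \<forall>a\<in>A. \<forall>j. X t j \<omega> \<noteq> y a"
    using A by (intro AE_finite_allI AE_points_avoid True)
  ultimately show ?thesis
  proof eventually_elim
    case (elim \<omega>)
    then show ?case using A True by (force simp: inj_on_def locs_def idx_def Xp_def)
  qed
next
  case False
  then show ?thesis using A by (intro AE_I2) (auto simp: inj_on_def locs_def idx_def pts_def)
qed

text \<open>Standard index set of a cluster with added points \<open>K\<close> and \<open>k\<close>
  further points; the latter are coordinates of an integration variable and no longer members of the
  enumeration.\<close>

definition WW :: "nat set \<Rightarrow> nat \<Rightarrow> point_index set" where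
  "WW K k = Inl ` K \<union> Inr ` {..<k}"

text \<open>The first conjunct excludes the degenerate case in which the root itself fails to be
  retained.\<close>

definition Cl_event :: "real \<Rightarrow> real \<Rightarrow> nat set \<Rightarrow> (nat \<Rightarrow> 'd point) \<Rightarrow> nat \<Rightarrow> point_index set \<Rightarrow> 'w set" where
  "Cl_event t p A y r W = {\<omega>\<in>space M. W \<subseteq> kept (keep_prob p) (idx t A) (marks t \<omega>) \<and> Cl t p A y r \<omega> = W}"

lemma pred_kept: "(\<lambda>k. u k (i, i)) \<in> borel_measurable N \<Longrightarrow> Measurable.pred N (\<lambda>k. i \<in> kept \<rho> I (u k))"
  unfolding kept_def by simp

lemma pred_cluster_eq:
  assumes z: "\<And>i. (\<lambda>k. z k i) \<in> borel_measurable N" and u: "\<And>q. (\<lambda>k. u k q) \<in> borel_measurable N"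
  shows "Measurable.pred N (\<lambda>k. W \<subseteq> kept \<rho> (I :: point_index set) (u k) \<and> reach (kept \<rho> I (u k)) (ladj (z k) (u k)) r = W)"
proof -
  note [measurable] = pred_kept[OF u] pred_reach pred_ladj[OF z u]
  have "(W \<subseteq> kept \<rho> I (u k) \<and> reach (kept \<rho> I (u k)) (ladj (z k) (u k)) r = W)
    \<longleftrightarrow> (\<forall>i. i \<in> W \<longrightarrow> i \<in> kept \<rho> I (u k)) \<and> (\<forall>i. i \<in> reach (kept \<rho> I (u k)) (ladj (z k) (u k)) r \<longleftrightarrow> i \<in> W)" for k
    by auto
  then show ?thesis by simp
qed

lemma Cl_event_measurable: "0 \<le> t \<Longrightarrow> Cl_event t p A y r W \<in> sets M"
  using pred_cluster_eq[of "locs t y" M "marks t" W "keep_prob p" "idx t A" "Inl r"] marks_measurable[of t]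
  unfolding Cl_event_def Cl_def by simp


lemma finite_WW [simp]: "finite K \<Longrightarrow> finite (WW K k)"
  by (simp add: WW_def)

text \<open>With the points fixed, \<open>finite_cluster_prob\<close> gives the probability for the
  finitely many Poisson points of index below \<open>N\<close>. Admitting more points only adds
  conditions, so these events decrease to the event for the whole process, and the probabilities
  follow by continuity from above.\<close>

lemma cluster_prob_index:
  assumes t: "0 \<le> t" and p: "0 \<le> p" "p \<le> 1" and A: "finite A" "inj_on y A"
    and K: "K \<subseteq> A" "r \<in> K" and J: "finite J" "J \<subseteq> pts t"
  defines "W \<equiv> Inl ` K \<union> Inr ` J"
  shows "emeasure M (Cl_event t p A y r W)
    = (\<integral>\<^sup>+\<omega>. ennreal (p ^ card J * conn_prob (Inl r) W (locs t y \<omega>) * (\<Prod>a\<in>A - K. 1 - hit (locs t y \<omega>) W (y a)))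
        * (INF N. ennreal (\<Prod>i\<in>(pts t - J) \<inter> {..<N}. 1 - p * hit (locs t y \<omega>) W (Xp t \<omega> i))) \<partial>M)"
proof -
  let ?\<rho> = "keep_prob p" and ?A = "PiM UNIV (\<lambda>_. borel) :: (nat \<Rightarrow> 'd point) measure"
  let ?B = "PiM UNIV (\<lambda>_. borel) :: (point_index \<times> point_index \<Rightarrow> real) measure"
  let ?ev = "\<lambda>I z u. W \<subseteq> kept ?\<rho> I u \<and> reach (kept ?\<rho> I u) (ladj z u) (Inl r) = W"
  let ?P = "\<lambda>x u. ?ev (idx t A) (case_sum y x) u"
  have W: "finite W" "Inl r \<in> W" "W \<subseteq> idx t A"
    using A K J by (auto simp: W_def idx_def intro: finite_subset)
  have pred: "Measurable.pred (?A \<Otimes>\<^sub>M ?B) (\<lambda>k. ?P (fst k) (snd k))"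
  proof (rule pred_cluster_eq)
    fix i show "(\<lambda>k. case_sum y (fst k) i) \<in> borel_measurable (?A \<Otimes>\<^sub>M ?B)"
      by (cases i) auto
  qed simp
  have sec: "{u. ?ev I z u} \<in> sets uniform_marks" for I z
    using pred_cluster_eq[of "\<lambda>_. z" uniform_marks "\<lambda>u. u" W ?\<rho> I "Inl r"]
    by (simp add: pred_def del: sets_uniform_marks)
  have "emeasure M (Cl_event t p A y r W) = (\<integral>\<^sup>+\<omega>. indicator (Cl_event t p A y r W) \<omega> \<partial>M)"
    using Cl_event_measurable[OF t] by simp
  also have "\<dots> = (\<integral>\<^sup>+\<omega>. (\<lambda>k. of_bool (?P (fst k) (snd k))) (Xp t \<omega>, marks t \<omega>) \<partial>M)"
    by (intro nn_integral_cong) (auto simp: Cl_event_def Cl_def locs_def indicator_def of_bool_def)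
  also have "\<dots> = (\<integral>\<^sup>+\<omega>. (\<integral>\<^sup>+u. (\<lambda>k. of_bool (?P (fst k) (snd k))) (Xp t \<omega>, u) \<partial>uniform_marks) \<partial>M)"
    by (rule points_marks_fubini[OF t]) (use pred in \<open>simp add: of_bool_def\<close>)
  also have "\<dots> = (\<integral>\<^sup>+\<omega>. emeasure uniform_marks {u. ?ev (idx t A) (locs t y \<omega>) u} \<partial>M)"
  proof (intro nn_integral_cong)
    fix \<omega>
    have "(\<integral>\<^sup>+u. (\<lambda>k. of_bool (?P (fst k) (snd k))) (Xp t \<omega>, u) \<partial>uniform_marks)
      = (\<integral>\<^sup>+u. indicator {u. ?ev (idx t A) (locs t y \<omega>) u} u \<partial>uniform_marks)"
      by (intro nn_integral_cong) (auto simp: locs_def indicator_def of_bool_def)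
    then show "(\<integral>\<^sup>+u. (\<lambda>k. of_bool (?P (fst k) (snd k))) (Xp t \<omega>, u) \<partial>uniform_marks)
      = emeasure uniform_marks {u. ?ev (idx t A) (locs t y \<omega>) u}"
      using sec by simp
  qed
  also have "\<dots> = (\<integral>\<^sup>+\<omega>. ennreal (p ^ card J * conn_prob (Inl r) W (locs t y \<omega>) * (\<Prod>a\<in>A - K. 1 - hit (locs t y \<omega>) W (y a)))
        * (INF N. ennreal (\<Prod>i\<in>(pts t - J) \<inter> {..<N}. 1 - p * hit (locs t y \<omega>) W (Xp t \<omega> i))) \<partial>M)"
  proof (intro nn_integral_cong_AE, use AE_inj_locs[OF A, of t] in eventually_elim)
    case (elim \<omega>)
    let ?z = "locs t y \<omega>"
    define F where "F N = Inl ` A \<union> Inr ` (pts t \<inter> {..<N})" for N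
    \<comment> \<open>Only index bounds beyond \<open>N0\<close> are considered, so that
      \<open>W\<close> is contained in every finite index set that occurs.\<close>
    obtain N0 where N0: "J \<subseteq> {..<N0}" using J(1) finite_nat_iff_bounded by blast
    let ?c = "p ^ card J * conn_prob (Inl r) W ?z * (\<Prod>a\<in>A - K. 1 - hit ?z W (y a))"
    let ?d = "\<lambda>N. \<Prod>i\<in>(pts t - J) \<inter> {..<N}. 1 - p * hit ?z W (Xp t \<omega> i)"
    let ?S = "\<lambda>n. {u. ?ev (F (N0 + n)) ?z u}"
    have Fsub: "F N \<subseteq> idx t A" for N by (auto simp: F_def idx_def)
    have WF: "W \<subseteq> F (N0 + n)" for n
    proof -
      have "J \<subseteq> pts t \<inter> {..<N0 + n}" using J N0 by (fastforce dest: subsetD)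
      then show ?thesis unfolding W_def F_def using K by blast
    qed
    have ph: "0 \<le> p * hit ?z W v" "p * hit ?z W v \<le> 1" for v
      using p hit_bounds[of ?z W v] by (auto intro: mult_le_one)
    have c0: "0 \<le> ?c"
      using p conn_prob_bounds[OF W(1)] hit_bounds by (intro mult_nonneg_nonneg prod_nonneg) auto
    have em: "emeasure uniform_marks (?S n) = ennreal ?c * ennreal (?d (N0 + n))" for n
    proof -
      have FW: "F (N0 + n) - W = Inl ` (A - K) \<union> Inr ` ((pts t - J) \<inter> {..<N0 + n})"
        by (auto simp: F_def W_def)
      have "emeasure uniform_marks (?S n)
        = ennreal ((\<Prod>i\<in>W. ?\<rho> i) * conn_prob (Inl r) W ?z * (\<Prod>j\<in>F (N0 + n) - W. 1 - ?\<rho> j * hit ?z W (?z j)))"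
        using A WF W p by (intro finite_cluster_prob inj_on_subset[OF elim Fsub])
          (auto simp: F_def keep_prob_def split: sum.split)
      also have "(\<Prod>i\<in>W. ?\<rho> i) = p ^ card J"
        unfolding W_def using J finite_subset[OF K(1) A(1)]
        by (subst prod.union_disjoint) (auto simp: prod.reindex keep_prob_def)
      also have "(\<Prod>j\<in>F (N0 + n) - W. 1 - ?\<rho> j * hit ?z W (?z j))
         = (\<Prod>a\<in>A - K. 1 - hit ?z W (y a)) * ?d (N0 + n)"
        unfolding FW using A
        by (subst prod.union_disjoint) (auto simp: prod.reindex keep_prob_def locs_def)
      also have "p ^ card J * conn_prob (Inl r) W ?z * ((\<Prod>a\<in>A - K. 1 - hit ?z W (y a)) * ?d (N0 + n)) = ?c * ?d (N0 + n)"
        by (simp only: mult.assoc)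
      also have "ennreal (?c * ?d (N0 + n)) = ennreal ?c * ennreal (?d (N0 + n))"
        using ph by (intro ennreal_mult c0 prod_nonneg) auto
      finally show ?thesis .
    qed
    \<comment> \<open>Apart from \<open>W \<subseteq> I\<close>, the index set enters only through
      conditions on single points outside \<open>W\<close>. This gives both the monotonicity in
      \<open>I\<close> and the passage to the limit.\<close>
    have ev_iff: "?ev I ?z u \<longleftrightarrow> W \<subseteq> I \<and> W \<subseteq> kept ?\<rho> W u \<and> reach W (ladj ?z u) (Inl r) = W
        \<and> (\<forall>j\<in>I - W. u (j, j) \<le> ?\<rho> j \<longrightarrow> (\<forall>w\<in>W. \<not> ladj ?z u w j))" for I u
    proof (cases "W \<subseteq> kept ?\<rho> I u")
      case True
      then have "W \<subseteq> I" "W \<subseteq> kept ?\<rho> W u" by (auto simp: kept_def)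
      moreover have "(\<forall>j\<in>kept ?\<rho> I u - W. \<forall>w\<in>W. \<not> ladj ?z u w j)
        \<longleftrightarrow> (\<forall>j\<in>I - W. u (j, j) \<le> ?\<rho> j \<longrightarrow> (\<forall>w\<in>W. \<not> ladj ?z u w j))"
        by (auto simp: kept_def)
      ultimately show ?thesis
        unfolding reach_eq_iff[OF True W(2), of "ladj ?z u"] using True by blast
    next
      case False
      then have "\<not> (W \<subseteq> I \<and> W \<subseteq> kept ?\<rho> W u)" by (auto simp: kept_def)
      then show ?thesis using False by blast
    qed
    have dec: "decseq ?S"
    proof (rule decseq_SucI, rule Collect_mono)
      fix n u
      have "F (N0 + n) \<subseteq> F (N0 + Suc n)" by (auto simp: F_def)
      then show "?ev (F (N0 + Suc n)) ?z u \<longrightarrow> ?ev (F (N0 + n)) ?z u"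
        unfolding ev_iff using WF[of n] by blast
    qed
    have Int: "{u. ?ev (idx t A) ?z u} = (\<Inter>n. ?S n)"
    proof (intro equalityI subsetI)
      fix u assume "u \<in> {u. ?ev (idx t A) ?z u}"
      then have u: "?ev (idx t A) ?z u" by simp
      have "?ev (F (N0 + n)) ?z u" for n
        using u WF[of n] Fsub[of "N0 + n"] unfolding ev_iff by blast
      then show "u \<in> (\<Inter>n. ?S n)" by simp
    next
      fix u assume u: "u \<in> (\<Inter>n. ?S n)"
      have ex: "\<exists>n. j \<in> F (N0 + n)" if "j \<in> idx t A" for j
      proof (cases j)
        case (Inr i)
        then show ?thesis using that by (intro exI[of _ "Suc i"]) (auto simp: F_def idx_def)
      qed (use that in \<open>auto simp: F_def idx_def\<close>)
      have "?ev (F (N0 + n)) ?z u" for n using u by simp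
      with ex have "?ev (idx t A) ?z u" using W(3) unfolding ev_iff by blast
      then show "u \<in> {u. ?ev (idx t A) ?z u}" by simp
    qed
    interpret U: prob_space "uniform_marks :: (point_index \<times> point_index \<Rightarrow> real) measure"
      by (rule prob_space_uniform_marks)
    have "(\<lambda>n. emeasure uniform_marks (?S n)) \<longlonglongrightarrow> emeasure uniform_marks (\<Inter>n. ?S n)"
      using sec dec by (intro Lim_emeasure_decseq) auto
    moreover have "(\<lambda>n. emeasure uniform_marks (?S n)) \<longlonglongrightarrow> ennreal ?c * (INF N. ennreal (?d N))"
    proof -
      have "decseq (\<lambda>N. ennreal (?d N))"
      proof (rule decseq_SucI, rule ennreal_leI)
        fix N
        have e: "(pts t - J) \<inter> {..<Suc N} = (if N \<in> pts t - J then insert N ((pts t - J) \<inter> {..<N}) else (pts t - J) \<inter> {..<N})"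
          by (auto simp: less_Suc_eq)
        have "?d (Suc N) = (if N \<in> pts t - J then 1 - p * hit ?z W (Xp t \<omega> N) else 1) * ?d N"
          unfolding e by simp
        also have "\<dots> \<le> ?d N"
          using ph by (intro mult_left_le_one_le prod_nonneg) auto
        finally show "?d (Suc N) \<le> ?d N" .
      qed
      then have "(\<lambda>N. ennreal (?d N)) \<longlonglongrightarrow> (INF N. ennreal (?d N))" by (rule LIMSEQ_INF)
      then have "(\<lambda>n. ennreal (?d (N0 + n))) \<longlonglongrightarrow> (INF N. ennreal (?d N))"
        by (subst add.commute) (rule LIMSEQ_ignore_initial_segment)
      then show ?thesis unfolding em by (intro ennreal_tendsto_cmult) auto
    qed
    ultimately show ?case unfolding Int by (rule LIMSEQ_unique)
  qed
  finally show ?thesis .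
qed


section \<open>Expected volume of the neighbourhood of a cluster\<close>

definition m\<phi> :: real where "m\<phi> = (LINT x|lborel. \<phi> x)"

lemma m\<phi>_pos: "0 < m\<phi>"
  unfolding m\<phi>_def by (rule phi_integral_pos)

lemma nn_integral_phi_shift: "(\<integral>\<^sup>+x. ennreal (\<phi> (x - c)) \<partial>lborel) = ennreal m\<phi>"
proof -
  have "(\<integral>\<^sup>+x. ennreal (\<phi> (x - c)) \<partial>lborel) = (\<integral>\<^sup>+x. ennreal (\<phi> (x - c)) \<partial>distr lborel borel ((+) c))"
    by (simp add: lborel_distr_plus)
  also have "\<dots> = (\<integral>\<^sup>+x. ennreal (\<phi> x) \<partial>lborel)"
    by (subst nn_integral_distr) auto
  also have "\<dots> = ennreal m\<phi>"
    unfolding m\<phi>_def using phi_integrable phi_range by (intro nn_integral_eq_integral) auto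
  finally show ?thesis .
qed

text \<open>A union bound, peeled off one point at a time; it is the source of the linear bound on
  \<open>V\<close>.\<close>

lemma hit_le_sum: "finite W \<Longrightarrow> hit z W y \<le> (\<Sum>w\<in>W. \<phi> (y - z w))"
proof (induction W rule: finite_induct)
  case (insert a W)
  have "hit z (insert a W) y = \<phi> (y - z a) * (\<Prod>w\<in>W. 1 - \<phi> (y - z w)) + hit z W y"
    using insert by (simp add: hit_def algebra_simps)
  also have "\<phi> (y - z a) * (\<Prod>w\<in>W. 1 - \<phi> (y - z w)) \<le> \<phi> (y - z a)"
    using phi_range by (intro mult_left_le prod_le_1) auto
  finally show ?case using insert by simp
qed (simp add: hit_def)

definition V :: "('i \<Rightarrow> 'd point) \<Rightarrow> 'i set \<Rightarrow> real" where
  "V z W = enn2real (\<integral>\<^sup>+x. ennreal (hit z W x) \<partial>lborel)"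

lemma hit_measurable:
  assumes "\<And>w. w \<in> W \<Longrightarrow> (\<lambda>k. z k w) \<in> borel_measurable N" "y \<in> borel_measurable N"
  shows "(\<lambda>k. hit (z k) W (y k)) \<in> borel_measurable N"
  unfolding hit_def using assms
  by (intro borel_measurable_diff borel_measurable_prod borel_measurable_const measurable_compose[OF _ phi_borel]) auto

lemma V_bounds:
  assumes W: "finite W"
  shows "(\<integral>\<^sup>+x. ennreal (hit z W x) \<partial>lborel) = ennreal (V z W)" "0 \<le> V z W" "V z W \<le> real (card W) * m\<phi>"
proof -
  have "(\<integral>\<^sup>+x. ennreal (hit z W x) \<partial>lborel) \<le> (\<integral>\<^sup>+x. (\<Sum>w\<in>W. ennreal (\<phi> (x - z w))) \<partial>lborel)"
    using phi_range by (intro nn_integral_mono) (simp add: sum_ennreal ennreal_leI hit_le_sum W)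
  also have "\<dots> = (\<Sum>w\<in>W. ennreal m\<phi>)"
    by (subst nn_integral_sum) (auto simp: nn_integral_phi_shift)
  also have "\<dots> = ennreal (real (card W) * m\<phi>)"
    using m\<phi>_pos by (simp add: ennreal_mult ennreal_of_nat_eq_real_of_nat)
  finally have le: "(\<integral>\<^sup>+x. ennreal (hit z W x) \<partial>lborel) \<le> ennreal (real (card W) * m\<phi>)" .
  then show eq: "(\<integral>\<^sup>+x. ennreal (hit z W x) \<partial>lborel) = ennreal (V z W)"
    unfolding V_def by (subst ennreal_enn2real) (auto intro: le_less_trans)
  show "0 \<le> V z W" by (simp add: V_def)
  show "V z W \<le> real (card W) * m\<phi>"
    using le m\<phi>_pos unfolding eq by (simp add: ennreal_le_iff)
qed

lemma V_relabel: "inj_on f W \<Longrightarrow> (\<And>i. i \<in> W \<Longrightarrow> z' i = z (f i)) \<Longrightarrow> V z' W = V z (f ` W)"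
  unfolding V_def using hit_relabel[of f W z' z] by simp

lemma V_measurable:
  assumes "\<And>w. w \<in> W \<Longrightarrow> (\<lambda>k. z k w) \<in> borel_measurable N"
  shows "(\<lambda>k. V (z k) W) \<in> borel_measurable N"
proof -
  have "(\<lambda>p. hit (z (fst p)) W (snd p)) \<in> borel_measurable (N \<Otimes>\<^sub>M lborel)"
    using assms by (intro hit_measurable measurable_compose[OF measurable_fst]) auto
  then show ?thesis
    unfolding V_def by (intro borel_measurable_enn2real lborel.borel_measurable_nn_integral) (simp add: case_prod_beta)
qed

lemma conn_prob_measurable:
  assumes "finite W" "\<And>w. w \<in> W \<Longrightarrow> (\<lambda>k. z k w) \<in> borel_measurable N"
  shows "(\<lambda>k. conn_prob r W (z k)) \<in> borel_measurable N"
proof -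
  have "(\<lambda>k. edge_prob (z k) e) \<in> borel_measurable N" if "e \<in> pairs W" for e
  proof -
    obtain i j where "e = {i, j}" "i \<in> W" "j \<in> W" using \<open>e \<in> pairs W\<close> by (auto simp: pairs_def card_2_iff)
    then show ?thesis using assms(2) by (simp add: measurable_compose[OF borel_measurable_diff phi_borel])
  qed
  then show ?thesis
    unfolding conn_prob_def Ber_def
    by (intro borel_measurable_sum borel_measurable_times borel_measurable_const borel_measurable_prod borel_measurable_diff) auto
qed

lemma case_sum_measurable:
  "i \<in> WW K k \<Longrightarrow> (\<lambda>w. case_sum y w i) \<in> borel_measurable (PiM {..<k} (\<lambda>_. lborel))"
  by (auto simp: WW_def intro: measurable_component_singleton[THEN measurable_compose])

text \<open>Up to the factor \<open>\<tau> ^ k / fact k\<close>, the density of the cluster at its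
  \<open>k\<close> Poisson points: they are connected to each other and to the added points of
  \<open>K\<close>, the added points outside \<open>K\<close> are missed, and the exponential is the
  probability that a process of intensity \<open>\<tau>\<close> has no further point joined to the
  cluster.\<close>

definition Phi :: "nat \<Rightarrow> nat set \<Rightarrow> nat set \<Rightarrow> (nat \<Rightarrow> 'd point) \<Rightarrow> real \<Rightarrow> nat \<Rightarrow> (nat \<Rightarrow> 'd point) \<Rightarrow> real" where
  "Phi r K A y \<tau> k w = conn_prob (Inl r) (WW K k) (case_sum y w)
     * (\<Prod>a\<in>A - K. 1 - hit (case_sum y w) (WW K k) (y a)) * exp (- (\<tau> * V (case_sum y w) (WW K k)))"

text \<open>Summing over index sets of size \<open>k\<close> removes the dependence on the
  enumeration: \<open>void_probability\<close> evaluates the sum over orderings, a point being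
  selected when it is retained and joined to the cluster. The powers of \<open>p\<close> and
  \<open>t\<close> combine, so the result depends on \<open>p * t\<close> only.\<close>

lemma cluster_law:
  assumes t: "0 \<le> t" and p: "0 \<le> p" "p \<le> 1" and A: "finite A" "inj_on y A" and K: "K \<subseteq> A" "r \<in> K"
  shows "(\<integral>\<^sup>+J. emeasure M (Cl_event t p A y r (Inl ` K \<union> Inr ` J)) \<partial>count_space {J. J \<subseteq> pts t \<and> finite J \<and> card J = k})
    = ennreal ((p * t) ^ k / fact k) * (\<integral>\<^sup>+w. ennreal (Phi r K A y (p * t) k w) \<partial>PiM {..<k} (\<lambda>_. lborel))"
proof -
  let ?Q = "PiM {..<k} (\<lambda>_. lborel) :: (nat \<Rightarrow> 'd point) measure"
  let ?z = "\<lambda>w. case_sum y w" and ?W = "WW K k"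
  have fK: "finite K" using A K finite_subset by auto
  have fW: "finite ?W" using fK by simp
  have rW: "Inl r \<in> ?W" using K by (auto simp: WW_def)
  let ?g = "\<lambda>w. p ^ k * conn_prob (Inl r) ?W (?z w) * (\<Prod>a\<in>A - K. 1 - hit (?z w) ?W (y a))"
  let ?a = "\<lambda>x w. p * hit (?z w) ?W x"
  let ?v = "\<lambda>w. p * V (?z w) ?W"
  note zm = case_sum_measurable[of _ K k y]
  have gm: "?g \<in> borel_measurable ?Q"
    by (intro borel_measurable_times borel_measurable_const borel_measurable_prod borel_measurable_diff
        conn_prob_measurable hit_measurable zm fW)
  have pk: "0 \<le> p ^ k" "p ^ k \<le> 1" using p by (auto intro: power_le_one)
  have g01: "0 \<le> ?g w" "?g w \<le> 1" for w
    using pk conn_prob_bounds[OF fW, of "Inl r" "?z w"] hit_bounds[of "?z w" ?W]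
    by (auto intro!: mult_nonneg_nonneg prod_nonneg mult_le_one prod_le_1)
  have am: "(\<lambda>q. ?a (fst q) (snd q)) \<in> borel_measurable (lborel \<Otimes>\<^sub>M ?Q)"
    by (intro borel_measurable_times borel_measurable_const hit_measurable measurable_compose[OF measurable_snd] zm) auto
  have a01: "0 \<le> ?a x w" "?a x w \<le> 1" for x w
    using p hit_bounds[of "?z w" ?W x] by (auto intro: mult_le_one)
  have v: "(\<integral>\<^sup>+x. ennreal (?a x w) \<partial>lborel) = ennreal (?v w)" if "w \<in> space ?Q" for w
  proof -
    have "(\<integral>\<^sup>+x. ennreal (?a x w) \<partial>lborel) = (\<integral>\<^sup>+x. ennreal p * ennreal (hit (?z w) ?W x) \<partial>lborel)"
      by (intro nn_integral_cong ennreal_mult p hit_bounds)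
    also have "\<dots> = ennreal p * ennreal (V (?z w) ?W)"
      by (subst nn_integral_cmult) (auto intro!: hit_measurable measurable_compose[OF _ measurable_ennreal] simp: V_bounds[OF fW])
    also have "\<dots> = ennreal (?v w)" using p V_bounds[OF fW] by (simp add: ennreal_mult)
    finally show ?thesis .
  qed
  have v0: "0 \<le> ?v w" for w using p V_bounds[OF fW] by simp
  have vC: "?v w \<le> real (card ?W) * m\<phi>" for w
    using p V_bounds(2,3)[OF fW, of "?z w"] mult_right_mono[of p 1 "V (?z w) ?W"] by simp
  have vm: "?v \<in> borel_measurable ?Q"
    by (intro borel_measurable_times borel_measurable_const V_measurable zm)
  let ?I = "\<lambda>j \<omega>. (INF N. ennreal (\<Prod>i\<in>(pts t - j ` {..<k}) \<inter> {..<N}. 1 - ?a (X t i \<omega>) (loc t k j \<omega>)))"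
  \<comment> \<open>\<open>map_sum id j\<close> sends coordinate \<open>i\<close> to index
    \<open>j i\<close>, so connectivity and hit probabilities become functions of the tuple of
    locations.\<close>
  have ev: "emeasure M (Cl_event t p A y r (Inl ` K \<union> Inr ` (j ` {..<k})))
     = (\<integral>\<^sup>+\<omega>. ennreal (?g (loc t k j \<omega>)) * ?I j \<omega> \<partial>M)" if j: "j \<in> injs k (pts t)" for j
  proof -
    let ?f = "map_sum id j"
    let ?W' = "Inl ` K \<union> Inr ` (j ` {..<k})"
    have ij: "inj_on j {..<k}" "j ` {..<k} \<subseteq> pts t" using j by (auto simp: injs_def)
    have f: "inj_on ?f ?W" "?f ` ?W = ?W'" "?f (Inl r) = Inl r"
      using ij by (auto simp: WW_def inj_on_def image_Un image_image)
    have z: "?z (loc t k j \<omega>) i = locs t y \<omega> (?f i)" if "i \<in> ?W" for i \<omega>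
      using that ij(2) by (auto simp: WW_def locs_def loc_def Xp_def pts_def split: if_splits)
    have c: "conn_prob (Inl r) ?W' (locs t y \<omega>) = conn_prob (Inl r) ?W (?z (loc t k j \<omega>))" for \<omega>
      using conn_prob_relabel[where z'="?z (loc t k j \<omega>)" and z="locs t y \<omega>", OF f(1) rW z] f by simp
    have h: "hit (locs t y \<omega>) ?W' x = hit (?z (loc t k j \<omega>)) ?W x" for \<omega> x
      using hit_relabel[where z'="?z (loc t k j \<omega>)" and z="locs t y \<omega>", OF f(1) z] f by simp
    have card: "card (j ` {..<k}) = k" using ij by (simp add: card_image)
    have Xp: "(\<Prod>i\<in>(pts t - j ` {..<k}) \<inter> {..<N}. 1 - p * hit (?z (loc t k j \<omega>)) ?W (Xp t \<omega> i))
       = (\<Prod>i\<in>(pts t - j ` {..<k}) \<inter> {..<N}. 1 - ?a (X t i \<omega>) (loc t k j \<omega>))" for N \<omega>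
      by (intro prod.cong refl) (auto simp: Xp_def pts_def split: if_splits)
    show ?thesis
      using cluster_prob_index[OF t p A K finite_imageI[OF finite_lessThan] ij(2)]
      unfolding c h card Xp .
  qed
  have "of_nat (fact k) * (\<integral>\<^sup>+J. emeasure M (Cl_event t p A y r (Inl ` K \<union> Inr ` J)) \<partial>count_space {J. J \<subseteq> pts t \<and> finite J \<and> card J = k})
     = (\<integral>\<^sup>+j. emeasure M (Cl_event t p A y r (Inl ` K \<union> Inr ` (j ` {..<k}))) \<partial>count_space (injs k (pts t)))"
    by (rule nn_integral_injs_image[symmetric])
  also have "\<dots> = (\<integral>\<^sup>+j. (\<integral>\<^sup>+\<omega>. ennreal (?g (loc t k j \<omega>)) * ?I j \<omega> \<partial>M) \<partial>count_space (injs k (pts t)))"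
    by (intro nn_integral_cong ev) simp
  also have "\<dots> = ennreal (t ^ k) * (\<integral>\<^sup>+w. ennreal (?g w) * ennreal (exp (- (t * ?v w))) \<partial>?Q)"
    by (rule void_probability[where f="\<lambda>w. ennreal (?g w)" and a="?a" and v="?v", OF t _ am a01 v v0 vC vm])
       (use gm g01 in auto)
  also have "\<dots> = ennreal (t ^ k) * (\<integral>\<^sup>+w. ennreal (p ^ k) * ennreal (Phi r K A y (p * t) k w) \<partial>?Q)"
  proof (rule arg_cong2[where f="(*)", OF refl], rule nn_integral_cong)
    fix w
    have "?g w * exp (- (t * ?v w)) = p ^ k * Phi r K A y (p * t) k w"
      by (simp add: Phi_def mult_ac)
    moreover have "ennreal (?g w) * ennreal (exp (- (t * ?v w))) = ennreal (?g w * exp (- (t * ?v w)))"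
      by (rule ennreal_mult[symmetric]) (use g01 in auto)
    moreover have "ennreal (p ^ k * Phi r K A y (p * t) k w) = ennreal (p ^ k) * ennreal (Phi r K A y (p * t) k w)"
      using pk conn_prob_bounds[OF fW] hit_bounds unfolding Phi_def
      by (intro ennreal_mult mult_nonneg_nonneg prod_nonneg) auto
    ultimately show "ennreal (?g w) * ennreal (exp (- (t * ?v w))) = ennreal (p ^ k) * ennreal (Phi r K A y (p * t) k w)"
      by (simp only:)
  qed
  also have "\<dots> = ennreal (t ^ k) * (ennreal (p ^ k) * (\<integral>\<^sup>+w. ennreal (Phi r K A y (p * t) k w) \<partial>?Q))"
    unfolding Phi_def
    by (subst nn_integral_cmult)
       (auto intro!: measurable_compose[OF _ measurable_ennreal] borel_measurable_times borel_measurable_const borel_measurable_prod borel_measurable_diff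
        conn_prob_measurable hit_measurable V_measurable measurable_compose[OF _ borel_measurable_exp] borel_measurable_uminus zm fW)
  also have "\<dots> = ennreal ((p * t) ^ k) * (\<integral>\<^sup>+w. ennreal (Phi r K A y (p * t) k w) \<partial>?Q)"
    using t p by (simp add: power_mult_distrib ennreal_mult mult_ac)
  finally have eq: "of_nat (fact k) * (\<integral>\<^sup>+J. emeasure M (Cl_event t p A y r (Inl ` K \<union> Inr ` J)) \<partial>count_space {J. J \<subseteq> pts t \<and> finite J \<and> card J = k})
     = ennreal ((p * t) ^ k) * (\<integral>\<^sup>+w. ennreal (Phi r K A y (p * t) k w) \<partial>?Q)" (is "_ * ?L = _ * ?R") .
  have cc: "ennreal (1 / fact k) * of_nat (fact k) = 1"
  proof -
    have "ennreal (1 / fact k) * of_nat (fact k) = ennreal (1 / fact k) * ennreal (fact k)"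
      by (simp only: ennreal_of_nat_eq_real_of_nat of_nat_fact)
    also have "\<dots> = ennreal (1 / fact k * fact k)" by (rule ennreal_mult[symmetric]) auto
    finally show ?thesis by simp
  qed
  have "?L = ennreal (1 / fact k) * (of_nat (fact k) * ?L)"
    unfolding mult.assoc[symmetric] cc by simp
  also have "\<dots> = ennreal (1 / fact k) * ennreal ((p * t) ^ k) * ?R" unfolding eq mult.assoc ..
  also have "ennreal (1 / fact k) * ennreal ((p * t) ^ k) = ennreal ((p * t) ^ k / fact k)"
    using t p by (simp add: ennreal_mult[symmetric])
  finally show ?thesis .
qed

end

lemma nn_integral_count_space_Times:
  fixes f :: "'a \<times> 'b \<Rightarrow> ennreal"
  shows "(\<integral>\<^sup>+p. f p \<partial>count_space (A \<times> B)) = (\<integral>\<^sup>+a. (\<integral>\<^sup>+b. f (a, b) \<partial>count_space B) \<partial>count_space A)"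
proof -
  have "(\<integral>\<^sup>+p. f p \<partial>count_space (A \<times> B)) = (\<integral>\<^sup>+p. f p * indicator (A \<times> B) p \<partial>count_space UNIV)"
    by (rule nn_integral_count_space_indicator) simp
  also have "\<dots> = (\<integral>\<^sup>+a. (\<integral>\<^sup>+b. f (a, b) * indicator (A \<times> B) (a, b) \<partial>count_space UNIV) \<partial>count_space UNIV)"
    by (rule nn_integral_fst_count_space[symmetric])
  also have "\<dots> = (\<integral>\<^sup>+a. (\<integral>\<^sup>+b. f (a, b) * indicator B b \<partial>count_space UNIV) * indicator A a \<partial>count_space UNIV)"
    by (intro nn_integral_cong) (auto simp: indicator_def nn_integral_multc[symmetric])
  also have "\<dots> = (\<integral>\<^sup>+a. (\<integral>\<^sup>+b. f (a, b) * indicator B b \<partial>count_space UNIV) \<partial>count_space A)"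
    by (rule nn_integral_count_space_indicator[symmetric]) simp
  also have "\<dots> = (\<integral>\<^sup>+a. (\<integral>\<^sup>+b. f (a, b) \<partial>count_space B) \<partial>count_space A)"
    by (intro nn_integral_cong nn_integral_count_space_indicator[symmetric]) simp
  finally show ?thesis .
qed

context random_connection_model
begin

lemma AE_marks_unit:
  assumes t: "0 \<le> t" shows "AE \<omega> in M. \<forall>q. marks t \<omega> q \<in> {0..1}"
proof -
  have "AE \<omega> in M. marks t \<omega> q \<in> {0..1}" for q
  proof -
    have m: "U t q \<in> measurable M lborel"
      using marks_measurable[OF t, of q] by (simp add: marks_def)
    have "AE u in uniform_measure lborel {0..1::real}. u \<in> {0..1}"
      by (rule AE_uniform_measureI) auto
    then have "AE u in distr M lborel (U t q). u \<in> {0..1}" unfolding marks_uniform[OF t] .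
    then show ?thesis unfolding marks_def by (rule AE_distrD[OF m])
  qed
  then show ?thesis by (simp add: AE_all_countable)
qed

lemma Cl_subset: "Cl t p A y r \<omega> \<subseteq> insert (Inl r) (idx t A)"
  unfolding Cl_def using reach_subset[of "kept (keep_prob p) (idx t A) (marks t \<omega>)"] by (fastforce simp: kept_def)

text \<open>A finite cluster is determined by its added indices \<open>K\<close> and its Poisson
  indices \<open>J\<close>, and there are countably many such pairs. The weight \<open>c\<close> is
  left general so that probabilities and exponential moments come from one formula.\<close>

lemma cluster_sum:
  fixes c :: "nat \<Rightarrow> ennreal"
  assumes t: "0 \<le> t" and p: "0 \<le> p" "p \<le> 1" and A: "finite A" "inj_on y A" and r: "r \<in> A"
  shows "(\<integral>\<^sup>+\<omega>. (if finite (Cl t p A y r \<omega>) \<and> Inl b \<in> Cl t p A y r \<omega> then c (card (Cl t p A y r \<omega>)) else 0) \<partial>M)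
    = (\<Sum>K\<in>{K\<in>Pow A. r \<in> K \<and> b \<in> K}. \<Sum>k. c (card K + k) *
        (ennreal ((p * t) ^ k / fact k) * (\<integral>\<^sup>+w. ennreal (Phi r K A y (p * t) k w) \<partial>PiM {..<k} (\<lambda>_. lborel))))"
proof -
  let ?K = "{K\<in>Pow A. r \<in> K \<and> b \<in> K}" and ?J = "{J. J \<subseteq> pts t \<and> finite J \<and> True}"
  let ?C = "Cl t p A y r" and ?g = "\<lambda>(K, J). Inl ` K \<union> Inr ` J :: point_index set"
  let ?h = "\<lambda>W. c (card W) * emeasure M (Cl_event t p A y r W)"
  have finK: "finite ?K" using A by simp
  have cJ: "countable ?J" by (rule countable_finite_subsets)
  then have cI: "countable (?K \<times> ?J)" by (rule countable_SIGMA[OF countable_finite[OF finK]])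
  have g_inj: "?g q = ?g q' \<longleftrightarrow> q = q'" for q q' by (cases q; cases q') auto
  have "(\<integral>\<^sup>+\<omega>. (if finite (?C \<omega>) \<and> Inl b \<in> ?C \<omega> then c (card (?C \<omega>)) else 0) \<partial>M)
     = (\<integral>\<^sup>+\<omega>. (\<integral>\<^sup>+q. c (card (?g q)) * indicator (Cl_event t p A y r (?g q)) \<omega> \<partial>count_space (?K \<times> ?J)) \<partial>M)"
  proof (intro nn_integral_cong_AE, use AE_marks_unit[OF t] AE_space in eventually_elim)
    case (elim \<omega>)
    let ?kp = "kept (keep_prob p) (idx t A) (marks t \<omega>)"
    have "Inl r \<in> ?kp" using elim r by (auto simp: kept_def idx_def keep_prob_def)
    then have sub: "?C \<omega> \<subseteq> ?kp" unfolding Cl_def using reach_subset by fastforce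
    \<comment> \<open>The marks lie in \<open>{0..1}\<close> almost surely, hence the root is
      retained and the extra condition in \<open>Cl_event\<close> is automatic.\<close>
    have ev: "\<omega> \<in> Cl_event t p A y r W \<longleftrightarrow> ?C \<omega> = W" for W
      using elim sub by (auto simp: Cl_event_def)
    show ?case
    proof (cases "finite (?C \<omega>) \<and> Inl b \<in> ?C \<omega>")
      case True
      define K J where "K = {a. Inl a \<in> ?C \<omega>}" and "J = {i. Inr i \<in> ?C \<omega>}"
      have KJ: "?g (K, J) = ?C \<omega>"
      proof -
        have "x \<in> ?g (K, J) \<longleftrightarrow> x \<in> ?C \<omega>" for x by (cases x) (auto simp: K_def J_def)
        then show ?thesis by blast
      qed
      have "Inl r \<in> ?C \<omega>" by (simp add: Cl_def)
      moreover have "K \<subseteq> A" "J \<subseteq> pts t" using sub by (auto simp: K_def J_def kept_def idx_def)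
      moreover have "finite J" using True by (auto simp: J_def intro: finite_vimageI[of _ Inr, unfolded vimage_def])
      ultimately have mem: "(K, J) \<in> ?K \<times> ?J" using True by (auto simp: K_def)
      have "(\<integral>\<^sup>+q. c (card (?g q)) * indicator (Cl_event t p A y r (?g q)) \<omega> \<partial>count_space (?K \<times> ?J))
        = (\<Sum>q\<in>{(K, J)}. c (card (?g q)) * indicator (Cl_event t p A y r (?g q)) \<omega>)"
      proof (rule nn_integral_count_space')
        fix q assume "q \<in> ?K \<times> ?J" "q \<notin> {(K, J)}"
        then have "?g q \<noteq> ?C \<omega>" using g_inj[of q "(K, J)"] KJ by auto
        then show "c (card (?g q)) * indicator (Cl_event t p A y r (?g q)) \<omega> = 0"
          using ev[of "?g q"] by (auto simp: indicator_def)
      qed (use mem in auto)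
      also have "\<dots> = c (card (?C \<omega>))" using ev[of "?g (K, J)"] KJ by simp
      finally show ?thesis using True by simp
    next
      case False
      have "c (card (?g q)) * indicator (Cl_event t p A y r (?g q)) \<omega> = 0" if "q \<in> ?K \<times> ?J" for q
      proof -
        have "finite (?g q)" "Inl b \<in> ?g q" using that A by (auto intro: finite_subset)
        then show ?thesis using ev[of "?g q"] False by (auto simp: indicator_def)
      qed
      then have "(\<integral>\<^sup>+q. c (card (?g q)) * indicator (Cl_event t p A y r (?g q)) \<omega> \<partial>count_space (?K \<times> ?J)) = 0"
        by (subst nn_integral_cong[of _ _ "\<lambda>_. 0"]) auto
      then show ?thesis using False by auto
    qed
  qed
  also have "\<dots> = (\<integral>\<^sup>+q. ?h (?g q) \<partial>count_space (?K \<times> ?J))"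
    using Cl_event_measurable[OF t] cI
    by (subst nn_integral_count_space_nn_integral) (auto simp: nn_integral_cmult)
  also have "\<dots> = (\<Sum>K\<in>?K. \<integral>\<^sup>+J. ?h (?g (K, J)) \<partial>count_space ?J)"
    by (simp only: nn_integral_count_space_Times nn_integral_count_space_finite[OF finK])
  also have "\<dots> = (\<Sum>K\<in>?K. \<Sum>k. c (card K + k) *
        (ennreal ((p * t) ^ k / fact k) * (\<integral>\<^sup>+w. ennreal (Phi r K A y (p * t) k w) \<partial>PiM {..<k} (\<lambda>_. lborel))))"
  proof (rule sum.cong[OF refl])
    fix K assume K: "K \<in> ?K"
    then have fK: "finite K" using A finite_subset by auto
    have "(\<integral>\<^sup>+J. ?h (?g (K, J)) \<partial>count_space ?J)
       = (\<Sum>k. of_bool True * (\<integral>\<^sup>+J. ?h (?g (K, J)) \<partial>count_space {J. J \<subseteq> pts t \<and> finite J \<and> card J = k}))"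
      by (rule nn_integral_finite_subsets_by_card[where Q="\<lambda>_. True"])
    also have "\<dots> = (\<Sum>k. \<integral>\<^sup>+J. c (card K + k) * emeasure M (Cl_event t p A y r (Inl ` K \<union> Inr ` J)) 
        \<partial>count_space {J. J \<subseteq> pts t \<and> finite J \<and> card J = k})"
    proof (intro suminf_cong)
      fix k
      have cg: "card (?g (K, J)) = card K + card J" if "finite J" for J :: "nat set"
        using fK that by simp (subst card_Un_disjoint, auto simp: card_image)
      have "(\<integral>\<^sup>+J. ?h (?g (K, J)) \<partial>count_space {J. J \<subseteq> pts t \<and> finite J \<and> card J = k})
        = (\<integral>\<^sup>+J. c (card K + k) * emeasure M (Cl_event t p A y r (Inl ` K \<union> Inr ` J)) 
        \<partial>count_space {J. J \<subseteq> pts t \<and> finite J \<and> card J = k})"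
      proof (rule nn_integral_cong)
        fix J assume "J \<in> space (count_space {J. J \<subseteq> pts t \<and> finite J \<and> card J = k})"
        then have "finite J" "card J = k" by simp_all
        then have "card (?g (K, J)) = card K + k" using cg by simp
        then show "?h (?g (K, J)) = c (card K + k) * emeasure M (Cl_event t p A y r (Inl ` K \<union> Inr ` J))"
          by (simp only: prod.case)
      qed
      then show "of_bool True * (\<integral>\<^sup>+J. ?h (?g (K, J)) \<partial>count_space {J. J \<subseteq> pts t \<and> finite J \<and> card J = k})
        = (\<integral>\<^sup>+J. c (card K + k) * emeasure M (Cl_event t p A y r (Inl ` K \<union> Inr ` J)) 
        \<partial>count_space {J. J \<subseteq> pts t \<and> finite J \<and> card J = k})"
        by (simp only: of_bool_eq mult_1)
    qed
    also have "\<dots> = (\<Sum>k. c (card K + k) *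
        (ennreal ((p * t) ^ k / fact k) * (\<integral>\<^sup>+w. ennreal (Phi r K A y (p * t) k w) \<partial>PiM {..<k} (\<lambda>_. lborel))))"
      using K cluster_law[OF t p A, of K r] by (simp add: nn_integral_cmult)
    finally show "(\<integral>\<^sup>+J. ?h (?g (K, J)) \<partial>count_space ?J) = \<dots>" .
  qed
  finally show ?thesis .
qed

section \<open>From the graph on points to the graph on indices\<close>

lemma marked_edges_eq:
  "marked_edges X U t A y \<omega> = {({locs t y \<omega> i, locs t y \<omega> j}, marks t \<omega> (i, j)) | i j.
     i \<in> idx t A \<and> j \<in> idx t A \<and> lex_less (locs t y \<omega> i) (locs t y \<omega> j)}"
proof -
  have I: "Inl ` A \<union> (if 0 < t then range Inr else {}) = idx t A"
    by (auto simp: idx_def pts_def)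
  have z: "case_sum y (\<lambda>j. X t j \<omega>) i = locs t y \<omega> i" if "i \<in> idx t A" for i
    using that by (auto simp: idx_def pts_def locs_def Xp_def split: if_splits)
  show ?thesis
    unfolding marked_edges_def Let_def I marks_def
    by (rule Collect_cong) (metis z)
qed

text \<open>For distinct points each pair carries exactly one mark. As soon as there are two points,
  all of them are vertices and \<open>z\<close> is an isomorphism from the index graph.\<close>

lemma cluster_marked_edges:
  fixes z :: "'i \<Rightarrow> 'd point"
  assumes inj: "inj_on z I" and u: "\<And>q. u q \<in> {0..1}" and r: "r \<in> I"
  defines "\<xi> \<equiv> {({z i, z j}, u (i, j)) | i j. i \<in> I \<and> j \<in> I \<and> lex_less (z i) (z j)}"
  shows "cluster \<phi> (z r) \<xi> = z ` reach I (ladj z u) r"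
proof -
  have zeq: "z i = z j \<longleftrightarrow> i = j" if "i \<in> I" "j \<in> I" for i j
    using inj that by (auto simp: inj_on_def)
  have mem: "({z i, z j}, v) \<in> \<xi> \<longleftrightarrow> (lex_less (z i) (z j) \<and> v = u (i, j)) \<or> (lex_less (z j) (z i) \<and> v = u (j, i))"
    if ij: "i \<in> I" "j \<in> I" for i j v
  proof
    assume "({z i, z j}, v) \<in> \<xi>"
    then obtain i' j' where a: "i' \<in> I" "j' \<in> I" "lex_less (z i') (z j')" "{z i, z j} = {z i', z j'}" "v = u (i', j')"
      unfolding \<xi>_def by blast
    then have "(z i = z i' \<and> z j = z j') \<or> (z i = z j' \<and> z j = z i')" by (simp add: doubleton_eq_iff)
    then have "(i = i' \<and> j = j') \<or> (i = j' \<and> j = i')" using zeq ij a(1,2) by simp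
    then show "(lex_less (z i) (z j) \<and> v = u (i, j)) \<or> (lex_less (z j) (z i) \<and> v = u (j, i))" using a by auto
  next
    assume "(lex_less (z i) (z j) \<and> v = u (i, j)) \<or> (lex_less (z j) (z i) \<and> v = u (j, i))"
    then show "({z i, z j}, v) \<in> \<xi>"
    proof
      assume "lex_less (z i) (z j) \<and> v = u (i, j)"
      then show ?thesis unfolding \<xi>_def using ij by blast
    next
      assume "lex_less (z j) (z i) \<and> v = u (j, i)"
      moreover have "{z i, z j} = {z j, z i}" by auto
      ultimately show ?thesis unfolding \<xi>_def using ij by blast
    qed
  qed
  have verts: "z i \<in> graph_verts \<xi>" if ij: "i \<in> I" "j \<in> I" "i \<noteq> j" for i j
  proof -
    have ne: "z i \<noteq> z j" using zeq ij by simp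
    have "\<exists>v. {w\<in>{0..1}. ({z i, z j}, w) \<in> \<xi>} = {v}"
    proof (cases "lex_less (z i) (z j)")
      case True
      then have "{w\<in>{0..1}. ({z i, z j}, w) \<in> \<xi>} = {u (i, j)}"
        using mem[OF ij(1,2)] lex_less_asym[OF True] u[of "(i, j)"] by auto
      then show ?thesis by blast
    next
      case False
      then have "lex_less (z j) (z i)" using lex_less_total[OF ne] by blast
      then have "{w\<in>{0..1}. ({z i, z j}, w) \<in> \<xi>} = {u (j, i)}"
        using mem[OF ij(1,2)] False u[of "(j, i)"] by auto
      then show ?thesis by blast
    qed
    then have "card {w\<in>{0..1}. ({z i, z j}, w) \<in> \<xi>} = 1" by (metis One_nat_def card_1_singleton_iff)
    moreover have "card {z i, z j} = 2" using ne by simp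
    ultimately have "{z i, z j} \<in> {e. card e = 2 \<and> card {w\<in>{0..1}. (e, w) \<in> \<xi>} = 1}" by blast
    moreover have "z i \<in> {z i, z j}" by simp
    ultimately show ?thesis unfolding graph_verts_def by (rule UnionI)
  qed
  have verts_sub: "x \<in> z ` I" if xv: "x \<in> graph_verts \<xi>" for x
  proof -
    obtain e where e: "x \<in> e" "e \<in> {e. card e = 2 \<and> card {w\<in>{0..1}. (e, w) \<in> \<xi>} = 1}"
      using xv unfolding graph_verts_def by (rule UnionE)
    from e(2) have "card {w\<in>{0..1}. (e, w) \<in> \<xi>} = 1" unfolding mem_Collect_eq by (rule conjunct2)
    then obtain w where "w \<in> {w\<in>{0..1}. (e, w) \<in> \<xi>}" by (metis card_1_singletonE insertI1)
    then have "(e, w) \<in> \<xi>" by simp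
    then show ?thesis using e(1) unfolding \<xi>_def by auto
  qed
  have adj: "graph_adj \<phi> \<xi> (z i) (z j) \<longleftrightarrow> ladj z u i j" if ij: "i \<in> I" "j \<in> I" for i j
  proof -
    have s: "\<phi> (z j - z i) = \<phi> (z i - z j)" using phi_sym[of "z i - z j"] by simp
    have "graph_adj \<phi> \<xi> (z i) (z j) \<longleftrightarrow> i \<noteq> j \<and> (\<exists>w\<in>{0..1}. ({z i, z j}, w) \<in> \<xi> \<and> w \<le> \<phi> (z j - z i))"
      unfolding graph_adj_def using verts[OF ij] verts[OF ij(2,1)] zeq[OF ij] by auto
    also have "\<dots> \<longleftrightarrow> ladj z u i j"
      unfolding mem[OF ij] s ladj_def using u[of "(i, j)"] u[of "(j, i)"] by auto
    finally show ?thesis .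
  qed
  have sub: "reach I (ladj z u) r \<subseteq> I" using reach_subset[of I "ladj z u" r] r by auto
  have reach: "{y. (graph_adj \<phi> \<xi>)\<^sup>*\<^sup>* (z r) y} = z ` reach I (ladj z u) r"
  proof (intro equalityI subsetI)
    fix x assume "x \<in> {y. (graph_adj \<phi> \<xi>)\<^sup>*\<^sup>* (z r) y}"
    then have "(graph_adj \<phi> \<xi>)\<^sup>*\<^sup>* (z r) x" by simp
    then show "x \<in> z ` reach I (ladj z u) r"
    proof induction
      case (step a b)
      then obtain i where i: "i \<in> reach I (ladj z u) r" "a = z i" by auto
      have "b \<in> graph_verts \<xi>" using step(2) by (simp add: graph_adj_def)
      then obtain j where j: "j \<in> I" "b = z j" using verts_sub by blast
      have iI: "i \<in> I" using i sub by auto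
      then have "ladj z u i j" using step(2) adj[OF _ j(1)] i j by simp
      then show ?case using reach_step[OF i(1) iI j(1)] j by blast
    qed simp
  next
    fix x assume "x \<in> z ` reach I (ladj z u) r"
    then obtain i where i: "i \<in> reach I (ladj z u) r" "x = z i" by auto
    from i(1) have "(graph_adj \<phi> \<xi>)\<^sup>*\<^sup>* (z r) (z i)"
      by (induction rule: reach_induct) (auto simp: adj intro: rtranclp.rtrancl_into_rtrancl)
    then show "x \<in> {y. (graph_adj \<phi> \<xi>)\<^sup>*\<^sup>* (z r) y}" using i by simp
  qed
  show ?thesis
  proof (cases "z r \<in> graph_verts \<xi>")
    case True
    then show ?thesis by (simp add: cluster_def reach)
  next
    case False
    \<comment> \<open>A point without partner is not a vertex; the value that \<open>cluster\<close>
      prescribes in this case agrees with \<open>reach\<close>.\<close>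
    then have "I = {r}" using verts[OF r] r by blast
    then have "reach I (ladj z u) r = {r}" using sub reach_self[of r I "ladj z u"] by blast
    then show ?thesis using False by (simp add: cluster_def)
  qed
qed

lemma cluster_eq_Cl:
  assumes t: "0 \<le> t" and A: "finite A" "inj_on y A" and r: "r \<in> A"
  shows "AE \<omega> in M. inj_on (locs t y \<omega>) (idx t A) \<and> Cl t 1 A y r \<omega> \<subseteq> idx t A \<and>
    cluster \<phi> (y r) (marked_edges X U t A y \<omega>) = locs t y \<omega> ` Cl t 1 A y r \<omega>"
  using AE_marks_unit[OF t] AE_inj_locs[OF A, of t]
proof eventually_elim
  case (elim \<omega>)
  have rI: "Inl r \<in> idx t A" using r by (auto simp: idx_def)
  have "kept (keep_prob 1) (idx t A) (marks t \<omega>) = idx t A"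
    using elim(1) by (auto simp: kept_def keep_prob_def split: sum.split)
  then have C: "Cl t 1 A y r \<omega> = reach (idx t A) (ladj (locs t y \<omega>) (marks t \<omega>)) (Inl r)"
    by (simp add: Cl_def)
  have yr: "y r = locs t y \<omega> (Inl r)" by (simp add: locs_def)
  have "cluster \<phi> (y r) (marked_edges X U t A y \<omega>) = locs t y \<omega> ` Cl t 1 A y r \<omega>"
    unfolding marked_edges_eq C yr by (rule cluster_marked_edges) (use elim rI in auto)
  moreover have "Cl t 1 A y r \<omega> \<subseteq> idx t A" using Cl_subset[of t 1 A y r \<omega>] rI by auto
  ultimately show ?case using elim(2) by blast
qed

end

section \<open>Exponential moments of the cluster size\<close>

lemma pred_finite_set:
  fixes S :: "'k \<Rightarrow> 'i::countable set"
  assumes [measurable]: "\<And>i. Measurable.pred N (\<lambda>k. i \<in> S k)"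
  shows "Measurable.pred N (\<lambda>k. finite (S k))"
proof -
  have "finite A \<longleftrightarrow> (\<exists>n. \<forall>i. i \<in> A \<longrightarrow> to_nat i \<le> n)" for A :: "'i set"
  proof
    assume "finite A"
    then have "finite (to_nat ` A)" by simp
    then obtain n where "\<forall>x\<in>to_nat ` A. x \<le> n" using finite_nat_set_iff_bounded_le by blast
    then show "\<exists>n. \<forall>i. i \<in> A \<longrightarrow> to_nat i \<le> n" by blast
  next
    assume "\<exists>n. \<forall>i. i \<in> A \<longrightarrow> to_nat i \<le> n"
    then have "finite (to_nat ` A)" using finite_nat_set_iff_bounded_le by blast
    then show "finite A" using finite_imageD inj_on_subset[OF inj_to_nat] by blast
  qed
  then show ?thesis by simp
qed

text \<open>A function of a random finite set of countable type is a countable sum over the possible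
  values of the set.\<close>

lemma card_function_measurable:
  fixes S :: "'k \<Rightarrow> 'i::countable set" and c :: "nat \<Rightarrow> ennreal"
  assumes S: "\<And>i. Measurable.pred N (\<lambda>k. i \<in> S k)"
  shows "(\<lambda>k. if finite (S k) then c (card (S k)) else 0) \<in> borel_measurable N"
proof -
  have "Measurable.pred N (\<lambda>k. S k = W)" for W
  proof -
    note S[measurable]
    have "S k = W \<longleftrightarrow> (\<forall>i. i \<in> S k \<longleftrightarrow> i \<in> W)" for k by auto
    then show ?thesis by simp
  qed
  then have m: "(\<lambda>k. c (card W) * of_bool (S k = W)) \<in> borel_measurable N" for W
    by (simp add: of_bool_def)
  have "(if finite (S k) then c (card (S k)) else 0)
      = (\<integral>\<^sup>+W. c (card W) * of_bool (S k = W) \<partial>count_space {W. finite W})" for k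
  proof (cases "finite (S k)")
    case True
    then show ?thesis by (subst nn_integral_count_space'[of "{S k}"]) auto
  next
    case False
    then have "(\<integral>\<^sup>+W. c (card W) * of_bool (S k = W) \<partial>count_space {W. finite W}) = (\<integral>\<^sup>+W. 0 \<partial>count_space {W :: 'i set. finite W})"
      by (intro nn_integral_cong) auto
    then show ?thesis using False by simp
  qed
  then show ?thesis
    using borel_measurable_nn_integral_count_space[OF countable_Collect_finite m] by simp
qed

lemma nn_integral_lborel_shift:
  fixes f :: "'a::euclidean_space \<Rightarrow> ennreal"
  assumes [measurable]: "f \<in> borel_measurable borel"
  shows "(\<integral>\<^sup>+x. f (x + c) \<partial>lborel) = (\<integral>\<^sup>+x. f x \<partial>lborel)"
proof -
  have "(\<integral>\<^sup>+x. f x \<partial>lborel) = (\<integral>\<^sup>+x. f x \<partial>distr lborel borel ((+) c))"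
    by (simp add: lborel_distr_plus)
  also have "\<dots> = (\<integral>\<^sup>+x. f (c + x) \<partial>lborel)" by (subst nn_integral_distr) auto
  finally show ?thesis by (simp add: add.commute)
qed

lemma nn_integral_PiM_lborel_shift:
  fixes F :: "('i \<Rightarrow> 'a::euclidean_space) \<Rightarrow> ennreal"
  assumes I: "finite I" and F: "F \<in> borel_measurable (PiM I (\<lambda>_. lborel))"
  shows "(\<integral>\<^sup>+w. F (\<lambda>i\<in>I. w i + c) \<partial>PiM I (\<lambda>_. lborel)) = (\<integral>\<^sup>+w. F w \<partial>PiM I (\<lambda>_. lborel))"
proof -
  interpret L: product_sigma_finite "\<lambda>_::'i. lborel :: 'a measure" by standard
  let ?Q = "PiM I (\<lambda>_. lborel) :: ('i \<Rightarrow> 'a) measure"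
  let ?s = "\<lambda>w. \<lambda>i\<in>I. w i + c"
  have s: "?s \<in> measurable ?Q ?Q"
  proof (rule measurable_restrict)
    fix i assume "i \<in> I"
    then have "(\<lambda>w. w i) \<in> borel_measurable ?Q"
      using measurable_component_singleton[of i I "\<lambda>_. lborel :: 'a measure"] by simp
    then show "(\<lambda>w. w i + c) \<in> measurable ?Q lborel" by simp
  qed
  have vm: "(\<lambda>x. x + c) -` B \<in> sets borel" if "B \<in> sets borel" for B
    using measurable_sets[of "\<lambda>x. x + c" borel borel B] that by simp
  have "distr ?Q ?Q ?s = ?Q"
  proof (rule L.PiM_eqI[OF I])
    fix A :: "'i \<Rightarrow> 'a set" assume A: "\<And>i. i \<in> I \<Longrightarrow> A i \<in> sets lborel"
    have "emeasure (distr ?Q ?Q ?s) (Pi\<^sub>E I A) = emeasure ?Q (Pi\<^sub>E I (\<lambda>i. (\<lambda>x. x + c) -` A i))"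
      using A I s by (subst emeasure_distr) (auto intro!: arg_cong[where f="emeasure ?Q"] sets_PiM_I_finite simp: space_PiM PiE_iff extensional_def)
    also have "\<dots> = (\<Prod>i\<in>I. emeasure lborel ((\<lambda>x. x + c) -` A i))"
      using A by (intro L.emeasure_PiM I) (auto intro: vm)
    also have "\<dots> = (\<Prod>i\<in>I. emeasure lborel (A i))"
    proof (rule prod.cong[OF refl])
      fix i assume i: "i \<in> I"
      have "emeasure lborel ((\<lambda>x. x + c) -` A i) = (\<integral>\<^sup>+x. indicator (A i) (x + c) \<partial>lborel)"
        using A[OF i] by (subst nn_integral_indicator[symmetric]) (auto intro!: nn_integral_cong vm simp: indicator_def)
      also have "\<dots> = emeasure lborel (A i)"
        using A[OF i] by (subst nn_integral_lborel_shift) auto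
      finally show "emeasure lborel ((\<lambda>x. x + c) -` A i) = emeasure lborel (A i)" .
    qed
    finally show "emeasure (distr ?Q ?Q ?s) (Pi\<^sub>E I A) = (\<Prod>i\<in>I. emeasure lborel (A i))" .
  qed simp
  then have "(\<integral>\<^sup>+w. F w \<partial>?Q) = (\<integral>\<^sup>+w. F w \<partial>distr ?Q ?Q ?s)" by simp
  also have "\<dots> = (\<integral>\<^sup>+w. F (?s w) \<partial>?Q)" by (rule nn_integral_distr[OF s]) (simp add: F)
  finally show ?thesis by simp
qed

lemma if_le_ennreal: "(if c then a else 0) \<le> (a :: ennreal)"
  by simp

lemma half_ennreal:
  assumes "0 \<le> a" "0 \<le> b"
  shows "ennreal (1 / 2) * ennreal a + ennreal (1 / 2) * ennreal b = ennreal (1 / 2 * a + 1 / 2 * b)"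
proof -
  have "ennreal (1 / 2) * ennreal a = ennreal (1 / 2 * a)" "ennreal (1 / 2) * ennreal b = ennreal (1 / 2 * b)"
    using assms by (intro ennreal_mult[symmetric]; simp)+
  moreover have "ennreal (1 / 2 * a) + ennreal (1 / 2 * b) = ennreal (1 / 2 * a + 1 / 2 * b)"
    using assms by (intro ennreal_plus[symmetric]) auto
  ultimately show ?thesis by (simp only:)
qed

section \<open>Stationarity and the size of the cluster of one added point\<close>

context random_connection_model
begin

lemma conn_prob_shift: "conn_prob r W (\<lambda>i. z i + c) = conn_prob r W z"
  unfolding conn_prob_def
proof (rule Ber_cong)
  fix e assume "e \<in> pairs W"
  then obtain i j where "e = {i, j}" by (auto simp: pairs_def card_2_iff)
  then show "edge_prob (\<lambda>i. z i + c) e = edge_prob z e" by simp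
qed auto

lemma V_shift: "V (\<lambda>i. z i + c) W = V z W"
proof -
  have "hit (\<lambda>i. z i + c) W x = hit z W (x + (- c))" for x
    by (simp add: hit_def algebra_simps)
  moreover have "(\<integral>\<^sup>+x. ennreal (hit z W (x + (- c))) \<partial>lborel) = (\<integral>\<^sup>+x. ennreal (hit z W x) \<partial>lborel)"
    by (rule nn_integral_lborel_shift) (auto intro!: measurable_compose[OF _ measurable_ennreal] hit_measurable)
  ultimately show ?thesis by (simp add: V_def)
qed

lemma Phi_measurable:
  assumes "finite K"
  shows "Phi r K A y \<tau> k \<in> borel_measurable (PiM {..<k} (\<lambda>_. lborel))"
  unfolding Phi_def using assms
  by (intro borel_measurable_times borel_measurable_const borel_measurable_prod borel_measurable_diff
        conn_prob_measurable hit_measurable V_measurable measurable_compose[OF _ borel_measurable_exp] borel_measurable_uminus case_sum_measurable finite_WW)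

text \<open>Translation by \<open>y a\<close> moves the root to the origin; connectivity, volumes
  and Lebesgue measure are invariant.\<close>

lemma Phi_single:
  "(\<integral>\<^sup>+w. ennreal (Phi a {a} {a} y \<tau> k w) \<partial>PiM {..<k} (\<lambda>_. lborel))
    = (\<integral>\<^sup>+w. ennreal (Phi 0 {0} {0} (\<lambda>_. 0) \<tau> k w) \<partial>PiM {..<k} (\<lambda>_. lborel))"
proof -
  have "Phi a {a} {a} y \<tau> k (\<lambda>i\<in>{..<k}. w i + y a) = Phi 0 {0} {0} (\<lambda>_. 0) \<tau> k w" for w
  proof -
    let ?f = "map_sum (\<lambda>_::nat. a) id :: point_index \<Rightarrow> point_index" and ?z = "case_sum y (\<lambda>i\<in>{..<k}. w i + y a)"
    let ?z' = "\<lambda>i. case_sum (\<lambda>_. 0) w i + y a"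
    have f: "inj_on ?f (WW {0} k)" "?f ` WW {0} k = WW {a} k" "?f (Inl 0) = Inl a"
      by (auto simp: WW_def inj_on_def image_Un image_image)
    have z: "?z' i = ?z (?f i)" if "i \<in> WW {0} k" for i using that by (auto simp: WW_def)
    have "conn_prob (Inl 0) (WW {0} k) ?z' = conn_prob (?f (Inl 0)) (?f ` WW {0} k) ?z"
      by (rule conn_prob_relabel[OF f(1)]) (use z in \<open>auto simp: WW_def\<close>)
    moreover have "V ?z' (WW {0} k) = V ?z (?f ` WW {0} k)"
      by (rule V_relabel[OF f(1)]) (use z in auto)
    ultimately show ?thesis
      unfolding f Phi_def conn_prob_shift V_shift by simp
  qed
  then show ?thesis
    using nn_integral_PiM_lborel_shift[of "{..<k}" "\<lambda>w. ennreal (Phi a {a} {a} y \<tau> k w)" "y a"]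
      measurable_compose[OF Phi_measurable measurable_ennreal] by simp
qed

text \<open>For intensity \<open>s\<close>, the probability that the cluster of a single added point
  is finite and contains exactly \<open>k\<close> points of the process.\<close>

definition Q :: "real \<Rightarrow> nat \<Rightarrow> ennreal" where
  "Q s k = ennreal (s ^ k / fact k) * (\<integral>\<^sup>+w. ennreal (Phi 0 {0} {0} (\<lambda>_. 0) s k w) \<partial>PiM {..<k} (\<lambda>_. lborel))"

lemma cluster_sum_single:
  assumes t: "0 \<le> t" and p: "0 \<le> p" "p \<le> 1"
  shows "(\<integral>\<^sup>+\<omega>. (if finite (Cl t p {a} y a \<omega>) then c (card (Cl t p {a} y a \<omega>)) else 0) \<partial>M)
    = (\<Sum>k. c (Suc k) * Q (p * t) k)"
proof -
  have "{K\<in>Pow {a}. a \<in> K \<and> a \<in> K} = {{a}}" by auto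
  moreover have "Inl a \<in> Cl t p {a} y a \<omega>" for \<omega> by (simp add: Cl_def)
  ultimately show ?thesis
    using cluster_sum[OF t p, of "{a}" y a a c] by (simp add: Q_def Phi_single[where a=a and y=y])
qed

lemma pred_Cl: "0 \<le> t \<Longrightarrow> Measurable.pred M (\<lambda>\<omega>. i \<in> Cl t p A y r \<omega>)"
  unfolding Cl_def by (intro pred_reach pred_kept pred_ladj marks_measurable locs_measurable)

lemma pred_finite_Cl: "0 \<le> t \<Longrightarrow> Measurable.pred M (\<lambda>\<omega>. finite (Cl t p A y r \<omega>))"
  by (intro pred_finite_set pred_Cl)

text \<open>Everything is expressed by the numbers \<open>Q s k\<close>, that is, by the law of the
  cluster size. In this form the property passes from the process at intensity \<open>t\<close>
  thinned by \<open>p\<close> to the model at \<open>s = p * t\<close>, although the two processes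
  are unrelated. Total mass one says that the cluster is almost surely finite.\<close>

definition exp_tail :: "real \<Rightarrow> real \<Rightarrow> bool" where
  "exp_tail s z \<longleftrightarrow> 0 \<le> s \<and> 0 < z \<and> (\<Sum>k. ennreal (exp (z * real (Suc k))) * Q s k) < \<infinity> \<and> (\<Sum>k. Q s k) = 1"

text \<open>The cluster at intensity \<open>p t\<close> is realised inside the one at intensity \<open>t\<close> by thinning.\<close>

lemma exp_tail_thinned:
  assumes t: "0 \<le> t" and p: "0 \<le> p" "p \<le> 1" and z: "0 < z" and em: "exp_moment M \<phi> X U t z < \<infinity>"
  shows "exp_tail (p * t) z"
proof -
  let ?C = "Cl t p {0} (\<lambda>_. 0) 0" and ?Cb = "Cl t 1 {0} (\<lambda>_. 0) 0"
  define F :: "'w \<Rightarrow> ennreal" where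
    "F \<omega> = (let C = cluster \<phi> 0 (marked_edges X U t {0} (\<lambda>_. 0) \<omega>)
            in if finite C then ennreal (exp (z * real (card C))) else \<infinity>)" for \<omega>
  have F: "(\<integral>\<^sup>+\<omega>. F \<omega> \<partial>M) < \<infinity>" using em by (simp add: exp_moment_def F_def)
  have AE_F: "AE \<omega> in M. F \<omega> = (if finite (?Cb \<omega>) then ennreal (exp (z * real (card (?Cb \<omega>)))) else \<infinity>)"
  proof -
    have "AE \<omega> in M. inj_on (locs t (\<lambda>_. 0) \<omega>) (idx t {0}) \<and> ?Cb \<omega> \<subseteq> idx t {0} \<and>
        cluster \<phi> 0 (marked_edges X U t {0} (\<lambda>_. 0) \<omega>) = locs t (\<lambda>_. 0) \<omega> ` ?Cb \<omega>"
      by (rule cluster_eq_Cl[OF t, of "{0}" "\<lambda>_. 0" 0]) auto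
    then show ?thesis
  proof eventually_elim
    case (elim \<omega>)
    then have i: "inj_on (locs t (\<lambda>_. 0) \<omega>) (?Cb \<omega>)" by (auto intro: inj_on_subset)
    show ?case using elim i by (simp add: F_def Let_def card_image finite_image_iff)
  qed
  qed
  have sub: "?C \<omega> \<subseteq> ?Cb \<omega>" for \<omega>
    unfolding Cl_def
  proof (intro reach_mono)
    show "kept (keep_prob p) (idx t {0}) (marks t \<omega>) \<subseteq> kept (keep_prob 1) (idx t {0}) (marks t \<omega>)"
    proof
      fix i assume "i \<in> kept (keep_prob p) (idx t {0}) (marks t \<omega>)"
      then show "i \<in> kept (keep_prob 1) (idx t {0}) (marks t \<omega>)"
        using p by (cases i) (auto simp: kept_def keep_prob_def)
    qed
  qed
  have "(\<Sum>k. ennreal (exp (z * real (Suc k))) * Q (p * t) k)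
      = (\<integral>\<^sup>+\<omega>. (if finite (?C \<omega>) then ennreal (exp (z * real (card (?C \<omega>)))) else 0) \<partial>M)"
    by (rule cluster_sum_single[OF t p, symmetric])
  also have "\<dots> \<le> (\<integral>\<^sup>+\<omega>. F \<omega> \<partial>M)"
  proof (rule nn_integral_mono_AE, use AE_F in eventually_elim)
    case (elim \<omega>)
    have "card (?C \<omega>) \<le> card (?Cb \<omega>)" if "finite (?Cb \<omega>)" using card_mono[OF that sub] .
    then show ?case unfolding elim using z by (auto intro!: ennreal_leI)
  qed
  also have "\<dots> < \<infinity>" by (rule F)
  finally have 1: "(\<Sum>k. ennreal (exp (z * real (Suc k))) * Q (p * t) k) < \<infinity>" .
  let ?N = "{\<omega>\<in>space M. \<not> finite (?C \<omega>)}"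
  have N: "?N \<in> sets M" using pred_finite_Cl[OF t, of p "{0}" "\<lambda>_. 0" 0] by (simp add: pred_def sets.sets_Collect_neg)
  \<comment> \<open>On this event the larger cluster is infinite too and the integrand of the moment
    is \<open>\<infinity>\<close>; a finite moment forces the event to be null.\<close>
  have "\<infinity> * emeasure M ?N = (\<integral>\<^sup>+\<omega>. \<infinity> * indicator ?N \<omega> \<partial>M)"
    using N by (simp add: nn_integral_cmult_indicator)
  also have "\<dots> \<le> (\<integral>\<^sup>+\<omega>. F \<omega> \<partial>M)"
  proof (rule nn_integral_mono_AE, use AE_F in eventually_elim)
    case (elim \<omega>)
    show ?case unfolding elim using finite_subset[OF sub] by (auto simp: indicator_def)
  qed
  also have "\<dots> < \<infinity>" by (rule F)
  finally have N0: "emeasure M ?N = 0"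
    by (metis ennreal_top_mult infinity_ennreal_def less_irrefl)
  have "AE \<omega> in M. \<omega> \<notin> ?N" using N N0 by (intro AE_not_in) (simp add: null_sets_def)
  then have fin: "AE \<omega> in M. finite (?C \<omega>)" using AE_space by eventually_elim auto
  have "(\<Sum>k. Q (p * t) k) = (\<integral>\<^sup>+\<omega>. (if finite (?C \<omega>) then 1 else 0) \<partial>M)"
    using cluster_sum_single[OF t p, of 0 "\<lambda>_. 0" "\<lambda>_. 1"] by simp
  also have "\<dots> = (\<integral>\<^sup>+\<omega>. 1 \<partial>M)"
    by (intro nn_integral_cong_AE, use fin in eventually_elim) auto
  finally have "(\<Sum>k. Q (p * t) k) = 1" by (simp add: emeasure_space_1)
  then show ?thesis using 1 t p z by (simp add: exp_tail_def)
qed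

text \<open>The supremum provides an intensity above \<open>s\<close> with a finite moment; thinning
  by \<open>s / t\<close> and by \<open>1\<close> gives the two conclusions with a common rate. The
  second intensity is strictly positive and takes over when \<open>s = 0\<close>.\<close>

lemma subcritical_exp_tail:
  assumes "s \<in> subcritical M \<phi> X U"
  shows "\<exists>s' z. s < s' \<and> exp_tail s z \<and> exp_tail s' z"
proof -
  have s: "0 \<le> s" "ereal s < t_star M \<phi> X U" using assms by (auto simp: subcritical_def)
  then obtain t z where t: "0 \<le> t" "0 < z" "exp_moment M \<phi> X U t z < \<infinity>" "s < t"
    unfolding t_star_def less_SUP_iff by auto
  have "exp_tail (s / t * t) z" by (rule exp_tail_thinned) (use t s in auto)
  moreover have "exp_tail (1 * t) z" by (rule exp_tail_thinned) (use t in auto)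
  ultimately show ?thesis using t s by auto
qed

lemma single_exp_moment:
  assumes g: "exp_tail s z"
  shows "(\<integral>\<^sup>+\<omega>. (if finite (Cl s 1 {a} y a \<omega>) then ennreal (exp (z * real (card (Cl s 1 {a} y a \<omega>)))) else 0) \<partial>M)
    = (\<Sum>k. ennreal (exp (z * real (Suc k))) * Q s k)"
  using cluster_sum_single[of s 1 a y "\<lambda>n. ennreal (exp (z * real n))"] g by (simp add: exp_tail_def)

lemma AE_finite_single:
  assumes g: "exp_tail s z" shows "AE \<omega> in M. finite (Cl s 1 {a} y a \<omega>)"
proof -
  have s: "0 \<le> s" using g by (simp add: exp_tail_def)
  let ?N = "{\<omega>\<in>space M. finite (Cl s 1 {a} y a \<omega>)}"
  have N: "?N \<in> sets M" using pred_finite_Cl[OF s, of 1 "{a}" y a] by (simp add: pred_def)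
  have "1 = (\<integral>\<^sup>+\<omega>. (if finite (Cl s 1 {a} y a \<omega>) then 1 else 0) \<partial>M)"
    using cluster_sum_single[of s 1 a y "\<lambda>_. 1"] g by (simp add: exp_tail_def)
  also have "\<dots> = (\<integral>\<^sup>+\<omega>. indicator ?N \<omega> \<partial>M)"
    by (intro nn_integral_cong) (auto simp: indicator_def)
  also have "\<dots> = emeasure M ?N" using N by simp
  finally have "prob ?N = 1" by (simp add: emeasure_eq_measure)
  from AE_prob_1[OF this] show ?thesis by eventually_elim auto
qed

text \<open>Along a path, a visit to an added point restarts the cluster of that point, and a step
  to a Poisson point stays inside the cluster currently followed. This reduces several added points
  to one.\<close>

lemma Cl_subset_Union:
  assumes r: "r \<in> A"
  shows "Cl s p A y r \<omega> \<subseteq> (\<Union>a\<in>A. Cl s p {a} y a \<omega>)"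
proof
  fix x assume "x \<in> Cl s p A y r \<omega>"
  then show "x \<in> (\<Union>a\<in>A. Cl s p {a} y a \<omega>)"
    unfolding Cl_def[of s p A]
  proof (induction rule: reach_induct)
    case base
    have "Inl r \<in> Cl s p {r} y r \<omega>" by (simp add: Cl_def)
    then show ?case using r by blast
  next
    case (step i j)
    then obtain a where a: "a \<in> A" "i \<in> Cl s p {a} y a \<omega>" by auto
    show ?case
    proof (cases j)
      case (Inl b)
      then have "b \<in> A" "j \<in> Cl s p {b} y b \<omega>" using step(3) by (auto simp: kept_def idx_def Cl_def)
      then show ?thesis by blast
    next
      case (Inr n)
      have "i \<in> idx s {a}" using Cl_subset[of s p "{a}" y a \<omega>] a(2) by (auto simp: idx_def)
      then have ia: "i \<in> kept (keep_prob p) (idx s {a}) (marks s \<omega>)" using step(2) by (auto simp: kept_def)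
      have ja: "j \<in> kept (keep_prob p) (idx s {a}) (marks s \<omega>)" using step(3) Inr by (auto simp: kept_def idx_def)
      have "j \<in> Cl s p {a} y a \<omega>"
        unfolding Cl_def by (rule reach_step[OF a(2)[unfolded Cl_def] ia ja step(4)])
      then show ?thesis using a(1) by blast
    qed
  qed
qed

lemma AE_finite_Cl:
  assumes g: "exp_tail s z" and A: "finite A" "r \<in> A" shows "AE \<omega> in M. finite (Cl s 1 A y r \<omega>)"
proof -
  have "AE \<omega> in M. \<forall>a\<in>A. finite (Cl s 1 {a} y a \<omega>)"
    using A AE_finite_single[OF g] by (intro AE_finite_allI) auto
  then show ?thesis
  proof eventually_elim
    case (elim \<omega>)
    then show ?case using A by (intro finite_subset[OF Cl_subset_Union[OF A(2)]]) auto
  qed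
qed

text \<open>Clusters are almost surely finite here, so the decomposition \<open>cluster_sum\<close>
  with constant weight one captures the whole event.\<close>

lemma connection_prob:
  assumes g: "exp_tail s z" and A: "finite A" "inj_on y A" and r: "r \<in> A"
  shows "emeasure M {\<omega>\<in>space M. Inl b \<in> Cl s 1 A y r \<omega>}
    = (\<Sum>K\<in>{K\<in>Pow A. r \<in> K \<and> b \<in> K}. \<Sum>k. ennreal (s ^ k / fact k) *
        (\<integral>\<^sup>+w. ennreal (Phi r K A y s k w) \<partial>PiM {..<k} (\<lambda>_. lborel)))"
proof -
  have s: "0 \<le> s" using g by (simp add: exp_tail_def)
  have "{\<omega>\<in>space M. Inl b \<in> Cl s 1 A y r \<omega>} \<in> sets M" using pred_Cl[OF s] by (simp add: pred_def)
  then have "emeasure M {\<omega>\<in>space M. Inl b \<in> Cl s 1 A y r \<omega>} = (\<integral>\<^sup>+\<omega>. indicator {\<omega>\<in>space M. Inl b \<in> Cl s 1 A y r \<omega>} \<omega> \<partial>M)"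
    by simp
  also have "\<dots> = (\<integral>\<^sup>+\<omega>. (if finite (Cl s 1 A y r \<omega>) \<and> Inl b \<in> Cl s 1 A y r \<omega> then 1 else 0) \<partial>M)"
    by (intro nn_integral_cong_AE, use AE_finite_Cl[OF g A(1) r] AE_space in eventually_elim) (auto simp: indicator_def)
  finally show ?thesis
    using cluster_sum[OF s _ _ A r, of 1 b "\<lambda>_. 1"] by simp
qed

text \<open>The cluster of two added points is covered by the clusters of each of them; the
  bound \<open>2 a b \<le> a\<^sup>2 + b\<^sup>2\<close> for the exponentials then costs half of the exponential rate.\<close>

lemma two_point_exp_moment:
  assumes g: "exp_tail s z" and x: "x \<noteq> 0"
  shows "(\<Sum>k. ennreal (exp (z / 2 * real (Suc (Suc k)))) * (ennreal (s ^ k / fact k) *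
        (\<integral>\<^sup>+w. ennreal (Phi 0 {0, 1} {0, 1} (\<lambda>k. if k = 0 then 0 else x) s k w) \<partial>PiM {..<k} (\<lambda>_. lborel))))
    \<le> (\<Sum>k. ennreal (exp (z * real (Suc k))) * Q s k)"
proof -
  let ?y = "\<lambda>k::nat. if k = 0 then 0 else x" and ?A = "{0, 1::nat}"
  let ?C = "Cl s 1 ?A ?y 0" and ?Ca = "Cl s 1 {0} ?y 0" and ?Cb = "Cl s 1 {1} ?y 1"
  let ?e = "\<lambda>C. if finite C then ennreal (exp (z * real (card C))) else 0"
  have s: "0 \<le> s" and z: "0 < z" using g by (auto simp: exp_tail_def)
  have inj: "inj_on ?y ?A" using x by (auto simp: inj_on_def)
  have "{K\<in>Pow ?A. 0 \<in> K \<and> 1 \<in> K} = {?A}" by auto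
  then have "(\<Sum>k. ennreal (exp (z / 2 * real (Suc (Suc k)))) * (ennreal (s ^ k / fact k) *
        (\<integral>\<^sup>+w. ennreal (Phi 0 ?A ?A ?y s k w) \<partial>PiM {..<k} (\<lambda>_. lborel))))
    = (\<integral>\<^sup>+\<omega>. (if finite (?C \<omega>) \<and> Inl 1 \<in> ?C \<omega> then ennreal (exp (z / 2 * real (card (?C \<omega>)))) else 0) \<partial>M)"
    using cluster_sum[OF s _ _ _ inj, of 1 0 1 "\<lambda>n. ennreal (exp (z / 2 * real n))"] by simp
  also have "\<dots> \<le> (\<integral>\<^sup>+\<omega>. ennreal (1 / 2) * ?e (?Ca \<omega>) + ennreal (1 / 2) * ?e (?Cb \<omega>) \<partial>M)"
  proof (intro nn_integral_mono_AE, use AE_finite_single[OF g, of 0 ?y] AE_finite_single[OF g, of 1 ?y] in eventually_elim)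
    case (elim \<omega>)
    have "?C \<omega> \<subseteq> ?Ca \<omega> \<union> ?Cb \<omega>" using Cl_subset_Union[of 0 ?A s 1 ?y \<omega>] by simp
    then have "card (?C \<omega>) \<le> card (?Ca \<omega>) + card (?Cb \<omega>)"
      using elim card_mono[of "?Ca \<omega> \<union> ?Cb \<omega>" "?C \<omega>"] card_Un_le[of "?Ca \<omega>" "?Cb \<omega>"] by auto
    then have "exp (z / 2 * real (card (?C \<omega>))) \<le> exp (z / 2 * real (card (?Ca \<omega>))) * exp (z / 2 * real (card (?Cb \<omega>)))"
      using z by (simp add: exp_add[symmetric] distrib_left[symmetric])
    also have "\<dots> \<le> 1 / 2 * exp (z * real (card (?Ca \<omega>))) + 1 / 2 * exp (z * real (card (?Cb \<omega>)))"
    proof -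
      define a b where "a = exp (z / 2 * real (card (?Ca \<omega>)))" and "b = exp (z / 2 * real (card (?Cb \<omega>)))"
      have "exp (z * real (card (?Ca \<omega>))) = a * a" "exp (z * real (card (?Cb \<omega>))) = b * b"
        by (simp_all add: a_def b_def exp_add[symmetric])
      moreover have "a * b \<le> 1 / 2 * (a * a) + 1 / 2 * (b * b)" using sum_squares_bound[of a b] by (simp add: power2_eq_square)
      ultimately show ?thesis by (simp add: a_def b_def)
    qed
    finally have "ennreal (exp (z / 2 * real (card (?C \<omega>))))
      \<le> ennreal (1 / 2 * exp (z * real (card (?Ca \<omega>))) + 1 / 2 * exp (z * real (card (?Cb \<omega>))))"
      by (rule ennreal_leI)
    also have "\<dots> = ennreal (1 / 2) * ?e (?Ca \<omega>) + ennreal (1 / 2) * ?e (?Cb \<omega>)"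
      using elim by (simp only: if_True half_ennreal[OF exp_ge_zero exp_ge_zero])
    finally show ?case by (rule order_trans[OF if_le_ennreal])
  qed
  also have "\<dots> = ennreal (1 / 2) * (\<integral>\<^sup>+\<omega>. ?e (?Ca \<omega>) \<partial>M) + ennreal (1 / 2) * (\<integral>\<^sup>+\<omega>. ?e (?Cb \<omega>) \<partial>M)"
  proof -
    have m: "(\<lambda>\<omega>. ?e (Cl s 1 {a} ?y a \<omega>)) \<in> borel_measurable M" for a
      by (rule card_function_measurable) (rule pred_Cl[OF s])
    show ?thesis using m[of 0] m[of 1] by (simp add: nn_integral_add nn_integral_cmult)
  qed
  also have "\<dots> = (ennreal (1 / 2) + ennreal (1 / 2)) * (\<Sum>k. ennreal (exp (z * real (Suc k))) * Q s k)"
    unfolding single_exp_moment[OF g] by (rule distrib_right[symmetric])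
  also have "ennreal (1 / 2) + ennreal (1 / 2) = 1"
    using half_ennreal[of 1 1] by simp
  finally show ?thesis by simp
qed

end

section \<open>Series for the connection probabilities\<close>

lemma pred_eq_euclidean:
  fixes f g :: "'k \<Rightarrow> 'a::euclidean_space"
  assumes [measurable]: "f \<in> borel_measurable N" "g \<in> borel_measurable N"
  shows "Measurable.pred N (\<lambda>k. f k = g k)"
proof -
  have "f k = g k \<longleftrightarrow> dist (f k) (g k) = 0" for k by simp
  then show ?thesis by simp
qed

text \<open>The model case is \<open>\<tau> S S'\<close> equal to the product of
  \<open>1 - a j\<close> over \<open>S\<close> and of \<open>a j\<close> over \<open>S'\<close>;
  then the sum expands \<open>a j = 1 - (1 - a j)\<close> over all \<open>j\<close> in
  \<open>D\<close>. The argument uses only the additive rule for one index, so it also covers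
  integrals of such products. Each induction step moves one \<open>j\<close> from the alternating
  sum into \<open>S0\<close>.\<close>

lemma alternating_sum_split:
  fixes \<tau> :: "'i set \<Rightarrow> 'i set \<Rightarrow> real"
  assumes "finite D"
    and "\<And>S S' j. S \<subseteq> D \<Longrightarrow> j \<in> D \<Longrightarrow> j \<notin> S \<Longrightarrow> j \<notin> S' \<Longrightarrow> \<tau> (insert j S) S' + \<tau> S (insert j S') = \<tau> S S'"
    and "S0 \<inter> D = {}"
  shows "(\<Sum>S\<in>Pow D. (-1) ^ card S * \<tau> S S0) = \<tau> {} (S0 \<union> D)"
  using assms
proof (induction D arbitrary: S0 rule: finite_induct)
  case (insert j D)
  have fin: "finite S" if "S \<in> Pow D" for S using that insert by (auto intro: finite_subset)
  have "(\<Sum>S\<in>Pow (insert j D). (-1) ^ card S * \<tau> S S0)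
    = (\<Sum>S\<in>Pow D. (-1) ^ card S * \<tau> S S0) + (\<Sum>S\<in>insert j ` Pow D. (-1) ^ card S * \<tau> S S0)"
    unfolding Pow_insert using insert by (intro sum.union_disjoint) auto
  also have "(\<Sum>S\<in>insert j ` Pow D. (-1) ^ card S * \<tau> S S0) = (\<Sum>S\<in>Pow D. (-1) ^ card (insert j S) * \<tau> (insert j S) S0)"
  proof (subst sum.reindex)
    show "inj_on (insert j) (Pow D)"
    proof (rule inj_onI)
      fix S S' assume "S \<in> Pow D" "S' \<in> Pow D" "insert j S = insert j S'"
      moreover have "j \<notin> S" "j \<notin> S'" using insert.hyps(2) calculation by auto
      ultimately show "S = S'" by (simp add: insert_ident)
    qed
  qed simp
  also have "\<dots> = (\<Sum>S\<in>Pow D. - ((-1) ^ card S * \<tau> (insert j S) S0))"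
    using insert fin by (intro sum.cong refl) (subst card_insert_disjoint, auto)
  also have "(\<Sum>S\<in>Pow D. (-1) ^ card S * \<tau> S S0) + \<dots> = (\<Sum>S\<in>Pow D. (-1) ^ card S * \<tau> S (insert j S0))"
    unfolding sum.distrib[symmetric]
  proof (rule sum.cong[OF refl])
    fix S assume "S \<in> Pow D"
    then have "\<tau> (insert j S) S0 + \<tau> S (insert j S0) = \<tau> S S0" using insert by (intro insert.prems(1)) auto
    then show "(-1) ^ card S * \<tau> S S0 + - ((-1) ^ card S * \<tau> (insert j S) S0) = (-1) ^ card S * \<tau> S (insert j S0)"
      by (metis (no_types) add_diff_cancel_left' add_uminus_conv_diff right_diff_distrib')
  qed
  also have "\<dots> = \<tau> {} (insert j S0 \<union> D)"
  proof (rule insert.IH)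
    show "\<tau> (insert i S) S' + \<tau> S (insert i S') = \<tau> S S'"
      if "S \<subseteq> D" "i \<in> D" "i \<notin> S" "i \<notin> S'" for S S' i
      using insert.prems(1)[of S i S'] that by blast
    show "insert j S0 \<inter> D = {}" using insert.prems(2) insert.hyps(2) by blast
  qed
  finally show ?case by simp
qed simp

lemma sum_Pow_Pow:
  assumes "finite D"
  shows "(\<Sum>J\<in>Pow D. \<Sum>K\<in>Pow J. f J K) = (\<Sum>K\<in>Pow D. \<Sum>S\<in>Pow (D - K). f (K \<union> S) K)"
proof -
  have fin: "finite J" if "J \<in> Pow D" for J using that assms by (auto intro: finite_subset)
  have "(\<Sum>J\<in>Pow D. \<Sum>K\<in>Pow J. f J K) = (\<Sum>(J, K)\<in>(SIGMA J:Pow D. Pow J). f J K)"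
    using assms fin by (intro sum.Sigma) auto
  also have "\<dots> = (\<Sum>(K, S)\<in>(SIGMA K:Pow D. Pow (D - K)). f (K \<union> S) K)"
    by (rule sum.reindex_bij_witness[of _ "\<lambda>(K, S). (K \<union> S, K)" "\<lambda>(J, K). (K, J - K)"]) (auto simp: Un_absorb1)
  also have "\<dots> = (\<Sum>K\<in>Pow D. \<Sum>S\<in>Pow (D - K). f (K \<union> S) K)"
    using assms by (intro sum.Sigma[symmetric]) auto
  finally show ?thesis .
qed

section \<open>Measurability in the added points and link probabilities\<close>

context random_connection_model
begin

text \<open>Expectations have to be measurable in the added points, including configurations where
  points coincide and the index graph is not the graph on points. Vertices and edges are therefore
  rewritten with equality tests between points and quantifiers over the countable index set.\<close>

lemma pred_mem_cluster:
  fixes z :: "'k \<Rightarrow> 'i::countable \<Rightarrow> 'd point" and u :: "'k \<Rightarrow> 'i \<times> 'i \<Rightarrow> real"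
  assumes z[measurable]: "\<And>i. (\<lambda>k. z k i) \<in> borel_measurable N" and u[measurable]: "\<And>q. (\<lambda>k. u k q) \<in> borel_measurable N"
    and r: "r \<in> I"
  shows "Measurable.pred N (\<lambda>k. z k b \<in> cluster \<phi> (z k r) {({z k i, z k j}, u k (i, j)) | i j. i \<in> I \<and> j \<in> I \<and> lex_less (z k i) (z k j)})"
proof -
  let ?\<xi> = "\<lambda>k. {({z k i, z k j}, u k (i, j)) | i j. i \<in> I \<and> j \<in> I \<and> lex_less (z k i) (z k j)}"
  \<comment> \<open>\<open>Mk k i j p\<close> says that the index pair \<open>p\<close> contributes
    a mark to the edge between the points of \<open>i\<close> and \<open>j\<close>; several pairs
    may do so when points coincide.\<close>
  define Mk where "Mk k i j p \<longleftrightarrow> fst p \<in> I \<and> snd p \<in> I \<and> lex_less (z k (fst p)) (z k (snd p)) \<and>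
     ((z k i = z k (fst p) \<and> z k j = z k (snd p)) \<or> (z k i = z k (snd p) \<and> z k j = z k (fst p)))" for k i j and p :: "'i \<times> 'i"
  have eq[measurable]: "Measurable.pred N (\<lambda>k. z k i = z k j)" for i j by (rule pred_eq_euclidean[OF z z])
  have lx[measurable]: "Measurable.pred N (\<lambda>k. lex_less (z k i) (z k j))" for i j by (rule pred_lex_less[OF z z])
  have Mk[measurable]: "Measurable.pred N (\<lambda>k. Mk k i j p)" for i j p unfolding Mk_def by measurable
  have mem: "({z k i, z k j}, v) \<in> ?\<xi> k \<longleftrightarrow> (\<exists>p. Mk k i j p \<and> v = u k p)" for k i j v
    unfolding Mk_def by (auto simp: doubleton_eq_iff)
  \<comment> \<open>The marks of an edge form a set, so having exactly one mark means that all
    contributing pairs with a mark in \<open>{0..1}\<close> carry the same value.\<close>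
  define vt where "vt k i \<longleftrightarrow> (\<exists>j. j \<in> I \<and> z k i \<noteq> z k j \<and> (\<exists>p. Mk k i j p \<and> 0 \<le> u k p \<and> u k p \<le> 1 \<and>
      (\<forall>q. Mk k i j q \<and> 0 \<le> u k q \<and> u k q \<le> 1 \<longrightarrow> u k q = u k p)))" for k i
  have vtm[measurable]: "Measurable.pred N (\<lambda>k. vt k i)" for i unfolding vt_def by measurable
  have card1: "card {w\<in>{0..1}. ({z k i, z k j}, w) \<in> ?\<xi> k} = 1 \<longleftrightarrow> (\<exists>p. Mk k i j p \<and> 0 \<le> u k p \<and> u k p \<le> 1 \<and>
      (\<forall>q. Mk k i j q \<and> 0 \<le> u k q \<and> u k q \<le> 1 \<longrightarrow> u k q = u k p))" for k i j
  proof -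
    have "card {w\<in>{0..1}. ({z k i, z k j}, w) \<in> ?\<xi> k} = 1 \<longleftrightarrow> (\<exists>v. {w\<in>{0..1}. \<exists>p. Mk k i j p \<and> w = u k p} = {v})"
      unfolding mem by (simp add: card_1_singleton_iff)
    also have "\<dots> \<longleftrightarrow> (\<exists>p. Mk k i j p \<and> 0 \<le> u k p \<and> u k p \<le> 1 \<and>
      (\<forall>q. Mk k i j q \<and> 0 \<le> u k q \<and> u k q \<le> 1 \<longrightarrow> u k q = u k p))"
    proof
      assume "\<exists>v. {w\<in>{0..1}. \<exists>p. Mk k i j p \<and> w = u k p} = {v}"
      then obtain v where v: "{w\<in>{0..1}. \<exists>p. Mk k i j p \<and> w = u k p} = {v}" by blast
      then have "v \<in> {w\<in>{0..1}. \<exists>p. Mk k i j p \<and> w = u k p}" by blast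
      then obtain p where p: "Mk k i j p" "v = u k p" "0 \<le> v" "v \<le> 1" by auto
      have "u k q = u k p" if "Mk k i j q \<and> 0 \<le> u k q \<and> u k q \<le> 1" for q
      proof -
        have "u k q \<in> {w\<in>{0..1}. \<exists>p. Mk k i j p \<and> w = u k p}"
          by (intro CollectI conjI exI[of _ q]) (use that in auto)
        then show ?thesis unfolding v using p by simp
      qed
      then show "\<exists>p. Mk k i j p \<and> 0 \<le> u k p \<and> u k p \<le> 1 \<and>
        (\<forall>q. Mk k i j q \<and> 0 \<le> u k q \<and> u k q \<le> 1 \<longrightarrow> u k q = u k p)" using p by blast
    next
      assume "\<exists>p. Mk k i j p \<and> 0 \<le> u k p \<and> u k p \<le> 1 \<and>
        (\<forall>q. Mk k i j q \<and> 0 \<le> u k q \<and> u k q \<le> 1 \<longrightarrow> u k q = u k p)"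
      then obtain p where p: "Mk k i j p" "0 \<le> u k p" "u k p \<le> 1"
        "\<And>q. Mk k i j q \<Longrightarrow> 0 \<le> u k q \<Longrightarrow> u k q \<le> 1 \<Longrightarrow> u k q = u k p" by blast
      have "{w\<in>{0..1}. \<exists>p. Mk k i j p \<and> w = u k p} = {u k p}"
      proof (intro equalityI subsetI)
        fix w assume "w \<in> {w\<in>{0..1}. \<exists>p. Mk k i j p \<and> w = u k p}"
        then obtain q where q: "Mk k i j q" "w = u k q" "w \<in> {0..1}" by blast
        then show "w \<in> {u k p}" using p(4)[OF q(1)] by simp
      next
        fix w assume "w \<in> {u k p}"
        then show "w \<in> {w\<in>{0..1}. \<exists>p. Mk k i j p \<and> w = u k p}"
          using p(1-3) by (intro CollectI conjI exI[of _ p]) simp_all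
      qed
      then show "\<exists>v. {w\<in>{0..1}. \<exists>p. Mk k i j p \<and> w = u k p} = {v}" by blast
    qed
    finally show ?thesis .
  qed
  have vt: "z k i \<in> graph_verts (?\<xi> k) \<longleftrightarrow> vt k i" if i: "i \<in> I" for k i
  proof
    assume "z k i \<in> graph_verts (?\<xi> k)"
    then obtain e where e: "z k i \<in> e" "card e = 2" "card {w\<in>{0..1}. (e, w) \<in> ?\<xi> k} = 1"
      unfolding graph_verts_def by blast
    from e(3) have "{w\<in>{0..1}. (e, w) \<in> ?\<xi> k} \<noteq> {}" by (metis card.empty zero_neq_one)
    then obtain w where "(e, w) \<in> ?\<xi> k" by blast
    then obtain i' j' where ij: "e = {z k i', z k j'}" "i' \<in> I" "j' \<in> I" by blast
    have "z k i' \<noteq> z k j'" using e(2) ij(1) by auto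
    then obtain j where j: "j \<in> I" "e = {z k i, z k j}" "z k i \<noteq> z k j"
      using e(1) ij by (auto simp: insert_commute)
    show "vt k i" unfolding vt_def using j e(3) card1[of k i j] by auto
  next
    assume "vt k i"
    then obtain j where j: "j \<in> I" "z k i \<noteq> z k j" "card {w\<in>{0..1}. ({z k i, z k j}, w) \<in> ?\<xi> k} = 1"
      unfolding vt_def card1[symmetric] by blast
    then have "{z k i, z k j} \<in> {e. card e = 2 \<and> card {w\<in>{0..1}. (e, w) \<in> ?\<xi> k} = 1}" by simp
    then show "z k i \<in> graph_verts (?\<xi> k)" unfolding graph_verts_def by (rule UnionI) simp
  qed
  define ad where "ad k i j \<longleftrightarrow> vt k i \<and> vt k j \<and> z k i \<noteq> z k j \<and>
     (\<exists>p. Mk k i j p \<and> 0 \<le> u k p \<and> u k p \<le> 1 \<and> u k p \<le> \<phi> (z k j - z k i))" for k i j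
  have adm[measurable]: "Measurable.pred N (\<lambda>k. ad k i j)" for i j unfolding ad_def by measurable
  have ad: "graph_adj \<phi> (?\<xi> k) (z k i) (z k j) \<longleftrightarrow> ad k i j" if "i \<in> I" "j \<in> I" for k i j
    unfolding graph_adj_def vt[OF that(1)] vt[OF that(2)] mem ad_def by (auto simp: Bex_def)
  have verts_sub: "\<exists>j\<in>I. x = z k j" if xv: "x \<in> graph_verts (?\<xi> k)" for x k
  proof -
    obtain e where e: "x \<in> e" "card {w\<in>{0..1}. (e, w) \<in> ?\<xi> k} = 1"
      using xv unfolding graph_verts_def by blast
    from e(2) have "{w\<in>{0..1}. (e, w) \<in> ?\<xi> k} \<noteq> {}" by (metis card.empty zero_neq_one)
    then show ?thesis using e(1) by blast
  qed
  have reach: "(graph_adj \<phi> (?\<xi> k))\<^sup>*\<^sup>* (z k r) x \<longleftrightarrow> x \<in> z k ` reach I (ad k) r" for k x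
  proof
    have sub: "reach I (ad k) r \<subseteq> I" using reach_subset[of I "ad k" r] r by auto
    assume "(graph_adj \<phi> (?\<xi> k))\<^sup>*\<^sup>* (z k r) x"
    then show "x \<in> z k ` reach I (ad k) r"
    proof induction
      case (step a b)
      then obtain i where i: "i \<in> reach I (ad k) r" "a = z k i" by auto
      have "b \<in> graph_verts (?\<xi> k)" using step(2) by (simp add: graph_adj_def)
      then obtain j where j: "j \<in> I" "b = z k j" using verts_sub by blast
      have iI: "i \<in> I" using i sub by auto
      then have "ad k i j" using step(2) ad[OF iI j(1)] i j by simp
      then show ?case using reach_step[OF i(1) iI j(1)] j by blast
    qed simp
  next
    assume "x \<in> z k ` reach I (ad k) r"
    then obtain i where i: "i \<in> reach I (ad k) r" "x = z k i" by auto
    from i(1) have "(graph_adj \<phi> (?\<xi> k))\<^sup>*\<^sup>* (z k r) (z k i)"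
    proof (induction rule: reach_induct)
      case (step i j)
      then show ?case using ad[of i j k] by (meson rtranclp.rtrancl_into_rtrancl)
    qed simp
    then show "(graph_adj \<phi> (?\<xi> k))\<^sup>*\<^sup>* (z k r) x" using i by simp
  qed
  have "z k b \<in> cluster \<phi> (z k r) (?\<xi> k) \<longleftrightarrow>
      (vt k r \<and> (\<exists>c. c \<in> reach I (ad k) r \<and> z k b = z k c)) \<or> (\<not> vt k r \<and> z k b = z k r)" for k
    unfolding cluster_def vt[OF r] using reach[of k "z k b"] by auto
  moreover have "Measurable.pred N (\<lambda>k. c \<in> reach I (ad k) r)" for c
    by (rule pred_reach) auto
  ultimately show ?thesis by simp
qed

definition yf :: "nat \<Rightarrow> 'd point \<Rightarrow> (nat \<Rightarrow> 'd point) \<Rightarrow> nat \<Rightarrow> 'd point" where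
  "yf n x xs = (\<lambda>k. if k = 0 then 0 else if k \<le> n then xs k else x)"

lemma pred_connected_to:
  assumes y: "\<And>a. (\<lambda>k. y k a) \<in> borel_measurable N" and w: "w \<in> measurable N M" and t: "0 \<le> t" and A: "0 \<in> A"
    and y0: "\<And>k. y k 0 = 0"
  shows "Measurable.pred N (\<lambda>k. y k b \<in> cluster \<phi> 0 (marked_edges X U t A (y k) (w k)))"
proof -
  have z: "(\<lambda>k. locs t (y k) (w k) i) \<in> borel_measurable N" for i
    unfolding locs_def using y measurable_compose[OF w Xp_measurable] by (cases i) auto
  have u: "(\<lambda>k. marks t (w k) q) \<in> borel_measurable N" for q
    by (rule measurable_compose[OF w marks_measurable[OF t]])
  have "Inl 0 \<in> idx t A" using A by (simp add: idx_def)
  from pred_mem_cluster[where z="\<lambda>k. locs t (y k) (w k)" and u="\<lambda>k. marks t (w k)" and b="Inl b", OF z u this] show ?thesis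
    unfolding marked_edges_eq by (simp add: locs_def y0)
qed

definition link_prob :: "nat \<Rightarrow> 'd point \<Rightarrow> real \<Rightarrow> (nat \<Rightarrow> 'd point) \<Rightarrow> nat set \<Rightarrow> real" where
  "link_prob n x s xs J = \<P>(\<omega> in M. x \<in> cluster \<phi> 0 (marked_edges X U s ({0} \<union> J \<union> {Suc n}) (yf n x xs) \<omega>))"

lemma pair_conn_eq: "pair_conn M \<phi> X U s x = link_prob 0 x s xs {}"
proof -
  have "yf 0 x xs = (\<lambda>k. if k = 0 then 0 else x)" by (auto simp: yf_def fun_eq_iff)
  moreover have "{0} \<union> {} \<union> {Suc 0} = {0, 1}" by auto
  ultimately show ?thesis by (simp only: pair_conn_def link_prob_def)
qed

lemma link_event_measurable:
  assumes "0 \<le> s"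
  shows "{\<omega>\<in>space M. x \<in> cluster \<phi> 0 (marked_edges X U s ({0} \<union> J \<union> {Suc n}) (yf n x xs) \<omega>)} \<in> sets M"
  using pred_connected_to[of "\<lambda>_. yf n x xs" M "\<lambda>\<omega>. \<omega>" s "{0} \<union> J \<union> {Suc n}" "Suc n"] assms
  by (simp add: yf_def pred_def)

lemma expansion_integrand_eq:
  assumes s: "0 \<le> s"
  shows "expansion_integrand M \<phi> X U n x s xs = (\<Sum>J\<in>Pow {1..n}. (-1) ^ (n - card J) * link_prob n x s xs J)"
proof -
  let ?E = "\<lambda>J. {\<omega>\<in>space M. x \<in> cluster \<phi> 0 (marked_edges X U s ({0} \<union> J \<union> {Suc n}) (yf n x xs) \<omega>)}"
  have "expansion_integrand M \<phi> X U n x s xs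
    = (LINT \<omega>|M. (\<Sum>J\<in>Pow {1..n}. (-1) ^ (n - card J) * indicator (?E J) \<omega>))"
    unfolding expansion_integrand_def yf_def[symmetric]
    by (intro Bochner_Integration.integral_cong refl sum.cong) (auto simp: indicator_def)
  also have "\<dots> = (\<Sum>J\<in>Pow {1..n}. (-1) ^ (n - card J) * (LINT \<omega>|M. indicator (?E J) \<omega>))"
    using link_event_measurable[OF s]
    by (subst Bochner_Integration.integral_sum) (auto intro!: integrable_mult_right integrable_real_indicator simp: emeasure_eq_measure)
  also have "\<dots> = (\<Sum>J\<in>Pow {1..n}. (-1) ^ (n - card J) * link_prob n x s xs J)"
    using link_event_measurable[OF s] by (simp add: link_prob_def)
  finally show ?thesis .
qed

lemma yf_measurable: "(\<lambda>xs. yf n x xs a) \<in> borel_measurable (PiM {1..n} (\<lambda>_. lborel))"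
proof (cases "a \<in> {1..n}")
  case True
  then have "(\<lambda>xs. xs a) \<in> borel_measurable (PiM {1..n} (\<lambda>_. lborel :: 'd point measure))"
    using measurable_component_singleton[of a "{1..n}" "\<lambda>_. lborel :: 'd point measure"] by simp
  then show ?thesis using True by (simp add: yf_def)
qed (auto simp: yf_def)

lemma link_prob_measurable:
  assumes s: "0 \<le> s"
  shows "(\<lambda>xs. link_prob n x s xs J) \<in> borel_measurable (PiM {1..n} (\<lambda>_. lborel))"
proof -
  let ?N = "PiM {1..n} (\<lambda>_. lborel) :: (nat \<Rightarrow> 'd point) measure"
  let ?P = "\<lambda>xs \<omega>. x \<in> cluster \<phi> 0 (marked_edges X U s ({0} \<union> J \<union> {Suc n}) (yf n x xs) \<omega>)"
  have "Measurable.pred (?N \<Otimes>\<^sub>M M) (\<lambda>k. yf n x (fst k) (Suc n) \<in> cluster \<phi> 0 (marked_edges X U s ({0} \<union> J \<union> {Suc n}) (yf n x (fst k)) (snd k)))"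
  proof (rule pred_connected_to[OF _ measurable_snd s])
    show "(\<lambda>k. yf n x (fst k) a) \<in> borel_measurable (?N \<Otimes>\<^sub>M M)" for a
      by (rule measurable_compose[OF measurable_fst yf_measurable])
  qed (auto simp: yf_def)
  then have "Measurable.pred (?N \<Otimes>\<^sub>M M) (\<lambda>k. ?P (fst k) (snd k))" by (simp add: yf_def)
  then have "(\<lambda>(xs, \<omega>). of_bool (?P xs \<omega>) :: real) \<in> borel_measurable (?N \<Otimes>\<^sub>M M)"
    by (simp add: case_prod_beta of_bool_def)
  then have "(\<lambda>xs. LINT \<omega>|M. (of_bool (?P xs \<omega>) :: real)) \<in> borel_measurable ?N"
    by (rule borel_measurable_lebesgue_integral)
  moreover have "(LINT \<omega>|M. (of_bool (?P xs \<omega>) :: real)) = link_prob n x s xs J" for xs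
  proof -
    have "(LINT \<omega>|M. (of_bool (?P xs \<omega>) :: real)) = (LINT \<omega>|M. indicator {\<omega>\<in>space M. ?P xs \<omega>} \<omega>)"
      by (intro Bochner_Integration.integral_cong) (auto simp: indicator_def)
    then show ?thesis using link_event_measurable[OF s] by (simp add: link_prob_def)
  qed
  ultimately show ?thesis by simp
qed

section \<open>Inclusion-exclusion over the added points\<close>

definition link_integrand :: "nat \<Rightarrow> 'd point \<Rightarrow> (nat \<Rightarrow> 'd point) \<Rightarrow> real \<Rightarrow> nat set \<Rightarrow> nat set \<Rightarrow> nat set \<Rightarrow> nat \<Rightarrow> (nat \<Rightarrow> 'd point) \<Rightarrow> real" where
  "link_integrand n x xs s K S S' k w = (let z = case_sum (yf n x xs) w; W = WW ({0} \<union> K \<union> {Suc n}) k in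
     conn_prob (Inl 0) W z * (\<Prod>j\<in>S. 1 - hit z W (xs j)) * (\<Prod>j\<in>S'. hit z W (xs j)) * exp (- (s * V z W)))"

text \<open>\<open>link_series n x xs s K S S'\<close> is the probability that the cluster of \<open>0\<close> contains \<open>x\<close> and, of the points
  \<open>x\<^sub>1, \<dots>, x\<^sub>n\<close>, those with index in \<open>K\<close>, misses those in \<open>S\<close>, and would hit each of those in \<open>S'\<close>.\<close>

definition link_series :: "nat \<Rightarrow> 'd point \<Rightarrow> (nat \<Rightarrow> 'd point) \<Rightarrow> real \<Rightarrow> nat set \<Rightarrow> nat set \<Rightarrow> nat set \<Rightarrow> ennreal" where
  "link_series n x xs s K S S' = (\<Sum>k. ennreal (s ^ k / fact k) * (\<integral>\<^sup>+w. ennreal (link_integrand n x xs s K S S' k w) \<partial>PiM {..<k} (\<lambda>_. lborel)))"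

lemma link_integrand_nonneg: "finite K \<Longrightarrow> 0 \<le> link_integrand n x xs s K S S' k w"
  unfolding link_integrand_def Let_def using hit_bounds
  by (intro mult_nonneg_nonneg prod_nonneg conn_prob_bounds(1)) auto

lemma link_integrand_measurable:
  assumes "finite K"
  shows "link_integrand n x xs s K S S' k \<in> borel_measurable (PiM {..<k} (\<lambda>_. lborel))"
  unfolding link_integrand_def Let_def using assms
  by (intro borel_measurable_times borel_measurable_const borel_measurable_prod borel_measurable_diff
        conn_prob_measurable hit_measurable V_measurable measurable_compose[OF _ borel_measurable_exp] borel_measurable_uminus case_sum_measurable finite_WW) auto

text \<open>An added point is either missed or hit, with probabilities adding up to one. This is the
  rule that \<open>alternating_sum_split\<close> asks for.\<close>

lemma link_series_split:
  assumes K: "finite K" and j: "j \<notin> S" "j \<notin> S'" and fin: "finite S" "finite S'"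
  shows "link_series n x xs s K (insert j S) S' + link_series n x xs s K S (insert j S') = link_series n x xs s K S S'"
proof -
  let ?N = "\<lambda>k. PiM {..<k} (\<lambda>_. lborel) :: (nat \<Rightarrow> 'd point) measure"
  have m: "(\<lambda>w. ennreal (link_integrand n x xs s K S S' k w)) \<in> borel_measurable (?N k)" for S S' k
    by (rule measurable_compose[OF link_integrand_measurable[OF K] measurable_ennreal])
  have "link_integrand n x xs s K (insert j S) S' k w + link_integrand n x xs s K S (insert j S') k w = link_integrand n x xs s K S S' k w" for k w
    using j fin by (simp add: link_integrand_def Let_def algebra_simps)
  then have "ennreal (link_integrand n x xs s K (insert j S) S' k w) + ennreal (link_integrand n x xs s K S (insert j S') k w) = ennreal (link_integrand n x xs s K S S' k w)" for k w
    using link_integrand_nonneg[OF K] by (metis ennreal_plus)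
  then have "(\<integral>\<^sup>+w. ennreal (link_integrand n x xs s K (insert j S) S' k w) \<partial>?N k) + (\<integral>\<^sup>+w. ennreal (link_integrand n x xs s K S (insert j S') k w) \<partial>?N k)
      = (\<integral>\<^sup>+w. ennreal (link_integrand n x xs s K S S' k w) \<partial>?N k)" for k
    by (subst nn_integral_add[symmetric]) (auto intro: m)
  then show ?thesis
    unfolding link_series_def by (subst suminf_add) (auto simp: distrib_left[symmetric] summableI)
qed

lemma link_series_mono: "finite K \<Longrightarrow> link_series n x xs s K S S' \<le> link_series n x xs s K {} {}"
proof -
  assume K: "finite K"
  have "link_integrand n x xs s K S S' k w \<le> link_integrand n x xs s K {} {} k w" for k w
  proof -
    let ?z = "case_sum (yf n x xs) w" and ?W = "WW ({0} \<union> K \<union> {Suc n}) k"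
    have "(\<Prod>j\<in>S. 1 - hit ?z ?W (xs j)) * (\<Prod>j\<in>S'. hit ?z ?W (xs j)) \<le> 1"
      using hit_bounds by (intro mult_le_one prod_le_1 prod_nonneg) auto
    then have "conn_prob (Inl 0) ?W ?z * ((\<Prod>j\<in>S. 1 - hit ?z ?W (xs j)) * (\<Prod>j\<in>S'. hit ?z ?W (xs j))) * exp (- (s * V ?z ?W))
       \<le> conn_prob (Inl 0) ?W ?z * exp (- (s * V ?z ?W))"
      using conn_prob_bounds(1)[of ?W "Inl 0" ?z] K by (intro mult_right_mono mult_left_le) auto
    then show ?thesis by (simp add: link_integrand_def Let_def mult.assoc)
  qed
  then show ?thesis
    unfolding link_series_def by (intro suminf_le mult_left_mono nn_integral_mono ennreal_leI) (auto simp: summableI)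
qed

text \<open>The event is split according to the set \<open>K\<close> of points from \<open>J\<close>
  that lie in the cluster of \<open>0\<close> together with \<open>x\<close>; the others are missed.
  Distinctness of all added points allows the cluster to be read off from indices.\<close>

lemma link_prob_expansion:
  assumes g: "exp_tail s z" and inj: "inj_on (yf n x xs) {0..Suc n}" and J: "J \<subseteq> {1..n}"
  shows "ennreal (link_prob n x s xs J) = (\<Sum>K\<in>Pow J. link_series n x xs s K (J - K) {})"
proof -
  have s: "0 \<le> s" using g by (simp add: exp_tail_def)
  let ?A = "{0} \<union> J \<union> {Suc n}" and ?y = "yf n x xs"
  have A: "finite ?A" using J finite_subset by auto
  have AI: "inj_on ?y ?A" using J by (intro inj_on_subset[OF inj]) auto
  have y0: "?y 0 = 0" "?y (Suc n) = x" by (auto simp: yf_def)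
  have "AE \<omega> in M. inj_on (locs s ?y \<omega>) (idx s ?A) \<and> Cl s 1 ?A ?y 0 \<omega> \<subseteq> idx s ?A \<and>
      cluster \<phi> (?y 0) (marked_edges X U s ?A ?y \<omega>) = locs s ?y \<omega> ` Cl s 1 ?A ?y 0 \<omega>"
    by (rule cluster_eq_Cl[OF s A AI]) simp
  then have ae: "AE \<omega> in M. \<omega> \<in> {\<omega>\<in>space M. x \<in> cluster \<phi> 0 (marked_edges X U s ?A ?y \<omega>)}
      \<longleftrightarrow> \<omega> \<in> {\<omega>\<in>space M. Inl (Suc n) \<in> Cl s 1 ?A ?y 0 \<omega>}"
  proof eventually_elim
    case (elim \<omega>)
    have x: "locs s ?y \<omega> (Inl (Suc n)) = x" and i: "Inl (Suc n) \<in> idx s ?A" using y0 by (auto simp: locs_def idx_def)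
    have "locs s ?y \<omega> (Inl (Suc n)) \<in> locs s ?y \<omega> ` Cl s 1 ?A ?y 0 \<omega> \<longleftrightarrow> Inl (Suc n) \<in> Cl s 1 ?A ?y 0 \<omega>"
      by (rule inj_on_image_mem_iff[of _ "idx s ?A"]) (use elim i in auto)
    moreover have "cluster \<phi> 0 (marked_edges X U s ?A ?y \<omega>) = locs s ?y \<omega> ` Cl s 1 ?A ?y 0 \<omega>"
      using elim y0(1) by simp
    ultimately show ?case unfolding x by (simp only: mem_Collect_eq)
  qed
  have "ennreal (link_prob n x s xs J) = emeasure M {\<omega>\<in>space M. x \<in> cluster \<phi> 0 (marked_edges X U s ?A ?y \<omega>)}"
    by (simp add: link_prob_def emeasure_eq_measure)
  also have "\<dots> = emeasure M {\<omega>\<in>space M. Inl (Suc n) \<in> Cl s 1 ?A ?y 0 \<omega>}"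
    using pred_Cl[OF s] by (intro emeasure_eq_AE ae link_event_measurable[OF s]) (simp add: pred_def)
  also have "\<dots> = (\<Sum>K\<in>{K\<in>Pow ?A. 0 \<in> K \<and> Suc n \<in> K}. \<Sum>k. ennreal (s ^ k / fact k) *
        (\<integral>\<^sup>+w. ennreal (Phi 0 K ?A ?y s k w) \<partial>PiM {..<k} (\<lambda>_. lborel)))"
    by (rule connection_prob[OF g A AI]) simp
  also have "\<dots> = (\<Sum>K\<in>Pow J. link_series n x xs s K (J - K) {})"
  proof (rule sum.reindex_bij_witness[of _ "\<lambda>K. {0} \<union> K \<union> {Suc n}" "\<lambda>K. K - {0, Suc n}"])
    fix K assume K: "K \<in> {K\<in>Pow ?A. 0 \<in> K \<and> Suc n \<in> K}"
    have e: "{0} \<union> (K - {0, Suc n}) \<union> {Suc n} = K" using K by auto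
    then show "{0} \<union> (K - {0, Suc n}) \<union> {Suc n} = K" .
    show "K - {0, Suc n} \<in> Pow J" using K by auto
    have d: "J - (K - {0, Suc n}) = ?A - K" using K J by auto
    have "?y a = xs a" if "a \<in> ?A - K" for a using that K J by (auto simp: yf_def)
    then have "(\<Prod>a\<in>?A - K. 1 - hit (case_sum ?y w) (WW K k) (?y a)) = (\<Prod>a\<in>?A - K. 1 - hit (case_sum ?y w) (WW K k) (xs a))" for w k
      by (intro prod.cong) auto
    then have "Phi 0 K ?A ?y s k w = link_integrand n x xs s (K - {0, Suc n}) (J - (K - {0, Suc n})) {} k w" for k w
      unfolding link_integrand_def Let_def e d Phi_def by (simp add: mult.assoc)
    then show "link_series n x xs s (K - {0, Suc n}) (J - (K - {0, Suc n})) {} = (\<Sum>k. ennreal (s ^ k / fact k) *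
        (\<integral>\<^sup>+w. ennreal (Phi 0 K ?A ?y s k w) \<partial>PiM {..<k} (\<lambda>_. lborel)))"
      by (simp add: link_series_def)
  next
    fix K assume K: "K \<in> Pow J"
    show "{0} \<union> K \<union> {Suc n} - {0, Suc n} = K" using K J by auto
    show "{0} \<union> K \<union> {Suc n} \<in> {K\<in>Pow ?A. 0 \<in> K \<and> Suc n \<in> K}" using K by auto
  qed
  finally show ?thesis .
qed

text \<open>Write \<open>J\<close> as the disjoint union of the part \<open>K\<close> inside the
  cluster and the missed part \<open>S\<close>. For fixed \<open>K\<close> the alternating sum over
  \<open>S\<close> replaces missing by hitting for all remaining points. Only the sign belonging to
  \<open>K\<close> survives, and its factor is nonnegative, so it can be integrated by
  Tonelli.\<close>

lemma expansion_integrand_link_series: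
  assumes g: "exp_tail s z" and inj: "inj_on (yf n x xs) {0..Suc n}"
  shows "expansion_integrand M \<phi> X U n x s xs = (\<Sum>K\<in>Pow {1..n}. (-1) ^ (n - card K) * enn2real (link_series n x xs s K {} ({1..n} - K)))"
proof -
  have s: "0 \<le> s" using g by (simp add: exp_tail_def)
  let ?D = "{1..n}" and ?l = "\<lambda>K S S'. enn2real (link_series n x xs s K S S')"
  have finK: "finite K" if "K \<in> Pow ?D" for K using that finite_subset by auto
  \<comment> \<open>Each series is dominated by one term in the expansion of a probability and so is
    finite; this justifies passing from \<open>ennreal\<close> to real numbers.\<close>
  have fin: "link_series n x xs s K S S' < \<infinity>" if K: "K \<in> Pow ?D" for K S S'
  proof -
    have "link_series n x xs s K S S' \<le> link_series n x xs s K (K - K) {}" using link_series_mono[OF finK[OF K]] by simp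
    also have "\<dots> \<le> (\<Sum>K'\<in>Pow K. link_series n x xs s K' (K - K') {})" using finK[OF K] by (intro member_le_sum) auto
    also have "\<dots> = ennreal (link_prob n x s xs K)" using link_prob_expansion[OF g inj, of K] K by simp
    also have "\<dots> < \<infinity>" by simp
    finally show ?thesis .
  qed
  have lp: "link_prob n x s xs J = (\<Sum>K\<in>Pow J. ?l K (J - K) {})" if J: "J \<in> Pow ?D" for J
  proof -
    have fJ: "link_series n x xs s K (J - K) {} < top" if "K \<in> Pow J" for K using fin[of K "J - K" "{}"] that J by auto
    have "link_prob n x s xs J = enn2real (ennreal (link_prob n x s xs J))" by (simp add: link_prob_def)
    also have "\<dots> = enn2real (\<Sum>K\<in>Pow J. link_series n x xs s K (J - K) {})" using link_prob_expansion[OF g inj, of J] J by simp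
    also have "\<dots> = (\<Sum>K\<in>Pow J. ?l K (J - K) {})" using enn2real_sum[of "Pow J" "\<lambda>K. link_series n x xs s K (J - K) {}"] fJ by (simp add: o_def)
    finally show ?thesis .
  qed
  have "expansion_integrand M \<phi> X U n x s xs = (\<Sum>J\<in>Pow ?D. \<Sum>K\<in>Pow J. (-1) ^ (n - card J) * ?l K (J - K) {})"
    unfolding expansion_integrand_eq[OF s] using lp by (simp add: sum_distrib_left)
  also have "\<dots> = (\<Sum>K\<in>Pow ?D. \<Sum>S\<in>Pow (?D - K). (-1) ^ (n - card (K \<union> S)) * ?l K (K \<union> S - K) {})"
    by (rule sum_Pow_Pow) simp
  also have "\<dots> = (\<Sum>K\<in>Pow ?D. (-1) ^ (n - card K) * (\<Sum>S\<in>Pow (?D - K). (-1) ^ card S * ?l K S {}))"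
  proof (rule sum.cong[OF refl])
    fix K assume K: "K \<in> Pow ?D"
    have "(-1) ^ (n - card (K \<union> S)) * ?l K (K \<union> S - K) {} = (-1) ^ (n - card K) * ((-1) ^ card S * ?l K S {})"
      if S: "S \<in> Pow (?D - K)" for S
    proof -
      have fS: "finite S" using S finite_subset by auto
      have d: "K \<inter> S = {}" "K \<union> S - K = S" using S by auto
      have c: "card (K \<union> S) = card K + card S" using finK[OF K] fS d by (simp add: card_Un_disjoint)
      have "card (K \<union> S) \<le> card ?D" using K S by (intro card_mono) auto
      then have "n - card K = (n - card (K \<union> S)) + card S" using c by simp
      then have "(-1::real) ^ (n - card K) * (-1) ^ card S = (-1) ^ (n - card (K \<union> S))"
        by (simp add: power_add power_mult_distrib[symmetric] mult.assoc)
      then show ?thesis unfolding d by (metis mult.assoc)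
    qed
    then show "(\<Sum>S\<in>Pow (?D - K). (-1) ^ (n - card (K \<union> S)) * ?l K (K \<union> S - K) {})
       = (-1) ^ (n - card K) * (\<Sum>S\<in>Pow (?D - K). (-1) ^ card S * ?l K S {})"
      by (simp add: sum_distrib_left)
  qed
  also have "\<dots> = (\<Sum>K\<in>Pow ?D. (-1) ^ (n - card K) * ?l K {} (?D - K))"
  proof (rule sum.cong[OF refl])
    fix K assume K: "K \<in> Pow ?D"
    define \<tau> where "\<tau> S S' = (if finite S \<and> finite S' then ?l K S S' else 0)" for S S'
    have "(\<Sum>S\<in>Pow (?D - K). (-1) ^ card S * \<tau> S {}) = \<tau> {} ({} \<union> (?D - K))"
    proof (rule alternating_sum_split)
      fix S S' :: "nat set" and j assume "j \<notin> S" "j \<notin> S'"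
      then show "\<tau> (insert j S) S' + \<tau> S (insert j S') = \<tau> S S'"
        using link_series_split[OF finK[OF K], of j S S' n x xs s] fin[OF K]
        by (auto simp: \<tau>_def enn2real_plus[symmetric])
    qed auto
    moreover have "(\<Sum>S\<in>Pow (?D - K). (-1) ^ card S * \<tau> S {}) = (\<Sum>S\<in>Pow (?D - K). (-1) ^ card S * ?l K S {})"
      by (intro sum.cong refl) (auto simp: \<tau>_def intro: finite_subset)
    moreover have "\<tau> {} ({} \<union> (?D - K)) = ?l K {} (?D - K)" by (simp add: \<tau>_def)
    ultimately show "(-1) ^ (n - card K) * (\<Sum>S\<in>Pow (?D - K). (-1) ^ card S * ?l K S {}) = (-1) ^ (n - card K) * ?l K {} (?D - K)"
      by simp
  qed
  finally show ?thesis .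
qed

end

section \<open>Integration over the added points\<close>

text \<open>All coordinates carry the same Lebesgue measure, so the variables of both families can
  be renumbered along \<open>c\<close> and integrated as a single tuple.\<close>

lemma nn_integral_PiM_lborel_merge:
  fixes F :: "(nat \<Rightarrow> 'a::euclidean_space) \<Rightarrow> ennreal" and c :: "nat \<Rightarrow> nat + nat"
  assumes K: "finite K" and c: "bij_betw c {..<m} (Inl ` K \<union> Inr ` {..<k})"
    and F: "F \<in> borel_measurable (PiM {..<m} (\<lambda>_. lborel))"
  shows "(\<integral>\<^sup>+y. (\<integral>\<^sup>+w. F (\<lambda>i\<in>{..<m}. case_sum y w (c i)) \<partial>PiM {..<k} (\<lambda>_. lborel)) \<partial>PiM K (\<lambda>_. lborel))
    = (\<integral>\<^sup>+v. F v \<partial>PiM {..<m} (\<lambda>_. lborel))"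
proof -
  interpret L: product_sigma_finite "\<lambda>_::nat. lborel :: 'a measure" by standard
  let ?QK = "PiM K (\<lambda>_. lborel) :: (nat \<Rightarrow> 'a) measure" and ?Qk = "PiM {..<k} (\<lambda>_. lborel) :: (nat \<Rightarrow> 'a) measure"
  let ?Qm = "PiM {..<m} (\<lambda>_. lborel) :: (nat \<Rightarrow> 'a) measure"
  interpret sK: sigma_finite_measure ?QK by (rule L.sigma_finite[OF K])
  interpret sk: sigma_finite_measure ?Qk by (rule L.sigma_finite) simp
  let ?T = "\<lambda>p. \<lambda>i\<in>{..<m}. case_sum (fst p) (snd p) (c i)"
  have cim: "c ` {..<m} = Inl ` K \<union> Inr ` {..<k}" and cinj: "inj_on c {..<m}" using c by (auto simp: bij_betw_def)
  have T: "?T \<in> measurable (?QK \<Otimes>\<^sub>M ?Qk) ?Qm"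
  proof (rule measurable_restrict)
    fix i assume i: "i \<in> {..<m}"
    then have ci: "c i \<in> Inl ` K \<union> Inr ` {..<k}" using cim by blast
    show "(\<lambda>p. case_sum (fst p) (snd p) (c i)) \<in> measurable (?QK \<Otimes>\<^sub>M ?Qk) lborel"
    proof (cases "c i")
      case (Inl a)
      then have "a \<in> K" using ci by auto
      then show ?thesis using Inl measurable_compose[OF measurable_fst measurable_component_singleton[of a K "\<lambda>_. lborel :: 'a measure"]] by simp
    next
      case (Inr a)
      then have "a \<in> {..<k}" using ci by auto
      then show ?thesis using Inr measurable_compose[OF measurable_snd measurable_component_singleton[of a "{..<k}" "\<lambda>_. lborel :: 'a measure"]] by simp
    qed
  qed
  have "distr (?QK \<Otimes>\<^sub>M ?Qk) ?Qm ?T = ?Qm"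
  proof (rule L.PiM_eqI)
    fix A :: "nat \<Rightarrow> 'a set" assume A: "\<And>i. i \<in> {..<m} \<Longrightarrow> A i \<in> sets lborel"
    define B where "B l = A (the_inv_into {..<m} c l)" for l
    have Bc: "B (c i) = A i" if "i < m" for i using that cinj by (simp add: B_def the_inv_into_f_f)
    have Bs: "B l \<in> sets lborel" if l: "l \<in> Inl ` K \<union> Inr ` {..<k}" for l
    proof -
      have "l \<in> c ` {..<m}" using l unfolding cim .
      then obtain i where i: "i \<in> {..<m}" "l = c i" by blast
      then show ?thesis using Bc[of i] A[of i] by simp
    qed
    have pre: "?T -` Pi\<^sub>E {..<m} A \<inter> space (?QK \<Otimes>\<^sub>M ?Qk) = Pi\<^sub>E K (\<lambda>a. B (Inl a)) \<times> Pi\<^sub>E {..<k} (\<lambda>a. B (Inr a))" (is "?l = ?r")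
    proof (intro set_eqI)
      fix p
      have e1: "p \<in> ?l \<longleftrightarrow> p \<in> space (?QK \<Otimes>\<^sub>M ?Qk) \<and> (\<forall>l\<in>c ` {..<m}. case_sum (fst p) (snd p) l \<in> B l)"
        using Bc by (auto simp: PiE_iff)
      have e2: "(\<forall>l\<in>c ` {..<m}. case_sum (fst p) (snd p) l \<in> B l)
        \<longleftrightarrow> (\<forall>a\<in>K. fst p a \<in> B (Inl a)) \<and> (\<forall>a\<in>{..<k}. snd p a \<in> B (Inr a))"
        unfolding cim ball_Un by simp
      show "p \<in> ?l \<longleftrightarrow> p \<in> ?r"
        unfolding e1 e2 by (cases p) (auto simp: space_pair_measure space_PiM PiE_iff)
    qed
    have "emeasure (distr (?QK \<Otimes>\<^sub>M ?Qk) ?Qm ?T) (Pi\<^sub>E {..<m} A) = emeasure (?QK \<Otimes>\<^sub>M ?Qk) (Pi\<^sub>E K (\<lambda>a. B (Inl a)) \<times> Pi\<^sub>E {..<k} (\<lambda>a. B (Inr a)))"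
      unfolding pre[symmetric] using A by (intro emeasure_distr T sets_PiM_I_finite) auto
    also have "\<dots> = emeasure ?QK (Pi\<^sub>E K (\<lambda>a. B (Inl a))) * emeasure ?Qk (Pi\<^sub>E {..<k} (\<lambda>a. B (Inr a)))"
      using K Bs by (intro sk.emeasure_pair_measure_Times sets_PiM_I_finite) auto
    also have "\<dots> = (\<Prod>a\<in>K. emeasure lborel (B (Inl a))) * (\<Prod>a<k. emeasure lborel (B (Inr a)))"
      using K Bs by (intro arg_cong2[where f="(*)"] L.emeasure_PiM) auto
    also have "\<dots> = (\<Prod>l\<in>Inl ` K \<union> Inr ` {..<k}. emeasure lborel (B l))"
      using K by (subst prod.union_disjoint) (auto simp: prod.reindex)
    also have "\<dots> = (\<Prod>i<m. emeasure lborel (A i))"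
      unfolding cim[symmetric] using cinj Bc by (simp add: prod.reindex)
    finally show "emeasure (distr (?QK \<Otimes>\<^sub>M ?Qk) ?Qm ?T) (Pi\<^sub>E {..<m} A) = (\<Prod>i<m. emeasure lborel (A i))" .
  qed simp_all
  then have "(\<integral>\<^sup>+v. F v \<partial>?Qm) = (\<integral>\<^sup>+v. F v \<partial>distr (?QK \<Otimes>\<^sub>M ?Qk) ?Qm ?T)" by simp
  also have "\<dots> = (\<integral>\<^sup>+p. F (?T p) \<partial>(?QK \<Otimes>\<^sub>M ?Qk))" by (rule nn_integral_distr[OF T]) (simp add: F)
  also have "\<dots> = (\<integral>\<^sup>+y. (\<integral>\<^sup>+w. F (?T (y, w)) \<partial>?Qk) \<partial>?QK)"
    by (rule sk.nn_integral_fst[symmetric]) (rule measurable_compose[OF T F])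
  finally show ?thesis unfolding fst_conv snd_conv by (rule sym)
qed

text \<open>With the other coordinates fixed, the forbidden value of coordinate \<open>i\<close> is
  one point, hence a null set. In the applications \<open>h\<close> is a constant or another
  coordinate.\<close>

lemma AE_PiM_lborel_distinct:
  fixes D :: "nat set"
  assumes D: "finite D" "i \<in> D"
    and h: "h \<in> borel_measurable (PiM (D - {i}) (\<lambda>_. lborel :: 'a::euclidean_space measure))"
  shows "AE xs in PiM D (\<lambda>_. lborel). xs i \<noteq> h (restrict xs (D - {i}))"
proof -
  interpret L: product_sigma_finite "\<lambda>_::nat. lborel :: 'a measure" by standard
  let ?Q = "PiM D (\<lambda>_. lborel) :: (nat \<Rightarrow> 'a) measure" and ?Q' = "PiM (D - {i}) (\<lambda>_. lborel) :: (nat \<Rightarrow> 'a) measure"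
  let ?S = "{xs\<in>space ?Q. xs i = h (restrict xs (D - {i}))}"
  have ins: "insert i (D - {i}) = D" using D by auto
  have "(\<lambda>xs. h (restrict xs (D - {i}))) \<in> borel_measurable ?Q"
    by (rule measurable_compose[OF measurable_restrict_subset h]) auto
  moreover have "(\<lambda>xs. xs i) \<in> borel_measurable ?Q"
    using measurable_component_singleton[OF D(2), of "\<lambda>_. lborel :: 'a measure"] by simp
  ultimately have S: "?S \<in> sets ?Q" using pred_eq_euclidean[of "\<lambda>xs. xs i" ?Q] by (simp add: pred_def)
  have "emeasure ?Q ?S = (\<integral>\<^sup>+xs. indicator ?S xs \<partial>PiM (insert i (D - {i})) (\<lambda>_. lborel))"
    unfolding ins using S by simp
  also have "\<dots> = (\<integral>\<^sup>+x. (\<integral>\<^sup>+y. indicator ?S (x(i := y)) \<partial>lborel) \<partial>?Q')"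
    using D S by (intro L.product_nn_integral_insert) (simp_all add: insert_absorb)
  also have "\<dots> \<le> (\<integral>\<^sup>+x. (\<integral>\<^sup>+y. indicator {h x} y \<partial>lborel) \<partial>?Q')"
  proof (intro nn_integral_mono)
    fix x y assume x: "x \<in> space ?Q'"
    have "restrict (x(i := y)) (D - {i}) = x"
      using x by (auto simp: space_PiM PiE_def extensional_def fun_eq_iff)
    then show "indicator ?S (x(i := y)) \<le> (indicator {h x} y :: ennreal)" by (auto simp: indicator_def)
  qed
  also have "\<dots> = 0" by simp
  finally have "emeasure ?Q ?S = 0" by simp
  then have "AE xs in ?Q. xs \<notin> ?S" using S by (intro AE_not_in) (simp add: null_sets_def)
  then show ?thesis using AE_space by eventually_elim auto
qed

section \<open>Clusters containing the pair \<open>0\<close>, \<open>x\<close> and further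
  points\<close>

context random_connection_model
begin

lemma AE_inj_yf:
  assumes x: "x \<noteq> 0"
  shows "AE xs in PiM {1..n} (\<lambda>_. lborel). inj_on (yf n x xs) {0..Suc n}"
proof -
  let ?Q = "PiM {1..n} (\<lambda>_. lborel) :: (nat \<Rightarrow> 'd point) measure"
  have c: "AE xs in ?Q. \<forall>i\<in>{1..n}. xs i \<noteq> c" for c :: "'d point"
    by (intro AE_finite_allI) (auto intro: AE_PiM_lborel_distinct[where h="\<lambda>_. c"])
  have d: "AE xs in ?Q. \<forall>i\<in>{1..n}. \<forall>j\<in>{1..n}. i \<noteq> j \<longrightarrow> xs i \<noteq> xs j"
  proof (intro AE_finite_allI finite_atLeastAtMost)
    fix i j assume i: "i \<in> {1..n}" and j: "j \<in> {1..n}"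
    show "AE xs in ?Q. i \<noteq> j \<longrightarrow> xs i \<noteq> xs j"
    proof (cases "i = j")
      case False
      have "(\<lambda>xs. xs j) \<in> borel_measurable (PiM ({1..n} - {i}) (\<lambda>_. lborel :: 'd point measure))"
        using measurable_component_singleton[of j "{1..n} - {i}" "\<lambda>_. lborel :: 'd point measure"] j False by simp
      from AE_PiM_lborel_distinct[OF finite_atLeastAtMost i this] show ?thesis
        using j False by (auto elim!: eventually_mono)
    qed simp
  qed
  show ?thesis using c[of 0] c[of x] d
  proof eventually_elim
    case (elim xs)
    show ?case
    proof (rule inj_onI)
      fix a b assume ab: "a \<in> {0..Suc n}" "b \<in> {0..Suc n}" "yf n x xs a = yf n x xs b"
      have "a = 0 \<or> a \<in> {1..n} \<or> a = Suc n" "b = 0 \<or> b \<in> {1..n} \<or> b = Suc n" using ab by auto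
      then consider "a \<in> {1..n}" "b \<in> {1..n}" | "a = 0 \<or> a = Suc n" | "b = 0 \<or> b = Suc n" by blast
      then show "a = b"
      proof cases
        case 1
        then have "xs a = xs b" using ab(3) by (simp add: yf_def)
        then show ?thesis using elim(3) 1 by blast
      next
        case 2
        have "xs b \<noteq> 0" "xs b \<noteq> x" if "b \<in> {1..n}" using elim(1,2) that by blast+
        then show ?thesis using 2 ab x by (auto simp: yf_def split: if_splits)
      next
        case 3
        have "xs a \<noteq> 0" "xs a \<noteq> x" if "a \<in> {1..n}" using elim(1,2) that by blast+
        then show ?thesis using 3 ab x by (auto simp: yf_def split: if_splits)
      qed
    qed
  qed
qed

definition yx :: "'d point \<Rightarrow> nat \<Rightarrow> 'd point" where
  "yx x = (\<lambda>k. if k = 0 then 0 else x)"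

definition pair_prob :: "'d point \<Rightarrow> nat \<Rightarrow> (nat \<Rightarrow> 'd point) \<Rightarrow> real" where
  "pair_prob x m v = conn_prob (Inl 0) (WW {0, 1} m) (case_sum (yx x) v)"

definition pair_volume :: "'d point \<Rightarrow> nat \<Rightarrow> (nat \<Rightarrow> 'd point) \<Rightarrow> real" where
  "pair_volume x m v = V (case_sum (yx x) v) (WW {0, 1} m)"

lemma pair_prob_bounds: "0 \<le> pair_prob x m v" "pair_prob x m v \<le> 1"
  by (auto simp: pair_prob_def intro!: conn_prob_bounds)

lemma card_WW: "finite K \<Longrightarrow> card (WW K k) = card K + k"
  unfolding WW_def by (subst card_Un_disjoint) (auto simp: card_image)

lemma pair_volume_bounds: "0 \<le> pair_volume x m v" "pair_volume x m v \<le> (real m + 2) * m\<phi>"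
  using V_bounds[of "WW {0, 1} m" "case_sum (yx x) v"] by (auto simp: pair_volume_def card_WW algebra_simps)

lemma case_sum_yx_measurable:
  assumes "i \<in> WW {0, 1} m"
  shows "(\<lambda>p. case_sum (yx (fst p)) (snd p) i) \<in> borel_measurable (lborel \<Otimes>\<^sub>M PiM {..<m} (\<lambda>_. lborel))"
proof (cases i)
  case (Inl a)
  then show ?thesis by (auto simp: yx_def)
next
  case (Inr j)
  then have "j \<in> {..<m}" using assms by (auto simp: WW_def)
  then show ?thesis using Inr measurable_compose[OF measurable_snd measurable_component_singleton[of j "{..<m}" "\<lambda>_. lborel :: 'd point measure"]] by simp
qed

lemma pair_prob_measurable2: "(\<lambda>p. pair_prob (fst p) m (snd p)) \<in> borel_measurable (lborel \<Otimes>\<^sub>M PiM {..<m} (\<lambda>_. lborel))"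
  unfolding pair_prob_def by (intro conn_prob_measurable case_sum_yx_measurable) auto

lemma pair_volume_measurable2: "(\<lambda>p. pair_volume (fst p) m (snd p)) \<in> borel_measurable (lborel \<Otimes>\<^sub>M PiM {..<m} (\<lambda>_. lborel))"
  unfolding pair_volume_def by (intro V_measurable case_sum_yx_measurable) auto

lemma pair_prob_measurable [measurable]: "pair_prob x m \<in> borel_measurable (PiM {..<m} (\<lambda>_. lborel))"
  using measurable_compose[OF measurable_Pair1' pair_prob_measurable2, of x m] by simp

lemma pair_volume_measurable [measurable]: "pair_volume x m \<in> borel_measurable (PiM {..<m} (\<lambda>_. lborel))"
  using measurable_compose[OF measurable_Pair1' pair_volume_measurable2, of x m] by simp

text \<open>The power of the volume comes from \<open>q\<close> added points that are required to be
  hit: integrating such a point over space gives one factor \<open>pair_volume\<close>.\<close>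

definition pair_moment :: "real \<Rightarrow> nat \<Rightarrow> nat \<Rightarrow> 'd point \<Rightarrow> ennreal" where
  "pair_moment s m q x = (\<integral>\<^sup>+v. ennreal (pair_prob x m v * pair_volume x m v ^ q * exp (- (s * pair_volume x m v))) \<partial>PiM {..<m} (\<lambda>_. lborel))"

lemma pair_moment_measurable: "pair_moment s m q \<in> borel_measurable borel"
proof -
  interpret L: product_sigma_finite "\<lambda>_::nat. lborel :: 'd point measure" by standard
  interpret sm: sigma_finite_measure "PiM {..<m} (\<lambda>_. lborel) :: (nat \<Rightarrow> 'd point) measure" by (rule L.sigma_finite) simp
  note [measurable] = pair_prob_measurable2 pair_volume_measurable2
  have "(\<lambda>x. \<integral>\<^sup>+v. ennreal (pair_prob x m v * pair_volume x m v ^ q * exp (- (s * pair_volume x m v))) \<partial>PiM {..<m} (\<lambda>_. lborel)) \<in> borel_measurable lborel"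
    by (rule sm.borel_measurable_nn_integral) (simp add: case_prod_beta)
  then show ?thesis by (simp add: pair_moment_def[abs_def])
qed

text \<open>An added point outside \<open>K\<close> enters only through its hit probability, whose
  integral is the volume \<open>V\<close>. The points of \<open>K\<close> are on the same footing as
  the \<open>k\<close> Poisson points and join them as integration variables, which accounts for
  \<open>card K + k\<close>.\<close>

lemma integral_link_series:
  assumes K: "K \<subseteq> {1..n}"
  shows "(\<integral>\<^sup>+xs. link_series n x xs s K {} ({1..n} - K) \<partial>PiM {1..n} (\<lambda>_. lborel))
    = (\<Sum>k. ennreal (s ^ k / fact k) * pair_moment s (card K + k) (n - card K) x)"
    and "(\<lambda>xs. link_series n x xs s K {} ({1..n} - K)) \<in> borel_measurable (PiM {1..n} (\<lambda>_. lborel))"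
proof -
  interpret L: product_sigma_finite "\<lambda>_::nat. lborel :: 'd point measure" by standard
  let ?D = "{1..n}" and ?R = "{1..n} - K" and ?K' = "{0} \<union> K \<union> {Suc n}"
  let ?Q = "\<lambda>I. PiM I (\<lambda>_. lborel) :: (nat \<Rightarrow> 'd point) measure"
  have fK: "finite K" using K finite_subset by auto
  interpret sk: sigma_finite_measure "?Q {..<k}" for k by (rule L.sigma_finite) simp
  interpret sR: sigma_finite_measure "?Q ?R" by (rule L.sigma_finite) simp
  let ?z = "\<lambda>xs w. case_sum (yf n x xs) w"
  have zm: "(\<lambda>p. ?z (fst p) (snd p) i) \<in> borel_measurable (?Q ?D \<Otimes>\<^sub>M ?Q {..<k})" if "i \<in> WW ?K' k" for i k
  proof (cases i)
    case (Inl a)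
    then show ?thesis using measurable_compose[OF measurable_fst yf_measurable] by simp
  next
    case (Inr j)
    then have "j \<in> {..<k}" using that by (auto simp: WW_def)
    then show ?thesis using Inr measurable_compose[OF measurable_snd measurable_component_singleton[of j "{..<k}" "\<lambda>_. lborel :: 'd point measure"]] by simp
  qed
  have xm: "(\<lambda>p. fst p j) \<in> borel_measurable (?Q ?D \<Otimes>\<^sub>M ?Q {..<k})" if "j \<in> ?R" for j k
    using that measurable_compose[OF measurable_fst measurable_component_singleton[of j ?D "\<lambda>_. lborel :: 'd point measure"]] by auto
  have LLm: "(\<lambda>p. link_integrand n x (fst p) s K {} ?R k (snd p)) \<in> borel_measurable (?Q ?D \<Otimes>\<^sub>M ?Q {..<k})" for k
    unfolding link_integrand_def Let_def
    by (intro borel_measurable_times borel_measurable_const borel_measurable_prod borel_measurable_diff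
        conn_prob_measurable hit_measurable V_measurable measurable_compose[OF _ borel_measurable_exp] borel_measurable_uminus zm xm finite_WW)
       (use fK in auto)
  have LLm': "(\<lambda>xs. \<integral>\<^sup>+w. ennreal (link_integrand n x xs s K {} ?R k w) \<partial>?Q {..<k}) \<in> borel_measurable (?Q ?D)" for k
    using LLm[of k] by (intro sk.borel_measurable_nn_integral) (simp add: case_prod_beta)
  show "(\<lambda>xs. link_series n x xs s K {} ?R) \<in> borel_measurable (?Q ?D)"
    unfolding link_series_def using LLm' by simp
  have "(\<integral>\<^sup>+xs. link_series n x xs s K {} ?R \<partial>?Q ?D)
     = (\<Sum>k. ennreal (s ^ k / fact k) * (\<integral>\<^sup>+xs. (\<integral>\<^sup>+w. ennreal (link_integrand n x xs s K {} ?R k w) \<partial>?Q {..<k}) \<partial>?Q ?D))"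
    unfolding link_series_def using LLm' by (simp add: nn_integral_suminf nn_integral_cmult)
  also have "\<dots> = (\<Sum>k. ennreal (s ^ k / fact k) * pair_moment s (card K + k) (n - card K) x)"
  proof (intro suminf_cong arg_cong2[where f="(*)"] refl)
    fix k
    let ?m = "card K + k" and ?W = "WW ?K' k"
    have DK: "K \<union> ?R = ?D" "K \<inter> ?R = {}" using K by auto
    have fW: "finite ?W" using fK by simp
    let ?G = "\<lambda>y w. conn_prob (Inl 0) ?W (?z y w)" and ?v = "\<lambda>y w. V (?z y w) ?W"
    \<comment> \<open>The coordinates outside \<open>K\<close> do not occur among the locations
      indexed by \<open>?W\<close>, so their integrals separate.\<close>
    have mg: "?z (merge K ?R (y, u)) w i = ?z y w i" if "i \<in> ?W" for y u w i
      using that K by (auto simp: WW_def yf_def merge_def)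
    have cc: "conn_prob (Inl 0) ?W (?z (merge K ?R (y, u)) w) = ?G y w" for y u w
      using conn_prob_relabel[of id ?W "Inl 0" "?z (merge K ?R (y, u)) w" "?z y w"] mg by (simp add: WW_def)
    have hh: "hit (?z (merge K ?R (y, u)) w) ?W b = hit (?z y w) ?W b" for y u w b
      using hit_relabel[of id ?W "?z (merge K ?R (y, u)) w" "?z y w"] mg by simp
    have vv: "V (?z (merge K ?R (y, u)) w) ?W = ?v y w" for y u w
      using V_relabel[of id ?W "?z (merge K ?R (y, u)) w" "?z y w"] mg by simp
    have link_integrand_merge: "ennreal (link_integrand n x (merge K ?R (y, u)) s K {} ?R k w) =
        ennreal (?G y w * exp (- (s * ?v y w))) * (\<Prod>j\<in>?R. ennreal (hit (?z y w) ?W (u j)))" for y u w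
    proof -
      have "link_integrand n x (merge K ?R (y, u)) s K {} ?R k w = (?G y w * exp (- (s * ?v y w))) * (\<Prod>j\<in>?R. hit (?z y w) ?W (u j))"
      proof -
        have "(\<Prod>j\<in>?R. hit (?z y w) ?W (merge K ?R (y, u) j)) = (\<Prod>j\<in>?R. hit (?z y w) ?W (u j))"
          by (rule prod.cong) (auto simp: merge_def)
        then show ?thesis unfolding link_integrand_def Let_def cc hh vv by (simp only: prod.empty mult_1_right mult_ac)
      qed
      moreover have "ennreal ((?G y w * exp (- (s * ?v y w))) * (\<Prod>j\<in>?R. hit (?z y w) ?W (u j)))
        = ennreal (?G y w * exp (- (s * ?v y w))) * ennreal (\<Prod>j\<in>?R. hit (?z y w) ?W (u j))"
        using conn_prob_bounds[OF fW] hit_bounds by (intro ennreal_mult mult_nonneg_nonneg prod_nonneg) auto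
      moreover have "(\<Prod>j\<in>?R. ennreal (hit (?z y w) ?W (u j))) = ennreal (\<Prod>j\<in>?R. hit (?z y w) ?W (u j))"
        by (intro prod_ennreal hit_bounds)
      ultimately show ?thesis by (simp only:)
    qed
    have hm: "(\<lambda>b. ennreal (hit z ?W b)) \<in> borel_measurable lborel" for z :: "point_index \<Rightarrow> 'd point"
      by (auto intro!: measurable_compose[OF _ measurable_ennreal] hit_measurable)
    have inner: "(\<integral>\<^sup>+u. ennreal (link_integrand n x (merge K ?R (y, u)) s K {} ?R k w) \<partial>?Q ?R)
       = ennreal (?G y w * ?v y w ^ (n - card K) * exp (- (s * ?v y w)))" for y w
    proof -
      have "(\<integral>\<^sup>+u. ennreal (link_integrand n x (merge K ?R (y, u)) s K {} ?R k w) \<partial>?Q ?R)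
        = ennreal (?G y w * exp (- (s * ?v y w))) * (\<integral>\<^sup>+u. (\<Prod>j\<in>?R. ennreal (hit (?z y w) ?W (u j))) \<partial>?Q ?R)"
        unfolding link_integrand_merge
      proof (intro nn_integral_cmult borel_measurable_prod_ennreal)
        fix j assume "j \<in> ?R"
        from measurable_compose[OF measurable_component_singleton[OF this, of "\<lambda>_. lborel :: 'd point measure"] hm[of "?z y w"]]
        show "(\<lambda>u. ennreal (hit (?z y w) ?W (u j))) \<in> borel_measurable (?Q ?R)" .
      qed
      also have "(\<integral>\<^sup>+u. (\<Prod>j\<in>?R. ennreal (hit (?z y w) ?W (u j))) \<partial>?Q ?R) = (\<Prod>j\<in>?R. ennreal (?v y w))"
      proof -
        have "(\<integral>\<^sup>+u. (\<Prod>j\<in>?R. ennreal (hit (?z y w) ?W (u j))) \<partial>?Q ?R) = (\<Prod>j\<in>?R. \<integral>\<^sup>+b. ennreal (hit (?z y w) ?W b) \<partial>lborel)"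
          by (rule L.product_nn_integral_prod[of ?R "\<lambda>_ b. ennreal (hit (?z y w) ?W b)"]) (use hm in simp_all)
        then show ?thesis by (simp only: V_bounds(1)[OF fW])
      qed
      also have "\<dots> = ennreal (?v y w ^ (n - card K))"
        using V_bounds[OF fW] fK K by (simp add: ennreal_power card_Diff_subset)
      also have "ennreal (?G y w * exp (- (s * ?v y w))) * ennreal (?v y w ^ (n - card K)) = ennreal (?G y w * ?v y w ^ (n - card K) * exp (- (s * ?v y w)))"
        using V_bounds[OF fW] conn_prob_bounds[OF fW] by (subst ennreal_mult[symmetric]) (auto simp: mult_ac)
      finally show ?thesis .
    qed
    have "(\<integral>\<^sup>+xs. (\<integral>\<^sup>+w. ennreal (link_integrand n x xs s K {} ?R k w) \<partial>?Q {..<k}) \<partial>?Q ?D)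
       = (\<integral>\<^sup>+y. (\<integral>\<^sup>+u. (\<integral>\<^sup>+w. ennreal (link_integrand n x (merge K ?R (y, u)) s K {} ?R k w) \<partial>?Q {..<k}) \<partial>?Q ?R) \<partial>?Q K)"
      using L.product_nn_integral_fold[OF DK(2) fK, of "\<lambda>xs. \<integral>\<^sup>+w. ennreal (link_integrand n x xs s K {} ?R k w) \<partial>?Q {..<k}"] LLm'[of k]
      unfolding DK(1) by simp
    also have "\<dots> = (\<integral>\<^sup>+y. (\<integral>\<^sup>+w. (\<integral>\<^sup>+u. ennreal (link_integrand n x (merge K ?R (y, u)) s K {} ?R k w) \<partial>?Q ?R) \<partial>?Q {..<k}) \<partial>?Q K)"
    proof (rule nn_integral_cong)
      fix y assume y: "y \<in> space (?Q K)"
      interpret P: pair_sigma_finite "?Q ?R" "?Q {..<k}" by standard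
      have mm: "(\<lambda>u. merge K ?R (y, u)) \<in> measurable (?Q ?R) (?Q ?D)"
        using measurable_compose[OF measurable_Pair1'[OF y] measurable_merge[where J="?R"]] unfolding DK(1) .
      have "(\<lambda>p. ennreal (link_integrand n x (merge K ?R (y, fst p)) s K {} ?R k (snd p))) \<in> borel_measurable (?Q ?R \<Otimes>\<^sub>M ?Q {..<k})"
        using measurable_compose[OF measurable_Pair[OF measurable_compose[OF measurable_fst mm] measurable_snd] LLm[of k]]
        by (intro measurable_compose[OF _ measurable_ennreal]) simp
      then show "(\<integral>\<^sup>+u. (\<integral>\<^sup>+w. ennreal (link_integrand n x (merge K ?R (y, u)) s K {} ?R k w) \<partial>?Q {..<k}) \<partial>?Q ?R)
        = (\<integral>\<^sup>+w. (\<integral>\<^sup>+u. ennreal (link_integrand n x (merge K ?R (y, u)) s K {} ?R k w) \<partial>?Q ?R) \<partial>?Q {..<k})"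
        by (intro P.Fubini'[symmetric]) (simp add: case_prod_beta)
    qed
    also have "\<dots> = (\<integral>\<^sup>+y. (\<integral>\<^sup>+w. ennreal (?G y w * ?v y w ^ (n - card K) * exp (- (s * ?v y w))) \<partial>?Q {..<k}) \<partial>?Q K)"
      unfolding inner ..
    also have "\<dots> = pair_moment s ?m (n - card K) x"
    proof -
      have "card (Inl ` K \<union> Inr ` {..<k} :: point_index set) = ?m"
        using card_WW[OF fK, of k] by (simp add: WW_def)
      moreover have "finite (Inl ` K \<union> Inr ` {..<k} :: point_index set)" using fK by simp
      ultimately obtain c :: "nat \<Rightarrow> point_index" where c: "bij_betw c {..<?m} (Inl ` K \<union> Inr ` {..<k})"
        using ex_bij_betw_nat_finite[of "Inl ` K \<union> Inr ` {..<k} :: point_index set"] by (auto simp: atLeast0LessThan)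
      have cim: "c ` {..<?m} = Inl ` K \<union> Inr ` {..<k}" and cinj: "inj_on c {..<?m}" using c by (auto simp: bij_betw_def)
      let ?F = "\<lambda>v. ennreal (pair_prob x ?m v * pair_volume x ?m v ^ (n - card K) * exp (- (s * pair_volume x ?m v)))"
      \<comment> \<open>Index \<open>1\<close> of the pair stands for \<open>x\<close>, which has
        index \<open>Suc n\<close> among the added points; \<open>c\<close> places the remaining
        coordinates.\<close>
      let ?f = "case_sum (\<lambda>a. if a = 0 then Inl 0 else Inl (Suc n)) c :: point_index \<Rightarrow> point_index"
      have ci: "c i \<noteq> Inl 0" "c i \<noteq> Inl (Suc n)" if "i < ?m" for i
      proof -
        have "c i \<in> Inl ` K \<union> Inr ` {..<k}" using that cim by blast
        then show "c i \<noteq> Inl 0" "c i \<noteq> Inl (Suc n)" using K by auto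
      qed
      have f: "inj_on ?f (WW {0, 1} ?m)"
      proof (rule inj_onI)
        fix a b assume ab: "a \<in> WW {0, 1} ?m" "b \<in> WW {0, 1} ?m" "?f a = ?f b"
        show "a = b"
        proof (cases a)
          case (Inl a')
          then show ?thesis using ab ci by (cases b) (auto simp: WW_def split: if_splits)
        next
          case (Inr i)
          show ?thesis
          proof (cases b)
            case (Inl b')
            then show ?thesis using Inr ab ci[of i] by (auto simp: WW_def split: if_splits)
          next
            case (Inr j)
            then show ?thesis using \<open>a = Inr i\<close> ab inj_onD[OF cinj, of i j] by (auto simp: WW_def)
          qed
        qed
      qed
      have fim: "?f ` WW {0, 1} ?m = ?W"
      proof -
        have "?f ` WW {0, 1} ?m = {Inl 0, Inl (Suc n)} \<union> c ` {..<?m}" by (auto simp: WW_def image_Un image_image)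
        then show ?thesis unfolding cim by (auto simp: WW_def)
      qed
      have FE: "?F (\<lambda>i\<in>{..<?m}. case_sum y w (c i)) = ennreal (?G y w * ?v y w ^ (n - card K) * exp (- (s * ?v y w)))" for y w
      proof -
        let ?u = "\<lambda>i\<in>{..<?m}. case_sum y w (c i)"
        have zz: "case_sum (yx x) ?u i = ?z y w (?f i)" if "i \<in> WW {0, 1} ?m" for i
        proof (cases i)
          case (Inl a)
          then show ?thesis using that by (auto simp: WW_def yx_def yf_def)
        next
          case (Inr j)
          then have j: "j < ?m" using that by (auto simp: WW_def)
          then have "c j \<in> Inl ` K \<union> Inr ` {..<k}" using cim by blast
          then have "case_sum y w (c j) = ?z y w (c j)" using K by (auto simp: yf_def)
          then show ?thesis using Inr j by simp
        qed
        have "conn_prob (Inl 0) (WW {0, 1} ?m) (case_sum (yx x) ?u) = conn_prob (?f (Inl 0)) (?f ` WW {0, 1} ?m) (?z y w)"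
        proof (rule conn_prob_relabel[OF f])
          show "Inl 0 \<in> WW {0, 1} ?m" by (simp add: WW_def)
          show "case_sum (yx x) ?u i = ?z y w (?f i)" if "i \<in> WW {0, 1} ?m" for i using that by (rule zz)
        qed
        then have "pair_prob x ?m ?u = ?G y w" unfolding pair_prob_def fim by simp
        moreover
        have "V (case_sum (yx x) ?u) (WW {0, 1} ?m) = V (?z y w) (?f ` WW {0, 1} ?m)"
        proof (rule V_relabel[OF f])
          show "case_sum (yx x) ?u i = ?z y w (?f i)" if "i \<in> WW {0, 1} ?m" for i using that by (rule zz)
        qed
        then have "pair_volume x ?m ?u = ?v y w" unfolding pair_volume_def fim .
        ultimately show ?thesis by simp
      qed
      have "?F \<in> borel_measurable (?Q {..<?m})" by measurable
      from nn_integral_PiM_lborel_merge[OF fK c this] show ?thesis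
        unfolding FE by (simp add: pair_moment_def)
    qed
    finally show "(\<integral>\<^sup>+xs. (\<integral>\<^sup>+w. ennreal (link_integrand n x xs s K {} ?R k w) \<partial>?Q {..<k}) \<partial>?Q ?D) = pair_moment s ?m (n - card K) x" .
  qed
  finally show "(\<integral>\<^sup>+xs. link_series n x xs s K {} ?R \<partial>?Q ?D) = (\<Sum>k. ennreal (s ^ k / fact k) * pair_moment s (card K + k) (n - card K) x)" .
qed

end

section \<open>Taylor expansion in the intensity\<close>

lemma ennreal_suminf_sums:
  assumes nn: "\<And>i. 0 \<le> f i" and fin: "(\<Sum>i. ennreal (f i)) < \<infinity>"
  shows "f sums enn2real (\<Sum>i. ennreal (f i))"
proof -
  have s: "summable f" using fin nn by (intro summable_suminf_not_top) auto
  have "(\<Sum>i. ennreal (f i)) = ennreal (suminf f)" by (rule suminf_ennreal2[OF nn s])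
  then show ?thesis using suminf_nonneg[OF s nn] summable_sums[OF s] by simp
qed

lemma sums_le_single:
  fixes f :: "nat \<Rightarrow> real"
  assumes "f sums a" "\<And>n. 0 \<le> f n" shows "f n \<le> a"
  using sum_le_suminf[OF sums_summable[OF assms(1)], of "{n}"] assms by (simp add: sums_iff)

lemma sums_abs_le:
  fixes f :: "nat \<Rightarrow> real"
  assumes f: "f sums a" and c: "c sums b" and le: "\<And>n. \<bar>f n\<bar> \<le> c n" shows "\<bar>a\<bar> \<le> b"
proof -
  have s: "summable (\<lambda>n. \<bar>f n\<bar>)"
    by (rule summable_comparison_test'[OF sums_summable[OF c], of 0]) (use le in auto)
  have "\<bar>suminf f\<bar> \<le> (\<Sum>n. \<bar>f n\<bar>)" by (rule summable_rabs[OF s])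
  also have "\<dots> \<le> suminf c" by (intro suminf_le le s sums_summable[OF c])
  finally show ?thesis using f c by (simp add: sums_iff)
qed

text \<open>\<open>tcoeff s v m n\<close> is the coefficient of \<open>h\<^sup>n\<close> in \<open>(s + h)\<^sup>m exp (h v)\<close>; its absolute value at \<open>- v\<close>
  is at most its value at \<open>v\<close>.\<close>

definition tcoeff :: "real \<Rightarrow> real \<Rightarrow> nat \<Rightarrow> nat \<Rightarrow> real" where
  "tcoeff s v m n = (\<Sum>l\<le>n. real (m choose l) * s ^ (m - l) * (v ^ (n - l) / fact (n - l)))"

text \<open>Cauchy product of the binomial expansion with the exponential series.\<close>

lemma tcoeff_sums:
  "(\<lambda>n. h ^ n * tcoeff s v m n) sums ((s + h) ^ m * exp (h * v))"
proof -
  let ?a = "\<lambda>l. real (m choose l) * s ^ (m - l) * h ^ l" and ?b = "\<lambda>j. (h * v) ^ j / fact j"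
  have a0: "?a l = 0" if "l \<notin> {..m}" for l using that by (simp add: binomial_eq_0)
  have suma: "summable (\<lambda>l. norm (?a l))" using a0 by (intro summable_finite[of "{..m}"]) auto
  have "?a sums (\<Sum>l\<in>{..m}. ?a l)" by (rule sums_finite) (use a0 in auto)
  also have "(\<Sum>l\<in>{..m}. ?a l) = (s + h) ^ m"
    by (subst add.commute) (simp add: binomial_ring mult_ac)
  finally have A: "(\<Sum>l. ?a l) = (s + h) ^ m" by (simp add: sums_iff)
  have b: "?b sums exp (h * v)"
    using exp_converges[of "h * v"] by (simp add: scaleR_conv_of_real field_simps)
  have sumb: "summable (\<lambda>j. norm (?b j))"
    using summable_norm_exp[of "h * v"] by (simp add: scaleR_conv_of_real field_simps)
  have B: "(\<Sum>j. ?b j) = exp (h * v)" using b by (simp add: sums_iff)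
  have "(\<lambda>n. \<Sum>l\<le>n. ?a l * ?b (n - l)) sums ((\<Sum>l. ?a l) * (\<Sum>j. ?b j))"
    by (rule Cauchy_product_sums[OF suma sumb])
  moreover have "(\<Sum>l\<le>n. ?a l * ?b (n - l)) = h ^ n * tcoeff s v m n" for n
    unfolding tcoeff_def sum_distrib_left
  proof (rule sum.cong[OF refl])
    fix l assume "l \<in> {..n}"
    then have "h ^ n = h ^ l * h ^ (n - l)" by (simp add: power_add[symmetric])
    then show "?a l * ?b (n - l) = h ^ n * (real (m choose l) * s ^ (m - l) * (v ^ (n - l) / fact (n - l)))"
      by (simp add: power_mult_distrib)
  qed
  ultimately show ?thesis unfolding A B by simp
qed

lemma tcoeff_nonneg: "0 \<le> s \<Longrightarrow> 0 \<le> v \<Longrightarrow> 0 \<le> tcoeff s v m n"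
  unfolding tcoeff_def by (intro sum_nonneg mult_nonneg_nonneg divide_nonneg_nonneg zero_le_power) auto

text \<open>A Cauchy estimate: a nonnegative term of a power series evaluated at \<open>r\<close> is
  at most its sum there.\<close>

lemma tcoeff_term_le:
  assumes "0 \<le> s" "0 \<le> v" "0 < r" "l \<le> n"
  shows "r ^ n * (real (m choose l) * s ^ (m - l) * (v ^ (n - l) / fact (n - l))) \<le> (s + r) ^ m * exp (r * v)"
proof -
  have "r ^ n * (real (m choose l) * s ^ (m - l) * (v ^ (n - l) / fact (n - l))) \<le> r ^ n * tcoeff s v m n"
    unfolding tcoeff_def using assms
    by (intro mult_left_mono member_le_sum[of l "{..n}" "\<lambda>l. real (m choose l) * s ^ (m - l) * (v ^ (n - l) / fact (n - l))"]) auto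
  also have "\<dots> \<le> (s + r) ^ m * exp (r * v)"
    by (rule sums_le_single[OF tcoeff_sums]) (use assms tcoeff_nonneg[OF assms(1,2), of m] in simp)
  finally show ?thesis .
qed

text \<open>Within radius \<open>r / 2\<close> the term of order \<open>n\<close> is at most
  \<open>(1 / 2) ^ n\<close> times the corresponding term of the majorant at \<open>r\<close>, so
  the tail from \<open>N\<close> on gains the factor \<open>(1 / 2) ^ N\<close>.\<close>

lemma tcoeff_remainder:
  assumes s: "0 \<le> s" and v: "0 \<le> v" and r: "0 < r" and h: "\<bar>h\<bar> \<le> r / 2"
  shows "\<bar>(s + h) ^ m * exp (- (h * v)) - (\<Sum>n<N. h ^ n * tcoeff s (- v) m n)\<bar> \<le> (1 / 2) ^ N * ((s + r) ^ m * exp (r * v))"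
proof -
  let ?T = "\<lambda>n. h ^ n * tcoeff s (- v) m n" and ?H = "\<lambda>n. r ^ n * tcoeff s v m n"
  have H: "?H sums ((s + r) ^ m * exp (r * v))" by (rule tcoeff_sums)
  have H0: "0 \<le> ?H n" for n using tcoeff_nonneg[OF s v] r by simp
  have T: "?T sums ((s + h) ^ m * exp (- (h * v)))" using tcoeff_sums[of h s "- v" m] by simp
  have abs: "\<bar>tcoeff s (- v) m n\<bar> \<le> tcoeff s v m n" for n
    unfolding tcoeff_def using s v
    by (intro order_trans[OF sum_abs] sum_mono) (simp add: abs_mult power_abs)
  have le: "\<bar>?T n\<bar> \<le> (1 / 2) ^ n * ?H n" for n
  proof -
    have "\<bar>?T n\<bar> = \<bar>h\<bar> ^ n * \<bar>tcoeff s (- v) m n\<bar>" by (simp add: abs_mult power_abs)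
    also have "\<dots> \<le> (r / 2) ^ n * tcoeff s v m n" using h abs by (intro mult_mono power_mono) auto
    also have "\<dots> = (1 / 2) ^ n * ?H n" by (simp add: power_divide)
    finally show ?thesis .
  qed
  have le': "\<bar>?T (n + N)\<bar> \<le> (1 / 2) ^ N * ?H (n + N)" for n
  proof -
    have "(1 / 2 :: real) ^ (n + N) \<le> (1 / 2) ^ N" by (intro power_decreasing) auto
    then have "(1 / 2) ^ (n + N) * ?H (n + N) \<le> (1 / 2) ^ N * ?H (n + N)" using H0 by (intro mult_right_mono)
    then show ?thesis using le[of "n + N"] by linarith
  qed
  have sH: "summable (\<lambda>n. ?H (n + N))" using sums_summable[OF H] by (rule summable_ignore_initial_segment)
  have sT: "summable (\<lambda>n. \<bar>?T (n + N)\<bar>)"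
    by (rule summable_comparison_test'[OF summable_mult[OF sH, of "(1 / 2) ^ N"], of 0]) (use le' in auto)
  have "(s + h) ^ m * exp (- (h * v)) - (\<Sum>n<N. ?T n) = (\<Sum>n. ?T (n + N))"
    using suminf_split_initial_segment[OF sums_summable[OF T], of N] T by (simp add: sums_iff)
  also have "\<bar>\<dots>\<bar> \<le> (\<Sum>n. \<bar>?T (n + N)\<bar>)" by (rule summable_rabs[OF sT])
  also have "\<dots> \<le> (\<Sum>n. (1 / 2) ^ N * ?H (n + N))" by (intro suminf_le le' sT summable_mult sH)
  also have "\<dots> = (1 / 2) ^ N * (\<Sum>n. ?H (n + N))" by (rule suminf_mult[OF sH])
  also have "\<dots> \<le> (1 / 2) ^ N * ((s + r) ^ m * exp (r * v))"
  proof (intro mult_left_mono)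
    have "(\<Sum>n. ?H (n + N)) = suminf ?H - (\<Sum>n<N. ?H n)"
      using suminf_split_initial_segment[OF sums_summable[OF H], of N] by simp
    also have "\<dots> \<le> suminf ?H" using sum_nonneg[of "{..<N}" ?H] H0 by simp
    finally show "(\<Sum>n. ?H (n + N)) \<le> (s + r) ^ m * exp (r * v)" using H by (simp add: sums_iff)
  qed simp
  finally show ?thesis .
qed

lemma sum_Pow_card:
  assumes "finite D"
  shows "(\<Sum>K\<in>Pow D. f (card K)) = (\<Sum>l\<le>card D. real (card D choose l) * f l)"
proof -
  have "(\<Sum>K\<in>Pow D. f (card K)) = (\<Sum>l\<in>{..card D}. \<Sum>K\<in>{K\<in>Pow D. card K = l}. f (card K))"
    using assms by (intro sum.group[symmetric]) (auto intro: card_mono)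
  also have "\<dots> = (\<Sum>l\<le>card D. real (card D choose l) * f l)"
  proof (rule sum.cong[OF refl])
    fix l
    have "card {K \<in> Pow D. card K = l} = card D choose l" using n_subsets[OF assms, of l] by simp
    then show "(\<Sum>K\<in>{K\<in>Pow D. card K = l}. f (card K)) = real (card D choose l) * f l" by simp
  qed
  finally show ?thesis .
qed

section \<open>Coefficients and remainder of the expansion\<close>

context random_connection_model
begin

definition pair_exp :: "real \<Rightarrow> real \<Rightarrow> nat \<Rightarrow> 'd point \<Rightarrow> ennreal" where
  "pair_exp s r m x = (\<integral>\<^sup>+v. ennreal (pair_prob x m v * exp ((r - s) * pair_volume x m v)) \<partial>PiM {..<m} (\<lambda>_. lborel))"

definition pair_majorant :: "real \<Rightarrow> real \<Rightarrow> 'd point \<Rightarrow> ennreal" where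
  "pair_majorant s r x = (\<Sum>m. ennreal ((s + r) ^ m / fact m) * pair_exp s r m x)"

text \<open>Up to sign and factorials, the contribution to \<open>p_n\<close> of \<open>l\<close>
  added points inside the cluster and \<open>n - l\<close> added points that are only hit.\<close>

definition coeff_series :: "real \<Rightarrow> nat \<Rightarrow> nat \<Rightarrow> 'd point \<Rightarrow> ennreal" where
  "coeff_series s n l x = (\<Sum>k. ennreal (s ^ k / fact k) * pair_moment s (l + k) (n - l) x)"

lemma coeff_series_measurable: "coeff_series s n l \<in> borel_measurable borel"
  unfolding coeff_series_def[abs_def] using pair_moment_measurable by simp

text \<open>Put \<open>m = l + k\<close>. Since \<open>1 / fact k\<close> is
  \<open>fact l / fact m\<close> times the binomial coefficient \<open>m choose l\<close>, the
  integrand is up to factorials a single term of \<open>tcoeff\<close>, to which the Cauchy estimate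
  applies.\<close>

lemma coeff_series_le:
  assumes s: "0 \<le> s" and r: "0 < r" and l: "l \<le> n"
  shows "coeff_series s n l x \<le> ennreal (fact l * fact (n - l) / r ^ n) * pair_majorant s r x"
proof -
  have "ennreal (s ^ k / fact k) * pair_moment s (l + k) (n - l) x
     \<le> ennreal (fact l * fact (n - l) / r ^ n) * (ennreal ((s + r) ^ (l + k) / fact (l + k)) * pair_exp s r (l + k) x)" for k
  proof -
    let ?Q = "PiM {..<l+k} (\<lambda>_. lborel) :: (nat \<Rightarrow> 'd point) measure"
    let ?g = "pair_prob x (l + k)" and ?v = "pair_volume x (l + k)"
    let ?c = "fact l * fact (n - l) / r ^ n :: real"
    have "s ^ k / fact k * (?g v * ?v v ^ (n - l) * exp (- (s * ?v v)))
      \<le> ?c * ((s + r) ^ (l + k) / fact (l + k)) * (?g v * exp ((r - s) * ?v v))" for v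
    proof -
      have v0: "0 \<le> ?v v" by (rule pair_volume_bounds)
      have ch: "real ((l + k) choose l) = fact (l + k) / (fact l * fact k)"
        using binomial_fact[of l "l + k", where 'a=real] by simp
      have "r ^ n * (real ((l + k) choose l) * s ^ k * (?v v ^ (n - l) / fact (n - l))) \<le> (s + r) ^ (l + k) * exp (r * ?v v)"
        using tcoeff_term_le[OF s v0 r l, of "l + k"] by simp
      then have "s ^ k / fact k * ?v v ^ (n - l) \<le> ?c * ((s + r) ^ (l + k) / fact (l + k)) * exp (r * ?v v)"
        unfolding ch using r by (simp add: field_simps)
      then have "(s ^ k / fact k * ?v v ^ (n - l)) * (?g v * exp (- (s * ?v v)))
        \<le> (?c * ((s + r) ^ (l + k) / fact (l + k)) * exp (r * ?v v)) * (?g v * exp (- (s * ?v v)))"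
        using pair_prob_bounds by (intro mult_right_mono) auto
      also have "\<dots> = ?c * ((s + r) ^ (l + k) / fact (l + k)) * (?g v * (exp (r * ?v v) * exp (- (s * ?v v))))"
        by (simp only: mult_ac)
      also have "exp (r * ?v v) * exp (- (s * ?v v)) = exp ((r - s) * ?v v)"
        by (simp add: exp_add[symmetric] left_diff_distrib)
      finally show ?thesis by (simp only: mult_ac)
    qed
    note pt = this
    have "ennreal (s ^ k / fact k) * pair_moment s (l + k) (n - l) x
      = (\<integral>\<^sup>+v. ennreal (s ^ k / fact k * (?g v * ?v v ^ (n - l) * exp (- (s * ?v v)))) \<partial>?Q)"
      unfolding pair_moment_def using s pair_prob_bounds pair_volume_bounds
      by (subst nn_integral_cmult[symmetric]) (auto intro!: nn_integral_cong simp: ennreal_mult[symmetric])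
    also have "\<dots> \<le> (\<integral>\<^sup>+v. ennreal (?c * ((s + r) ^ (l + k) / fact (l + k)) * (?g v * exp ((r - s) * ?v v))) \<partial>?Q)"
      by (intro nn_integral_mono ennreal_leI pt)
    also have "\<dots> = ennreal (?c * ((s + r) ^ (l + k) / fact (l + k))) * pair_exp s r (l + k) x"
      unfolding pair_exp_def using s r pair_prob_bounds
      by (subst nn_integral_cmult[symmetric]) (auto intro!: nn_integral_cong simp: ennreal_mult[symmetric])
    also have "ennreal (?c * ((s + r) ^ (l + k) / fact (l + k))) = ennreal ?c * ennreal ((s + r) ^ (l + k) / fact (l + k))"
      using s r by (intro ennreal_mult) auto
    finally show ?thesis by (simp only: mult.assoc)
  qed
  then have "coeff_series s n l x \<le> (\<Sum>k. ennreal (fact l * fact (n - l) / r ^ n) * (ennreal ((s + r) ^ (l + k) / fact (l + k)) * pair_exp s r (l + k) x))"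
    unfolding coeff_series_def by (intro suminf_le) (auto simp: summableI)
  also have "\<dots> = ennreal (fact l * fact (n - l) / r ^ n) * (\<Sum>k. ennreal ((s + r) ^ (l + k) / fact (l + k)) * pair_exp s r (l + k) x)"
    by simp
  also have "(\<Sum>k. ennreal ((s + r) ^ (l + k) / fact (l + k)) * pair_exp s r (l + k) x) \<le> pair_majorant s r x"
    unfolding pair_majorant_def
    using suminf_offset[of "\<lambda>m. ennreal ((s + r) ^ m / fact m) * pair_exp s r m x" l] by (simp add: summableI add.commute)
  finally show ?thesis by (simp add: mult_left_mono)
qed

text \<open>Added points are almost everywhere distinct, so the integrand may be replaced by its
  link series and integrated term by term. The result depends only on the size of \<open>K\<close>,
  and the \<open>n choose l\<close> sets of equal size combine with \<open>1 / fact n\<close>. The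
  finite majorant permits the return from \<open>ennreal\<close> to signed reals.\<close>

lemma expansion_coeff_coeff_series:
  assumes g: "exp_tail s z" and x: "x \<noteq> 0" and r: "0 < r" and S: "pair_majorant s r x < \<infinity>"
  shows "expansion_coeff M \<phi> X U n x s = (\<Sum>l\<le>n. (-1) ^ (n - l) / (fact l * fact (n - l)) * enn2real (coeff_series s n l x))"
proof -
  have s: "0 \<le> s" using g by (simp add: exp_tail_def)
  have fin: "coeff_series s n l x < \<infinity>" if "l \<le> n" for l
    using coeff_series_le[OF s r that, of x] S by (auto simp: ennreal_mult_less_top intro: le_less_trans)
  show ?thesis
  proof (cases "n = 0")
    case True
    have "inj_on (yf 0 x (\<lambda>_. 0)) {0..Suc 0}" using x by (auto simp: inj_on_def yf_def)
    from link_prob_expansion[OF g this, of "{}"] have "ennreal (link_prob 0 x s (\<lambda>_. 0) {}) = link_series 0 x (\<lambda>_. 0) s {} {} {}" by simp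
    also have "\<dots> = coeff_series s 0 0 x"
    proof -
      have y: "yf 0 x (\<lambda>_. 0) = yx x" by (auto simp: yf_def yx_def fun_eq_iff)
      have K: "{0} \<union> {} \<union> {Suc 0} = {0, 1::nat}" by auto
      have "link_integrand 0 x (\<lambda>_. 0) s {} {} {} k w = pair_prob x k w * pair_volume x k w ^ 0 * exp (- (s * pair_volume x k w))" for k w
        unfolding link_integrand_def Let_def pair_prob_def pair_volume_def y K prod.empty power_0 by (simp only: mult_1_right)
      then show ?thesis unfolding link_series_def coeff_series_def pair_moment_def diff_0_eq_0 add_0 by (simp only:)
    qed
    finally have "enn2real (ennreal (link_prob 0 x s (\<lambda>_. 0) {})) = enn2real (coeff_series s 0 0 x)" by (rule arg_cong)
    moreover have "0 \<le> link_prob 0 x s (\<lambda>_. 0) {}" unfolding link_prob_def by (rule measure_nonneg)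
    ultimately have "link_prob 0 x s (\<lambda>_. 0) {} = enn2real (coeff_series s 0 0 x)" by (simp only: enn2real_ennreal)
    then show ?thesis using True by (simp add: expansion_coeff_def pair_conn_eq[of s x "\<lambda>_. 0"])
  next
    case False
    let ?D = "{1..n}" and ?Q = "PiM {1..n} (\<lambda>_. lborel) :: (nat \<Rightarrow> 'd point) measure"
    let ?L = "\<lambda>K xs. link_series n x xs s K {} (?D - K)"
    have cD: "card K \<le> n" if "K \<in> Pow ?D" for K using that card_mono[of ?D K] by simp
    have LI: "(\<integral>\<^sup>+xs. ?L K xs \<partial>?Q) = coeff_series s n (card K) x" if "K \<in> Pow ?D" for K
      using integral_link_series(1)[of K n x s] that by (simp add: coeff_series_def)
    have Lm: "?L K \<in> borel_measurable ?Q" if "K \<in> Pow ?D" for K using integral_link_series(2)[of K n x s] that by simp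
    have Lfin: "AE xs in ?Q. ?L K xs \<noteq> \<infinity>" if K: "K \<in> Pow ?D" for K
      using LI[OF K] fin[OF cD[OF K]] Lm[OF K] by (intro nn_integral_PInf_AE) auto
    have int: "integrable ?Q (\<lambda>xs. enn2real (?L K xs))" "(LINT xs|?Q. enn2real (?L K xs)) = enn2real (coeff_series s n (card K) x)"
      if K: "K \<in> Pow ?D" for K
    proof -
      have m: "(\<lambda>xs. enn2real (?L K xs)) \<in> borel_measurable ?Q" using Lm[OF K] by (rule borel_measurable_enn2real)
      have e: "(\<integral>\<^sup>+xs. ennreal (enn2real (?L K xs)) \<partial>?Q) = coeff_series s n (card K) x"
        unfolding LI[OF K, symmetric]
        by (intro nn_integral_cong_AE, use Lfin[OF K] in eventually_elim) (auto simp: less_top)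
      show "integrable ?Q (\<lambda>xs. enn2real (?L K xs))"
        using e fin[OF cD[OF K]] by (intro integrableI_nonneg m) auto
      show "(LINT xs|?Q. enn2real (?L K xs)) = enn2real (coeff_series s n (card K) x)"
        unfolding e[symmetric] by (rule integral_eq_nn_integral[OF m]) simp
    qed
    have "expansion_coeff M \<phi> X U n x s = 1 / fact n * (LINT xs|?Q. expansion_integrand M \<phi> X U n x s xs)"
      using False by (simp add: expansion_coeff_def)
    also have "(LINT xs|?Q. expansion_integrand M \<phi> X U n x s xs)
      = (LINT xs|?Q. (\<Sum>K\<in>Pow ?D. (-1) ^ (n - card K) * enn2real (?L K xs)))"
    proof (rule integral_cong_AE)
      show "(\<lambda>xs. expansion_integrand M \<phi> X U n x s xs) \<in> borel_measurable ?Q"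
        unfolding expansion_integrand_eq[OF s]
        by (intro borel_measurable_sum borel_measurable_times borel_measurable_const link_prob_measurable s)
      show "(\<lambda>xs. \<Sum>K\<in>Pow ?D. (-1) ^ (n - card K) * enn2real (?L K xs)) \<in> borel_measurable ?Q"
        using Lm by (intro borel_measurable_sum borel_measurable_times borel_measurable_const borel_measurable_enn2real) auto
      show "AE xs in ?Q. expansion_integrand M \<phi> X U n x s xs = (\<Sum>K\<in>Pow ?D. (-1) ^ (n - card K) * enn2real (?L K xs))"
        using AE_inj_yf[OF x, of n] by eventually_elim (rule expansion_integrand_link_series[OF g])
    qed
    also have "\<dots> = (\<Sum>K\<in>Pow ?D. (-1) ^ (n - card K) * enn2real (coeff_series s n (card K) x))"
      using int by (subst Bochner_Integration.integral_sum) auto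
    also have "\<dots> = (\<Sum>l\<le>n. real (n choose l) * ((-1) ^ (n - l) * enn2real (coeff_series s n l x)))"
      using sum_Pow_card[of ?D "\<lambda>l. (-1) ^ (n - l) * enn2real (coeff_series s n l x)"] by simp
    also have "1 / fact n * \<dots> = (\<Sum>l\<le>n. (-1) ^ (n - l) / (fact l * fact (n - l)) * enn2real (coeff_series s n l x))"
      unfolding sum_distrib_left
    proof (rule sum.cong[OF refl])
      fix l assume "l \<in> {..n}"
      then have "real (n choose l) = fact n / (fact l * fact (n - l))" using binomial_fact[of l n, where 'a=real] by simp
      then show "1 / fact n * (real (n choose l) * ((-1) ^ (n - l) * enn2real (coeff_series s n l x)))
        = (-1) ^ (n - l) / (fact l * fact (n - l)) * enn2real (coeff_series s n l x)" by simp
    qed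
    finally show ?thesis .
  qed
qed

text \<open>The factorials of \<open>coeff_series_le\<close> cancel. What remains are
  \<open>n + 1\<close> equal bounds, and \<open>n + 1 \<le> 2 ^ n\<close> turns \<open>1 / r\<close>
  into \<open>2 / r\<close>.\<close>

lemma expansion_coeff_bound:
  assumes g: "exp_tail s z" and x: "x \<noteq> 0" and r: "0 < r" and S: "pair_majorant s r x < \<infinity>"
  shows "ennreal \<bar>expansion_coeff M \<phi> X U n x s\<bar> \<le> ennreal ((2 / r) ^ n) * pair_majorant s r x"
proof -
  have s: "0 \<le> s" using g by (simp add: exp_tail_def)
  let ?S = "enn2real (pair_majorant s r x)"
  have H: "enn2real (coeff_series s n l x) \<le> fact l * fact (n - l) / r ^ n * ?S" if l: "l \<le> n" for l
  proof -
    have "enn2real (coeff_series s n l x) \<le> enn2real (ennreal (fact l * fact (n - l) / r ^ n) * pair_majorant s r x)"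
      using coeff_series_le[OF s r l, of x] S by (intro enn2real_mono) (auto simp: ennreal_mult_less_top)
    then show ?thesis using r by (simp add: enn2real_mult)
  qed
  have "\<bar>expansion_coeff M \<phi> X U n x s\<bar> \<le> (\<Sum>l\<le>n. \<bar>(-1) ^ (n - l) / (fact l * fact (n - l)) * enn2real (coeff_series s n l x)\<bar>)"
    unfolding expansion_coeff_coeff_series[OF assms] by (rule sum_abs)
  also have "\<dots> \<le> (\<Sum>l\<le>n. ?S / r ^ n)"
  proof (rule sum_mono)
    fix l assume "l \<in> {..n}"
    then have "1 / (fact l * fact (n - l)) * enn2real (coeff_series s n l x) \<le> 1 / (fact l * fact (n - l)) * (fact l * fact (n - l) / r ^ n * ?S)"
      using H by (intro mult_left_mono) auto
    then show "\<bar>(-1) ^ (n - l) / (fact l * fact (n - l)) * enn2real (coeff_series s n l x)\<bar> \<le> ?S / r ^ n"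
      by (simp add: abs_mult power_abs)
  qed
  also have "\<dots> = (real n + 1) * (?S / r ^ n)" by (simp add: algebra_simps)
  also have "\<dots> \<le> 2 ^ n * (?S / r ^ n)"
  proof (rule mult_right_mono)
    have "n + 1 \<le> 2 ^ n" by (induction n) auto
    then have "real (n + 1) \<le> real (2 ^ n)" by (rule of_nat_mono)
    then show "real n + 1 \<le> 2 ^ n" by simp
  qed (use r in simp)
  also have "\<dots> = (2 / r) ^ n * ?S" by (simp add: power_divide)
  finally have "ennreal \<bar>expansion_coeff M \<phi> X U n x s\<bar> \<le> ennreal ((2 / r) ^ n * ?S)" by (rule ennreal_leI)
  also have "\<dots> = ennreal ((2 / r) ^ n) * pair_majorant s r x" using S r by (simp add: ennreal_mult)
  finally show ?thesis .
qed

text \<open>For each \<open>m\<close> the estimate \<open>tcoeff_remainder\<close> is integrated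
  against \<open>pair_prob\<close> times \<open>exp (- (s * pair_volume))\<close> and then summed
  with weight \<open>1 / fact m\<close>. This works because the connection probability at
  \<open>t\<close> and the coefficients at \<open>s\<close> are such sums, of
  \<open>(s + h) ^ m * exp (- (h * y))\<close> and of its Taylor coefficients.\<close>

lemma expansion_remainder:
  assumes g: "exp_tail s z" and gt: "exp_tail t z'" and x: "x \<noteq> 0" and r: "0 < r" and S: "pair_majorant s r x < \<infinity>"
    and h: "\<bar>t - s\<bar> \<le> r / 2"
  shows "ennreal \<bar>pair_conn M \<phi> X U t x - (\<Sum>n<N. (t - s) ^ n * expansion_coeff M \<phi> X U n x s)\<bar>
    \<le> ennreal ((1 / 2) ^ N) * pair_majorant s r x"
proof -
  have s: "0 \<le> s" and t: "0 \<le> t" using g gt by (auto simp: exp_tail_def)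
  define h where "h = t - s"
  let ?Q = "\<lambda>m. PiM {..<m} (\<lambda>_. lborel) :: (nat \<Rightarrow> 'd point) measure"
  let ?g = "pair_prob x" and ?v = "pair_volume x"
  have g0: "0 \<le> ?g m v" and v0: "0 \<le> ?v m v" for m v using pair_prob_bounds pair_volume_bounds by auto
  have Gfin: "pair_exp s r m x < \<infinity>" for m
  proof -
    have "ennreal ((s + r) ^ m / fact m) * pair_exp s r m x \<le> pair_majorant s r x"
      unfolding pair_majorant_def using ennreal_suminf_lessD by (intro sum_le_suminf[of _ "{m}", simplified]) (auto simp: summableI)
    then have "ennreal ((s + r) ^ m / fact m) * pair_exp s r m x < \<infinity>" using S by (rule le_less_trans)
    moreover have "(s + r) ^ m / fact m > 0" using s r by simp
    then have "ennreal ((s + r) ^ m / fact m) \<noteq> 0" by (simp only: ennreal_eq_0_iff not_le)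
    ultimately show ?thesis unfolding infinity_ennreal_def ennreal_mult_less_top by auto
  qed
  have Gint: "integrable (?Q m) (\<lambda>v. ?g m v * exp ((r - s) * ?v m v))" for m
    using Gfin[of m] g0 by (intro integrableI_nonneg) (auto simp: pair_exp_def)
  define G where "G m = (LINT v|?Q m. ?g m v * exp ((r - s) * ?v m v))" for m
  have GG: "pair_exp s r m x = ennreal (G m)" and G0: "0 \<le> G m" for m
    unfolding pair_exp_def G_def using Gint[of m] g0 by (auto intro!: nn_integral_eq_integral integral_nonneg_AE)
  have Ssum: "(\<lambda>m. (s + r) ^ m / fact m * G m) sums enn2real (pair_majorant s r x)"
  proof -
    have e: "ennreal ((s + r) ^ m / fact m) * pair_exp s r m x = ennreal ((s + r) ^ m / fact m * G m)" for m
      unfolding GG using s r G0 by (intro ennreal_mult[symmetric]) auto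
    show ?thesis using S s r G0 unfolding pair_majorant_def e by (intro ennreal_suminf_sums mult_nonneg_nonneg) auto
  qed
  \<comment> \<open>Functions of the volume that grow no faster than \<open>exp (r * y)\<close> are
    integrable against the weight, by comparison with \<open>pair_exp\<close>, which the finite
    majorant makes finite.\<close>
  have dom: "integrable (?Q m) (\<lambda>v. ?g m v * f (?v m v) * exp (- (s * ?v m v)))"
    if [measurable]: "f \<in> borel_measurable borel" and f: "\<And>y. 0 \<le> y \<Longrightarrow> \<bar>f y\<bar> \<le> C * exp (r * y)" for f :: "real \<Rightarrow> real" and C m
  proof (rule Bochner_Integration.integrable_bound[OF integrable_mult_right[OF Gint[of m], of C]])
    show "AE v in ?Q m. norm (?g m v * f (?v m v) * exp (- (s * ?v m v))) \<le> norm (C * (?g m v * exp ((r - s) * ?v m v)))"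
    proof (intro AE_I2)
      fix v
      have "?g m v * \<bar>f (?v m v)\<bar> * exp (- (s * ?v m v)) \<le> ?g m v * (C * exp (r * ?v m v)) * exp (- (s * ?v m v))"
        using g0 f[OF v0] by (intro mult_right_mono mult_left_mono) auto
      also have "\<dots> = C * (?g m v * (exp (r * ?v m v) * exp (- (s * ?v m v))))" by (simp only: mult_ac)
      also have "exp (r * ?v m v) * exp (- (s * ?v m v)) = exp ((r - s) * ?v m v)"
        by (simp add: exp_add[symmetric] left_diff_distrib)
      finally have "?g m v * \<bar>f (?v m v)\<bar> * exp (- (s * ?v m v)) \<le> C * (?g m v * exp ((r - s) * ?v m v))" .
      also have "\<dots> \<le> \<bar>C\<bar> * (?g m v * exp ((r - s) * ?v m v))"
        using g0 by (intro mult_right_mono abs_ge_self) auto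
      finally show "norm (?g m v * f (?v m v) * exp (- (s * ?v m v))) \<le> norm (C * (?g m v * exp ((r - s) * ?v m v)))"
        using g0 by (simp add: abs_mult)
    qed
  qed measurable
  define E where "E m f = (LINT v|?Q m. ?g m v * f (?v m v) * exp (- (s * ?v m v)))" for m and f :: "real \<Rightarrow> real"
  have pow_int: "integrable (?Q m) (\<lambda>v. ?g m v * ?v m v ^ q * exp (- (s * ?v m v)))" for m q
  proof (rule dom[of "\<lambda>y. y ^ q" "fact q / r ^ q"])
    fix y :: real assume y: "0 \<le> y"
    have "(\<lambda>n. (r * y) ^ n / fact n) sums exp (r * y)"
      using exp_converges[of "r * y"] by (simp add: scaleR_conv_of_real field_simps)
    then have "(r * y) ^ q / fact q \<le> exp (r * y)" by (rule sums_le_single) (use y r in simp)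
    then show "\<bar>y ^ q\<bar> \<le> fact q / r ^ q * exp (r * y)" using y r by (simp add: power_mult_distrib field_simps)
  qed measurable
  have pair_moment: "pair_moment s m q x = ennreal (E m (\<lambda>y. y ^ q))" and E0: "0 \<le> E m (\<lambda>y. y ^ q)" for m q
    unfolding pair_moment_def E_def using pow_int[of m q] g0 v0
    by (auto intro!: nn_integral_eq_integral integral_nonneg_AE)
  \<comment> \<open>Renumbered by \<open>m = l + k\<close>; the binomial coefficient supplies zero
    terms for \<open>m < l\<close>, so the series for all \<open>l\<close> run over the same range
    and can be added.\<close>
  have HHs: "(\<lambda>m. real (m choose l) * s ^ (m - l) * (fact l / fact m) * E m (\<lambda>y. y ^ (n - l))) sums enn2real (coeff_series s n l x)"
    if l: "l \<le> n" for n l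
  proof -
    let ?f = "\<lambda>m. real (m choose l) * s ^ (m - l) * (fact l / fact m) * E m (\<lambda>y. y ^ (n - l))"
    have fin: "coeff_series s n l x < \<infinity>"
      using coeff_series_le[OF s r l, of x] S by (auto simp: ennreal_mult_less_top intro: le_less_trans)
    have e: "ennreal (s ^ k / fact k) * pair_moment s (l + k) (n - l) x = ennreal (s ^ k / fact k * E (l + k) (\<lambda>y. y ^ (n - l)))" for k
      unfolding pair_moment using s E0 by (intro ennreal_mult[symmetric]) auto
    have "(\<lambda>k. s ^ k / fact k * E (l + k) (\<lambda>y. y ^ (n - l))) sums enn2real (coeff_series s n l x)"
      using fin s E0 unfolding coeff_series_def e by (intro ennreal_suminf_sums mult_nonneg_nonneg) auto
    moreover have "s ^ k / fact k * E (l + k) (\<lambda>y. y ^ (n - l)) = ?f (k + l)" for k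
      using binomial_fact[of l "k + l", where 'a=real] by (simp add: add.commute)
    ultimately have "(\<lambda>k. ?f (k + l)) sums enn2real (coeff_series s n l x)" by (simp only:)
    moreover have "?f i = 0" if "i < l" for i using that by (simp add: binomial_eq_0)
    ultimately show ?thesis using sums_zero_iff_shift[of l ?f "enn2real (coeff_series s n l x)"] by blast
  qed
  have tc_int: "integrable (?Q m) (\<lambda>v. ?g m v * tcoeff s (- ?v m v) m n * exp (- (s * ?v m v)))"
    and tc_E: "E m (\<lambda>y. tcoeff s (- y) m n)
      = (\<Sum>l\<le>n. real (m choose l) * s ^ (m - l) * ((-1) ^ (n - l) / fact (n - l)) * E m (\<lambda>y. y ^ (n - l)))" for m n
  proof -
    have eq: "?g m v * tcoeff s (- ?v m v) m n * exp (- (s * ?v m v))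
      = (\<Sum>l\<le>n. real (m choose l) * s ^ (m - l) * ((-1) ^ (n - l) / fact (n - l)) * (?g m v * ?v m v ^ (n - l) * exp (- (s * ?v m v))))" for v
      unfolding tcoeff_def sum_distrib_left sum_distrib_right power_minus[of "?v m v"]
      by (intro sum.cong refl) (simp only: times_divide_eq_left times_divide_eq_right mult_ac)
    show "integrable (?Q m) (\<lambda>v. ?g m v * tcoeff s (- ?v m v) m n * exp (- (s * ?v m v)))"
      unfolding eq by (intro Bochner_Integration.integrable_sum integrable_mult_right pow_int)
    show "E m (\<lambda>y. tcoeff s (- y) m n)
      = (\<Sum>l\<le>n. real (m choose l) * s ^ (m - l) * ((-1) ^ (n - l) / fact (n - l)) * E m (\<lambda>y. y ^ (n - l)))"
      unfolding E_def eq using pow_int by (subst Bochner_Integration.integral_sum) auto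
  qed
  \<comment> \<open>Here the coefficient defined by inclusion-exclusion is recognised as a Taylor
    coefficient, summand by summand in \<open>m\<close>.\<close>
  have psum: "(\<lambda>m. 1 / fact m * E m (\<lambda>y. tcoeff s (- y) m n)) sums expansion_coeff M \<phi> X U n x s" for n
  proof -
    have "(\<lambda>m. \<Sum>l\<le>n. (-1) ^ (n - l) / (fact l * fact (n - l)) * (real (m choose l) * s ^ (m - l) * (fact l / fact m) * E m (\<lambda>y. y ^ (n - l))))
       sums (\<Sum>l\<le>n. (-1) ^ (n - l) / (fact l * fact (n - l)) * enn2real (coeff_series s n l x))"
      by (intro sums_sum sums_mult HHs) auto
    moreover have "(\<Sum>l\<le>n. (-1) ^ (n - l) / (fact l * fact (n - l)) * (real (m choose l) * s ^ (m - l) * (fact l / fact m) * E m (\<lambda>y. y ^ (n - l))))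
       = 1 / fact m * E m (\<lambda>y. tcoeff s (- y) m n)" for m
      unfolding tc_E sum_distrib_left by (intro sum.cong refl) (simp add: mult_ac)
    ultimately show ?thesis unfolding expansion_coeff_coeff_series[OF g x r S] by (simp only:)
  qed
  have hr: "\<bar>h\<bar> \<le> r / 2" using \<open>\<bar>t - s\<bar> \<le> r / 2\<close> by (simp add: h_def)
  let ?F = "\<lambda>m y. (s + h) ^ m * exp (- (h * y))"
  have F_int: "integrable (?Q m) (\<lambda>v. ?g m v * ?F m (?v m v) * exp (- (s * ?v m v)))" for m
  proof (rule dom[of "?F m" "\<bar>(s + h) ^ m\<bar>"])
    fix y :: real assume "0 \<le> y"
    then have "- (h * y) \<le> r * y" using hr r mult_right_mono[of "- h" r y] by simp
    then show "\<bar>?F m y\<bar> \<le> \<bar>(s + h) ^ m\<bar> * exp (r * y)" by (simp add: abs_mult mult_left_mono)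
  qed measurable
  \<comment> \<open>The factor \<open>exp (- (s * V))\<close> stays in the weight and the rest of
    \<open>exp (- (t * V))\<close> goes into the function being expanded, so that the expansion
    variable is \<open>h = t - s\<close>.\<close>
  have Psum: "(\<lambda>m. 1 / fact m * E m (?F m)) sums pair_conn M \<phi> X U t x"
  proof -
    have "inj_on (yf 0 x (\<lambda>_. 0)) {0..Suc 0}" using x by (auto simp: inj_on_def yf_def)
    from link_prob_expansion[OF gt this, of "{}"] have lp: "ennreal (link_prob 0 x t (\<lambda>_. 0) {}) = link_series 0 x (\<lambda>_. 0) t {} {} {}" by simp
    have y: "yf 0 x (\<lambda>_. 0) = yx x" by (auto simp: yf_def yx_def fun_eq_iff)
    have K: "{0} \<union> {} \<union> {Suc 0} = {0, 1::nat}" by auto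
    have link_integrand: "link_integrand 0 x (\<lambda>_. 0) t {} {} {} k w = ?g k w * exp (- (t * ?v k w))" for k w
      unfolding link_integrand_def Let_def pair_prob_def pair_volume_def y K prod.empty by (simp only: mult_1_right)
    have FE: "?g m v * ?F m (?v m v) * exp (- (s * ?v m v)) = t ^ m * (?g m v * exp (- (t * ?v m v)))" for m v
    proof -
      have sh: "s + h = t" by (simp add: h_def)
      have "?g m v * ?F m (?v m v) * exp (- (s * ?v m v)) = t ^ m * (?g m v * (exp (- (h * ?v m v)) * exp (- (s * ?v m v))))"
        unfolding sh by (simp only: mult_ac)
      also have "exp (- (h * ?v m v)) * exp (- (s * ?v m v)) = exp (- (t * ?v m v))"
        unfolding exp_add[symmetric] by (simp add: h_def algebra_simps)
      finally show ?thesis .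
    qed
    have EF0: "0 \<le> E m (?F m)" for m
      unfolding E_def FE using t g0 by (intro integral_nonneg_AE AE_I2 mult_nonneg_nonneg) auto
    have "ennreal (t ^ m / fact m) * (\<integral>\<^sup>+w. ennreal (?g m w * exp (- (t * ?v m w))) \<partial>?Q m) = ennreal (1 / fact m * E m (?F m))" for m
    proof -
      have "ennreal (t ^ m / fact m) * (\<integral>\<^sup>+w. ennreal (?g m w * exp (- (t * ?v m w))) \<partial>?Q m)
        = (\<integral>\<^sup>+w. ennreal (1 / fact m * (t ^ m * (?g m w * exp (- (t * ?v m w))))) \<partial>?Q m)"
        using t g0 by (subst nn_integral_cmult[symmetric]) (auto intro!: nn_integral_cong simp: ennreal_mult[symmetric])
      also have "\<dots> = ennreal (LINT w|?Q m. 1 / fact m * (t ^ m * (?g m w * exp (- (t * ?v m w)))))"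
        using t g0 F_int[of m] unfolding FE by (intro nn_integral_eq_integral) auto
      also have "(LINT w|?Q m. 1 / fact m * (t ^ m * (?g m w * exp (- (t * ?v m w))))) = 1 / fact m * E m (?F m)"
        unfolding E_def FE by simp
      finally show ?thesis .
    qed
    then have LLe: "link_series 0 x (\<lambda>_. 0) t {} {} {} = (\<Sum>m. ennreal (1 / fact m * E m (?F m)))"
      unfolding link_series_def link_integrand by simp
    have "(\<lambda>m. 1 / fact m * E m (?F m)) sums enn2real (\<Sum>m. ennreal (1 / fact m * E m (?F m)))"
    proof (rule ennreal_suminf_sums)
      show "0 \<le> 1 / fact m * E m (?F m)" for m using EF0[of m] by simp
      show "(\<Sum>m. ennreal (1 / fact m * E m (?F m))) < \<infinity>" unfolding LLe[symmetric] lp[symmetric] by simp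
    qed
    also have "enn2real (\<Sum>m. ennreal (1 / fact m * E m (?F m))) = pair_conn M \<phi> X U t x"
      unfolding LLe[symmetric] lp[symmetric] pair_conn_eq[of t x "\<lambda>_. 0"] by (simp add: link_prob_def)
    finally show ?thesis .
  qed
  let ?R = "\<lambda>m y. ?F m y - (\<Sum>n<N. h ^ n * tcoeff s (- y) m n)"
  have dsum: "(\<lambda>m. 1 / fact m * E m (?F m) - (\<Sum>n<N. h ^ n * (1 / fact m * E m (\<lambda>y. tcoeff s (- y) m n))))
     sums (pair_conn M \<phi> X U t x - (\<Sum>n<N. h ^ n * expansion_coeff M \<phi> X U n x s))"
    by (intro sums_diff Psum sums_sum sums_mult psum)
  have term_le: "\<bar>1 / fact m * E m (?F m) - (\<Sum>n<N. h ^ n * (1 / fact m * E m (\<lambda>y. tcoeff s (- y) m n)))\<bar>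
     \<le> (1 / 2) ^ N * ((s + r) ^ m / fact m * G m)" for m
  proof -
    have eq: "?g m v * ?R m (?v m v) * exp (- (s * ?v m v)) = ?g m v * ?F m (?v m v) * exp (- (s * ?v m v))
       - (\<Sum>n<N. h ^ n * (?g m v * tcoeff s (- ?v m v) m n * exp (- (s * ?v m v))))" for v
      by (simp only: right_diff_distrib left_diff_distrib sum_distrib_left sum_distrib_right mult_ac)
    have R_int: "integrable (?Q m) (\<lambda>v. ?g m v * ?R m (?v m v) * exp (- (s * ?v m v)))"
      unfolding eq by (intro Bochner_Integration.integrable_diff F_int Bochner_Integration.integrable_sum integrable_mult_right tc_int)
    have ER: "E m (?F m) - (\<Sum>n<N. h ^ n * E m (\<lambda>y. tcoeff s (- y) m n)) = E m (?R m)"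
    proof -
      have "E m (?R m) = E m (?F m) - (LINT v|?Q m. (\<Sum>n<N. h ^ n * (?g m v * tcoeff s (- ?v m v) m n * exp (- (s * ?v m v)))))"
        unfolding E_def eq by (intro Bochner_Integration.integral_diff F_int Bochner_Integration.integrable_sum integrable_mult_right tc_int)
      also have "(LINT v|?Q m. (\<Sum>n<N. h ^ n * (?g m v * tcoeff s (- ?v m v) m n * exp (- (s * ?v m v)))))
        = (\<Sum>n<N. h ^ n * E m (\<lambda>y. tcoeff s (- y) m n))"
        unfolding E_def using tc_int by (subst Bochner_Integration.integral_sum) auto
      finally show ?thesis by simp
    qed
    have "\<bar>E m (?R m)\<bar> \<le> (LINT v|?Q m. \<bar>?g m v * ?R m (?v m v) * exp (- (s * ?v m v))\<bar>)"
      unfolding E_def by (rule integral_abs_bound)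
    also have "\<dots> \<le> (LINT v|?Q m. (1 / 2) ^ N * (s + r) ^ m * (?g m v * exp ((r - s) * ?v m v)))"
    proof (rule integral_mono[OF integrable_abs[OF R_int] integrable_mult_right[OF Gint]])
      fix v
      have "?g m v * \<bar>?R m (?v m v)\<bar> * exp (- (s * ?v m v)) \<le> ?g m v * ((1 / 2) ^ N * ((s + r) ^ m * exp (r * ?v m v))) * exp (- (s * ?v m v))"
        using g0 by (intro mult_right_mono mult_left_mono tcoeff_remainder[OF s v0 r hr]) auto
      also have "\<dots> = (1 / 2) ^ N * (s + r) ^ m * (?g m v * (exp (r * ?v m v) * exp (- (s * ?v m v))))" by (simp only: mult_ac)
      also have "exp (r * ?v m v) * exp (- (s * ?v m v)) = exp ((r - s) * ?v m v)"
        by (simp add: exp_add[symmetric] left_diff_distrib)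
      finally show "\<bar>?g m v * ?R m (?v m v) * exp (- (s * ?v m v))\<bar> \<le> (1 / 2) ^ N * (s + r) ^ m * (?g m v * exp ((r - s) * ?v m v))"
        using g0 by (simp add: abs_mult)
    qed
    also have "\<dots> = (1 / 2) ^ N * (s + r) ^ m * G m" by (simp add: G_def)
    finally have "1 / fact m * \<bar>E m (?R m)\<bar> \<le> 1 / fact m * ((1 / 2) ^ N * (s + r) ^ m * G m)" by (intro mult_left_mono) auto
    moreover have "1 / fact m * E m (?F m) - (\<Sum>n<N. h ^ n * (1 / fact m * E m (\<lambda>y. tcoeff s (- y) m n))) = 1 / fact m * E m (?R m)"
      unfolding ER[symmetric] right_diff_distrib sum_distrib_left by (simp add: mult_ac)
    ultimately show ?thesis by (simp add: abs_mult)
  qed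
  have "\<bar>pair_conn M \<phi> X U t x - (\<Sum>n<N. h ^ n * expansion_coeff M \<phi> X U n x s)\<bar> \<le> (1 / 2) ^ N * enn2real (pair_majorant s r x)"
    using sums_abs_le[OF dsum sums_mult[OF Ssum, of "(1 / 2) ^ N"] term_le] .
  then have "ennreal \<bar>pair_conn M \<phi> X U t x - (\<Sum>n<N. h ^ n * expansion_coeff M \<phi> X U n x s)\<bar> \<le> ennreal ((1 / 2) ^ N * enn2real (pair_majorant s r x))"
    by (rule ennreal_leI)
  also have "\<dots> = ennreal ((1 / 2) ^ N) * pair_majorant s r x" using S by (simp add: ennreal_mult)
  finally show ?thesis by (simp add: h_def)
qed

end

section \<open>Convergence of the expansion\<close>

lemma borel_measurable_if_singleton:
  fixes g :: "'a::{second_countable_topology,t2_space} \<Rightarrow> 'b::topological_space"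
  assumes "g \<in> borel_measurable borel" "\<And>x. x \<noteq> a \<Longrightarrow> f x = g x"
  shows "f \<in> borel_measurable borel"
proof -
  have "f = (\<lambda>x. if x \<in> {a} then f a else g x)" using assms(2) by auto
  moreover have "(\<lambda>x. if x \<in> {a} then f a else g x) \<in> borel_measurable borel"
    using assms(1) by (intro measurable_If_set) auto
  ultimately show ?thesis by simp
qed

lemma alternating_sum_Pow:
  assumes "0 < n" shows "(\<Sum>J\<in>Pow {1..n}. (-1) ^ (n - card J)) = (0::real)"
proof -
  have "(\<Sum>J\<in>Pow {1..n}. (-1) ^ (n - card J)) = (\<Sum>l\<le>n. real (n choose l) * (-1) ^ (n - l))"
    using sum_Pow_card[of "{1..n}" "\<lambda>l. (-1) ^ (n - l)"] by simp
  also have "\<dots> = (1 + (- 1)) ^ n" unfolding binomial_ring by simp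
  finally show ?thesis using assms by simp
qed

lemma borel_measurable_ennreal_suminf_mult:
  fixes f :: "nat \<Rightarrow> 'a \<Rightarrow> ennreal"
  assumes "\<And>m. f m \<in> borel_measurable N"
  shows "(\<lambda>x. \<Sum>m. c m * f m x) \<in> borel_measurable N"
  using assms by measurable

section \<open>Domination by exponentially tilted cluster sizes\<close>

context random_connection_model
begin

lemma pair_exp_measurable: "pair_exp s r m \<in> borel_measurable borel"
proof -
  interpret L: product_sigma_finite "\<lambda>_::nat. lborel :: 'd point measure" by standard
  interpret sm: sigma_finite_measure "PiM {..<m} (\<lambda>_. lborel) :: (nat \<Rightarrow> 'd point) measure" by (rule L.sigma_finite) simp
  note [measurable] = pair_prob_measurable2 pair_volume_measurable2
  have "(\<lambda>x. \<integral>\<^sup>+v. ennreal (pair_prob x m v * exp ((r - s) * pair_volume x m v)) \<partial>PiM {..<m} (\<lambda>_. lborel)) \<in> borel_measurable lborel"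
    by (rule sm.borel_measurable_nn_integral) (simp add: case_prod_beta)
  then show ?thesis by (simp add: pair_exp_def[abs_def])
qed

lemma pair_majorant_measurable: "pair_majorant s r \<in> borel_measurable borel"
  unfolding pair_majorant_def[abs_def] by (rule borel_measurable_ennreal_suminf_mult[OF pair_exp_measurable])

text \<open>For \<open>x \<noteq> 0\<close>, the expectation of \<open>exp (z / 2 * card C)\<close>
  on the event that the cluster \<open>C\<close> of \<open>0\<close> is finite and contains
  \<open>x\<close>; \<open>Suc (Suc m)\<close> counts \<open>m\<close> Poisson points and the two
  added ones.\<close>

definition pair_tilted :: "real \<Rightarrow> real \<Rightarrow> 'd point \<Rightarrow> ennreal" where
  "pair_tilted s z x = (\<Sum>m. ennreal (exp (z / 2 * real (Suc (Suc m)))) * (ennreal (s ^ m / fact m) * pair_moment s m 0 x))"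

lemma pair_tilted_le:
  assumes "exp_tail s z" "x \<noteq> 0"
  shows "pair_tilted s z x \<le> (\<Sum>k. ennreal (exp (z * real (Suc k))) * Q s k)"
proof -
  have yx: "(\<lambda>k. if k = 0 then 0 else x) = yx x" by (simp add: yx_def)
  have K: "{0, 1} - {0, 1::nat} = {}" by simp
  have "Phi 0 {0, 1} {0, 1} (yx x) s m v = pair_prob x m v * pair_volume x m v ^ 0 * exp (- (s * pair_volume x m v))" for m v
    unfolding Phi_def pair_prob_def pair_volume_def K prod.empty power_0 by (simp only: mult_1_right)
  then show ?thesis using two_point_exp_moment[OF assms] unfolding pair_tilted_def pair_moment_def yx by (simp only:)
qed

text \<open>Integrating over \<open>x\<close> turns the second added point into one more point of
  the cluster of the origin: a pair with \<open>m\<close> further points becomes a single root with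
  \<open>m + 1\<close>.\<close>

lemma nn_integral_pair_moment: "(\<integral>\<^sup>+x. pair_moment s m 0 x \<partial>lborel) = (\<integral>\<^sup>+v. ennreal (Phi 0 {0} {0} (\<lambda>_. 0) s (Suc m) v) \<partial>PiM {..<Suc m} (\<lambda>_. lborel))"
proof -
  interpret L: product_sigma_finite "\<lambda>_::nat. lborel :: 'd point measure" by standard
  let ?F = "\<lambda>v. ennreal (Phi 0 {0} {0} (\<lambda>_. 0) s (Suc m) v)"
  \<comment> \<open>Coordinate \<open>0\<close> of the longer tuple plays the part of
    \<open>x\<close>; the others are shifted by one.\<close>
  define c :: "nat \<Rightarrow> point_index" where "c i = (case i of 0 \<Rightarrow> Inl 1 | Suc j \<Rightarrow> Inr j)" for i
  have cim: "c ` {..<Suc m} = Inl ` {1} \<union> Inr ` {..<m}"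
    unfolding lessThan_Suc_eq_insert_0 image_insert image_image by (simp add: c_def)
  have cinj: "inj_on c {..<Suc m}" by (auto simp: inj_on_def c_def split: nat.splits)
  have c: "bij_betw c {..<Suc m} (Inl ` {1} \<union> Inr ` {..<m})" using cim cinj by (simp only: bij_betw_def simp_thms)
  define f :: "point_index \<Rightarrow> point_index" where "f = case_sum (\<lambda>_. Inl 0) c"
  have f: "inj_on f (WW {0} (Suc m))"
    using cinj by (auto simp: inj_on_def f_def WW_def c_def split: nat.splits)
  have "f ` WW {0} (Suc m) = {Inl 0} \<union> c ` {..<Suc m}"
    unfolding WW_def image_Un image_image f_def by simp
  then have fim: "f ` WW {0} (Suc m) = WW {0, 1} m" unfolding cim WW_def by auto
  have FE: "?F (\<lambda>i\<in>{..<Suc m}. case_sum y w (c i)) = ennreal (pair_prob (y 1) m w * pair_volume (y 1) m w ^ 0 * exp (- (s * pair_volume (y 1) m w)))" for y w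
  proof -
    let ?u = "\<lambda>i\<in>{..<Suc m}. case_sum y w (c i)"
    have zz: "case_sum (\<lambda>_. 0) ?u i = case_sum (yx (y 1)) w (f i)" if "i \<in> WW {0} (Suc m)" for i
      using that by (auto simp: WW_def f_def c_def yx_def split: nat.splits)
    have "conn_prob (Inl 0) (WW {0} (Suc m)) (case_sum (\<lambda>_. 0) ?u) = conn_prob (f (Inl 0)) (f ` WW {0} (Suc m)) (case_sum (yx (y 1)) w)"
    proof (rule conn_prob_relabel[OF f])
      show "Inl 0 \<in> WW {0} (Suc m)" by (simp add: WW_def)
    qed (rule zz)
    moreover have "V (case_sum (\<lambda>_. 0) ?u) (WW {0} (Suc m)) = V (case_sum (yx (y 1)) w) (f ` WW {0} (Suc m))"
      by (rule V_relabel[OF f]) (rule zz)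
    moreover have "f (Inl 0) = Inl 0" by (simp add: f_def)
    ultimately have "conn_prob (Inl 0) (WW {0} (Suc m)) (case_sum (\<lambda>_. 0) ?u) = pair_prob (y 1) m w"
        "V (case_sum (\<lambda>_. 0) ?u) (WW {0} (Suc m)) = pair_volume (y 1) m w"
      unfolding pair_prob_def pair_volume_def fim by (simp_all only:)
    moreover have "{0} - {0::nat} = {}" by simp
    ultimately show ?thesis unfolding Phi_def by (simp only: prod.empty power_0)
  qed
  have Fm: "?F \<in> borel_measurable (PiM {..<Suc m} (\<lambda>_. lborel))"
    by (intro measurable_compose[OF _ measurable_ennreal] Phi_measurable) simp
  have "(\<integral>\<^sup>+v. ?F v \<partial>PiM {..<Suc m} (\<lambda>_. lborel)) = (\<integral>\<^sup>+y. pair_moment s m 0 (y 1) \<partial>PiM {1::nat} (\<lambda>_. lborel))"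
    using nn_integral_PiM_lborel_merge[OF _ c Fm] unfolding FE pair_moment_def by simp
  also have "\<dots> = (\<integral>\<^sup>+x. pair_moment s m 0 x \<partial>lborel)"
    using pair_moment_measurable[of s m 0] by (intro L.product_nn_integral_singleton) simp
  finally show ?thesis by simp
qed

text \<open>Passing from \<open>s ^ m / fact m\<close> to \<open>s ^ Suc m / fact (Suc m)\<close>
  costs the factor \<open>Suc m / s\<close>. The other half of the exponential rate pays for it
  through \<open>z / 2 * Suc m \<le> exp (z / 2 * (m + 2))\<close>, which leaves the constant
  \<open>2 / (z * s)\<close>.\<close>

lemma nn_integral_pair_tilted_le:
  assumes g: "exp_tail s z" and s: "0 < s"
  shows "(\<integral>\<^sup>+x. pair_tilted s z x \<partial>lborel) \<le> ennreal (2 / (z * s)) * (\<Sum>k. ennreal (exp (z * real (Suc k))) * Q s k)"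
proof -
  have z: "0 < z" using g by (simp add: exp_tail_def)
  let ?I = "\<lambda>m. \<integral>\<^sup>+x. pair_moment s m 0 x \<partial>lborel" and ?e = "\<lambda>k. ennreal (exp (z * real (Suc k))) * Q s k"
  have Im: "pair_moment s m 0 \<in> borel_measurable lborel" for m using pair_moment_measurable[of s m 0] by simp
  have "(\<integral>\<^sup>+x. pair_tilted s z x \<partial>lborel) = (\<Sum>m. ennreal (exp (z / 2 * real (Suc (Suc m)))) * (ennreal (s ^ m / fact m) * ?I m))"
    unfolding pair_tilted_def using Im by (simp add: nn_integral_suminf nn_integral_cmult)
  also have "\<dots> \<le> (\<Sum>m. ennreal (2 / (z * s)) * ?e (Suc m))"
  proof (intro suminf_le allI summableI)
    fix m
    let ?y = "z / 2 * real (Suc (Suc m))"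
    have "?y \<le> exp ?y" using exp_ge_add_one_self[of ?y] by linarith
    then have "z / 2 * real (Suc m) \<le> exp ?y" using z by (simp add: algebra_simps)
    then have "exp ?y * (z / 2 * real (Suc m)) \<le> exp ?y * exp ?y" by (intro mult_left_mono) auto
    also have "exp ?y * exp ?y = exp (z * real (Suc (Suc m)))" by (simp add: exp_add[symmetric] algebra_simps)
    finally have le: "exp ?y * (z / 2 * real (Suc m)) \<le> exp (z * real (Suc (Suc m)))" .
    have "exp ?y * (s ^ m / fact m) = 2 / (z * s) * ((exp ?y * (z / 2 * real (Suc m))) * (s ^ Suc m / fact (Suc m)))"
    proof -
      have "real (Suc m) * (s ^ Suc m / fact (Suc m)) = s * (s ^ m / fact m)" by (simp del: of_nat_Suc)
      then have "(exp ?y * (z / 2 * real (Suc m))) * (s ^ Suc m / fact (Suc m)) = exp ?y * (z / 2) * (s * (s ^ m / fact m))"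
        by (simp only: mult.assoc)
      then show ?thesis using z s by simp
    qed
    also have "\<dots> \<le> 2 / (z * s) * (exp (z * real (Suc (Suc m))) * (s ^ Suc m / fact (Suc m)))"
      using z s by (intro mult_left_mono mult_right_mono le) auto
    finally have "ennreal (exp ?y * (s ^ m / fact m)) \<le> ennreal (2 / (z * s) * (exp (z * real (Suc (Suc m))) * (s ^ Suc m / fact (Suc m))))"
      by (rule ennreal_leI)
    also have "\<dots> = ennreal (2 / (z * s)) * (ennreal (exp (z * real (Suc (Suc m)))) * ennreal (s ^ Suc m / fact (Suc m)))"
    proof -
      have "0 \<le> 2 / (z * s)" and b: "0 \<le> s ^ Suc m / fact (Suc m)" using z s by auto
      then show ?thesis by (simp only: ennreal_mult[OF _ mult_nonneg_nonneg[OF exp_ge_zero b]] ennreal_mult[OF exp_ge_zero b])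
    qed
    finally have "ennreal (exp ?y * (s ^ m / fact m)) * ?I m
      \<le> ennreal (2 / (z * s)) * (ennreal (exp (z * real (Suc (Suc m)))) * ennreal (s ^ Suc m / fact (Suc m))) * ?I m"
      by (rule mult_right_mono) simp
    also have "\<dots> = ennreal (2 / (z * s)) * ?e (Suc m)" unfolding Q_def nn_integral_pair_moment by (simp only: mult.assoc)
    also have "ennreal (exp ?y * (s ^ m / fact m)) = ennreal (exp ?y) * ennreal (s ^ m / fact m)"
      using s by (intro ennreal_mult) auto
    finally show "ennreal (exp ?y) * (ennreal (s ^ m / fact m) * ?I m) \<le> ennreal (2 / (z * s)) * ?e (Suc m)"
      by (simp only: mult.assoc)
  qed
  also have "\<dots> = ennreal (2 / (z * s)) * (\<Sum>m. ?e (Suc m))" by (rule ennreal_suminf_cmult)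
  also have "(\<Sum>m. ?e (Suc m)) \<le> (\<Sum>k. ?e k)" using suminf_offset[of ?e 1] by (simp add: summableI)
  finally show ?thesis by (simp add: mult_left_mono)
qed

text \<open>Both series carry the same connectivity weights, so it suffices to compare the remaining
  factors for each \<open>m\<close> and each volume \<open>v\<close> allowed by
  \<open>pair_volume_bounds\<close>. The reference intensity \<open>s'\<close> may differ from
  \<open>s\<close>.\<close>

lemma pair_majorant_le_pair_tilted:
  assumes s: "0 \<le> s" "0 \<le> s'" "0 \<le> r" "0 \<le> c"
    and le: "\<And>m v. 0 \<le> v \<Longrightarrow> v \<le> (real m + 2) * m\<phi> \<Longrightarrow>
      (s + r) ^ m * exp ((r - s + s') * v) \<le> c * (s' ^ m * exp (z / 2 * real (Suc (Suc m))))"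
  shows "pair_majorant s r x \<le> ennreal c * pair_tilted s' z x"
proof -
  have "ennreal ((s + r) ^ m / fact m) * pair_exp s r m x
    \<le> ennreal c * (ennreal (exp (z / 2 * real (Suc (Suc m)))) * (ennreal (s' ^ m / fact m) * pair_moment s' m 0 x))" for m
  proof -
    let ?Q = "PiM {..<m} (\<lambda>_. lborel) :: (nat \<Rightarrow> 'd point) measure"
    let ?g = "pair_prob x m" and ?v = "pair_volume x m" and ?E = "exp (z / 2 * real (Suc (Suc m)))"
    have pt: "(s + r) ^ m / fact m * (?g v * exp ((r - s) * ?v v)) \<le> c * (?E * (s' ^ m / fact m)) * (?g v * ?v v ^ 0 * exp (- (s' * ?v v)))" for v
    proof -
      have "exp ((r - s) * ?v v) = exp ((r - s + s') * ?v v) * exp (- (s' * ?v v))"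
        unfolding exp_add[symmetric] by (simp add: algebra_simps)
      then have "(s + r) ^ m / fact m * (?g v * exp ((r - s) * ?v v))
        = ((s + r) ^ m * exp ((r - s + s') * ?v v)) * (?g v * exp (- (s' * ?v v)) / fact m)" by simp
      also have "\<dots> \<le> (c * (s' ^ m * ?E)) * (?g v * exp (- (s' * ?v v)) / fact m)"
        using pair_prob_bounds by (intro mult_right_mono le pair_volume_bounds) auto
      finally show ?thesis by (simp add: mult_ac)
    qed
    have "ennreal ((s + r) ^ m / fact m) * pair_exp s r m x = (\<integral>\<^sup>+v. ennreal ((s + r) ^ m / fact m * (?g v * exp ((r - s) * ?v v))) \<partial>?Q)"
      unfolding pair_exp_def using s pair_prob_bounds
      by (subst nn_integral_cmult[symmetric]) (auto intro!: nn_integral_cong simp: ennreal_mult[symmetric])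
    also have "\<dots> \<le> (\<integral>\<^sup>+v. ennreal (c * (?E * (s' ^ m / fact m)) * (?g v * ?v v ^ 0 * exp (- (s' * ?v v)))) \<partial>?Q)"
      by (intro nn_integral_mono ennreal_leI pt)
    also have "\<dots> = ennreal (c * (?E * (s' ^ m / fact m))) * pair_moment s' m 0 x"
      unfolding pair_moment_def using s pair_prob_bounds
      by (subst nn_integral_cmult[symmetric]) (auto intro!: nn_integral_cong simp: ennreal_mult[symmetric])
    also have "ennreal (c * (?E * (s' ^ m / fact m))) = ennreal c * (ennreal ?E * ennreal (s' ^ m / fact m))"
      using s by (subst ennreal_mult; (subst ennreal_mult)?) auto
    finally show ?thesis by (simp only: mult.assoc)
  qed
  then have "pair_majorant s r x \<le> (\<Sum>m. ennreal c * (ennreal (exp (z / 2 * real (Suc (Suc m)))) * (ennreal (s' ^ m / fact m) * pair_moment s' m 0 x)))"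
    unfolding pair_majorant_def by (intro suminf_le summableI allI)
  then show ?thesis unfolding pair_tilted_def ennreal_suminf_cmult .
qed

text \<open>At \<open>s > 0\<close> the weights at intensities \<open>s\<close> and \<open>s + r\<close> differ by an exponential factor in the
  cluster size; at \<open>s = 0\<close> the comparison is with some \<open>s' > 0\<close> instead.\<close>

lemma subcritical_pair_majorant_bounds:
  assumes "s \<in> subcritical M \<phi> X U"
  obtains z r C where "exp_tail s z" "0 < r" "1 \<le> C" "\<And>x. x \<noteq> 0 \<Longrightarrow> pair_majorant s r x \<le> ennreal C"
    "(\<integral>\<^sup>+x. pair_majorant s r x \<partial>lborel) \<le> ennreal C"
proof -
  obtain s1 z where g: "exp_tail s z" "exp_tail s1 z" "s < s1" using subcritical_exp_tail[OF assms] by blast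
  have s: "0 \<le> s" and z: "0 < z" using g by (auto simp: exp_tail_def)
  have mp: "0 < m\<phi>" by (rule m\<phi>_pos)
  have "\<exists>s' r c. 0 < s' \<and> exp_tail s' z \<and> 0 < r \<and> 0 \<le> c \<and> (\<forall>m v. 0 \<le> v \<longrightarrow> v \<le> (real m + 2) * m\<phi> \<longrightarrow>
      (s + r) ^ m * exp ((r - s + s') * v) \<le> c * (s' ^ m * exp (z / 2 * real (Suc (Suc m)))))"
  proof (cases "s = 0")
    case False
    then have s0: "0 < s" using s by simp
    \<comment> \<open>By \<open>1 + r / s \<le> exp (r / s)\<close> and the bound on
      \<open>v\<close>, the factor \<open>(1 + r / s) ^ m * exp (r * v)\<close> is at most
      \<open>exp ((m + 2) * r * (1 / s + m\<phi>))\<close>. This \<open>r\<close> makes the last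
      exponent equal to \<open>(m + 2) * z / 2\<close>.\<close>
    define r where "r = z / 2 / (1 / s + m\<phi>)"
    have d: "0 < 1 / s + m\<phi>" using s0 mp by (simp add: add_pos_pos)
    have r: "0 < r" using z d by (simp add: r_def)
    have rz: "r * (1 / s + m\<phi>) = z / 2"
      by (rule iffD1[OF nonzero_eq_divide_eq r_def]) (use d in linarith)
    have "(s + r) ^ m * exp ((r - s + s) * v) \<le> 1 * (s ^ m * exp (z / 2 * real (Suc (Suc m))))"
      if v: "0 \<le> v" "v \<le> (real m + 2) * m\<phi>" for m v
    proof -
      have "(s + r) ^ m = s ^ m * (1 + r / s) ^ m"
        using s0 by (simp add: power_mult_distrib[symmetric] field_simps)
      also have "\<dots> \<le> s ^ m * exp (r / s) ^ m"
        using s0 r by (intro mult_left_mono power_mono exp_ge_add_one_self) auto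
      also have "exp (r / s) ^ m = exp (real m * (r / s))" by (rule exp_of_nat_mult[symmetric])
      finally have "(s + r) ^ m * exp (r * v) \<le> s ^ m * exp (real m * (r / s)) * exp (r * v)" by (rule mult_right_mono) simp
      also have "\<dots> = s ^ m * exp (real m * (r / s) + r * v)" by (simp add: exp_add)
      also have "\<dots> \<le> s ^ m * exp (z / 2 * real (Suc (Suc m)))"
      proof -
        have "real m * (r / s) \<le> (real m + 2) * (r / s)" using r s0 by (intro mult_right_mono) auto
        moreover have "r * v \<le> r * ((real m + 2) * m\<phi>)" using r v by (intro mult_left_mono) auto
        moreover have "(real m + 2) * (r / s) + r * ((real m + 2) * m\<phi>) = (real m + 2) * (r * (1 / s + m\<phi>))"
          by (simp add: algebra_simps)
        ultimately have "real m * (r / s) + r * v \<le> (real m + 2) * (z / 2)" unfolding rz by linarith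
        then have "real m * (r / s) + r * v \<le> z / 2 * real (Suc (Suc m))" by (simp add: algebra_simps)
        then show ?thesis using s0 by (intro mult_left_mono) auto
      qed
      finally show ?thesis by simp
    qed
    then show ?thesis using s0 r g(1) by (intro exI[of _ s] exI[of _ r] exI[of _ 1]) auto
  next
    case True
    then have s1: "0 < s1" using g by simp
    \<comment> \<open>With \<open>s = 0\<close>, the ratio of \<open>r ^ m\<close> to
      \<open>s1 ^ m\<close> must absorb \<open>exp (2 * s1 * v)\<close>, where \<open>v\<close> is
      at most \<open>(m + 2) * m\<phi>\<close>. This \<open>r\<close> cancels the part growing with
      \<open>m\<close>; what remains is the constant \<open>exp (4 * s1 * m\<phi>)\<close>.\<close>
    define r where "r = s1 * exp (- (2 * s1 * m\<phi>))"
    have r: "0 < r" "r \<le> s1" using s1 mp by (auto simp: r_def)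
    have "(s + r) ^ m * exp ((r - s + s1) * v) \<le> exp (4 * s1 * m\<phi>) * (s1 ^ m * exp (z / 2 * real (Suc (Suc m))))"
      if v: "0 \<le> v" "v \<le> (real m + 2) * m\<phi>" for m v
    proof -
      have "(r + s1) * v \<le> (2 * s1) * ((real m + 2) * m\<phi>)" using r s1 v by (intro mult_mono) auto
      then have "r ^ m * exp ((r + s1) * v) \<le> r ^ m * exp ((2 * s1) * ((real m + 2) * m\<phi>))"
        using r by (intro mult_left_mono) auto
      also have "(2 * s1) * ((real m + 2) * m\<phi>) = real m * (2 * s1 * m\<phi>) + 4 * s1 * m\<phi>" by (simp add: algebra_simps)
      also have "r ^ m * exp (real m * (2 * s1 * m\<phi>) + 4 * s1 * m\<phi>) = (r * exp (2 * s1 * m\<phi>)) ^ m * exp (4 * s1 * m\<phi>)"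
        by (simp add: exp_add power_mult_distrib exp_of_nat_mult)
      also have "r * exp (2 * s1 * m\<phi>) = s1" by (simp add: r_def exp_minus)
      finally have "r ^ m * exp ((r + s1) * v) \<le> exp (4 * s1 * m\<phi>) * (s1 ^ m * 1)" by (simp add: mult_ac)
      also have "\<dots> \<le> exp (4 * s1 * m\<phi>) * (s1 ^ m * exp (z / 2 * real (Suc (Suc m))))"
        using s1 z by (intro mult_left_mono) auto
      finally show ?thesis using True by simp
    qed
    then show ?thesis using s1 r g(2) by (intro exI[of _ s1] exI[of _ r] exI[of _ "exp (4 * s1 * m\<phi>)"]) auto
  qed
  then obtain s' r c where *: "0 < s'" "exp_tail s' z" "0 < r" "0 \<le> c"
    and le: "\<And>m v. 0 \<le> v \<Longrightarrow> v \<le> (real m + 2) * m\<phi> \<Longrightarrow>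
      (s + r) ^ m * exp ((r - s + s') * v) \<le> c * (s' ^ m * exp (z / 2 * real (Suc (Suc m))))" by blast
  have ST: "pair_majorant s r x \<le> ennreal c * pair_tilted s' z x" for x
    using s * by (intro pair_majorant_le_pair_tilted le) auto
  let ?E = "\<Sum>k. ennreal (exp (z * real (Suc k))) * Q s' k"
  have E: "?E < \<infinity>" using *(2) by (simp add: exp_tail_def)
  have b1: "pair_majorant s r x \<le> ennreal c * ?E" if "x \<noteq> 0" for x
    using ST[of x] mult_left_mono[OF pair_tilted_le[OF *(2) that], of "ennreal c"] by (rule order_trans) simp
  have Tm: "pair_tilted s' z \<in> borel_measurable lborel"
    unfolding pair_tilted_def[abs_def] using pair_moment_measurable by (simp add: borel_measurable_ennreal_suminf_mult)
  have "(\<integral>\<^sup>+x. pair_majorant s r x \<partial>lborel) \<le> (\<integral>\<^sup>+x. ennreal c * pair_tilted s' z x \<partial>lborel)" by (intro nn_integral_mono ST)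
  also have "\<dots> = ennreal c * (\<integral>\<^sup>+x. pair_tilted s' z x \<partial>lborel)" by (rule nn_integral_cmult[OF Tm])
  also have "\<dots> \<le> ennreal c * (ennreal (2 / (z * s')) * ?E)"
    by (intro mult_left_mono nn_integral_pair_tilted_le *) simp
  finally have b2: "(\<integral>\<^sup>+x. pair_majorant s r x \<partial>lborel) \<le> ennreal c * (ennreal (2 / (z * s')) * ?E)" .
  \<comment> \<open>One constant for both norms. The summand \<open>1\<close> is there for
    \<open>x = 0\<close>, where the coefficient of order zero equals one.\<close>
  let ?B = "1 + ennreal c * ?E + ennreal c * (ennreal (2 / (z * s')) * ?E)"
  have "?B < \<infinity>" using E by (simp add: ennreal_mult_less_top)
  then have B: "ennreal (enn2real ?B) = ?B" by simp
  show ?thesis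
  proof (rule that[OF g(1) *(3), of "enn2real ?B"])
    have "ennreal 1 \<le> ennreal (enn2real ?B)" unfolding B by (simp add: add.assoc)
    then show "1 \<le> enn2real ?B" by (subst (asm) ennreal_le_iff) auto
    show "pair_majorant s r x \<le> ennreal (enn2real ?B)" if "x \<noteq> 0" for x
      unfolding B using b1[OF that] by (rule order_trans) (simp add: add_increasing add_increasing2)
    show "(\<integral>\<^sup>+x. pair_majorant s r x \<partial>lborel) \<le> ennreal (enn2real ?B)"
      unfolding B using b2 by (rule order_trans) (simp add: add_increasing)
  qed
qed

text \<open>The origin lies in its own cluster whatever the edges, so all link probabilities are one
  and the alternating sum over subsets vanishes for \<open>n > 0\<close>. The point
  \<open>x = 0\<close> is treated apart since it coincides with the first added point.\<close>

lemma expansion_coeff_zero: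
  assumes s: "0 \<le> s" shows "expansion_coeff M \<phi> X U n 0 s = of_bool (n = 0)"
proof -
  have "0 \<in> cluster \<phi> 0 \<xi>" for \<xi> :: "('d point set \<times> real) set" by (simp add: cluster_def)
  then have l: "link_prob n 0 s xs J = 1" for n xs J unfolding link_prob_def by (simp add: prob_space)
  show ?thesis
  proof (cases "n = 0")
    case True
    then show ?thesis by (simp add: expansion_coeff_def pair_conn_eq[of s 0 "\<lambda>_. 0"] l)
  next
    case False
    have "expansion_integrand M \<phi> X U n 0 s = (\<lambda>_. 0)"
      unfolding expansion_integrand_eq[OF s, abs_def] l mult_1_right using alternating_sum_Pow False by simp
    then show ?thesis using False by (simp add: expansion_coeff_def)
  qed
qed

text \<open>A pointwise bound by the majorant serves both norms; \<open>x = 0\<close> is null for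
  the integral, while the supremum needs its own estimate there.\<close>

lemma norm_bounds:
  assumes C: "\<And>x. x \<noteq> 0 \<Longrightarrow> pair_majorant s r x \<le> ennreal C" "(\<integral>\<^sup>+x. pair_majorant s r x \<partial>lborel) \<le> ennreal C" "0 \<le> C" and a: "0 \<le> a"
    and f: "\<And>x. x \<noteq> 0 \<Longrightarrow> ennreal \<bar>f x\<bar> \<le> ennreal a * pair_majorant s r x" "\<bar>f 0\<bar> \<le> C * a"
  shows "sup_norm f \<le> ennreal (C * a)" "L1_norm f \<le> ennreal (C * a)"
proof -
  have aC: "ennreal (C * a) = ennreal a * ennreal C" using a C by (simp add: ennreal_mult[symmetric] mult.commute)
  have "ennreal \<bar>f x\<bar> \<le> ennreal (C * a)" for x
  proof (cases "x = 0")
    case False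
    show ?thesis unfolding aC by (rule order_trans[OF f(1)[OF False] mult_left_mono[OF C(1)[OF False]]]) simp
  qed (use f(2) in \<open>simp add: ennreal_leI\<close>)
  then show "sup_norm f \<le> ennreal (C * a)" unfolding sup_norm_def by (rule SUP_least)
  have Sm: "pair_majorant s r \<in> borel_measurable lborel" using pair_majorant_measurable by simp
  have "L1_norm f \<le> (\<integral>\<^sup>+x. ennreal a * pair_majorant s r x \<partial>lborel)"
    unfolding L1_norm_def by (rule nn_integral_mono_AE) (use AE_lborel_singleton[of 0] f(1) in auto)
  also have "\<dots> = ennreal a * (\<integral>\<^sup>+x. pair_majorant s r x \<partial>lborel)" by (rule nn_integral_cmult[OF Sm])
  also have "\<dots> \<le> ennreal (C * a)" unfolding aC by (rule mult_left_mono[OF C(2)]) simp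
  finally show "L1_norm f \<le> ennreal (C * a)" .
qed

section \<open>Norm bounds and convergence in both norms\<close>

lemma coeff_measurable:
  assumes "s \<in> subcritical M \<phi> X U"
  shows "(\<lambda>x. expansion_coeff M \<phi> X U n x s) \<in> borel_measurable borel"
proof -
  obtain z r C where g: "exp_tail s z" "0 < r" "\<And>x. x \<noteq> 0 \<Longrightarrow> pair_majorant s r x \<le> ennreal C"
    using subcritical_pair_majorant_bounds[OF assms] by metis
  show ?thesis
  proof (rule borel_measurable_if_singleton)
    show "(\<lambda>x. \<Sum>l\<le>n. (-1) ^ (n - l) / (fact l * fact (n - l)) * enn2real (coeff_series s n l x)) \<in> borel_measurable borel"
      using coeff_series_measurable by (intro borel_measurable_sum borel_measurable_times borel_measurable_const borel_measurable_enn2real)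
    show "expansion_coeff M \<phi> X U n x s = (\<Sum>l\<le>n. (-1) ^ (n - l) / (fact l * fact (n - l)) * enn2real (coeff_series s n l x))"
      if "x \<noteq> 0" for x
      by (rule expansion_coeff_coeff_series[OF g(1) that g(2)]) (use le_less_trans[OF g(3)[OF that]] in simp)
  qed
qed

lemma coeff_norm_bounds:
  assumes "s \<in> subcritical M \<phi> X U"
  shows "\<exists>c1 c2. \<forall>n. sup_norm (\<lambda>x. expansion_coeff M \<phi> X U n x s) \<le> ennreal (c1 * c2 ^ n) \<and>
            L1_norm (\<lambda>x. expansion_coeff M \<phi> X U n x s) \<le> ennreal (c1 * c2 ^ n)"
proof -
  obtain z r C where g: "exp_tail s z" "0 < r" and C: "1 \<le> C" "\<And>x. x \<noteq> 0 \<Longrightarrow> pair_majorant s r x \<le> ennreal C"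
    "(\<integral>\<^sup>+x. pair_majorant s r x \<partial>lborel) \<le> ennreal C"
    using subcritical_pair_majorant_bounds[OF assms] by metis
  have s: "0 \<le> s" using g by (simp add: exp_tail_def)
  have fin: "pair_majorant s r x < \<infinity>" if "x \<noteq> 0" for x using le_less_trans[OF C(2)[OF that]] by simp
  have C0: "0 \<le> C" using C by simp
  have p0: "0 \<le> (2 / r) ^ n" for n using g by simp
  have z0: "\<bar>expansion_coeff M \<phi> X U n 0 s\<bar> \<le> C * (2 / r) ^ n" for n
    using C(1) p0[of n] C0 unfolding expansion_coeff_zero[OF s] by (cases "n = 0") simp_all
  have b: "ennreal \<bar>expansion_coeff M \<phi> X U n x s\<bar> \<le> ennreal ((2 / r) ^ n) * pair_majorant s r x" if "x \<noteq> 0" for x n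
    by (rule expansion_coeff_bound[OF g(1) that g(2) fin[OF that]])
  show ?thesis
    by (intro exI[of _ C] exI[of _ "2 / r"] allI conjI norm_bounds[OF C(2,3) C0 p0] b z0) auto
qed

lemma pair_conn_coeff: "pair_conn M \<phi> X U t = (\<lambda>x. expansion_coeff M \<phi> X U 0 x t)"
  by (simp add: expansion_coeff_def fun_eq_iff)

lemma coeff_in_L1_Linf:
  assumes "s \<in> subcritical M \<phi> X U"
  shows "in_L1 (\<lambda>x. h * expansion_coeff M \<phi> X U n x s)" "in_Linf (\<lambda>x. h * expansion_coeff M \<phi> X U n x s)"
proof -
  let ?f = "\<lambda>x. expansion_coeff M \<phi> X U n x s"
  obtain c1 c2 where "sup_norm ?f \<le> ennreal (c1 * c2 ^ n)" "L1_norm ?f \<le> ennreal (c1 * c2 ^ n)"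
    using coeff_norm_bounds[OF assms] by metis
  then have fin: "sup_norm ?f < \<infinity>" "L1_norm ?f < \<infinity>" by (auto intro: le_less_trans)
  have fm: "?f \<in> borel_measurable borel" by (rule coeff_measurable[OF assms])
  have e: "ennreal \<bar>h * ?f x\<bar> = ennreal \<bar>h\<bar> * ennreal \<bar>?f x\<bar>" for x by (simp add: abs_mult ennreal_mult)
  have fm': "(\<lambda>x. ennreal \<bar>?f x\<bar>) \<in> borel_measurable lborel" using fm by simp
  have "L1_norm (\<lambda>x. h * ?f x) = ennreal \<bar>h\<bar> * L1_norm ?f"
    unfolding L1_norm_def e by (rule nn_integral_cmult[OF fm'])
  then show "in_L1 (\<lambda>x. h * ?f x)" using fm fin by (simp add: in_L1_def ennreal_mult_less_top)
  have "sup_norm (\<lambda>x. h * ?f x) \<le> ennreal \<bar>h\<bar> * sup_norm ?f"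
    unfolding sup_norm_def e by (intro SUP_least mult_left_mono SUP_upper) auto
  also have "\<dots> < \<infinity>" using fin by (simp add: ennreal_mult_less_top)
  finally show "in_Linf (\<lambda>x. h * ?f x)" using fm by (simp add: in_Linf_def)
qed

text \<open>The case \<open>N = 0\<close> is excluded because at \<open>x = 0\<close> the remainder
  vanishes only after the term of order zero has been subtracted.\<close>

lemma tendsto_half_power:
  fixes f :: "nat \<Rightarrow> ennreal"
  assumes C: "0 \<le> C" and f: "\<And>N. 0 < N \<Longrightarrow> f N \<le> ennreal (C * (1 / 2) ^ N)"
  shows "f \<longlonglongrightarrow> 0"
proof (rule tendsto_sandwich[of "\<lambda>_. 0" f sequentially "\<lambda>N. ennreal (C * (1 / 2) ^ N)"])
  show "eventually (\<lambda>N. f N \<le> ennreal (C * (1 / 2) ^ N)) sequentially"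
    using eventually_gt_at_top[of 0] by eventually_elim (rule f)
  have "(\<lambda>N. C * (1 / 2) ^ N) \<longlonglongrightarrow> C * 0" by (intro tendsto_mult_left LIMSEQ_realpow_zero) auto
  then have "(\<lambda>N. ennreal (C * (1 / 2) ^ N)) \<longlonglongrightarrow> ennreal 0" by (intro tendsto_ennrealI) simp
  then show "(\<lambda>N. ennreal (C * (1 / 2) ^ N)) \<longlonglongrightarrow> 0" by simp
qed auto

lemma local_expansion:
  assumes s: "s \<in> subcritical M \<phi> X U"
  shows "\<exists>V. openin (top_of_set (subcritical M \<phi> X U)) V \<and> s \<in> V \<and>
     (\<forall>t\<in>V. sums_in_L1 (\<lambda>n x. (t - s) ^ n * expansion_coeff M \<phi> X U n x s) (pair_conn M \<phi> X U t) \<and>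
        sums_in_Linf (\<lambda>n x. (t - s) ^ n * expansion_coeff M \<phi> X U n x s) (pair_conn M \<phi> X U t))"
proof -
  obtain z r C where g: "exp_tail s z" "0 < r" and C: "1 \<le> C" "\<And>x. x \<noteq> 0 \<Longrightarrow> pair_majorant s r x \<le> ennreal C"
    "(\<integral>\<^sup>+x. pair_majorant s r x \<partial>lborel) \<le> ennreal C"
    using subcritical_pair_majorant_bounds[OF s] by metis
  have s0: "0 \<le> s" using g by (simp add: exp_tail_def)
  have C0: "0 \<le> C" using C by simp
  have fin: "pair_majorant s r x < \<infinity>" if "x \<noteq> 0" for x using le_less_trans[OF C(2)[OF that]] by simp
  \<comment> \<open>Half the displacement \<open>r\<close> of the majorant, so that the remainders
    decay like \<open>(1 / 2) ^ N\<close>.\<close>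
  let ?W = "{s - r / 2<..<s + r / 2}"
  have "sums_in_L1 (\<lambda>n x. (t - s) ^ n * expansion_coeff M \<phi> X U n x s) (pair_conn M \<phi> X U t) \<and>
        sums_in_Linf (\<lambda>n x. (t - s) ^ n * expansion_coeff M \<phi> X U n x s) (pair_conn M \<phi> X U t)"
    if t: "t \<in> subcritical M \<phi> X U" "t \<in> ?W" for t
  proof -
    obtain z' where gt: "exp_tail t z'" using subcritical_exp_tail[OF t(1)] by blast
    have t0: "0 \<le> t" using gt by (simp add: exp_tail_def)
    have h: "\<bar>t - s\<bar> \<le> r / 2" using t(2) unfolding greaterThanLessThan_iff abs_le_iff by linarith
    let ?R = "\<lambda>N x. pair_conn M \<phi> X U t x - (\<Sum>n<N. (t - s) ^ n * expansion_coeff M \<phi> X U n x s)"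
    have p0: "0 \<le> (1 / 2 :: real) ^ N" for N by simp
    have R: "ennreal \<bar>?R N x\<bar> \<le> ennreal ((1 / 2) ^ N) * pair_majorant s r x" if "x \<noteq> 0" for x N
      by (rule expansion_remainder[OF g(1) gt that g(2) fin[OF that] h])
    have R0: "\<bar>?R N 0\<bar> \<le> C * (1 / 2) ^ N" if "0 < N" for N
    proof -
      have "(\<Sum>n<N. (t - s) ^ n * expansion_coeff M \<phi> X U n 0 s) = (\<Sum>n\<in>{0}. (t - s) ^ n * expansion_coeff M \<phi> X U n 0 s)"
        using that by (intro sum.mono_neutral_right) (auto simp: expansion_coeff_zero[OF s0])
      then have "?R N 0 = 0" by (simp add: expansion_coeff_zero[OF s0] pair_conn_coeff expansion_coeff_zero[OF t0])
      then show ?thesis using C0 by simp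
    qed
    have "(\<lambda>N. sup_norm (?R N)) \<longlonglongrightarrow> 0" "(\<lambda>N. L1_norm (?R N)) \<longlonglongrightarrow> 0"
      by (rule tendsto_half_power[OF C0], rule norm_bounds[OF C(2,3) C0 p0 R R0]; assumption)+
    moreover have "in_L1 (pair_conn M \<phi> X U t)" "in_Linf (pair_conn M \<phi> X U t)"
      using coeff_in_L1_Linf[OF t(1), of 1 0] by (simp_all add: pair_conn_coeff)
    ultimately show ?thesis
      unfolding sums_in_L1_def sums_in_Linf_def using coeff_in_L1_Linf[OF s] by blast
  qed
  moreover have "openin (top_of_set (subcritical M \<phi> X U)) (subcritical M \<phi> X U \<inter> ?W)"
    by (rule openin_open_Int) simp
  moreover have "s \<in> ?W" using g(2) by simp
  ultimately show ?thesis using s by (intro exI[of _ "subcritical M \<phi> X U \<inter> ?W"]) blast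
qed

end

theorem corollary4p9:
  fixes M :: "'w measure"
    and \<phi> :: "'d::{finite,linorder} point \<Rightarrow> real"
    and X :: "real \<Rightarrow> nat \<Rightarrow> 'w \<Rightarrow> 'd point"
    and U :: "real \<Rightarrow> point_index \<times> point_index \<Rightarrow> 'w \<Rightarrow> real"
  assumes "random_connection_model M \<phi> X U"
  shows "(\<forall>t\<in>subcritical M \<phi> X U. \<exists>c1 c2 :: real. \<forall>n.
            sup_norm (\<lambda>x. expansion_coeff M \<phi> X U n x t) \<le> ennreal (c1 * c2 ^ n) \<and>
            L1_norm (\<lambda>x. expansion_coeff M \<phi> X U n x t) \<le> ennreal (c1 * c2 ^ n)) \<and>
         (\<forall>s\<in>subcritical M \<phi> X U.
            \<exists>V. openin (top_of_set (subcritical M \<phi> X U)) V \<and> s \<in> V \<and>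
              (\<forall>t\<in>V.
                 sums_in_L1 (\<lambda>n x. (t - s) ^ n * expansion_coeff M \<phi> X U n x s) (pair_conn M \<phi> X U t) \<and>
                 sums_in_Linf (\<lambda>n x. (t - s) ^ n * expansion_coeff M \<phi> X U n x s) (pair_conn M \<phi> X U t)))"
proof -
  interpret random_connection_model M \<phi> X U by fact
  show ?thesis using coeff_norm_bounds local_expansion by blast
qed

end
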